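(* Consider the infinite-horizon symmetric Cobb–Douglas/Lévy economy described in the context. Define $$\gamma(t):=\frac1A\Big[\Big(\frac{\alpha+\beta}{\alpha}\Big)\mathcal{E}_x(t)\inf_{0\le s\le t}\Big(\mathcal{E}_c^{\frac{\beta(1-\alpha)}{1-\alpha-\beta}}(s)\,\mathcal{E}_x^{\frac{\alpha\beta}{1-\alpha-\beta}}(s)\Big)\Big]^{-\frac1{1-\alpha}},\qquad\theta(t):=\sup_{0\le s\le t}\Big(\mathcal{E}_c^{-\frac{1-\alpha}{1-\alpha-\beta}}(s)\,\mathcal{E}_x^{-\frac{\alpha}{1-\alpha-\beta}}(s)\Big),$$ $$\kappa:=\frac{w_o}{E\big[\int_0^\infty\psi_x(t)\gamma(t)\,dt+\frac1n\int_0^\infty\psi_c(t)\,d\theta(t)\big]},\qquad A:=E\Big[\int_0^\infty\delta e^{-ru}\inf_{0\le s\le u}\Big(\mathcal{E}_c(s)\,\mathcal{E}_x^{-\frac{\alpha}{1-\alpha}}(u-s)\Big)du\Big],$$ with $\delta:=\frac\beta\alpha\big(\frac{\alpha+\beta}\alpha\big)^{\frac1{\alpha-1}}$. Then the symmetric Nash equilibrium of the public good contribution game is given by $$\hat C^i(t)=\frac\kappa n\theta(t),\qquad\hat x^i(t)=\kappa\gamma(t),\quad i=1,\dots,n,$$ with Lagrange multipliers $$\hat\lambda^i=A^{1-\alpha}\kappa^{\alpha+\beta-1},\quad i=1,\dots,n.$$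
   Context: Economy. Horizon $T=\infty$, $n>1$ agents, filtered probability space $(\Omega,\mathcal{F},\{\mathcal{F}_t\},P)$ satisfying the usual conditions, constant discount rate $r$. All agents have the same initial wealth $w^i=w_o>0$ and utility $u^i(x,c)=\frac{x^\alpha c^\beta}{\alpha+\beta}$ with $\alpha,\beta\in(0,1)$, $\alpha+\beta<1$. Prices: $\psi_x(t)=e^{-rt}\mathcal{E}_x(t)$, $\mathcal{E}_x(t)=e^{Z_x(t)-\pi_x(1)t}$, and $\psi_c(t)=e^{-rt}\mathcal{E}_c(t)$, $\mathcal{E}_c(t)=e^{Z_c(t)-\pi_c(1)t}$, where $Z_x,Z_c$ are independent Lévy processes (with respect to $\{\mathcal{F}_t\}$) whose Laplace exponents $\pi_x(\xi):=\log E[e^{\xi Z_x(1)}]$, $\pi_c(\xi):=\log E[e^{\xi Z_c(1)}]$ are well defined for all $\xi\in\mathbb{R}$. The rate satisfies $$r>\max\Big\{0,\ \tfrac{\alpha}{1-\alpha}\pi_x(1),\ \tfrac{\alpha}{1-\alpha}\pi_x(1)+\pi_x\big(-\tfrac{2\alpha}{1-\alpha}\big),\ \hat\pi(2)+\tfrac{\alpha}{1-\alpha}\pi_x(1),\ \widetilde\pi(1)\Big\},$$ where $$\hat\pi(2)=\tfrac{2}{1-\alpha-\beta}\big[\beta\pi_c(1)+\tfrac{\alpha\beta}{1-\alpha}\pi_x(1)\big]+\pi_c\big(-\tfrac{2\beta}{1-\alpha-\beta}\big)+\pi_x\big(-\tfrac{2\alpha\beta}{(1-\alpha)(1-\alpha-\beta)}\big),$$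 $$\widetilde\pi(1)=\tfrac1{1-\alpha-\beta}\big[\beta\pi_c(1)+\alpha\pi_x(1)\big]+\pi_c\big(-\tfrac{\beta}{1-\alpha-\beta}\big)+\pi_x\big(-\tfrac{\alpha}{1-\alpha-\beta}\big).$$ Integrals $\int_0^\infty(\cdot)\,dC(t)$ against nondecreasing right-continuous $C$ include the point mass $C(0)$ at $t=0$ (convention $C(0-)=0$); the same for $d\theta$. Game. $\mathcal{B}_{w_o}$ is the set of nonnegative optional pairs $(x^i,C^i)$ with $C^i$ right-continuous, nondecreasing, $C^i(0-)=0$, and $E[\int_0^\infty\psi_x(t)x^i(t)dt+\int_0^\infty\psi_c(t)dC^i(t)]\le w_o$. Agent $i$'s payoff is $U^i(x^i,C^i;C^{-i})=E[\int_0^\infty e^{-rt}u^i(x^i(t),C^i(t)+C^{-i}(t))dt]$, $C^{-i}:=\sum_{j\ne i}C^j$. A tuple is a Nash equilibrium if for each $i$, $(\hat x^i,\hat C^i)$ maximizes $U^i(\cdot,\cdot;\hat C^{-i})$ over $\mathcal{B}_{w_o}$; it is symmetric if $(\hat x^i,\hat C^i)$ does not depend on $i$. The Lagrange multiplier $\hat\lambda^i>0$ is the one for which agent $i$'s first order conditions hold, with $\hat C:=\sum_j\hat C^j$: the budget constraint binds; $E[\int_\tau^\infty e^{-rt}u^i_c(\hat x^i(t),\hat C(t))dt|\mathcal{F}_\tau]\le\hat\lambda^i\psi_c(\tau)$ a.s. for all stopping times $\tau$; $E[\int_0^\infty(E[\int_t^\infty e^{-rs}u^i_c(\hat x^i(s),\hat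 C(s))ds|\mathcal{F}_t]-\hat\lambda^i\psi_c(t))d\hat C^i(t)]=0$; and $e^{-rt}u^i_x(\hat x^i(t),\hat C(t))=\hat\lambda^i\psi_x(t)$ $P\otimes dt$-a.e. *)

theory Defs
  imports "HOL-Probability.Probability"
begin

text \<open>
  Processes have type \<open>real \<Rightarrow> 'a \<Rightarrow> real\<close> (time first) and only their values at times
  \<open>t \<ge> 0\<close> and outcomes in the sample space matter.  Filtrations are indexed by \<open>ennreal\<close>, that is
  by \<open>[0, \<infinity>]\<close>, so that the library notions of stopping time and of the sigma-algebra of a
  stopping time cover stopping times that take the value \<open>\<infinity>\<close>.
\<close>

text \<open>The index \<open>\<infinity>\<close> carries no further information: \<open>F \<top>\<close> is generated by the \<open>F t\<close> with
  \<open>t < \<infinity>\<close>.\<close>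

definition usual_conditions :: "'a measure \<Rightarrow> (ennreal \<Rightarrow> 'a measure) \<Rightarrow> bool" where
  "usual_conditions M F \<longleftrightarrow>
     complete_measure M \<and>
     filtration (space M) F \<and>
     (\<forall>t. subalgebra M (F t)) \<and>
     sets (F \<top>) = sigma_sets (space M) (\<Union>t\<in>{..<\<top>}. sets (F t)) \<and>
     null_sets M \<subseteq> sets (F 0) \<and>
     (\<forall>t<\<top>. sets (F t) = (\<Inter>s\<in>{t<..}. sets (F s)))"

definition adapted :: "(ennreal \<Rightarrow> 'a measure) \<Rightarrow> (real \<Rightarrow> 'a \<Rightarrow> real) \<Rightarrow> bool" where
  "adapted F X \<longleftrightarrow> (\<forall>t\<ge>0. X t \<in> borel_measurable (F (ennreal t)))"

definition cadlag :: "(real \<Rightarrow> real) \<Rightarrow> bool" where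
  "cadlag f \<longleftrightarrow> (\<forall>t\<ge>0. continuous (at_right t) f) \<and> (\<forall>t>0. \<exists>l. (f \<longlongrightarrow> l) (at_left t))"

definition optional_algebra :: "'a measure \<Rightarrow> (ennreal \<Rightarrow> 'a measure) \<Rightarrow> ('a \<times> real) measure" where
  "optional_algebra M F = sigma (space M \<times> {0..})
     {{(\<omega>, t) \<in> space M \<times> {0..}. X t \<omega> \<in> B} | X B.
        adapted F X \<and> (\<forall>\<omega>\<in>space M. cadlag (\<lambda>t. X t \<omega>)) \<and> B \<in> sets borel}"

definition optional_process ::
  "'a measure \<Rightarrow> (ennreal \<Rightarrow> 'a measure) \<Rightarrow> (real \<Rightarrow> 'a \<Rightarrow> real) \<Rightarrow> bool" where
  "optional_process M F X \<longleftrightarrow> (\<lambda>(\<omega>, t). X t \<omega>) \<in> borel_measurable (optional_algebra M F)"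

definition levy_process ::
  "'a measure \<Rightarrow> (ennreal \<Rightarrow> 'a measure) \<Rightarrow> (real \<Rightarrow> 'a \<Rightarrow> real) \<Rightarrow> bool" where
  "levy_process M F Z \<longleftrightarrow>
     adapted F Z \<and>
     (\<forall>\<omega>\<in>space M. Z 0 \<omega> = 0 \<and> cadlag (\<lambda>t. Z t \<omega>)) \<and>
     (\<forall>s t. 0 \<le> s \<and> s \<le> t \<longrightarrow>
        prob_space.indep_set M (sets (F (ennreal s)))
          {(\<lambda>\<omega>. Z t \<omega> - Z s \<omega>) -` B \<inter> space M | B. B \<in> sets borel} \<and>
        distr M borel (\<lambda>\<omega>. Z t \<omega> - Z s \<omega>) = distr M borel (Z (t - s)))"

definition independent_processes ::
  "'a measure \<Rightarrow> (real \<Rightarrow> 'a \<Rightarrow> real) \<Rightarrow> (real \<Rightarrow> 'a \<Rightarrow> real) \<Rightarrow> bool" where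
  "independent_processes M X Y \<longleftrightarrow>
     prob_space.indep_var M
       (Pi\<^sub>M {0..} (\<lambda>_. borel)) (\<lambda>\<omega>. \<lambda>t\<in>{0..}. X t \<omega>)
       (Pi\<^sub>M {0..} (\<lambda>_. borel)) (\<lambda>\<omega>. \<lambda>t\<in>{0..}. Y t \<omega>)"

definition laplace_exponent :: "'a measure \<Rightarrow> (real \<Rightarrow> 'a \<Rightarrow> real) \<Rightarrow> real \<Rightarrow> real" where
  "laplace_exponent M Z \<xi> = ln (\<integral>\<omega>. exp (\<xi> * Z 1 \<omega>) \<partial>M)"

definition exp_martingale ::
  "'a measure \<Rightarrow> (real \<Rightarrow> 'a \<Rightarrow> real) \<Rightarrow> real \<Rightarrow> 'a \<Rightarrow> real" where
  "exp_martingale M Z t \<omega> = exp (Z t \<omega> - laplace_exponent M Z 1 * t)"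

text \<open>Extending \<open>C\<close> by \<open>0\<close> to the negative half-line encodes \<open>C(0-) = 0\<close>: the measure has the
  atom \<open>C 0\<close> at time \<open>0\<close>.\<close>

definition stieltjes :: "(real \<Rightarrow> 'a \<Rightarrow> real) \<Rightarrow> 'a \<Rightarrow> real measure" where
  "stieltjes C \<omega> = interval_measure (\<lambda>t. if t < 0 then 0 else C t \<omega>)"

definition spending ::
  "'a measure \<Rightarrow> (real \<Rightarrow> 'a \<Rightarrow> real) \<Rightarrow> (real \<Rightarrow> 'a \<Rightarrow> real) \<Rightarrow>
   (real \<Rightarrow> 'a \<Rightarrow> real) \<Rightarrow> (real \<Rightarrow> 'a \<Rightarrow> real) \<Rightarrow> ennreal" where
  "spending M \<psi>x \<psi>c x C =
     (\<integral>\<^sup>+\<omega>. ((\<integral>\<^sup>+t\<in>{0..}. ennreal (\<psi>x t \<omega> * x t \<omega>) \<partial>lborel)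
            + (\<integral>\<^sup>+t\<in>{0..}. ennreal (\<psi>c t \<omega>) \<partial>stieltjes C \<omega>)) \<partial>M)"

definition budget_set ::
  "'a measure \<Rightarrow> (ennreal \<Rightarrow> 'a measure) \<Rightarrow> (real \<Rightarrow> 'a \<Rightarrow> real) \<Rightarrow> (real \<Rightarrow> 'a \<Rightarrow> real) \<Rightarrow> real \<Rightarrow>
   ((real \<Rightarrow> 'a \<Rightarrow> real) \<times> (real \<Rightarrow> 'a \<Rightarrow> real)) set" where
  "budget_set M F \<psi>x \<psi>c w =
     {(x, C). optional_process M F x \<and> optional_process M F C \<and>
        (\<forall>\<omega>\<in>space M. (\<forall>t\<ge>0. 0 \<le> x t \<omega> \<and> 0 \<le> C t \<omega>) \<and>
           mono_on {0..} (\<lambda>t. C t \<omega>) \<and> (\<forall>t\<ge>0. continuous (at_right t) (\<lambda>t. C t \<omega>))) \<and>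
        spending M \<psi>x \<psi>c x C \<le> ennreal w}"

text \<open>\<open>D\<close> is the sum of the other agents' contributions.\<close>

definition payoff ::
  "'a measure \<Rightarrow> real \<Rightarrow> (real \<Rightarrow> real \<Rightarrow> real) \<Rightarrow>
   (real \<Rightarrow> 'a \<Rightarrow> real) \<Rightarrow> (real \<Rightarrow> 'a \<Rightarrow> real) \<Rightarrow> (real \<Rightarrow> 'a \<Rightarrow> real) \<Rightarrow> ennreal" where
  "payoff M r u x C D =
     (\<integral>\<^sup>+\<omega>. (\<integral>\<^sup>+t\<in>{0..}. ennreal (exp (- r * t) * u (x t \<omega>) (C t \<omega> + D t \<omega>)) \<partial>lborel) \<partial>M)"

definition nash_equilibrium ::
  "'a measure \<Rightarrow> (ennreal \<Rightarrow> 'a measure) \<Rightarrow> (real \<Rightarrow> 'a \<Rightarrow> real) \<Rightarrow> (real \<Rightarrow> 'a \<Rightarrow> real) \<Rightarrow>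
   real \<Rightarrow> (real \<Rightarrow> real \<Rightarrow> real) \<Rightarrow> real \<Rightarrow> nat \<Rightarrow>
   (nat \<Rightarrow> real \<Rightarrow> 'a \<Rightarrow> real) \<Rightarrow> (nat \<Rightarrow> real \<Rightarrow> 'a \<Rightarrow> real) \<Rightarrow> bool" where
  "nash_equilibrium M F \<psi>x \<psi>c r u w n xs Cs \<longleftrightarrow>
     (\<forall>i\<in>{1..n}.
        (xs i, Cs i) \<in> budget_set M F \<psi>x \<psi>c w \<and>
        (\<forall>(x, C)\<in>budget_set M F \<psi>x \<psi>c w.
           payoff M r u x C (\<lambda>t \<omega>. \<Sum>j\<in>{1..n} - {i}. Cs j t \<omega>)
           \<le> payoff M r u (xs i) (Cs i) (\<lambda>t \<omega>. \<Sum>j\<in>{1..n} - {i}. Cs j t \<omega>)))"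

definition symmetric_profile ::
  "'a measure \<Rightarrow> nat \<Rightarrow> (nat \<Rightarrow> real \<Rightarrow> 'a \<Rightarrow> real) \<Rightarrow> (nat \<Rightarrow> real \<Rightarrow> 'a \<Rightarrow> real) \<Rightarrow> bool" where
  "symmetric_profile M n xs Cs \<longleftrightarrow>
     (\<forall>i\<in>{1..n}. \<forall>j\<in>{1..n}. \<forall>t\<ge>0. \<forall>\<omega>\<in>space M. xs i t \<omega> = xs j t \<omega> \<and> Cs i t \<omega> = Cs j t \<omega>)"

definition cobb_douglas :: "real \<Rightarrow> real \<Rightarrow> real \<Rightarrow> real \<Rightarrow> real" where
  "cobb_douglas \<alpha> \<beta> x c = x powr \<alpha> * c powr \<beta> / (\<alpha> + \<beta>)"

text \<open>The value of a process at a stopping time, set to \<open>0\<close> where the stopping time is \<open>\<infinity>\<close>.\<close>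

definition stopped_value :: "(real \<Rightarrow> 'a \<Rightarrow> 'b::zero) \<Rightarrow> ('a \<Rightarrow> ennreal) \<Rightarrow> 'a \<Rightarrow> 'b" where
  "stopped_value X \<tau> \<omega> = (if \<tau> \<omega> < \<top> then X (enn2real (\<tau> \<omega>)) \<omega> else 0)"

definition cond_exp_at ::
  "'a measure \<Rightarrow> (ennreal \<Rightarrow> 'a measure) \<Rightarrow> (real \<Rightarrow> 'a \<Rightarrow> ennreal) \<Rightarrow> ('a \<Rightarrow> ennreal) \<Rightarrow> 'a \<Rightarrow> ennreal"
where
  "cond_exp_at M F X \<tau> = nn_cond_exp M (filtration.pre_sigma (space M) F \<tau>) (stopped_value X \<tau>)"

text \<open>Conditional expectations at different times are only determined up to null sets that depend on
  the time.  The process \<open>t \<mapsto> E[X t | F t]\<close> inside a Stieltjes integral is therefore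
  read as an optional projection of \<open>X\<close>: the optional \<open>Y\<close>, unique up to indistinguishability,
  with \<open>Y \<tau> = E[X \<tau> | F \<tau>]\<close> a.s. on \<open>\<tau> < \<infinity>\<close> for every stopping time \<open>\<tau>\<close>.\<close>

definition optional_projection ::
  "'a measure \<Rightarrow> (ennreal \<Rightarrow> 'a measure) \<Rightarrow> (real \<Rightarrow> 'a \<Rightarrow> ennreal) \<Rightarrow> (real \<Rightarrow> 'a \<Rightarrow> real) \<Rightarrow> bool" where
  "optional_projection M F X Y \<longleftrightarrow>
     optional_process M F Y \<and>
     (\<forall>\<omega>\<in>space M. \<forall>t\<ge>0. 0 \<le> Y t \<omega>) \<and>
     (\<forall>\<tau>. stopping_time F \<tau> \<longrightarrow>
        (AE \<omega> in M. ennreal (stopped_value Y \<tau> \<omega>) = cond_exp_at M F X \<tau> \<omega>))"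

definition future_marginal_utility ::
  "real \<Rightarrow> (real \<Rightarrow> real \<Rightarrow> real) \<Rightarrow> (real \<Rightarrow> 'a \<Rightarrow> real) \<Rightarrow> (real \<Rightarrow> 'a \<Rightarrow> real) \<Rightarrow>
   real \<Rightarrow> 'a \<Rightarrow> ennreal" where
  "future_marginal_utility r u x C t \<omega> =
     (\<integral>\<^sup>+s\<in>{t..}. ennreal (exp (- r * s) * deriv (\<lambda>c. u (x s \<omega>) c) (C s \<omega>)) \<partial>lborel)"

text \<open>\<open>Ci\<close> is the agent's own contribution and \<open>C\<close> the aggregate one.\<close>

definition lagrange_multiplier ::
  "'a measure \<Rightarrow> (ennreal \<Rightarrow> 'a measure) \<Rightarrow> (real \<Rightarrow> 'a \<Rightarrow> real) \<Rightarrow> (real \<Rightarrow> 'a \<Rightarrow> real) \<Rightarrow>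
   real \<Rightarrow> (real \<Rightarrow> real \<Rightarrow> real) \<Rightarrow> real \<Rightarrow>
   (real \<Rightarrow> 'a \<Rightarrow> real) \<Rightarrow> (real \<Rightarrow> 'a \<Rightarrow> real) \<Rightarrow> (real \<Rightarrow> 'a \<Rightarrow> real) \<Rightarrow> real \<Rightarrow> bool" where
  "lagrange_multiplier M F \<psi>x \<psi>c r u w x Ci C l \<longleftrightarrow>
     0 < l \<and>
     spending M \<psi>x \<psi>c x Ci = ennreal w \<and>
     (\<forall>\<tau>. stopping_time F \<tau> \<longrightarrow>
        (AE \<omega> in M. cond_exp_at M F (future_marginal_utility r u x C) \<tau> \<omega>
                    \<le> ennreal (l * stopped_value \<psi>c \<tau> \<omega>))) \<and>
     (\<exists>Y. optional_projection M F (future_marginal_utility r u x C) Y \<and>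
        (AE \<omega> in M. set_integrable (stieltjes Ci \<omega>) {0..} (\<lambda>t. Y t \<omega> - l * \<psi>c t \<omega>)) \<and>
        integrable M (\<lambda>\<omega>. LINT t:{0..}|stieltjes Ci \<omega>. Y t \<omega> - l * \<psi>c t \<omega>) \<and>
        (LINT \<omega>|M. (LINT t:{0..}|stieltjes Ci \<omega>. Y t \<omega> - l * \<psi>c t \<omega>)) = 0) \<and>
     (AE (\<omega>, t) in M \<Otimes>\<^sub>M lborel. 0 \<le> t \<longrightarrow>
        exp (- r * t) * deriv (\<lambda>y. u y (C t \<omega>)) (x t \<omega>) = l * \<psi>x t \<omega>)"

end

theory Submission
  imports Defs "HOL-Real_Asymp.Real_Asymp"
begin

text \<open>Write \<open>X\<close>, \<open>C\<close> for the compensated processes, \<open>a = \<alpha> / (1 - \<alpha>)\<close>, and \<open>R\<close> for the running minimum of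
  \<open>G = C + a X\<close>.  In equilibrium the discounted marginal utility of the public good at \<open>t\<close> is
  proportional to \<open>exp (-rt - a X\<^sub>t + R\<^sub>t)\<close>.  By the strong Markov property the conditional expectation of its future
  integral at a stopping time is \<open>Y = exp (-rt + C\<^sub>t) \<Phi> (R\<^sub>t - G\<^sub>t)\<close> with \<open>\<Phi>\<close> increasing, so \<open>Y \<le> \<Phi> 0 \<psi>\<^sub>c\<close> with
  equality exactly when \<open>G\<close> is at its minimum, which is when the candidate contribution grows; time
  reversal identifies \<open>\<Phi> 0\<close> with \<open>A / \<delta>\<close>.  Splitting a contribution process into its levels turns the
  first order conditions into a linear price for contributions, and concavity of the utility makes the
  candidate optimal.  Doob's inequality and the conditions on \<open>r\<close> give finite values.

  For uniqueness, rescaling deviations force the budget shares of any symmetric equilibrium to be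
  those of the candidate; deviations towards the candidate then bound the candidate's value by that of the
  equilibrium, and strict concavity at the candidate forces equality.\<close>

text \<open>The exponents come from the static conditions. Equating the marginal utility of
  consumption with \<open>l * exp X\<close> and eliminating consumption leaves a marginal utility of
  the public good proportional to \<open>exp (- a * X) * c powr (- 1 / k)\<close> with
  \<open>k = (1 - \<alpha>) / (1 - \<alpha> - \<beta>)\<close>; taking \<open>c\<close> proportional
  to \<open>exp (- k * R)\<close> turns the power into \<open>exp R\<close>. Two obstacles shape the
  proof. Each process is a Levy process for the filtration on its own, and the two are independent
  of each other, but the Markov argument needs the pair of increments to be independent of the past;
  this has to be derived. Moreover, a symmetric equilibrium does not maximize a common objective:
  each agent provides only one n-th of the public good, so a joint deviation towards the candidate
  weighs the two goods like \<alpha> and \<beta> / n, while the concavity estimate asks for \<alpha>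
  and \<beta>. Equal budget shares repair this, since each good can then be moved towards the
  candidate separately within the budget.\<close>

abbreviation (input) "Borel M \<equiv> borel_measurable M"

section \<open>Paths\<close>

lemma dyadic_between:
 fixes a b :: real
 assumes "0 <= a" "a < b" "b <= 1"
 obtains p j :: nat where "j <= 2 ^ p" "a < real j / 2 ^ p" "real j / 2 ^ p < b"
proof -
 obtain p :: nat where p: "1 / (b - a) < 2 ^ p"
  using real_arch_pow[of 2 "1 / (b - a)"] by auto
 define j where "j = nat (\<lfloor>a * 2 ^ p\<rfloor> + 1)"
 have j: "real j = of_int \<lfloor>a * 2 ^ p\<rfloor> + 1"
  using assms(1) by (simp add: j_def)
 have 1: "a * 2 ^ p < real j" "real j <= a * 2 ^ p + 1"
  using j by linarith+
 have "1 < (b - a) * 2 ^ p"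
  using p assms by (simp add: field_simps)
 then have 2: "real j < b * 2 ^ p"
  using 1 by (simp add: algebra_simps)
 moreover have "b * 2 ^ p <= 1 * 2 ^ p"
  using assms(3) by (intro mult_right_mono) auto
 ultimately have "real j < 2 ^ p"
  by linarith
 then have "j <= 2 ^ p"
  using of_nat_le_iff[of j "2 ^ p", where ?'a = real] by simp
 then show thesis
  using that[of j p] 1 2 by (simp add: field_simps)
qed

text \<open>A value above \<open>y\<close> would, by one-sided continuity, persist on an open
  interval, and every such interval contains a grid point. The side may vary from point to point:
  the time-reversed paths treated later are right continuous at some points and left continuous at
  others.\<close>

lemma grid_bound:
 fixes f :: "real => real"
 assumes grid: "\<And>p j. j <= 2 ^ p ==> f (real j / 2 ^ p * N) <= y"
  and cont: "\<And>s. 0 < s ==> s < N ==> continuous (at_right s) f \<or> continuous (at_left s) f"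
  and s: "0 <= s" "s <= N"
 shows "f s <= y"
proof (rule ccontr)
 assume "\<not> f s <= y"
 then have gt: "y < f s" by simp
 \<comment> \<open>Both end points are grid points already for \<open>p = 0\<close>, so continuity
   is called upon only strictly between them.\<close>
 have "s \<noteq> 0"
  using gt grid[of 0 0] by auto
 moreover have "s \<noteq> N"
  using gt grid[of 1 0] by auto
 ultimately have s': "0 < s" "s < N"
  using s by auto
 obtain l u where lu: "l < u" "0 <= l" "u <= N" "\<And>z. l < z ==> z < u ==> y < f z"
 proof -
  consider "continuous (at_right s) f" | "continuous (at_left s) f"
   using cont[OF s'] by blast
  then show thesis
  proof cases
   case 1
   then have "eventually (\<lambda>z. y < f z) (at_right s)"
    using gt by (auto simp: continuous_within intro: order_tendstoD)
   then obtain b where "s < b" "\<And>z. s < z ==> z < b ==> y < f z"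
    unfolding eventually_at_right_field by blast
   then show thesis
    using s' by (intro that[of s "min b N"]) auto
  next
   case 2
   then have "eventually (\<lambda>z. y < f z) (at_left s)"
    using gt by (auto simp: continuous_within intro: order_tendstoD)
   then obtain b where "b < s" "\<And>z. b < z ==> z < s ==> y < f z"
    unfolding eventually_at_left_field by blast
   then show thesis
    using s' by (intro that[of "max b 0" s]) auto
  qed
 qed
 have N: "0 < N" using s' by simp
 obtain p j :: nat where pj: "j <= 2 ^ p" "l / N < real j / 2 ^ p" "real j / 2 ^ p < u / N"
 proof (rule dyadic_between)
  show "0 <= l / N" "l / N < u / N" "u / N <= 1"
   using lu N by (auto simp: divide_simps)
 qed
 then have "l < real j / 2 ^ p * N" "real j / 2 ^ p * N < u"
  using N by (auto simp: field_simps)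
 then show False
  using lu(4) grid[OF pj(1)] by (meson not_less)
qed

lemma cadlag_right: "cadlag f ==> 0 <= t ==> continuous (at_right t) f"
 by (simp add: cadlag_def)

lemma cadlag_left: "cadlag f ==> 0 < t ==> \<exists>l. (f \<longlongrightarrow> l) (at_left t)"
 by (simp add: cadlag_def)

text \<open>The first point strictly to the right of \<open>t\<close> in the grid of mesh
  \<open>1 / Suc n\<close>. Strictness gives convergence along \<open>at_right t\<close>, and it
  makes the event that a stopping time is rounded to a given grid point known at that grid
  point.\<close>

definition right_grid :: "nat => real => real" where
 "right_grid n t = real (nat \<lfloor>real (Suc n) * t\<rfloor> + 1) / real (Suc n)"

lemma right_grid_bounds:
 assumes "0 <= t"
 shows "t < right_grid n t" "right_grid n t <= t + 1 / real (Suc n)"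
proof -
 have "real (nat \<lfloor>real (Suc n) * t\<rfloor> + 1) = of_int \<lfloor>real (Suc n) * t\<rfloor> + 1"
  using assms by simp
 then have "real (Suc n) * t < real (nat \<lfloor>real (Suc n) * t\<rfloor> + 1)"
  "real (nat \<lfloor>real (Suc n) * t\<rfloor> + 1) <= real (Suc n) * t + 1"
  by linarith+
 moreover have "t < c / N" "c / N <= t + 1 / N" if "N * t < c" "c <= N * t + 1" "0 < N" for c N :: real
  using that by (auto simp: field_simps)
 ultimately show "t < right_grid n t" "right_grid n t <= t + 1 / real (Suc n)"
  unfolding right_grid_def by (meson of_nat_0_less_iff zero_less_Suc)+
qed

lemma right_grid_nonneg: "0 <= right_grid n t"
 by (simp add: right_grid_def)

lemma right_grid_at_right:
 assumes t: "0 <= t"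
 shows "filterlim (\<lambda>n. right_grid n t) (at_right t) sequentially"
proof -
 have "(\<lambda>n. t + 1 / real (Suc n)) \<longlonglongrightarrow> t + 0"
  by (intro tendsto_intros LIMSEQ_inverse_real_of_nat[unfolded inverse_eq_divide])
 then have "(\<lambda>n. right_grid n t) \<longlonglongrightarrow> t"
  using right_grid_bounds[OF t]
  by (intro tendsto_sandwich[of "\<lambda>_. t" "\<lambda>n. right_grid n t" sequentially "\<lambda>n. t + 1 / real (Suc n)" t])
   (auto intro!: eventuallyI less_imp_le[of t])
 then show ?thesis
  using right_grid_bounds(1)[OF t] by (auto simp: filterlim_at intro!: eventuallyI less_imp_neq[THEN not_sym])
qed

lemma right_grid_tendsto:
 fixes f :: "real => 'a :: topological_space"
 assumes "continuous (at_right t) f" "0 <= t"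
 shows "(\<lambda>n. f (right_grid n t)) \<longlonglongrightarrow> f t"
 using filterlim_compose[OF _ right_grid_at_right] assms by (auto simp: continuous_within)

section \<open>Cadlag paths: closure properties, boundedness, jumps\<close>

lemma cadlag_continuous_on: "continuous_on UNIV f ==> cadlag f"
 unfolding cadlag_def
 by (meson continuous_at_imp_continuous_at_within continuous_on_eq_continuous_at open_UNIV UNIV_I continuous_within)

lemma cadlag_compose2:
 fixes f g :: "real => real"
 assumes f: "cadlag f" and g: "cadlag g" and h: "continuous_on UNIV h"
 shows "cadlag (\<lambda>t. h (f t, g t))"
proof -
 have h': "isCont h x" for x
  using h by (auto simp: continuous_on_eq_continuous_at simp del: split_paired_All)
 have *: "((\<lambda>t. h (f t, g t)) \<longlongrightarrow> h (l, l')) G"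
  if "(f \<longlongrightarrow> l) G" "(g \<longlongrightarrow> l') G" for l l' and G :: "real filter"
  by (intro isCont_tendsto_compose[OF h'] tendsto_Pair that)
 show ?thesis
  unfolding cadlag_def continuous_within
 proof (intro conjI allI impI)
  show "((\<lambda>t. h (f t, g t)) \<longlongrightarrow> h (f t, g t)) (at_right t)" if "0 <= t" for t
   using f g that by (intro *) (auto simp: cadlag_def continuous_within)
  fix t :: real assume "0 < t"
  then obtain l l' where "(f \<longlongrightarrow> l) (at_left t)" "(g \<longlongrightarrow> l') (at_left t)"
   using cadlag_left[OF f] cadlag_left[OF g] by blast
  then have "((\<lambda>t. h (f t, g t)) \<longlongrightarrow> h (l, l')) (at_left t)"
   by (rule *)
  then show "\<exists>l. ((\<lambda>t. h (f t, g t)) \<longlongrightarrow> l) (at_left t)" ..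
 qed
qed

lemma cadlag_compose:
 fixes f h :: "real => real"
 assumes "cadlag f" "continuous_on UNIV h"
 shows "cadlag (\<lambda>t. h (f t))"
 using cadlag_compose2[OF assms(1) assms(1), of "\<lambda>p. h (fst p)"] assms(2)
 by (simp add: continuous_on_compose2[OF assms(2)] continuous_on_fst)

lemma cadlag_add: "cadlag f ==> cadlag g ==> cadlag (\<lambda>t. f t + g t)"
 using cadlag_compose2[of f g "\<lambda>p. fst p + snd p"] by (simp add: continuous_intros)

lemma cadlag_diff: "cadlag f ==> cadlag g ==> cadlag (\<lambda>t. f t - g t)"
 using cadlag_compose2[of f g "\<lambda>p. fst p - snd p"] by (simp add: continuous_intros)

lemma cadlag_mult: "cadlag f ==> cadlag g ==> cadlag (\<lambda>t. f t * g t)"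
 using cadlag_compose2[of f g "\<lambda>p. fst p * snd p"] by (simp add: continuous_intros)

lemma cadlag_const: "cadlag (\<lambda>t. c)"
 by (intro cadlag_continuous_on continuous_intros)

lemma cadlag_cmult: "cadlag f ==> cadlag (\<lambda>t. c * f t)"
 by (intro cadlag_mult cadlag_const)

lemma cadlag_exp: "cadlag f ==> cadlag (\<lambda>t. exp (f t))"
 by (rule cadlag_compose) (auto intro: continuous_intros)

text \<open>The two one-sided limits bound the path near every point, and compactness of the
  interval leaves finitely many neighbourhoods.\<close>

lemma cadlag_bounded:
 assumes f: "cadlag f"
 shows "\<exists>B. \<forall>s\<in>{0..N}. \<bar>f s\<bar> <= B"
proof -
 have "\<exists>U B. open U \<and> s \<in> U \<and> (\<forall>z\<in>U \<inter> {0..N}. \<bar>f z\<bar> <= B)" if s: "s \<in> {0..N}" for s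
 proof -
  have "((\<lambda>z. \<bar>f z\<bar>) \<longlongrightarrow> \<bar>f s\<bar>) (at_right s)"
   using cadlag_right[OF f, of s] s by (auto simp: continuous_within intro: tendsto_rabs)
  then have "eventually (\<lambda>z. \<bar>f z\<bar> < \<bar>f s\<bar> + 1) (at_right s)"
   by (rule order_tendstoD) simp
  then obtain b where b: "s < b" "\<And>z. s < z ==> z < b ==> \<bar>f z\<bar> < \<bar>f s\<bar> + 1"
   unfolding eventually_at_right_field by blast
  obtain a B where a: "a < s" "\<And>z. a < z ==> z < s ==> 0 <= z ==> \<bar>f z\<bar> < B"
  proof (cases "s = 0")
   case True
   \<comment> \<open>No left limit exists at 0, but points to the left of 0 lie outside the
     interval, so any left end and any bound serve.\<close>
   then show thesis by (intro that[of "-1" 0]) auto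
  next
   case False
   then obtain l where "(f \<longlongrightarrow> l) (at_left s)"
    using cadlag_left[OF f, of s] s by auto
   then have "((\<lambda>z. \<bar>f z\<bar>) \<longlongrightarrow> \<bar>l\<bar>) (at_left s)"
    by (rule tendsto_rabs)
   then have "eventually (\<lambda>z. \<bar>f z\<bar> < \<bar>l\<bar> + 1) (at_left s)"
    by (rule order_tendstoD) simp
   then show thesis
    unfolding eventually_at_left_field using that by blast
  qed
  have "\<forall>z\<in>{a<..<b} \<inter> {0..N}. \<bar>f z\<bar> <= max B (\<bar>f s\<bar> + 1)"
  proof
   fix z assume z: "z \<in> {a<..<b} \<inter> {0..N}"
   consider "z < s" | "z = s" | "s < z" by linarith
   then show "\<bar>f z\<bar> <= max B (\<bar>f s\<bar> + 1)"
    using a(2)[of z] b(2)[of z] z by cases auto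
  qed
  then show ?thesis
   using a(1) b(1) by (intro exI[of _ "{a<..<b}"] exI[of _ "max B (\<bar>f s\<bar> + 1)"]) auto
 qed
 then obtain U B where UB: "\<And>s. s \<in> {0..N} ==> open (U s) \<and> s \<in> U s \<and> (\<forall>z\<in>U s \<inter> {0..N}. \<bar>f z\<bar> <= B s)"
  by metis
 have "\<exists>D\<subseteq>{0..N}. finite D \<and> {0..N} \<subseteq> (\<Union>c\<in>D. U c)"
 proof (rule compactE_image[of "{0..N}" "{0..N}" U])
  show "{0..N} \<subseteq> (\<Union>c\<in>{0..N}. U c)" using UB by blast
 qed (use UB in auto)
 then obtain D where D: "D \<subseteq> {0..N}" "finite D" "{0..N} \<subseteq> (\<Union>c\<in>D. U c)"
  by blast
 have "\<bar>f s\<bar> <= (\<Sum>c\<in>D. \<bar>B c\<bar>)" if s: "s \<in> {0..N}" for s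
 proof -
  obtain c where c: "c \<in> D" "s \<in> U c" using D(3) s by auto
  then have "\<bar>f s\<bar> <= \<bar>B c\<bar>" using UB[of c] D(1) s by force
  also have "... <= (\<Sum>c\<in>D. \<bar>B c\<bar>)"
   using c(1) D(2) by (intro member_le_sum) auto
  finally show ?thesis .
 qed
 then show ?thesis by blast
qed

lemma bdd_image_cadlag:
 assumes "cadlag f" "A \<subseteq> {0..N}"
 shows "bdd_below (f ` A)" "bdd_above (f ` A)"
proof -
 obtain B where B: "\<And>s. s \<in> {0..N} ==> \<bar>f s\<bar> <= B"
  using cadlag_bounded[OF assms(1)] by blast
 have "- B <= f s \<and> f s <= B" if "s \<in> A" for s
  using B[of s] assms(2) that by force
 then show "bdd_below (f ` A)" "bdd_above (f ` A)"
  by (auto intro!: bdd_belowI2[where m = "- B"] bdd_aboveI2[where M = B])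
qed

text \<open>A jump is encoded by a rational level strictly between the left limit and the value, together
 with a rational left end point of an interval before the jump on one side of that level.\<close>

lemma countable_left_jumps:
 assumes f: "cadlag f"
 shows "countable {t. 0 < t \<and> \<not> continuous (at_left t) f}"
proof -
 define P where "P sg p q t \<longleftrightarrow> q < t \<and> p < sg * f t \<and> (\<forall>z. q < z \<longrightarrow> z < t \<longrightarrow> sg * f z < p)"
  for sg p q t :: real
 have inj: "t = t'" if "P sg p q t" "P sg p q t'" for sg p q t t'
 proof (rule ccontr)
  assume "t \<noteq> t'"
  then consider "t < t'" | "t' < t" by linarith
  then show False using that unfolding P_def by cases force+
 qed
 define J where "J = {t. 0 < t \<and> \<not> continuous (at_left t) f}"
 have ex: "\<exists>sg\<in>{1,-1}. \<exists>p\<in>\<rat>. \<exists>q\<in>\<rat>. P sg p q t" if t: "t \<in> J" for t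
 proof -
  obtain l where l: "(f \<longlongrightarrow> l) (at_left t)"
   using cadlag_left[OF f] t by (auto simp: J_def)
  have "l \<noteq> f t"
   using l t by (auto simp: J_def continuous_within)
  then obtain sg :: real where sg: "sg \<in> {1,-1}" "sg * l < sg * f t"
   by (metis insertI1 insertI2 linorder_neqE_linordered_idom mult_1 mult_minus1 neg_less_iff_less singletonI)
  obtain p where p: "p \<in> \<rat>" "sg * l < p" "p < sg * f t"
   using Rats_dense_in_real[OF sg(2)] by blast
  have "((\<lambda>z. sg * f z) \<longlongrightarrow> sg * l) (at_left t)"
   by (intro tendsto_intros l)
  then have "eventually (\<lambda>z. sg * f z < p) (at_left t)"
   using p(2) by (rule order_tendstoD)
  then obtain b where b: "b < t" "\<And>z. b < z ==> z < t ==> sg * f z < p"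
   unfolding eventually_at_left_field by blast
  obtain q where q: "q \<in> \<rat>" "b < q" "q < t"
   using Rats_dense_in_real[OF b(1)] by blast
  have "P sg p q t"
   using p(3) q b by (auto simp: P_def)
  then show ?thesis
   using sg p q by blast
 qed
 have "J \<subseteq> (\<Union>sg\<in>{1,-1}. \<Union>p\<in>\<rat>. \<Union>q\<in>\<rat>. {t. P sg p q t})"
 proof
  fix t assume "t \<in> J"
  then obtain sg p q where "sg \<in> {1,-1}" "p \<in> \<rat>" "q \<in> \<rat>" "P sg p q t"
   using ex by meson
  then show "t \<in> (\<Union>sg\<in>{1,-1}. \<Union>p\<in>\<rat>. \<Union>q\<in>\<rat>. {t. P sg p q t})"
   by (intro UN_I[of sg] UN_I[of p] UN_I[of q]) simp_all
 qed
 moreover have "countable {t. P sg p q t}" for sg p q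
 proof (cases "\<exists>t. P sg p q t")
  case True
  then obtain t where "P sg p q t" by blast
  then have "{t. P sg p q t} = {t}" using inj by blast
  then show ?thesis by simp
 next
  case False
  then have "{t. P sg p q t} = {}" by blast
  then show ?thesis by simp
 qed
 then have "countable (\<Union>sg\<in>{1,-1}. \<Union>p\<in>\<rat>. \<Union>q\<in>\<rat>. {t. P sg p q t})"
  by (intro countable_UN countable_rat) auto
 ultimately show ?thesis
  unfolding J_def by (rule countable_subset)
qed

section \<open>Running infima and their approximation along dyadic grids\<close>

definition running_inf :: "(real => real) => real => real" where
 "running_inf f t = (INF s\<in>{0..t}. f s)"

lemma running_inf_le: "cadlag f ==> 0 <= s ==> s <= t ==> running_inf f t <= f s"
 unfolding running_inf_def by (intro cINF_lower bdd_image_cadlag[where N = t]) auto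

lemma running_inf_greatest: "0 <= t ==> (\<And>s. 0 <= s ==> s <= t ==> c <= f s) ==> c <= running_inf f t"
 unfolding running_inf_def by (intro cINF_greatest) auto

lemma running_inf_antimono: "cadlag f ==> 0 <= s ==> s <= t ==> running_inf f t <= running_inf f s"
 by (rule running_inf_greatest) (auto intro: running_inf_le)

lemma running_inf_0 [simp]: "running_inf f 0 = f 0"
 by (simp add: running_inf_def)

text \<open>Monotonicity gives one half of the limit. For the other half, right continuity keeps
  \<open>f\<close> above any level below the infimum for a short time after
  \<open>t\<close>.\<close>

lemma continuous_right_running_inf:
 assumes f: "cadlag f" and t: "0 <= t"
 shows "continuous (at_right t) (running_inf f)"
 unfolding continuous_within
proof (rule order_tendstoI)
 fix a assume a: "a < running_inf f t"
 \<comment> \<open>The intermediate level saves the strict inequality, which weakens to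
   \<open><=\<close> when an infimum is taken.\<close>
 obtain a' where a': "a < a'" "a' < running_inf f t" using dense[OF a] by blast
 then have "a' < f t" using running_inf_le[OF f t, of t] by simp
 then have "eventually (\<lambda>z. a' < f z) (at_right t)"
  using cadlag_right[OF f t] by (auto simp: continuous_within intro: order_tendstoD)
 then obtain b where b: "t < b" "\<And>z. t < z ==> z < b ==> a' < f z"
  unfolding eventually_at_right_field by blast
 have "a < running_inf f z" if z: "t < z" "z < b" for z
 proof -
  have "a' <= f s" if s: "0 <= s" "s <= z" for s
   using b(2)[of s] running_inf_le[OF f s(1), of t] a' s z by (cases "s <= t") auto
  then have "a' <= running_inf f z"
   using t z by (intro running_inf_greatest) auto
  then show ?thesis using a' by simp
 qed
 then show "eventually (\<lambda>z. a < running_inf f z) (at_right t)"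
  unfolding eventually_at_right_field using b(1) by blast
next
 fix a assume "running_inf f t < a"
 then have "running_inf f z < a" if "t < z" for z
  using running_inf_antimono[OF f t, of z] that by simp
 then show "eventually (\<lambda>z. running_inf f z < a) (at_right t)"
  unfolding eventually_at_right_field using gt_ex by blast
qed

lemma cadlag_running_inf:
 assumes f: "cadlag f"
 shows "cadlag (running_inf f)"
 unfolding cadlag_def
proof (intro conjI allI impI)
 show "continuous (at_right t) (running_inf f)" if "0 <= t" for t
  by (rule continuous_right_running_inf[OF f that])
 fix t :: real assume t: "0 < t"
 define l where "l = (INF z\<in>{0..<t}. running_inf f z)"
 have bdd: "bdd_below (running_inf f ` {0..<t})"
  using running_inf_antimono[OF f, of _ t] by (intro bdd_belowI2[where m = "running_inf f t"]) auto
 have "(running_inf f \<longlongrightarrow> l) (at_left t)"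
 proof (rule order_tendstoI)
  fix a assume "a < l"
  then have "a < running_inf f z" if "0 < z" "z < t" for z
   using cINF_lower[OF bdd, of z] that by (auto simp: l_def)
  then show "eventually (\<lambda>z. a < running_inf f z) (at_left t)"
   unfolding eventually_at_left_field using t by blast
 next
  fix a assume "l < a"
  then obtain z where z: "0 <= z" "z < t" "running_inf f z < a"
   unfolding l_def using cINF_less_iff[OF _ bdd, of a] t by auto
  then have "running_inf f y < a" if "z < y" "y < t" for y
   using running_inf_antimono[OF f z(1), of y] that by simp
  then show "eventually (\<lambda>z. running_inf f z < a) (at_left t)"
   unfolding eventually_at_left_field using z by blast
 qed
 then show "\<exists>l. (running_inf f \<longlongrightarrow> l) (at_left t)" ..
qed

lemma continuous_right_shift:
 fixes f :: "real => real"
 assumes "continuous (at_right (s + t)) f"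
 shows "continuous (at_right t) (\<lambda>t. f (s + t))"
proof -
 have "filterlim (\<lambda>t. s + t) (at_right (s + t)) (at_right t)"
  by (auto simp: filterlim_at eventually_at_right_field intro!: tendsto_eq_intros gt_ex)
 then show ?thesis
  using assms unfolding continuous_within by (rule filterlim_compose[rotated])
qed

lemma cadlag_shift:
 assumes f: "cadlag f" and s: "0 <= s"
 shows "cadlag (\<lambda>t. f (s + t))"
 unfolding cadlag_def
proof (intro conjI allI impI)
 show "continuous (at_right t) (\<lambda>t. f (s + t))" if "0 <= t" for t
  using cadlag_right[OF f, of "s + t"] s that by (intro continuous_right_shift) auto
 fix t :: real assume "0 < t"
 then obtain l where l: "(f \<longlongrightarrow> l) (at_left (s + t))"
  using cadlag_left[OF f, of "s + t"] s by auto
 have "filterlim (\<lambda>t. s + t) (at_left (s + t)) (at_left t)"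
  by (auto simp: filterlim_at eventually_at_left_field intro!: tendsto_eq_intros lt_ex)
 then have "((\<lambda>t. f (s + t)) \<longlongrightarrow> l) (at_left t)"
  using l by (rule filterlim_compose[rotated])
 then show "\<exists>l. ((\<lambda>t. f (s + t)) \<longlongrightarrow> l) (at_left t)" ..
qed

text \<open>This splitting is why the pair of processes together with the minimum is Markov: the
  past enters the later minimum only through its value at \<open>s\<close>.\<close>

lemma running_inf_add:
 assumes f: "cadlag f" and s: "0 <= s" and v: "0 <= v"
 shows "running_inf f (s + v) = min (running_inf f s) (running_inf (\<lambda>t. f (s + t)) v)"
proof (rule antisym)
 have "running_inf f (s + v) <= running_inf (\<lambda>t. f (s + t)) v"
  using s by (intro running_inf_greatest v running_inf_le[OF f]) auto
 then show "running_inf f (s + v) <= min (running_inf f s) (running_inf (\<lambda>t. f (s + t)) v)"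
  using running_inf_antimono[OF f s] v by simp
 show "min (running_inf f s) (running_inf (\<lambda>t. f (s + t)) v) <= running_inf f (s + v)"
 proof (rule running_inf_greatest)
  fix z assume z: "0 <= z" "z <= s + v"
  show "min (running_inf f s) (running_inf (\<lambda>t. f (s + t)) v) <= f z"
  proof (cases "z <= s")
   case True
   then show ?thesis using running_inf_le[OF f z(1), of s] by auto
  next
   case False
   then have "running_inf (\<lambda>t. f (s + t)) v <= f (s + (z - s))"
    using z by (intro running_inf_le[OF cadlag_shift[OF f s]]) auto
   then show ?thesis by simp
  qed
 qed (use s v in auto)
qed

text \<open>Minima over finitely many times are measurable in the outcome and accessible to the
  discrete Markov argument; the dyadic grids are nested, so the minima decrease in
  \<open>p\<close>.\<close>

definition grid_min :: "(real => real) => real => nat => real" where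
 "grid_min f v p = (MIN j\<in>{0..2 ^ p}. f (real j / 2 ^ p * v))"

lemma grid_min_le: "j <= 2 ^ p ==> grid_min f v p <= f (real j / 2 ^ p * v)"
 unfolding grid_min_def by (intro Min_le) auto

lemma grid_min_decseq: "decseq (grid_min f v)"
proof (rule decseq_SucI)
 fix p
 have "f (real j / 2 ^ p * v) \<in> (\<lambda>j. f (real j / 2 ^ Suc p * v)) ` {0..2 ^ Suc p}"
  if "j \<in> {0..2 ^ p}" for j
  using that by (intro image_eqI[of _ _ "2 * j"]) auto
 then show "grid_min f v (Suc p) <= grid_min f v p"
  unfolding grid_min_def by (intro Min_antimono) auto
qed

text \<open>The decreasing minima converge to their own infimum, and \<open>grid_bound\<close> for
  \<open>- f\<close> shows that no value of \<open>f\<close> lies below it.\<close>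

lemma grid_min_tendsto:
 assumes v: "0 <= v" and bdd: "bdd_below (f ` {0..v})"
  and cont: "\<And>s. 0 < s ==> s < v ==> continuous (at_right s) f \<or> continuous (at_left s) f"
 shows "grid_min f v \<longlonglongrightarrow> (INF s\<in>{0..v}. f s)"
proof -
 let ?I = "INF s\<in>{0..v}. f s"
 have pt: "0 <= real j / 2 ^ p * v" "real j / 2 ^ p * v <= v" if "j <= 2 ^ p" for j p :: nat
 proof -
  have "real j <= 2 ^ p" using that of_nat_le_iff[of j "2 ^ p", where ?'a = real] by simp
  then show "real j / 2 ^ p * v <= v" using v by (intro mult_left_le_one_le) auto
 qed (use v in auto)
 have ge: "?I <= grid_min f v p" for p
  unfolding grid_min_def using pt bdd by (auto intro!: cINF_lower)
 have eq: "(INF p. grid_min f v p) = ?I"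
 proof (rule antisym)
  have bdd': "bdd_below (range (grid_min f v))"
   using ge by (intro bdd_belowI2)
  show "(INF p. grid_min f v p) <= ?I"
  proof (rule cINF_greatest)
   fix s assume s: "s \<in> {0..v}"
   have "- f s <= - (INF p. grid_min f v p)"
   proof (rule grid_bound[where f = "\<lambda>s. - f s" and N = v])
    fix p j :: nat assume "j <= 2 ^ p"
    then show "- f (real j / 2 ^ p * v) <= - (INF p. grid_min f v p)"
     using grid_min_le[of j p f v] cINF_lower[OF bdd', of p] by simp
   next
    fix s assume "0 < s" "s < v"
    then show "continuous (at_right s) (\<lambda>s. - f s) \<or> continuous (at_left s) (\<lambda>s. - f s)"
     using cont[of s] by (auto intro: continuous_intros)
   qed (use s in auto)
   then show "(INF p. grid_min f v p) <= f s" by simp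
  qed (use v in auto)
  show "?I <= (INF p. grid_min f v p)"
   using ge by (intro cINF_greatest) auto
 qed
 have "grid_min f v \<longlonglongrightarrow> (INF p. grid_min f v p)"
  by (rule LIMSEQ_decseq_INF[OF bdd_belowI2[OF ge] grid_min_decseq])
 then show ?thesis by (simp add: eq)
qed

lemma grid_min_running_inf:
 assumes f: "cadlag f" and v: "0 <= v"
 shows "grid_min f v \<longlonglongrightarrow> running_inf f v"
 unfolding running_inf_def using cadlag_right[OF f]
 by (intro grid_min_tendsto[OF v bdd_image_cadlag(1)[OF f order_refl]]) simp

section \<open>Stieltjes measures of nondecreasing paths and their levels\<close>

lemma interval_measure_eqI:
 assumes mono: "\<And>x y. x <= y ==> F x <= F y" and cont: "\<And>a. continuous (at_right a) F"
  and sets: "sets N = sets borel"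
  and eq: "\<And>a b. a <= b ==> emeasure N {a<..b} = ennreal (F b - F a)"
 shows "interval_measure F = N"
proof (rule measure_eqI_generator_eq[where \<Omega> = UNIV and E = "range (\<lambda>(a, b). {a<..b::real})"
    and A = "\<lambda>n. {- real n<..real n}"])
 show "Int_stable (range (\<lambda>(a, b). {a<..b::real}))"
  unfolding Int_stable_def
 proof (intro ballI)
  fix X Y assume "X \<in> range (\<lambda>(a, b). {a<..b::real})" "Y \<in> range (\<lambda>(a, b). {a<..b::real})"
  then obtain a b a' b' where "X = {a<..b}" "Y = {a'<..b'}" by auto
  then have "X \<inter> Y = (\<lambda>(a, b). {a<..b}) (max a a', min b b')" by auto
  then show "X \<inter> Y \<in> range (\<lambda>(a, b). {a<..b::real})" by blast
 qed
 show "emeasure (interval_measure F) X = emeasure N X"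
  if X: "X \<in> range (\<lambda>(a, b). {a<..b::real})" for X
 proof -
  obtain a b where X: "X = {a<..b}" using X by auto
  show ?thesis
  proof (cases "a <= b")
   case True
   then show ?thesis
    unfolding X by (simp add: emeasure_interval_measure_Ioc[OF _ mono cont] eq)
  qed (simp add: X)
 qed
 show "(\<Union>n. {- real n<..real n}) = UNIV"
 proof (intro set_eqI iffI UNIV_I)
  fix x :: real
  obtain n where "\<bar>x\<bar> < real n" using reals_Archimedean2 by blast
  then show "x \<in> (\<Union>n. {- real n<..real n})" by (intro UN_I[of n]) auto
 qed
 show "range (\<lambda>n. {- real n<..real n}) \<subseteq> range (\<lambda>(a, b). {a<..b::real})"
  by (auto simp: image_iff)
 show "emeasure (interval_measure F) {- real n<..real n} \<noteq> \<infinity>" for n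
  by (simp add: emeasure_interval_measure_Ioc[OF _ mono cont])
qed (auto simp: sets borel_sigma_sets_Ioc)

text \<open>The generalized inverse of a nondecreasing path.\<close>

definition first_reach :: "(real => real) => real => real" where
 "first_reach c y = Inf {t. 0 <= t \<and> y <= c t}"

locale nondecreasing_path =
 fixes c :: "real => real"
 assumes nonneg: "\<And>t. 0 <= t ==> 0 <= c t"
  and mono: "mono_on {0..} c"
  and right: "\<And>t. 0 <= t ==> continuous (at_right t) c"
begin

lemma le: "0 <= s ==> s <= t ==> c s <= c t"
 using mono by (auto simp: mono_on_def)

text \<open>By right continuity the level is already attained at the infimum. The existence premise
  excludes the empty set, whose \<open>Inf\<close> carries no information.\<close>

lemma first_reach_le_iff:
 assumes ex: "\<exists>s\<ge>0. y <= c s" and t: "0 <= t"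
 shows "first_reach c y <= t \<longleftrightarrow> y <= c t"
proof
 let ?S = "{t. 0 <= t \<and> y <= c t}"
 have bdd: "bdd_below ?S" by (intro bdd_belowI[of _ 0]) auto
 show "first_reach c y <= t" if "y <= c t"
  unfolding first_reach_def using that t by (intro cInf_lower bdd) auto
 assume le_t: "first_reach c y <= t"
 show "y <= c t"
 proof (rule ccontr)
  assume "\<not> y <= c t"
  then have "eventually (\<lambda>z. c z < y) (at_right t)"
   using right[OF t] by (auto simp: continuous_within intro: order_tendstoD)
  then obtain b where b: "t < b" "\<And>z. t < z ==> z < b ==> c z < y"
   unfolding eventually_at_right_field by blast
  have "b <= first_reach c y"
   unfolding first_reach_def
  proof (rule cInf_greatest)
   fix z assume z: "z \<in> ?S"
   show "b <= z"
   proof (rule ccontr)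
    assume "\<not> b <= z"
    moreover have "t < z"
     using z le[of z t] \<open>\<not> y <= c t\<close> by (cases "z <= t") auto
    ultimately show False using b(2)[of z] z by auto
   qed
  qed (use ex in auto)
  then show False using le_t b(1) by simp
 qed
qed

lemma first_reach_nonneg: "\<exists>s\<ge>0. y <= c s ==> 0 <= first_reach c y"
 unfolding first_reach_def by (intro cInf_greatest) auto

text \<open>Levels start above 0 because the path is continued by 0 to negative times; those in
  \<open>{0<..c 0}\<close> are reached at time 0 and account for the atom there.\<close>

definition levels :: "real set" where
 "levels = {y. 0 < y \<and> (\<exists>s\<ge>0. y <= c s)}"

lemma levels_borel [measurable]: "levels \<in> sets borel"
proof -
 have "levels = (\<Union>n. {0<..c (real n)})"
 proof (intro set_eqI iffI)
  fix y assume "y \<in> levels"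
  then obtain s where s: "0 < y" "0 <= s" "y <= c s" by (auto simp: levels_def)
  obtain n where "s <= real n" using real_arch_simple by blast
  then show "y \<in> (\<Union>n. {0<..c (real n)})"
   using s le[of s "real n"] by (intro UN_I[of n]) auto
 next
  fix y assume "y \<in> (\<Union>n. {0<..c (real n)})"
  then obtain n where "0 < y" "y <= c (real n)" by auto
  then show "y \<in> levels" by (auto simp: levels_def intro!: exI[of _ "real n"])
 qed
 then show ?thesis by simp
qed

lemma measurable_first_reach [measurable]: "first_reach c \<in> Borel (restrict_space lborel levels)"
proof (rule borel_measurableI_le)
 fix t
 have "{y \<in> space (restrict_space lborel levels). first_reach c y <= t} = (if 0 <= t then {0<..c t} else {}) \<inter> levels"
  using first_reach_le_iff[of _ t] first_reach_nonneg
  by (force simp: space_restrict_space levels_def)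
 also have "... \<in> sets (restrict_space lborel levels)"
  by (auto simp: sets_restrict_space)
 finally show "{y \<in> space (restrict_space lborel levels). first_reach c y <= t} \<in> sets (restrict_space lborel levels)" .
qed

definition ext :: "real => real" where "ext t = (if t < 0 then 0 else c t)"

lemma ext_mono: "s <= t ==> ext s <= ext t"
 using le nonneg by (auto simp: ext_def)

lemma ext_right: "continuous (at_right t) ext"
proof (cases "0 <= t")
 case True
 have "eventually (\<lambda>z. c z = ext z) (at_right t)"
  using True by (auto simp: eventually_at_right_field ext_def intro!: gt_ex)
 moreover have "(c \<longlongrightarrow> ext t) (at_right t)"
  using right[OF True] True by (simp add: continuous_within ext_def)
 ultimately show ?thesis
  unfolding continuous_within by (rule Lim_transform_eventually[rotated])
next
 case False
 have "eventually (\<lambda>z. 0 = ext z) (at_right t)"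
  using False by (auto simp: eventually_at_right_field ext_def intro!: exI[of _ 0])
 moreover have "((\<lambda>_. 0) \<longlongrightarrow> ext t) (at_right t)"
  using False by (simp add: ext_def)
 ultimately show ?thesis
  unfolding continuous_within by (rule Lim_transform_eventually[rotated])
qed

text \<open>The Stieltjes measure is the image of Lebesgue measure on the levels under the
  generalized inverse: a level is first reached in \<open>{a<..b}\<close> exactly if it lies in
  \<open>{ext a<..ext b}\<close>.\<close>

lemma interval_measure_ext:
 "interval_measure ext = distr (restrict_space lborel levels) borel (first_reach c)"
proof (rule interval_measure_eqI)
 fix a b :: real assume ab: "a <= b"
 have "first_reach c -` {a<..b} \<inter> levels = {ext a<..ext b}"
 proof (intro set_eqI iffI)
  fix y assume "y \<in> first_reach c -` {a<..b} \<inter> levels"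
  then have y: "y \<in> levels" "a < first_reach c y" "first_reach c y <= b" by auto
  then have ex: "\<exists>s\<ge>0. y <= c s" "0 < y" by (auto simp: levels_def)
  have "0 <= b" using first_reach_nonneg[OF ex(1)] y by simp
  then show "y \<in> {ext a<..ext b}"
   using first_reach_le_iff[OF ex(1), of b] first_reach_le_iff[OF ex(1), of a] y ex(2)
   by (auto simp: ext_def not_le[symmetric])
 next
  fix y assume "y \<in> {ext a<..ext b}"
  then have y: "ext a < y" "y <= ext b" by auto
  have "0 <= ext a" using nonneg by (simp add: ext_def)
  then have "0 < y" "0 <= b" "y <= c b" using y by (auto simp: ext_def split: if_splits)
  then have lev: "y \<in> levels" and ex: "\<exists>s\<ge>0. y <= c s" by (auto simp: levels_def)
  have "first_reach c y <= b"
   using first_reach_le_iff[OF ex \<open>0 <= b\<close>] \<open>y <= c b\<close> by simp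
  moreover have "a < first_reach c y"
   using first_reach_le_iff[OF ex, of a] first_reach_nonneg[OF ex] y(1)
   by (cases "0 <= a") (auto simp: ext_def)
  ultimately show "y \<in> first_reach c -` {a<..b} \<inter> levels" using lev by auto
 qed
 then have "emeasure (distr (restrict_space lborel levels) borel (first_reach c)) {a<..b}
   = emeasure (restrict_space lborel levels) {ext a<..ext b}"
  by (subst emeasure_distr) (auto simp: space_restrict_space)
 also have "... = emeasure lborel {ext a<..ext b}"
  using \<open>first_reach c -` {a<..b} \<inter> levels = _\<close>
  by (intro emeasure_restrict_space) auto
 also have "... = ennreal (ext b - ext a)"
  using ext_mono[OF ab] by simp
 finally show "emeasure (distr (restrict_space lborel levels) borel (first_reach c)) {a<..b} = ennreal (ext b - ext a)" .
qed (auto intro: ext_mono ext_right)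

lemma nn_integral_ext:
 fixes f :: "real => ennreal"
 assumes f: "(\<lambda>t. f t * indicator {0..} t) \<in> Borel borel"
 shows "(\<integral>\<^sup>+t\<in>{0..}. f t \<partial>interval_measure ext)
  = (\<integral>\<^sup>+y. (if y \<in> levels then f (first_reach c y) else 0) \<partial>lborel)"
proof -
 have "(\<integral>\<^sup>+t\<in>{0..}. f t \<partial>interval_measure ext)
   = (\<integral>\<^sup>+y. f (first_reach c y) * indicator {0..} (first_reach c y) \<partial>restrict_space lborel levels)"
  unfolding interval_measure_ext using f by (intro nn_integral_distr) auto
 also have "... = (\<integral>\<^sup>+y. (if y \<in> levels then f (first_reach c y) else 0) \<partial>lborel)"
  using first_reach_nonneg levels_borel
  by (subst nn_integral_restrict_space)
    (auto intro!: nn_integral_cong simp: levels_def[THEN eqset_imp_iff] split: split_indicator)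
 finally show ?thesis .
qed

end

lemma interval_measure_cmult:
 assumes mono: "\<And>x y. x <= y ==> F x <= F y" and cont: "\<And>a. continuous (at_right a) F"
  and c: "0 <= (c::real)"
 shows "interval_measure (\<lambda>t. c * F t) = scale_measure (ennreal c) (interval_measure F)"
proof (rule interval_measure_eqI)
 show "emeasure (scale_measure (ennreal c) (interval_measure F)) {a<..b} = ennreal (c * F b - c * F a)"
  if "a <= b" for a b
  using that c mono[OF that]
  by (simp add: emeasure_interval_measure_Ioc[OF _ mono cont] ennreal_mult[symmetric] right_diff_distrib)
qed (auto intro!: mult_left_mono mono c continuous_intros cont)

text \<open>A level first reached at some \<open>t\<close> in \<open>B\<close> must equal
  \<open>c t\<close>, since it would have been reached earlier otherwise. Flatness to the right
  allows replacing \<open>t\<close> by a rational time, so only countably many levels are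
  concerned.\<close>

lemma (in nondecreasing_path) AE_not_in_flat:
 assumes B: "B \<in> sets borel"
  and flat: "\<And>t. t \<in> B ==> 0 <= t \<and> (\<exists>u>t. c u = c t)"
  and no_jump: "\<And>t y. t \<in> B ==> y < c t ==> \<exists>s\<ge>0. s < t \<and> y <= c s"
 shows "AE t in interval_measure ext. t \<notin> B"
proof -
 have sub: "{y \<in> levels. first_reach c y \<in> B} \<subseteq> c ` {q\<in>\<rat>. 0 <= q}"
 proof
  fix y assume "y \<in> {y \<in> levels. first_reach c y \<in> B}"
  moreover define t where "t = first_reach c y"
  ultimately have y: "y \<in> levels" and t: "t \<in> B" by auto
  then have ex: "\<exists>s\<ge>0. y <= c s" by (auto simp: levels_def)
  have "0 <= t" using flat[OF t] by simp
  then have "y <= c t" using first_reach_le_iff[OF ex, of t] by (simp add: t_def)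
  have "\<not> y < c t"
  proof
   assume "y < c t"
   then obtain s where s: "0 <= s" "s < t" "y <= c s" using no_jump[OF t] by blast
   then show False using first_reach_le_iff[OF ex s(1)] by (simp add: t_def)
  qed
  with \<open>y <= c t\<close> have "y = c t" by simp
  obtain u where u: "t < u" "c u = c t" using flat[OF t] by blast
  obtain q where q: "q \<in> \<rat>" "t < q" "q < u" using Rats_dense_in_real[OF u(1)] by blast
  then have "c q = c t" using le[of t q] le[of q u] u \<open>0 <= t\<close> by simp
  then show "y \<in> c ` {q\<in>\<rat>. 0 <= q}" using q \<open>0 <= t\<close> \<open>y = c t\<close> by (auto intro!: image_eqI[of _ _ q])
 qed
 have "countable {y \<in> levels. first_reach c y \<in> B}"
  by (rule countable_subset[OF sub]) (intro countable_image countable_Collect countable_rat)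
 then have null: "{y \<in> levels. first_reach c y \<in> B} \<in> null_sets lborel"
  by (rule countable_imp_null_set_lborel)
 have "emeasure (interval_measure ext) B
   = emeasure (restrict_space lborel levels) {y \<in> levels. first_reach c y \<in> B}"
  unfolding interval_measure_ext using B
  by (subst emeasure_distr) (auto simp: space_restrict_space intro!: arg_cong2[where f = emeasure])
 also have "... = emeasure lborel {y \<in> levels. first_reach c y \<in> B}"
  by (rule emeasure_restrict_space) auto
 also have "... = 0" using null by auto
 finally show ?thesis
  using B by (intro AE_not_in) (auto simp: null_sets_def)
qed

section \<open>Increments of Levy processes\<close>

context prob_space
begin

lemma integrable_bounded:
 fixes f :: "'a => real"
 shows "f \<in> Borel M ==> (\<And>w. \<bar>f w\<bar> <= K) ==> integrable M f"
 by (intro integrable_const_bound[where B = K]) auto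

lemma indep_set_distr:
 assumes G: "subalgebra M G" and W: "W \<in> G \<rightarrow>\<^sub>M N" and Z: "Z \<in> M \<rightarrow>\<^sub>M L"
  and ind: "indep_set (sets G) {Z -` B \<inter> space M | B. B \<in> sets L}"
 shows "distr M (N \<Otimes>\<^sub>M L) (\<lambda>w. (W w, Z w)) = distr M N W \<Otimes>\<^sub>M distr M L Z"
proof -
 have WM: "W \<in> M \<rightarrow>\<^sub>M N"
  by (rule measurable_from_subalg[OF G W])
 interpret W: prob_space "distr M N W" by (rule prob_space_distr) fact
 interpret Z: prob_space "distr M L Z" by (rule prob_space_distr) fact
 show ?thesis
 proof (rule pair_measure_eqI[symmetric])
  fix A B assume AB: "A \<in> sets (distr M N W)" "B \<in> sets (distr M L Z)"
  have "W -` A \<inter> space M \<in> sets G"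
   using measurable_sets[OF W, of A] G AB by (simp add: subalgebra_def)
  then have "prob ((W -` A \<inter> space M) \<inter> (Z -` B \<inter> space M)) = prob (W -` A \<inter> space M) * prob (Z -` B \<inter> space M)"
   using AB by (intro indep_setD[OF ind]) auto
  moreover have "(W -` A \<inter> space M) \<inter> (Z -` B \<inter> space M) = (\<lambda>w. (W w, Z w)) -` (A \<times> B) \<inter> space M"
   by auto
  ultimately show "emeasure (distr M N W) A * emeasure (distr M L Z) B
    = emeasure (distr M (N \<Otimes>\<^sub>M L) (\<lambda>w. (W w, Z w))) (A \<times> B)"
   using AB WM Z by (simp add: emeasure_distr emeasure_eq_measure ennreal_mult[symmetric])
 qed (unfold_locales, simp)
qed

text \<open>The freezing rule: a variable independent of \<open>G\<close> is integrated while
  everything measurable with respect to \<open>G\<close> is held fixed.\<close>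

lemma indep_set_nn_integral:
 assumes G: "subalgebra M G" and W: "W \<in> G \<rightarrow>\<^sub>M N" and Z: "Z \<in> M \<rightarrow>\<^sub>M L"
  and ind: "indep_set (sets G) {Z -` B \<inter> space M | B. B \<in> sets L}"
  and f: "f \<in> Borel (N \<Otimes>\<^sub>M L)"
 shows "(\<integral>\<^sup>+w. f (W w, Z w) \<partial>M) = (\<integral>\<^sup>+w. \<integral>\<^sup>+w'. f (W w, Z w') \<partial>M \<partial>M)"
proof -
 note [measurable] = Z f measurable_from_subalg[OF G W]
 interpret Z: prob_space "distr M L Z" by (rule prob_space_distr) fact
 have "(\<integral>\<^sup>+w. f (W w, Z w) \<partial>M) = (\<integral>\<^sup>+p. f p \<partial>distr M (N \<Otimes>\<^sub>M L) (\<lambda>w. (W w, Z w)))"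
  by (subst nn_integral_distr) auto
 also have "... = (\<integral>\<^sup>+p. f p \<partial>(distr M N W \<Otimes>\<^sub>M distr M L Z))"
  by (simp add: indep_set_distr[OF G W Z ind])
 also have "... = (\<integral>\<^sup>+w. \<integral>\<^sup>+z. f (w, z) \<partial>distr M L Z \<partial>distr M N W)"
  by (subst Z.nn_integral_fst[symmetric]) auto
 also have "... = (\<integral>\<^sup>+w. \<integral>\<^sup>+w'. f (W w, Z w') \<partial>M \<partial>M)"
  by (subst nn_integral_distr, simp_all, intro nn_integral_cong, subst nn_integral_distr)
    (auto intro: measurable_compose_Pair1 dest: measurable_space[OF measurable_from_subalg[OF G W]])
 finally show ?thesis .
qed

lemma indep_set_integral:
 fixes f :: "'b \<times> 'c => real"
 assumes G: "subalgebra M G" and W: "W \<in> G \<rightarrow>\<^sub>M N" and Z: "Z \<in> M \<rightarrow>\<^sub>M L"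
  and ind: "indep_set (sets G) {Z -` B \<inter> space M | B. B \<in> sets L}"
  and f: "f \<in> Borel (N \<Otimes>\<^sub>M L)" and bnd: "\<And>p. \<bar>f p\<bar> <= K"
 shows "(\<integral>w. f (W w, Z w) \<partial>M) = (\<integral>w. \<integral>w'. f (W w, Z w') \<partial>M \<partial>M)"
proof -
 note [measurable] = Z f measurable_from_subalg[OF G W]
 interpret W: prob_space "distr M N W" by (rule prob_space_distr) fact
 interpret Z: prob_space "distr M L Z" by (rule prob_space_distr) fact
 interpret P: pair_prob_space "distr M N W" "distr M L Z" ..
 have "(\<integral>w. f (W w, Z w) \<partial>M) = (\<integral>p. f p \<partial>distr M (N \<Otimes>\<^sub>M L) (\<lambda>w. (W w, Z w)))"
  by (subst integral_distr) auto
 also have "... = (\<integral>p. f p \<partial>(distr M N W \<Otimes>\<^sub>M distr M L Z))"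
  by (simp add: indep_set_distr[OF G W Z ind])
 also have "... = (\<integral>w. \<integral>z. f (w, z) \<partial>distr M L Z \<partial>distr M N W)"
  using bnd by (intro P.integral_fst'[symmetric] P.integrable_const_bound[where B = K]) auto
 also have "... = (\<integral>w. \<integral>w'. f (W w, Z w') \<partial>M \<partial>M)"
  by (subst integral_distr, simp_all, intro Bochner_Integration.integral_cong refl, subst integral_distr)
    (auto intro: measurable_compose_Pair1 dest: measurable_space[OF measurable_from_subalg[OF G W]])
 finally show ?thesis .
qed

end

section \<open>Levy processes relative to a filtration\<close>

locale filtered_prob_space = prob_space M for M :: "'a measure" +
 fixes F :: "ennreal => 'a measure"
 assumes filtration: "filtration (space M) F" and subalg: "\<And>t. subalgebra M (F t)"
begin

sublocale filtration "space M" F by (rule filtration)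

lemma F_mono: "0 <= s ==> s <= t ==> f \<in> F (ennreal s) \<rightarrow>\<^sub>M N ==> f \<in> F (ennreal t) \<rightarrow>\<^sub>M N"
 using sets_F_mono[of "ennreal s" "ennreal t"] space_F
 by (auto simp: measurable_def ennreal_leI)

lemma F_to_M: "f \<in> F t \<rightarrow>\<^sub>M N ==> f \<in> M \<rightarrow>\<^sub>M N"
 by (rule measurable_from_subalg[OF subalg])

end

locale levy = filtered_prob_space +
 fixes Z :: "real => 'a => real"
 assumes levy: "levy_process M F Z"
begin

lemma Z_0: "w \<in> space M ==> Z 0 w = 0"
 and Z_cadlag: "w \<in> space M ==> cadlag (\<lambda>t. Z t w)"
 and Z_adapted: "adapted F Z"
 using levy by (auto simp: levy_process_def)

lemma Z_F: "0 <= s ==> s <= t ==> Z s \<in> Borel (F (ennreal t))"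
 using Z_adapted F_mono[of s t "Z s"] by (auto simp: adapted_def)

lemma Z_M [measurable]: "0 <= s ==> Z s \<in> Borel M"
 using Z_F[of s s] F_to_M by auto

lemma
 assumes "0 <= s" "0 <= h"
 shows increment_distr: "distr M borel (\<lambda>w. Z (s + h) w - Z s w) = distr M borel (Z h)"
  and increment_indep: "indep_set (sets (F (ennreal s)))
   {(\<lambda>w. Z (s + h) w - Z s w) -` B \<inter> space M | B. B \<in> sets borel}"
proof -
 have "0 <= s \<and> s <= s + h" using assms by simp
 with levy have "indep_set (sets (F (ennreal s)))
   {(\<lambda>w. Z (s + h) w - Z s w) -` B \<inter> space M | B. B \<in> sets borel} \<and>
  distr M borel (\<lambda>w. Z (s + h) w - Z s w) = distr M borel (Z (s + h - s))"
  unfolding levy_process_def by blast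
 then show "distr M borel (\<lambda>w. Z (s + h) w - Z s w) = distr M borel (Z h)"
  "indep_set (sets (F (ennreal s))) {(\<lambda>w. Z (s + h) w - Z s w) -` B \<inter> space M | B. B \<in> sets borel}"
  by simp_all
qed

lemma increment_nn_integral:
 assumes s: "0 <= s" "0 <= h" and W: "W \<in> F (ennreal s) \<rightarrow>\<^sub>M N"
  and f [measurable]: "f \<in> Borel (N \<Otimes>\<^sub>M borel)"
 shows "(\<integral>\<^sup>+w. f (W w, Z (s + h) w - Z s w) \<partial>M) = (\<integral>\<^sup>+w. \<integral>\<^sup>+w'. f (W w, Z h w') \<partial>M \<partial>M)"
proof -
 have [measurable]: "Z (s + h) \<in> Borel M" "Z s \<in> Borel M" "Z h \<in> Borel M"
  using s by auto
 have "(\<integral>\<^sup>+w. f (W w, Z (s + h) w - Z s w) \<partial>M)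
   = (\<integral>\<^sup>+w. \<integral>\<^sup>+w'. f (W w, Z (s + h) w' - Z s w') \<partial>M \<partial>M)"
  by (rule indep_set_nn_integral[OF subalg W _ increment_indep[OF s] f]) measurable
 also have "... = (\<integral>\<^sup>+w. \<integral>\<^sup>+w'. f (W w, Z h w') \<partial>M \<partial>M)"
 proof (rule nn_integral_cong)
  fix w assume "w \<in> space M"
  then have [measurable]: "(\<lambda>z. f (W w, z)) \<in> Borel borel"
   using measurable_space[OF F_to_M[OF W]] by (intro measurable_compose_Pair1[OF _ f]) auto
  show "(\<integral>\<^sup>+w'. f (W w, Z (s + h) w' - Z s w') \<partial>M) = (\<integral>\<^sup>+w'. f (W w, Z h w') \<partial>M)"
   using nn_integral_distr[of "\<lambda>w. Z (s + h) w - Z s w" M borel "\<lambda>z. f (W w, z)"]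
    nn_integral_distr[of "Z h" M borel "\<lambda>z. f (W w, z)"]
   by (simp add: increment_distr[OF s])
 qed
 finally show ?thesis .
qed

lemma increment_integral:
 fixes f :: "'c \<times> real => real"
 assumes s: "0 <= s" "0 <= h" and W: "W \<in> F (ennreal s) \<rightarrow>\<^sub>M N"
  and f [measurable]: "f \<in> Borel (N \<Otimes>\<^sub>M borel)" and bnd: "\<And>p. \<bar>f p\<bar> <= K"
 shows "(\<integral>w. f (W w, Z (s + h) w - Z s w) \<partial>M) = (\<integral>w. \<integral>w'. f (W w, Z h w') \<partial>M \<partial>M)"
proof -
 have [measurable]: "Z (s + h) \<in> Borel M" "Z s \<in> Borel M" "Z h \<in> Borel M"
  using s by auto
 have "(\<integral>w. f (W w, Z (s + h) w - Z s w) \<partial>M)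
   = (\<integral>w. \<integral>w'. f (W w, Z (s + h) w' - Z s w') \<partial>M \<partial>M)"
  by (rule indep_set_integral[OF subalg W _ increment_indep[OF s] f bnd]) measurable
 also have "... = (\<integral>w. \<integral>w'. f (W w, Z h w') \<partial>M \<partial>M)"
 proof (rule Bochner_Integration.integral_cong[OF refl])
  fix w assume "w \<in> space M"
  then have [measurable]: "(\<lambda>z. f (W w, z)) \<in> Borel borel"
   using measurable_space[OF F_to_M[OF W]] by (intro measurable_compose_Pair1[OF _ f]) auto
  show "(\<integral>w'. f (W w, Z (s + h) w' - Z s w') \<partial>M) = (\<integral>w'. f (W w, Z h w') \<partial>M)"
   using integral_distr[of "\<lambda>w. Z (s + h) w - Z s w" M borel "\<lambda>z. f (W w, z)"]
    integral_distr[of "Z h" M borel "\<lambda>z. f (W w, z)"]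
   by (simp add: increment_distr[OF s])
 qed
 finally show ?thesis .
qed

text \<open>Additivity gives \<open>E exp (\<xi> Z\<^sub>q) = exp (q \<pi>)\<close> for rational \<open>q\<close>.  Right continuity and Fatou
 give \<open>\<le>\<close> at every time, and \<open>\<le>\<close> at the two times \<open>t\<close> and \<open>n - t\<close> forces equality.\<close>

lemma exp_moment:
 assumes int: "integrable M (\<lambda>w. exp (\<xi> * Z 1 w))" and t: "0 <= t"
 shows "(\<integral>\<^sup>+w. ennreal (exp (\<xi> * Z t w)) \<partial>M) = ennreal (exp (t * laplace_exponent M Z \<xi>))"
proof -
 define \<pi> where "\<pi> = laplace_exponent M Z \<xi>"
 define \<phi> where "\<phi> t = (\<integral>\<^sup>+w. ennreal (exp (\<xi> * Z t w)) \<partial>M)" for t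
 have add: "\<phi> (s + u) = \<phi> s * \<phi> u" if su: "0 <= s" "0 <= u" for s u
 proof -
  have [measurable]: "Z s \<in> Borel M" "Z u \<in> Borel M" using su by auto
  have "\<phi> (s + u) = (\<integral>\<^sup>+w. (\<lambda>(w, z). ennreal (exp (\<xi> * (w + z)))) (Z s w, Z (s + u) w - Z s w) \<partial>M)"
   by (simp add: \<phi>_def)
  also have "... = (\<integral>\<^sup>+w. \<integral>\<^sup>+w'. (\<lambda>(w, z). ennreal (exp (\<xi> * (w + z)))) (Z s w, Z u w') \<partial>M \<partial>M)"
   by (rule increment_nn_integral[OF su Z_F[of s s]]) (use su in auto)
  also have "... = (\<integral>\<^sup>+w. \<integral>\<^sup>+w'. ennreal (exp (\<xi> * Z s w)) * ennreal (exp (\<xi> * Z u w')) \<partial>M \<partial>M)"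
   by (simp add: distrib_left exp_add ennreal_mult)
  also have "... = \<phi> s * \<phi> u"
   by (simp add: \<phi>_def nn_integral_cmult nn_integral_multc)
  finally show ?thesis .
 qed
 have pos: "\<phi> u \<noteq> 0" if "0 <= u" for u
 proof
  have [measurable]: "Z u \<in> Borel M" using that by auto
  assume "\<phi> u = 0"
  then have "AE w in M. False" by (simp add: \<phi>_def nn_integral_0_iff_AE)
  then show False by simp
 qed
 have one: "\<phi> 1 = ennreal (exp \<pi>)"
 proof -
  have eq: "\<phi> 1 = ennreal (\<integral>w. exp (\<xi> * Z 1 w) \<partial>M)"
   unfolding \<phi>_def using int by (intro nn_integral_eq_integral) auto
  then have "0 < (\<integral>w. exp (\<xi> * Z 1 w) \<partial>M)"
   using pos[of 1] by (auto simp: ennreal_eq_0_iff not_le)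
  then show ?thesis by (simp add: eq \<pi>_def laplace_exponent_def)
 qed
 have mult: "\<phi> (real n * u) = \<phi> u ^ n" if "0 <= u" for n u
 proof (induction n)
  case 0
  have "\<phi> 0 = (\<integral>\<^sup>+w. 1 \<partial>M)"
   unfolding \<phi>_def by (intro nn_integral_cong) (simp add: Z_0)
  then show ?case by (simp add: emeasure_space_1)
 next
  case (Suc n)
  have "\<phi> (real (Suc n) * u) = \<phi> (real n * u + u)"
   by (simp add: algebra_simps)
  also have "... = \<phi> (real n * u) * \<phi> u"
   using that by (intro add) auto
  finally show ?case by (simp only: Suc power_Suc2)
 qed
 have nat: "\<phi> (real n) = ennreal (exp (real n * \<pi>))" for n
  using mult[of 1 n] by (simp add: one ennreal_power exp_of_nat_mult)
 have fin: "\<phi> u < \<top>" if u: "0 <= u" for u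
 proof -
  obtain n where n: "u <= real n" using real_arch_simple by blast
  have "\<phi> u * \<phi> (real n - u) = \<phi> (real n)"
   using add[of u "real n - u"] u n by simp
  also have "... < \<top>" by (simp add: nat)
  finally have "\<phi> u * \<phi> (real n - u) < \<top>" .
  then show ?thesis
   using pos[of "real n - u"] n by (auto simp: ennreal_mult_less_top)
 qed
 have rat: "\<phi> (real m / real k) = ennreal (exp (real m / real k * \<pi>))" if k: "0 < k" for m k :: nat
 proof -
  let ?q = "real m / real k"
  have "\<phi> ?q ^ k = ennreal (exp (real m * \<pi>))"
   using mult[of ?q k] k by (simp add: nat)
  moreover obtain p where p: "\<phi> ?q = ennreal p" "0 <= p"
   using fin[of ?q] by (cases "\<phi> ?q") auto
  ultimately have "p ^ k = exp (real m * \<pi>)"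
   by (simp add: ennreal_power)
  also have "... = exp (?q * \<pi>) ^ k"
   using k by (simp add: exp_of_nat_mult[symmetric])
  finally have "p = exp (?q * \<pi>)"
   using k p(2) by (simp add: power_eq_iff_eq_base)
  then show ?thesis by (simp add: p)
 qed
 have le: "\<phi> u <= ennreal (exp (u * \<pi>))" if u: "0 <= u" for u
 proof -
  define q where "q n = right_grid n u" for n
  have "0 <= q n" for n
   by (simp add: q_def right_grid_nonneg)
  then have [measurable]: "Z u \<in> Borel M" "\<And>n. Z (q n) \<in> Borel M"
   using u by auto
  have lim: "(\<lambda>n. ennreal (exp (\<xi> * Z (q n) w))) \<longlonglongrightarrow> ennreal (exp (\<xi> * Z u w))" if "w \<in> space M" for w
   unfolding q_def using cadlag_right[OF Z_cadlag[OF that] u] u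
   by (intro tendsto_intros right_grid_tendsto[where f = "\<lambda>t. Z t w"]) 
  have "\<phi> u = (\<integral>\<^sup>+w. liminf (\<lambda>n. ennreal (exp (\<xi> * Z (q n) w))) \<partial>M)"
   unfolding \<phi>_def by (intro nn_integral_cong) (rule lim_imp_Liminf[OF _ lim, symmetric], auto)
  also have "... <= liminf (\<lambda>n. \<phi> (q n))"
   unfolding \<phi>_def by (intro nn_integral_liminf) measurable
  also have "liminf (\<lambda>n. \<phi> (q n)) = ennreal (exp (u * \<pi>))"
  proof (rule lim_imp_Liminf)
   have "\<phi> (q n) = ennreal (exp (q n * \<pi>))" for n
    using rat[of "Suc n" "nat \<lfloor>real (Suc n) * u\<rfloor> + 1"] by (simp add: q_def right_grid_def del: of_nat_Suc of_nat_add)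
   moreover have "q \<longlonglongrightarrow> u"
    unfolding q_def using u by (intro right_grid_tendsto[where f = "\<lambda>t. t"]) (auto intro: continuous_intros)
   ultimately show "(\<lambda>n. \<phi> (q n)) \<longlonglongrightarrow> ennreal (exp (u * \<pi>))"
    by (simp, intro tendsto_intros)
  qed simp
  finally show ?thesis .
 qed
 obtain n where n: "t <= real n" using real_arch_simple by blast
 obtain p where p: "\<phi> t = ennreal p" "0 <= p"
  using fin[OF t] by (cases "\<phi> t") auto
 have "ennreal (exp (real n * \<pi>)) = \<phi> t * \<phi> (real n - t)"
  using add[of t "real n - t"] t n by (simp add: nat)
 also have "... <= \<phi> t * ennreal (exp ((real n - t) * \<pi>))"
  using n by (intro mult_left_mono le) auto
 also have "... = ennreal (p * exp ((real n - t) * \<pi>))"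
  using p by (simp add: ennreal_mult)
 finally have "exp (real n * \<pi>) <= p * exp ((real n - t) * \<pi>)"
  using p by (simp add: ennreal_le_iff)
 also have "exp (real n * \<pi>) = exp (t * \<pi>) * exp ((real n - t) * \<pi>)"
  by (simp add: exp_add[symmetric] algebra_simps)
 finally have "exp (t * \<pi>) <= p" by simp
 then have "ennreal (exp (t * \<pi>)) <= \<phi> t" by (simp add: p ennreal_leI)
 with le[OF t] have "\<phi> t = ennreal (exp (t * \<pi>))" by simp
 then show ?thesis by (simp add: \<phi>_def \<pi>_def)
qed

end


text \<open>\<open>transition g u z = E g (z + Z\<^sub>u)\<close>, so \<open>t \<mapsto> transition g (T - t) (Z\<^sub>t - Z\<^sub>s)\<close> is the martingale of the
 conditional expectations of \<open>g (Z\<^sub>T - Z\<^sub>s)\<close>.\<close>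

definition (in levy) transition :: "(real => real) => real => real => real" where
 "transition g u z = (\<integral>w. g (z + Z u w) \<partial>M)"

section \<open>Martingales generated by a bounded function of an increment\<close>

locale levy_function = levy +
 fixes g :: "real => real"
 assumes g [measurable]: "g \<in> Borel borel" and g_le: "\<And>x. \<bar>g x\<bar> <= 1"
begin

lemma transition_measurable [measurable]:
 assumes "0 <= u"
 shows "transition g u \<in> Borel borel"
proof -
 have [measurable]: "Z u \<in> Borel M" using assms by simp
 show ?thesis unfolding transition_def by measurable
qed

lemma transition_integrable: "0 <= u ==> integrable M (\<lambda>w. g (z + Z u w))"
 by (rule integrable_const_bound[where B = 1]) (use g_le in auto)

lemma transition_le:
 assumes "0 <= u"
 shows "\<bar>transition g u z\<bar> <= 1"
proof -
 have "\<bar>transition g u z\<bar> <= (\<integral>w. \<bar>g (z + Z u w)\<bar> \<partial>M)"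
  unfolding transition_def by (rule integral_abs_bound)
 also have "... <= (\<integral>w. 1 \<partial>M)"
  using transition_integrable[OF assms, of z] g_le by (intro integral_mono) auto
 finally show ?thesis by (simp add: prob_space)
qed

text \<open>The Chapman-Kolmogorov equation, obtained by splitting the increment at time
  \<open>v\<close>.\<close>

lemma transition_add:
 assumes "0 <= u" "0 <= v"
 shows "transition g (v + u) z = (\<integral>w. transition g u (z + Z v w) \<partial>M)"
proof -
 have [measurable]: "Z u \<in> Borel M" "Z v \<in> Borel M" "Z (v + u) \<in> Borel M"
  using assms by auto
 have "transition g (v + u) z = (\<integral>w. (\<lambda>(y, x). g (z + y + x)) (Z v w, Z (v + u) w - Z v w) \<partial>M)"
  by (simp add: transition_def algebra_simps)
 also have "... = (\<integral>w. \<integral>w'. (\<lambda>(y, x). g (z + y + x)) (Z v w, Z u w') \<partial>M \<partial>M)"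
  by (rule increment_integral[where N = borel and K = 1]) (use assms g_le Z_F[of v v] in auto)
 finally show ?thesis by (simp add: transition_def)
qed

definition mart :: "real => real => real => 'a => real" where
 "mart s T t w = transition g (T - t) (Z t w - Z s w)"

lemma mart_F: "0 <= s ==> s <= t ==> t <= T ==> t <= t' ==> mart s T t \<in> Borel (F (ennreal t'))"
proof -
 assume t: "0 <= s" "s <= t" "t <= T" "t <= t'"
 then have [measurable]: "Z t \<in> Borel (F (ennreal t'))" "Z s \<in> Borel (F (ennreal t'))"
  "transition g (T - t) \<in> Borel borel"
  using Z_F[of t t'] Z_F[of s t'] by auto
 show "mart s T t \<in> Borel (F (ennreal t'))" unfolding mart_def by measurable
qed

lemma mart_M [measurable]: "0 <= s ==> s <= t ==> t <= T ==> mart s T t \<in> Borel M"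
 using F_to_M[OF mart_F[of s t T t]] by simp

lemma mart_le: "t <= T ==> \<bar>mart s T t w\<bar> <= 1"
 unfolding mart_def by (rule transition_le) simp

lemma mart_start: "s <= T ==> mart s T s w = transition g (T - s) 0"
 by (simp add: mart_def)

lemma mart_end: "w \<in> space M ==> mart s T T w = g (Z T w - Z s w)"
 by (simp add: mart_def transition_def Z_0 prob_space cong: Bochner_Integration.integral_cong)

text \<open>The martingale property tested against bounded weights known at time \<open>t\<close>.
  The weights used later also depend on the other process, which is possible because independence of
  the past is assumed for the whole filtration.\<close>

lemma mart_martingale:
 assumes t: "0 <= s" "s <= t" "t <= t'" "t' <= T" and W: "W \<in> Borel (F (ennreal t))" and Wb: "\<And>w. \<bar>W w\<bar> <= K"
 shows "(\<integral>w. W w * mart s T t' w \<partial>M) = (\<integral>w. W w * mart s T t w \<partial>M)"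
proof -
 \<comment> \<open>Clipping leaves the values of \<open>W\<close> unchanged and makes the integrand
   bounded for all arguments, as \<open>increment_integral\<close> demands.\<close>
 define c where "c x = max (- K) (min K x)" for x :: real
 have c [measurable]: "c \<in> Borel borel" unfolding c_def by measurable
 have K: "0 <= K" using Wb[of undefined] by simp
 have cW: "c (W w) = W w" for w using Wb[of w] by (auto simp: c_def)
 have cK: "\<bar>c x\<bar> <= K" for x using K by (auto simp: c_def)
 define f where "f p = c (fst (fst p)) * transition g (T - t') (snd (fst p) + snd p)" for p :: "(real \<times> real) \<times> real"
 have [measurable]: "transition g (T - t') \<in> Borel borel" using t by simp
 have f [measurable]: "f \<in> Borel ((borel \<Otimes>\<^sub>M borel) \<Otimes>\<^sub>M borel)" unfolding f_def by measurable
 have fb: "\<bar>f p\<bar> <= K" for p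
  using mult_mono[OF cK transition_le[of "T - t'"]] t K by (auto simp: f_def abs_mult split: prod.split)
 have "(\<integral>w. W w * mart s T t' w \<partial>M)
   = (\<integral>w. f ((W w, Z t w - Z s w), Z (t + (t' - t)) w - Z t w) \<partial>M)"
  by (simp add: f_def mart_def cW)
 also have "... = (\<integral>w. \<integral>w'. f ((W w, Z t w - Z s w), Z (t' - t) w') \<partial>M \<partial>M)"
 proof (rule increment_integral[OF _ _ _ f fb])
  show "(\<lambda>w. (W w, Z t w - Z s w)) \<in> F (ennreal t) \<rightarrow>\<^sub>M borel \<Otimes>\<^sub>M borel"
   using W t by (intro measurable_Pair borel_measurable_diff Z_F) auto
 qed (use t in auto)
 also have "... = (\<integral>w. W w * mart s T t w \<partial>M)"
  using transition_add[of "T - t'" "t' - t"] t by (simp add: f_def cW mart_def)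
 finally show ?thesis .
qed

lemma mart_increment_zero:
 assumes t: "0 <= s" "s <= t" "t <= t'" "t' <= T" and W: "W \<in> Borel (F (ennreal t))" and Wb: "\<And>w. \<bar>W w\<bar> <= K"
 shows "(\<integral>w. W w * (mart s T t' w - mart s T t w) \<partial>M) = 0"
proof -
 have [measurable]: "W \<in> Borel M" by (rule F_to_M[OF W])
 have [measurable]: "mart s T t' \<in> Borel M" "mart s T t \<in> Borel M"
  using t by auto
 have K: "0 <= K" using Wb[of undefined] by simp
 have "integrable M (\<lambda>w. W w * mart s T z w)" if "z = t \<or> z = t'" for z
 proof (rule integrable_bounded)
  show "\<bar>W w * mart s T z w\<bar> <= K * 1" for w
   unfolding abs_mult using mart_le[of z T s w] that t Wb K by (intro mult_mono) auto
 qed (use that in auto)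
 then show ?thesis
  using mart_martingale[OF t W Wb] by (simp add: right_diff_distrib)
qed

lemma mart_increment_le: "t <= T ==> t' <= T ==> \<bar>mart s T t' w - mart s T t w\<bar> <= 2"
 using mart_le[of t T s w] mart_le[of t' T s w] by linarith

lemma mart_orthogonal:
 assumes t: "0 <= s" "s <= t1" "t1 <= t2" "t2 <= t3" "t3 <= t4" "t4 <= T"
 shows "(\<integral>w. (mart s T t2 w - mart s T t1 w) * (mart s T t4 w - mart s T t3 w) \<partial>M) = 0"
proof (rule mart_increment_zero)
 show "(\<lambda>w. mart s T t2 w - mart s T t1 w) \<in> Borel (F (ennreal t3))"
  using t by (intro borel_measurable_diff mart_F) auto
 show "\<bar>mart s T t2 w - mart s T t1 w\<bar> <= 2" for w
  using t by (intro mart_increment_le) auto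
qed (use t in auto)

text \<open>Pythagoras: the increment is orthogonal to the past. Sums of second moments of
  increments therefore telescope.\<close>

lemma mart_sq_increment:
 assumes t: "0 <= s" "s <= t" "t <= t'" "t' <= T"
 shows "(\<integral>w. (mart s T t' w - mart s T t w)\<^sup>2 \<partial>M) = (\<integral>w. (mart s T t' w)\<^sup>2 \<partial>M) - (\<integral>w. (mart s T t w)\<^sup>2 \<partial>M)"
proof -
 have [measurable]: "mart s T t' \<in> Borel M" "mart s T t \<in> Borel M"
  using t by auto
 let ?d = "\<lambda>w. mart s T t' w - mart s T t w"
 have zero: "(\<integral>w. mart s T t w * ?d w \<partial>M) = 0"
  using t by (intro mart_increment_zero[where K = 1] mart_F mart_le) auto
 have le: "\<bar>mart s T t w\<bar> <= 1" "\<bar>mart s T t' w\<bar> <= 1" "\<bar>?d w\<bar> <= 2" for w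
  using t by (auto intro!: mart_le mart_increment_le)
 have 1: "integrable M (\<lambda>w. mart s T t w * ?d w)"
 proof (rule integrable_bounded)
  show "\<bar>mart s T t w * ?d w\<bar> <= 1 * 2" for w
   unfolding abs_mult using le by (intro mult_mono) auto
 qed simp
 have 2: "integrable M (\<lambda>w. (mart s T t w)\<^sup>2)" "integrable M (\<lambda>w. (mart s T t' w)\<^sup>2)"
  using le by (auto intro!: integrable_bounded[where K = 1] simp: abs_square_le_1)
 have "(\<integral>w. (?d w)\<^sup>2 \<partial>M) = (\<integral>w. (mart s T t' w)\<^sup>2 - (mart s T t w)\<^sup>2 - 2 * (mart s T t w * ?d w) \<partial>M)"
  by (intro Bochner_Integration.integral_cong) (auto simp: power2_eq_square algebra_simps)
 also have "... = (\<integral>w. (mart s T t' w)\<^sup>2 \<partial>M) - (\<integral>w. (mart s T t w)\<^sup>2 \<partial>M) - 2 * (\<integral>w. mart s T t w * ?d w \<partial>M)"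
  using 1 2 by simp
 finally show ?thesis using zero by simp
qed

text \<open>Measurability with respect to the path, as needed to exploit independence of two processes.\<close>

lemma mart_path:
 assumes t: "0 <= s" "s <= t" "t <= T"
 shows "\<exists>\<phi>\<in>borel_measurable (Pi\<^sub>M {0..} (\<lambda>_. borel)). \<forall>w. mart s T t w = \<phi> (\<lambda>t\<in>{0..}. Z t w)"
proof (intro bexI allI)
 have [measurable]: "transition g (T - t) \<in> Borel borel" using t by simp
 have [measurable]: "(\<lambda>p. p t) \<in> Borel (Pi\<^sub>M {0::real..} (\<lambda>_. borel :: real measure))"
  "(\<lambda>p. p s) \<in> Borel (Pi\<^sub>M {0::real..} (\<lambda>_. borel :: real measure))"
  using t by (auto intro: measurable_component_singleton)
 show "(\<lambda>p. transition g (T - t) (p t - p s)) \<in> Borel (Pi\<^sub>M {0..} (\<lambda>_. borel))"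
  by measurable
 show "mart s T t w = transition g (T - t) ((\<lambda>t\<in>{0..}. Z t w) t - (\<lambda>t\<in>{0..}. Z t w) s)" for w
  using t by (simp add: mart_def)
qed

text \<open>With \<open>\<rho> x = min 2 (L * \<bar>x\<bar>)\<close>, the transition function
  inherits from \<open>g\<close> the modulus \<rho>, so an increment is at most \<rho> of the
  increment of the process plus the mean of \<rho> over a step. One factor of the square is
  estimated by 2, the other by this sum. The bound does not depend on the time
  \<open>t\<close>.\<close>

lemma mart_lipschitz:
 assumes L: "\<And>x y. \<bar>g x - g y\<bar> <= L * \<bar>x - y\<bar>" and t: "0 <= s" "s <= t" "0 <= h" "t + h <= T"
 shows "(\<integral>w. (mart s T (t + h) w - mart s T t w)\<^sup>2 \<partial>M) <= 4 * (\<integral>w. min 2 (L * \<bar>Z h w\<bar>) \<partial>M)"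
proof -
 define \<rho> where "\<rho> x = min 2 (L * \<bar>x\<bar>)" for x
 have [measurable]: "\<rho> \<in> Borel borel" unfolding \<rho>_def by measurable
 have [measurable]: "Z h \<in> Borel M" "Z t \<in> Borel M" "Z (t + h) \<in> Borel M"
  "mart s T (t + h) \<in> Borel M" "mart s T t \<in> Borel M"
  "Z (T - (t + h)) \<in> Borel M"
  using t by auto
 have L0: "0 <= L" using L[of 0 1] abs_ge_zero[of "g 0 - g 1"] by simp
 have \<rho>0: "0 <= \<rho> x" and \<rho>2: "\<rho> x <= 2" for x using L0 by (auto simp: \<rho>_def)
 have \<rho>_int: "integrable M (\<lambda>w. \<rho> (f w))" if [measurable]: "f \<in> Borel M" for f
  using \<rho>0 \<rho>2 by (intro integrable_bounded[where K = 2]) auto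
 let ?u = "T - (t + h)"
 have tr: "\<bar>transition g ?u (y + x) - transition g ?u y\<bar> <= \<rho> x" for y x
 proof -
  have "\<bar>g a - g b\<bar> <= 2" for a b using g_le[of a] g_le[of b] by linarith
  then have pt: "\<bar>g (y + x + z) - g (y + z)\<bar> <= \<rho> x" for z
   using L[of "y + x + z" "y + z"] by (simp add: \<rho>_def)
  have "transition g ?u (y + x) - transition g ?u y = (\<integral>w. g (y + x + Z ?u w) - g (y + Z ?u w) \<partial>M)"
   unfolding transition_def using t
   by (intro Bochner_Integration.integral_diff[symmetric] transition_integrable) auto
  also have "\<bar>...\<bar> <= (\<integral>w. \<bar>g (y + x + Z ?u w) - g (y + Z ?u w)\<bar> \<partial>M)"
   by (rule integral_abs_bound)
  also have "... <= (\<integral>w. \<rho> x \<partial>M)"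
   using pt t by (intro integral_mono integrable_abs Bochner_Integration.integrable_diff transition_integrable) auto
  finally show ?thesis by (simp add: prob_space)
 qed
 have inc: "\<bar>mart s T (t + h) w - mart s T t w\<bar> <= \<rho> (Z (t + h) w - Z t w) + (\<integral>w. \<rho> (Z h w) \<partial>M)" for w
 proof -
  define y where "y = Z t w - Z s w"
  have tu: "T - t = h + ?u" by simp
  have int: "integrable M (\<lambda>w'. transition g ?u (y + Z h w'))"
   using transition_le[of ?u] t transition_measurable[of ?u] by (intro integrable_bounded[where K = 1]) auto
  have "mart s T t w = transition g (h + ?u) y"
   by (simp only: mart_def y_def tu[symmetric])
  also have "... = (\<integral>w'. transition g ?u (y + Z h w') \<partial>M)"
   using t by (intro transition_add) auto
  finally have eq: "mart s T t w - transition g ?u y = (\<integral>w'. transition g ?u (y + Z h w') - transition g ?u y \<partial>M)"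
   using int by (simp add: prob_space)
  have "\<bar>mart s T t w - transition g ?u y\<bar> <= (\<integral>w'. \<bar>transition g ?u (y + Z h w') - transition g ?u y\<bar> \<partial>M)"
   unfolding eq by (rule integral_abs_bound)
  also have "... <= (\<integral>w'. \<rho> (Z h w') \<partial>M)"
  proof (rule integral_mono)
   show "integrable M (\<lambda>w'. \<bar>transition g ?u (y + Z h w') - transition g ?u y\<bar>)"
    by (intro integrable_abs Bochner_Integration.integrable_diff int integrable_const)
   show "integrable M (\<lambda>w'. \<rho> (Z h w'))" by (rule \<rho>_int) measurable
  qed (rule tr)
  finally have "\<bar>mart s T t w - transition g ?u y\<bar> <= (\<integral>w'. \<rho> (Z h w') \<partial>M)" .
  moreover have "\<bar>mart s T (t + h) w - transition g ?u y\<bar> <= \<rho> (Z (t + h) w - Z t w)"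
   using tr[of y "Z (t + h) w - Z t w"] by (simp add: mart_def y_def)
  ultimately show ?thesis by linarith
 qed
 have "(mart s T (t + h) w - mart s T t w)\<^sup>2 <= 2 * (\<rho> (Z (t + h) w - Z t w) + (\<integral>w. \<rho> (Z h w) \<partial>M))" for w
 proof -
  have "(mart s T (t + h) w - mart s T t w)\<^sup>2 = \<bar>mart s T (t + h) w - mart s T t w\<bar> * \<bar>mart s T (t + h) w - mart s T t w\<bar>"
   by (simp add: power2_eq_square)
  also have "... <= 2 * (\<rho> (Z (t + h) w - Z t w) + (\<integral>w. \<rho> (Z h w) \<partial>M))"
   using t by (intro mult_mono inc mart_increment_le) auto
  finally show ?thesis .
 qed
 then have "(\<integral>w. (mart s T (t + h) w - mart s T t w)\<^sup>2 \<partial>M)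
   <= (\<integral>w. 2 * (\<rho> (Z (t + h) w - Z t w) + (\<integral>w. \<rho> (Z h w) \<partial>M)) \<partial>M)"
 proof (intro integral_mono)
  show "integrable M (\<lambda>w. (mart s T (t + h) w - mart s T t w)\<^sup>2)"
  proof (rule integrable_bounded)
   show "\<bar>(mart s T (t + h) w - mart s T t w)\<^sup>2\<bar> <= 2\<^sup>2" for w
    using abs_le_square_iff[of "mart s T (t + h) w - mart s T t w" 2] mart_increment_le[of t T "t + h" s w] t by simp
  qed simp
 qed (use \<rho>_int[of "\<lambda>w. Z (t + h) w - Z t w"] in auto)
 also have "... = 2 * ((\<integral>w. \<rho> (Z (t + h) w - Z t w) \<partial>M) + (\<integral>w. \<rho> (Z h w) \<partial>M))"
  using \<rho>_int[of "\<lambda>w. Z (t + h) w - Z t w"] by (simp add: prob_space)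
 also have "(\<integral>w. \<rho> (Z (t + h) w - Z t w) \<partial>M) = (\<integral>w. \<rho> (Z h w) \<partial>M)"
  using integral_distr[of "\<lambda>w. Z (t + h) w - Z t w" M borel \<rho>] integral_distr[of "Z h" M borel \<rho>]
   increment_distr[of t h] t by simp
 finally show ?thesis by (simp add: \<rho>_def)
qed

end

text \<open>Right continuity at time 0; the cut-off at 2 makes dominated convergence available
  without any moments.\<close>

lemma (in levy) small_increment:
 assumes L0: "0 <= L" and h: "0 <= h"
 shows "(\<lambda>m. \<integral>w. min 2 (L * \<bar>Z (h / real (Suc m)) w\<bar>) \<partial>M) \<longlonglongrightarrow> 0"
proof -
 have Zm: "Z (h / real (Suc m)) \<in> Borel M" for m using h by simp
 have lim: "(\<lambda>m. min 2 (L * \<bar>Z (h / real (Suc m)) w\<bar>)) \<longlonglongrightarrow> 0" if w: "w \<in> space M" for w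
 proof (cases "h = 0")
  case True
  then show ?thesis using w by (simp add: Z_0)
 next
  case False
  have "((\<lambda>t. Z t w) \<longlongrightarrow> 0) (at_right 0)"
   using cadlag_right[OF Z_cadlag[OF w], of 0] Z_0[OF w] by (simp add: continuous_within)
  moreover have "(\<lambda>m. h / real (Suc m)) \<longlonglongrightarrow> 0"
   by (rule LIMSEQ_Suc[OF lim_const_over_n])
  then have "filterlim (\<lambda>m. h / real (Suc m)) (at_right 0) sequentially"
   using False h by (auto simp: filterlim_at)
  ultimately have "(\<lambda>m. Z (h / real (Suc m)) w) \<longlonglongrightarrow> 0"
   by (rule filterlim_compose)
  then have "(\<lambda>m. min 2 (L * \<bar>Z (h / real (Suc m)) w\<bar>)) \<longlonglongrightarrow> min 2 (L * \<bar>0\<bar>)"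
   by (intro tendsto_intros)
  then show ?thesis by simp
 qed
 have "(\<lambda>m. \<integral>w. min 2 (L * \<bar>Z (h / real (Suc m)) w\<bar>) \<partial>M) \<longlonglongrightarrow> (\<integral>w. 0 \<partial>M)"
 proof (rule integral_dominated_convergence[where w = "\<lambda>_. 2"])
  show "(\<lambda>w. min 2 (L * \<bar>Z (h / real (Suc m)) w\<bar>)) \<in> Borel M" for m
   using Zm[of m] by measurable
  show "AE w in M. norm (min 2 (L * \<bar>Z (h / real (Suc m)) w\<bar>)) <= 2" for m
   using L0 by auto
 qed (use lim in auto)
 then show ?thesis by simp
qed

section \<open>Two independent Levy processes\<close>

locale levy_pair = X: levy M F X + C: levy M F C for M F and X C :: "real => 'a => real" +
 assumes independent: "independent_processes M X C"
begin

lemma path_integral_mult: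
 fixes \<phi> \<psi> :: "(real => real) => real"
 assumes [measurable]: "\<phi> \<in> Borel (Pi\<^sub>M {0..} (\<lambda>_. borel))" "\<psi> \<in> Borel (Pi\<^sub>M {0..} (\<lambda>_. borel))"
  and int: "integrable M (\<lambda>w. \<phi> (\<lambda>t\<in>{0..}. X t w))" "integrable M (\<lambda>w. \<psi> (\<lambda>t\<in>{0..}. C t w))"
 shows "(\<integral>w. \<phi> (\<lambda>t\<in>{0..}. X t w) * \<psi> (\<lambda>t\<in>{0..}. C t w) \<partial>M)
  = (\<integral>w. \<phi> (\<lambda>t\<in>{0..}. X t w) \<partial>M) * (\<integral>w. \<psi> (\<lambda>t\<in>{0..}. C t w) \<partial>M)"
proof -
 have "X.indep_var borel (\<phi> \<circ> (\<lambda>w. \<lambda>t\<in>{0..}. X t w)) borel (\<psi> \<circ> (\<lambda>w. \<lambda>t\<in>{0..}. C t w))"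
  using independent unfolding independent_processes_def by (rule X.indep_var_compose) measurable
 then show ?thesis
  using X.indep_var_lebesgue_integral[of "\<lambda>w. \<phi> (\<lambda>t\<in>{0..}. X t w)" "\<lambda>w. \<psi> (\<lambda>t\<in>{0..}. C t w)"] int
  by (simp add: comp_def)
qed

text \<open>Both increments are independent of \<open>F\<^sub>s\<close> separately and of each other.  That they are jointly
 independent of \<open>F\<^sub>s\<close> is due to the continuous time: with \<open>M\<^sub>k\<close>, \<open>N\<^sub>k\<close> the martingales of \<open>f (\<Delta>X)\<close>
 and \<open>g (\<Delta>C)\<close> along a partition, the only obstruction is \<open>Q = \<Sum> \<Delta>M\<^sub>k \<Delta>N\<^sub>k\<close>, and
 \<open>E Q\<^sup>2 = \<Sum> E (\<Delta>M\<^sub>k)\<^sup>2 E (\<Delta>N\<^sub>k)\<^sup>2\<close> vanishes with the mesh.\<close>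

lemma joint_increment_integral:
 fixes f g :: "real => real"
 assumes s: "0 <= s" "0 <= h" and B: "B \<in> sets (F (ennreal s))"
  and f: "f \<in> Borel borel" "\<And>x. \<bar>f x\<bar> <= 1"
  and g: "g \<in> Borel borel" "\<And>x. \<bar>g x\<bar> <= 1" and L: "\<And>x y. \<bar>g x - g y\<bar> <= L * \<bar>x - y\<bar>"
 shows "(\<integral>w. indicator B w * (f (X (s + h) w - X s w) * g (C (s + h) w - C s w)) \<partial>M)
  = measure M B * ((\<integral>w. f (X h w) \<partial>M) * (\<integral>w. g (C h w) \<partial>M))"
proof -
 interpret XF: levy_function M F X f by unfold_locales (use f in auto)
 interpret CF: levy_function M F C g by unfold_locales (use g in auto)
 define T where "T = s + h"
 define e where "e m = (\<integral>w. min 2 (L * \<bar>C (h / real (Suc m)) w\<bar>) \<partial>M)" for m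
 have L0: "0 <= L" using L[of 0 1] abs_ge_zero[of "g 0 - g 1"] by simp
 have e0: "e \<longlonglongrightarrow> 0" unfolding e_def using C.small_increment[OF L0 s(2)] .
 have BM [measurable]: "B \<in> sets M" using B X.subalg by (auto simp: subalgebra_def)
 let ?I = "\<integral>w. indicator B w * (f (X (s + h) w - X s w) * g (C (s + h) w - C s w)) \<partial>M"
 let ?J = "measure M B * ((\<integral>w. f (X h w) \<partial>M) * (\<integral>w. g (C h w) \<partial>M))"
 have bound: "\<bar>?I - ?J\<bar> <= \<epsilon> + 4 * e m / \<epsilon>" if \<epsilon>: "0 < \<epsilon>" for \<epsilon> m
 proof -
  define v where "v = h / real (Suc m)"
  define \<tau> where "\<tau> k = s + real k * v" for k
  have v: "0 <= v" using s by (simp add: v_def)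
  have \<tau>0: "\<tau> 0 = s" and \<tau>S: "\<tau> (Suc k) = \<tau> k + v" for k
   by (simp_all add: \<tau>_def algebra_simps)
  have \<tau>N: "\<tau> (Suc m) = T"
   by (simp add: \<tau>_def v_def T_def del: of_nat_Suc)
  have \<tau>_mono: "\<tau> j <= \<tau> k" if "j <= k" for j k
   using that v by (auto simp: \<tau>_def intro!: mult_right_mono)
  have \<tau>s: "s <= \<tau> k" for k using v by (simp add: \<tau>_def)
  have \<tau>T: "\<tau> k <= T" if "k <= Suc m" for k using \<tau>_mono[OF that] \<tau>N by simp
  define P where "P k = XF.mart s T (\<tau> k)" for k
  define R where "R k = CF.mart s T (\<tau> k)" for k
  define D where "D k w = P (Suc k) w - P k w" for k w
  define E where "E k w = R (Suc k) w - R k w" for k w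
  have Pm: "P k \<in> Borel M" and Rm: "R k \<in> Borel M" if "k <= Suc m" for k
   unfolding P_def R_def using s \<tau>s \<tau>T[OF that] by (auto intro: XF.mart_M CF.mart_M)
  have Dm: "D k \<in> Borel M" and Em: "E k \<in> Borel M" if "k < Suc m" for k
   unfolding D_def E_def using that by (auto intro!: borel_measurable_diff Pm Rm)
  have Pb: "\<bar>P k w\<bar> <= 1" and Rb: "\<bar>R k w\<bar> <= 1" if "k <= Suc m" for k w
   unfolding P_def R_def using \<tau>T[OF that] by (auto intro: XF.mart_le CF.mart_le)
  have Db: "\<bar>D k w\<bar> <= 2" and Eb: "\<bar>E k w\<bar> <= 2" if "k < Suc m" for k w
   unfolding D_def E_def P_def R_def using that
   by (auto intro!: XF.mart_increment_le CF.mart_increment_le \<tau>T)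
  have ind: "indicator B \<in> Borel (F (ennreal (\<tau> k)))" for k
   using B X.sets_F_mono[of "ennreal s" "ennreal (\<tau> k)"] \<tau>s by (auto simp: ennreal_leI)
  have abs_ind: "\<bar>indicator B w * y\<bar> <= \<bar>y\<bar>" for w and y :: real
   by (simp add: indicator_def)
  have zero1: "(\<integral>w. indicator B w * P k w * E k w \<partial>M) = 0" if k: "k < Suc m" for k
   unfolding E_def R_def
  proof (rule CF.mart_increment_zero)
   show "(\<lambda>w. indicator B w * P k w) \<in> Borel (F (ennreal (\<tau> k)))"
    unfolding P_def using s \<tau>s \<tau>T k by (intro borel_measurable_times ind XF.mart_F) auto
   show "\<bar>indicator B w * P k w\<bar> <= 1" for w
    using abs_ind Pb k by (meson less_or_eq_imp_le order_trans)
  qed (use s \<tau>s \<tau>T k \<tau>_mono in auto)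
  have zero2: "(\<integral>w. indicator B w * R k w * D k w \<partial>M) = 0" if k: "k < Suc m" for k
   unfolding D_def P_def
  proof (rule XF.mart_increment_zero)
   show "(\<lambda>w. indicator B w * R k w) \<in> Borel (F (ennreal (\<tau> k)))"
    unfolding R_def using s \<tau>s \<tau>T k by (intro borel_measurable_times ind CF.mart_F) auto
   show "\<bar>indicator B w * R k w\<bar> <= 1" for w
    using abs_ind Rb k by (meson less_or_eq_imp_le order_trans)
  qed (use s \<tau>s \<tau>T k \<tau>_mono in auto)
  define Q where "Q w = (\<Sum>k<Suc m. D k w * E k w)" for w
  have Qm [measurable]: "Q \<in> Borel M"
   unfolding Q_def using Dm Em by (intro borel_measurable_sum borel_measurable_times) auto
  have Qb: "\<bar>Q w\<bar> <= 4 * real (Suc m)" for w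
  proof -
   have "\<bar>Q w\<bar> <= (\<Sum>k<Suc m. \<bar>D k w * E k w\<bar>)" unfolding Q_def by (rule sum_abs)
   also have "... <= (\<Sum>k<Suc m. 2 * 2)"
    unfolding abs_mult using Db Eb by (intro sum_mono mult_mono) auto
   finally show ?thesis by simp
  qed
  \<comment> \<open>Summation by parts for a product of two martingales. The mixed terms have mean 0
    against the indicator of \<open>B\<close>, which leaves the covariation
    \<open>Q\<close>.\<close>
  have tele: "P (Suc m) w * R (Suc m) w - P 0 w * R 0 w
    = (\<Sum>k<Suc m. P k w * E k w + R k w * D k w) + Q w" for w
  proof -
   have "P (Suc m) w * R (Suc m) w - P 0 w * R 0 w = (\<Sum>k<Suc m. P (Suc k) w * R (Suc k) w - P k w * R k w)"
    using sum_lessThan_telescope[of "\<lambda>k. P k w * R k w" "Suc m"] by simp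
   also have "... = (\<Sum>k<Suc m. (P k w * E k w + R k w * D k w) + D k w * E k w)"
    by (intro sum.cong) (auto simp: D_def E_def algebra_simps)
   finally show ?thesis by (simp only: sum.distrib Q_def)
  qed
  have intPE: "integrable M (\<lambda>w. indicator B w * P k w * E k w)" if k: "k < Suc m" for k
  proof (rule X.integrable_bounded)
   show "\<bar>indicator B w * P k w * E k w\<bar> <= 1 * 2" for w
    unfolding abs_mult[of "indicator B w * P k w"] using k order_trans[OF abs_ind Pb[of k]]
    by (intro mult_mono Eb) auto
  qed (use k Pm[of k] Em[of k] in auto)
  have intRD: "integrable M (\<lambda>w. indicator B w * R k w * D k w)" if k: "k < Suc m" for k
  proof (rule X.integrable_bounded)
   show "\<bar>indicator B w * R k w * D k w\<bar> <= 1 * 2" for w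
    unfolding abs_mult[of "indicator B w * R k w"] using k order_trans[OF abs_ind Rb[of k]]
    by (intro mult_mono Db) auto
  qed (use k Rm[of k] Dm[of k] in auto)
  have intQ: "integrable M (\<lambda>w. indicator B w * Q w)"
   using Qb order_trans[OF abs_ind Qb] by (intro X.integrable_bounded) auto
  have PR0: "P 0 w * R 0 w = (\<integral>w. f (X h w) \<partial>M) * (\<integral>w. g (C h w) \<partial>M)" for w
   using XF.mart_start[of s T w] CF.mart_start[of s T w] s(2)
   by (simp add: P_def R_def \<tau>0 X.transition_def C.transition_def T_def)
  have PRN: "P (Suc m) w * R (Suc m) w = f (X (s + h) w - X s w) * g (C (s + h) w - C s w)" if "w \<in> space M" for w
   using XF.mart_end[OF that, of s T] CF.mart_end[OF that, of s T]
   by (simp add: P_def R_def \<tau>N T_def)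
  have "?I = (\<integral>w. indicator B w * (P 0 w * R 0 w)
    + (\<Sum>k<Suc m. indicator B w * P k w * E k w + indicator B w * R k w * D k w) + indicator B w * Q w \<partial>M)"
  proof (rule Bochner_Integration.integral_cong[OF refl])
   fix w assume w: "w \<in> space M"
   have "f (X (s + h) w - X s w) * g (C (s + h) w - C s w)
     = P 0 w * R 0 w + (\<Sum>k<Suc m. P k w * E k w + R k w * D k w) + Q w"
    using tele[of w] PRN[OF w] by linarith
   then have "indicator B w * (f (X (s + h) w - X s w) * g (C (s + h) w - C s w))
     = indicator B w * (P 0 w * R 0 w) + indicator B w * (\<Sum>k<Suc m. P k w * E k w + R k w * D k w) + indicator B w * Q w"
    by (simp only: distrib_left)
   also have "indicator B w * (\<Sum>k<Suc m. P k w * E k w + R k w * D k w)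
     = (\<Sum>k<Suc m. indicator B w * P k w * E k w + indicator B w * R k w * D k w)"
    by (simp only: sum_distrib_left distrib_left mult.assoc)
   finally show "indicator B w * (f (X (s + h) w - X s w) * g (C (s + h) w - C s w))
     = indicator B w * (P 0 w * R 0 w) + (\<Sum>k<Suc m. indicator B w * P k w * E k w + indicator B w * R k w * D k w) + indicator B w * Q w" .
  qed
  also have "... = ?J + (\<integral>w. indicator B w * Q w \<partial>M)"
  proof -
   have 1: "has_bochner_integral M (\<lambda>w. indicator B w * (P 0 w * R 0 w)) ?J"
    unfolding PR0 by (intro has_bochner_integral_mult_left has_bochner_integral_real_indicator) (auto simp: X.emeasure_eq_measure)
   have 2: "has_bochner_integral M (\<lambda>w. \<Sum>k<Suc m. indicator B w * P k w * E k w + indicator B w * R k w * D k w) (\<Sum>k<Suc m. 0 + 0)"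
    using has_bochner_integral_integrable[OF intPE] has_bochner_integral_integrable[OF intRD] zero1 zero2
    by (intro has_bochner_integral_sum has_bochner_integral_add) auto
   show ?thesis
    using has_bochner_integral_add[OF has_bochner_integral_add[OF 1 2] has_bochner_integral_integrable[OF intQ]]
    by (auto dest!: has_bochner_integral_integral_eq)
  qed
  finally have "?I - ?J = (\<integral>w. indicator B w * Q w \<partial>M)" by simp
  then have "\<bar>?I - ?J\<bar> <= (\<integral>w. \<bar>indicator B w * Q w\<bar> \<partial>M)"
   by (simp add: integral_abs_bound)
  \<comment> \<open>This trades the first moment of \<open>Q\<close> for its second, the only one
    that can be computed. The mesh is sent to 0 before \<epsilon>.\<close>
  also have "... <= (\<integral>w. \<epsilon> + (Q w)\<^sup>2 / \<epsilon> \<partial>M)"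
  proof (rule integral_mono)
   show "integrable M (\<lambda>w. \<bar>indicator B w * Q w\<bar>)" using intQ by (rule integrable_abs)
   show "integrable M (\<lambda>w. \<epsilon> + (Q w)\<^sup>2 / \<epsilon>)"
   proof (intro Bochner_Integration.integrable_add integrable_divide)
    show "integrable M (\<lambda>w. (Q w)\<^sup>2)"
    proof (rule X.integrable_bounded)
     show "\<bar>(Q w)\<^sup>2\<bar> <= (4 * real (Suc m))\<^sup>2" for w
      using Qb[of w] by (simp only: abs_power2 abs_le_square_iff[symmetric])
    qed simp
   qed (rule X.integrable_const)
   show "\<bar>indicator B w * Q w\<bar> <= \<epsilon> + (Q w)\<^sup>2 / \<epsilon>" for w
   proof (rule order_trans[OF abs_ind])
    have "\<bar>Q w\<bar> * \<epsilon> <= \<epsilon> * \<epsilon> + \<bar>Q w\<bar> * \<bar>Q w\<bar>"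
     using \<epsilon> mult_left_mono[of "\<bar>Q w\<bar>" \<epsilon> \<epsilon>] mult_left_mono[of \<epsilon> "\<bar>Q w\<bar>" "\<bar>Q w\<bar>"]
     by (cases "\<bar>Q w\<bar> <= \<epsilon>") (auto simp: mult.commute add_increasing2 add_increasing)
    then show "\<bar>Q w\<bar> <= \<epsilon> + (Q w)\<^sup>2 / \<epsilon>"
     using \<epsilon> by (simp add: field_simps power2_eq_square)
   qed
  qed
  also have "... = \<epsilon> + (\<integral>w. (Q w)\<^sup>2 \<partial>M) / \<epsilon>"
  proof -
   have "integrable M (\<lambda>w. (Q w)\<^sup>2)"
   proof (rule X.integrable_bounded)
    show "\<bar>(Q w)\<^sup>2\<bar> <= (4 * real (Suc m))\<^sup>2" for w
     using Qb[of w] by (simp only: abs_power2 abs_le_square_iff[symmetric])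
   qed simp
   then show ?thesis by (simp add: X.prob_space)
  qed
  also have "(\<integral>w. (Q w)\<^sup>2 \<partial>M) <= 4 * e m"
  proof -
   have DD: "integrable M (\<lambda>w. D j w * D k w)" and EE: "integrable M (\<lambda>w. E j w * E k w)"
    and DE: "integrable M (\<lambda>w. (D j w * D k w) * (E j w * E k w))"
    if jk: "j < Suc m" "k < Suc m" for j k
   proof -
    have 1: "\<bar>D j w * D k w\<bar> <= 2 * 2" for w
     unfolding abs_mult using jk by (intro mult_mono Db) auto
    have 2: "\<bar>E j w * E k w\<bar> <= 2 * 2" for w
     unfolding abs_mult using jk by (intro mult_mono Eb) auto
    have 3: "\<bar>(D j w * D k w) * (E j w * E k w)\<bar> <= (2 * 2) * (2 * 2)" for w
     unfolding abs_mult[of "D j w * D k w"] by (intro mult_mono 1 2) auto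
    note [measurable] = Dm[OF jk(1)] Dm[OF jk(2)] Em[OF jk(1)] Em[OF jk(2)]
    show "integrable M (\<lambda>w. D j w * D k w)" by (rule X.integrable_bounded[OF _ 1]) measurable
    show "integrable M (\<lambda>w. E j w * E k w)" by (rule X.integrable_bounded[OF _ 2]) measurable
    show "integrable M (\<lambda>w. (D j w * D k w) * (E j w * E k w))" by (rule X.integrable_bounded[OF _ 3]) measurable
   qed
   have prod: "(\<integral>w. (D j w * D k w) * (E j w * E k w) \<partial>M) = (\<integral>w. D j w * D k w \<partial>M) * (\<integral>w. E j w * E k w \<partial>M)"
    if jk: "j < Suc m" "k < Suc m" for j k
   proof -
    have "\<exists>\<phi>. \<forall>i\<le>Suc m. \<phi> i \<in> Borel (Pi\<^sub>M {0..} (\<lambda>_. borel)) \<and> (\<forall>w. P i w = \<phi> i (\<lambda>t\<in>{0..}. X t w))"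
     using XF.mart_path[OF s(1) \<tau>s \<tau>T] unfolding P_def by (intro choice) blast
    then obtain \<phi> where [measurable]: "\<And>i. i <= Suc m ==> \<phi> i \<in> Borel (Pi\<^sub>M {0..} (\<lambda>_. borel))"
     and \<phi>: "\<And>i w. i <= Suc m ==> P i w = \<phi> i (\<lambda>t\<in>{0..}. X t w)" by blast
    have "\<exists>\<psi>. \<forall>i\<le>Suc m. \<psi> i \<in> Borel (Pi\<^sub>M {0..} (\<lambda>_. borel)) \<and> (\<forall>w. R i w = \<psi> i (\<lambda>t\<in>{0..}. C t w))"
     using CF.mart_path[OF s(1) \<tau>s \<tau>T] unfolding R_def by (intro choice) blast
    then obtain \<psi> where [measurable]: "\<And>i. i <= Suc m ==> \<psi> i \<in> Borel (Pi\<^sub>M {0..} (\<lambda>_. borel))"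
     and \<psi>: "\<And>i w. i <= Suc m ==> R i w = \<psi> i (\<lambda>t\<in>{0..}. C t w)" by blast
    have le: "j <= Suc m" "k <= Suc m" "Suc j <= Suc m" "Suc k <= Suc m" using jk by auto
    have D\<phi>: "D j w * D k w = (\<lambda>p. (\<phi> (Suc j) p - \<phi> j p) * (\<phi> (Suc k) p - \<phi> k p)) (\<lambda>t\<in>{0..}. X t w)" for w
     using le by (simp add: D_def \<phi>)
    have E\<psi>: "E j w * E k w = (\<lambda>p. (\<psi> (Suc j) p - \<psi> j p) * (\<psi> (Suc k) p - \<psi> k p)) (\<lambda>t\<in>{0..}. C t w)" for w
     using le by (simp add: E_def \<psi>)
    show ?thesis
     using DD[OF jk] EE[OF jk] le unfolding D\<phi> E\<psi>
     by (intro path_integral_mult) measurable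
   qed
   have off: "(\<integral>w. D j w * D k w \<partial>M) = 0" if jk: "j < Suc m" "k < Suc m" "j \<noteq> k" for j k
   proof -
    have lt: "(\<integral>w. D j w * D k w \<partial>M) = 0" if "j < k" "k < Suc m" for j k
     unfolding D_def P_def using that s \<tau>s by (intro XF.mart_orthogonal \<tau>_mono \<tau>T) auto
    show ?thesis
     using lt[of j k] lt[of k j] jk by (cases "j < k") (auto simp: mult.commute)
   qed
   \<comment> \<open>Independence of the two processes factorizes each term of the double sum, and
     orthogonality of the increments \<open>D\<close> removes the terms off the diagonal.\<close>
   have "(\<integral>w. (Q w)\<^sup>2 \<partial>M) = (\<integral>w. (\<Sum>j<Suc m. \<Sum>k<Suc m. (D j w * D k w) * (E j w * E k w)) \<partial>M)"
    by (intro Bochner_Integration.integral_cong refl)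
      (simp add: Q_def power2_eq_square sum_product mult_ac del: sum.lessThan_Suc)
   also have "... = (\<Sum>j<Suc m. \<Sum>k<Suc m. \<integral>w. (D j w * D k w) * (E j w * E k w) \<partial>M)"
    using DE by (subst Bochner_Integration.integral_sum)
     (auto intro!: Bochner_Integration.integrable_sum sum.cong Bochner_Integration.integral_sum simp del: sum.lessThan_Suc)
   also have "... = (\<Sum>j<Suc m. \<Sum>k<Suc m. if j = k then (\<integral>w. (D j w)\<^sup>2 \<partial>M) * (\<integral>w. (E j w)\<^sup>2 \<partial>M) else 0)"
    by (intro sum.cong refl) (auto simp: prod off power2_eq_square)
   also have "... = (\<Sum>j<Suc m. (\<integral>w. (D j w)\<^sup>2 \<partial>M) * (\<integral>w. (E j w)\<^sup>2 \<partial>M))"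
    by (intro sum.cong refl) (simp del: sum.lessThan_Suc)
   \<comment> \<open>One factor is small uniformly in \<open>j\<close>; the sum of the other factors
     telescopes to at most 1.\<close>
   also have "... <= (\<Sum>j<Suc m. (\<integral>w. (D j w)\<^sup>2 \<partial>M) * (4 * e m))"
   proof (intro sum_mono mult_left_mono)
    fix j assume "j \<in> {..<Suc m}"
    then have "\<tau> j + v <= T" using \<tau>T[of "Suc j"] \<tau>S[of j] by simp
    then show "(\<integral>w. (E j w)\<^sup>2 \<partial>M) <= 4 * e m"
     unfolding E_def R_def \<tau>S e_def v_def[symmetric] using s \<tau>s v by (intro CF.mart_lipschitz L) auto
   qed simp
   also have "... = (\<Sum>j<Suc m. (\<integral>w. (P (Suc j) w)\<^sup>2 \<partial>M) - (\<integral>w. (P j w)\<^sup>2 \<partial>M)) * (4 * e m)"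
    unfolding sum_distrib_right[symmetric] D_def P_def using s \<tau>s
    by (intro arg_cong2[where f = "(*)"] sum.cong refl XF.mart_sq_increment \<tau>_mono \<tau>T) auto
   also have "... = ((\<integral>w. (P (Suc m) w)\<^sup>2 \<partial>M) - (\<integral>w. (P 0 w)\<^sup>2 \<partial>M)) * (4 * e m)"
    by (simp only: sum_lessThan_telescope[of "\<lambda>j. \<integral>w. (P j w)\<^sup>2 \<partial>M"])
   also have "... <= 1 * (4 * e m)"
   proof (rule mult_right_mono)
    have P1: "(\<integral>w. (P (Suc m) w)\<^sup>2 \<partial>M) <= (\<integral>w. 1 \<partial>M)"
     using Pb[of "Suc m"] Pm[of "Suc m"]
     by (intro integral_mono X.integrable_bounded[where K = 1]) (auto simp: abs_square_le_1)
    have P0: "0 <= (\<integral>w. (P 0 w)\<^sup>2 \<partial>M)"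
     by (rule Bochner_Integration.integral_nonneg) simp
    have "(\<integral>w. 1 \<partial>M) = (1 :: real)" by (simp add: X.prob_space)
    with P1 P0 show "(\<integral>w. (P (Suc m) w)\<^sup>2 \<partial>M) - (\<integral>w. (P 0 w)\<^sup>2 \<partial>M) <= 1"
     by linarith
    show "0 <= 4 * e m" using L0 by (auto simp: e_def)
   qed
   finally show ?thesis by simp
  qed
  finally show ?thesis using \<epsilon> by (simp add: divide_right_mono)
 qed
 have "\<bar>?I - ?J\<bar> <= \<epsilon>" if "0 < \<epsilon>" for \<epsilon>
 proof (rule LIMSEQ_le_const)
  show "(\<lambda>m. \<epsilon> + 4 * e m / \<epsilon>) \<longlonglongrightarrow> \<epsilon>"
   using tendsto_add[OF tendsto_const tendsto_divide[OF tendsto_mult_right_zero[OF e0] tendsto_const[of \<epsilon>]], of \<epsilon> 4] that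
   by simp
  show "\<exists>N. \<forall>m\<ge>N. \<bar>?I - ?J\<bar> <= \<epsilon> + 4 * e m / \<epsilon>"
   using bound[OF that] by blast
 qed
 then have "\<bar>?I - ?J\<bar> <= 0"
  using field_le_epsilon[of "\<bar>?I - ?J\<bar>" 0] by simp
 then show ?thesis by simp
qed

text \<open>The preceding lemma requires one Lipschitz factor. The ramps \<open>g n\<close>, equal
  to 1 up to \<open>b\<close> and to 0 from \<open>b + 1 / n\<close> on, approximate the indicator
  of a half-line, and half-lines generate the Borel sets.\<close>

lemma joint_increment_prob:
 assumes s: "0 <= s" "0 <= h" and B: "B \<in> sets (F (ennreal s))" and A: "A \<in> sets borel"
 shows "measure M ({w \<in> B. X (s + h) w - X s w \<in> A} \<inter> {w \<in> space M. C (s + h) w - C s w <= b})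
  = measure M B * measure M {w \<in> space M. X h w \<in> A} * measure M {w \<in> space M. C h w <= b}"
proof -
 note [measurable] = A
 have BM [measurable]: "B \<in> sets M" using B X.subalg by (auto simp: subalgebra_def)
 have Bsub: "B \<subseteq> space M" using BM by (rule sets.sets_into_space)
 have [measurable]: "X h \<in> Borel M" "C h \<in> Borel M"
  "X s \<in> Borel M" "C s \<in> Borel M"
  "X (s + h) \<in> Borel M" "C (s + h) \<in> Borel M" using s by auto
 define g where "g n x = max 0 (min 1 (1 - real n * (x - b)))" for n x
 have [measurable]: "g n \<in> Borel borel" for n unfolding g_def by measurable
 have gb: "\<bar>g n x\<bar> <= 1" for n x by (auto simp: g_def)
 have gL: "\<bar>g n x - g n y\<bar> <= real n * \<bar>x - y\<bar>" for n x y
 proof -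
  have "\<bar>g n x - g n y\<bar> <= \<bar>real n * (x - b) - real n * (y - b)\<bar>"
   by (auto simp: g_def)
  also have "... = real n * \<bar>x - y\<bar>"
   by (simp add: right_diff_distrib[symmetric] abs_mult)
  finally show ?thesis .
 qed
 have glim: "(\<lambda>n. g n x) \<longlonglongrightarrow> indicator {..b} x" for x
 proof (cases "x <= b")
  case True
  then have "g n x = 1" for n using mult_nonneg_nonpos[of "real n" "x - b"] by (auto simp: g_def)
  then show ?thesis using True by simp
 next
  case False
  then obtain N where N: "1 < real N * (x - b)"
   using ex_less_of_nat_mult[of "x - b" 1] by auto
  have "g n x = 0" if "N <= n" for n
  proof -
   have "real N * (x - b) <= real n * (x - b)" using that False by (intro mult_right_mono) auto
   then show ?thesis using N by (simp add: g_def)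
  qed
  then have "eventually (\<lambda>n. g n x = 0) sequentially"
   using eventually_sequentially by blast
  then show ?thesis using False by (simp add: tendsto_eventually)
 qed
 let ?f = "indicator A :: real => real"
 let ?l = "\<lambda>n. \<integral>w. indicator B w * (?f (X (s + h) w - X s w) * g n (C (s + h) w - C s w)) \<partial>M"
 let ?r = "\<lambda>n. measure M B * ((\<integral>w. ?f (X h w) \<partial>M) * (\<integral>w. g n (C h w) \<partial>M))"
 have eq: "?l n = ?r n" for n
  by (rule joint_increment_integral[OF s B _ _ _ gb gL]) (auto simp: indicator_def)
 have "?l \<longlonglongrightarrow> (\<integral>w. indicator B w * (?f (X (s + h) w - X s w) * indicator {..b} (C (s + h) w - C s w)) \<partial>M)"
  using gb by (intro integral_dominated_convergence[where w = "\<lambda>_. 1"] AE_I2 tendsto_intros glim)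
   (auto simp: indicator_def)
 also have "(\<integral>w. indicator B w * (?f (X (s + h) w - X s w) * indicator {..b} (C (s + h) w - C s w)) \<partial>M)
   = (\<integral>w. indicator ({w \<in> B. X (s + h) w - X s w \<in> A} \<inter> {w \<in> space M. C (s + h) w - C s w <= b}) w \<partial>M)"
  by (intro Bochner_Integration.integral_cong) (auto simp: indicator_def)
 also have "... = measure M ({w \<in> B. X (s + h) w - X s w \<in> A} \<inter> {w \<in> space M. C (s + h) w - C s w <= b})"
 proof -
  have "{w \<in> B. X (s + h) w - X s w \<in> A} \<inter> {w \<in> space M. C (s + h) w - C s w <= b}
   = B \<inter> {w \<in> space M. X (s + h) w - X s w \<in> A \<and> C (s + h) w - C s w <= b}" using Bsub by auto
  also have "... \<in> sets M" by measurable
  finally show ?thesis by (simp add: Int_absorb2 sets.sets_into_space)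
 qed
 finally have 1: "?l \<longlonglongrightarrow> ..." .
 have "?r \<longlonglongrightarrow> measure M B * ((\<integral>w. ?f (X h w) \<partial>M) * (\<integral>w. indicator {..b} (C h w) \<partial>M))"
  using gb by (intro tendsto_intros integral_dominated_convergence[where w = "\<lambda>_. 1"] AE_I2 glim) auto
 then have "?l \<longlonglongrightarrow> measure M B * ((\<integral>w. ?f (X h w) \<partial>M) * (\<integral>w. indicator {..b} (C h w) \<partial>M))"
  unfolding eq .
 also have "(\<integral>w. ?f (X h w) \<partial>M) = (\<integral>w. indicator {w \<in> space M. X h w \<in> A} w \<partial>M)"
  by (intro Bochner_Integration.integral_cong) (auto simp: indicator_def)
 also have "... = measure M {w \<in> space M. X h w \<in> A}"
  by (simp add: Int_absorb2)
 also have "(\<integral>w. indicator {..b} (C h w) \<partial>M) = (\<integral>w. indicator {w \<in> space M. C h w <= b} w \<partial>M)"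
  by (intro Bochner_Integration.integral_cong) (auto simp: indicator_def)
 also have "... = measure M {w \<in> space M. C h w <= b}"
  by (simp add: Int_absorb2)
 finally have 2: "?l \<longlonglongrightarrow> measure M B * (measure M {w \<in> space M. X h w \<in> A} * measure M {w \<in> space M. C h w <= b})" .
 show ?thesis using LIMSEQ_unique[OF 1 2] by simp
qed

text \<open>The past together with the increment of \<open>X\<close> generates a sigma-algebra
  \<open>G\<close>; by \<open>joint_increment_prob\<close> and intersection stability of
  \<open>E\<close> and \<open>H\<close>, the increment of \<open>C\<close> is independent of
  \<open>G\<close>. The freezing rule is then applied twice, first to the increment of
  \<open>C\<close> given \<open>G\<close> and then to that of \<open>X\<close> given the
  past.\<close>

lemma joint_nn_integral:
 fixes V :: "'c \<times> real \<times> real => ennreal"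
 assumes s: "0 <= s" "0 <= h" and W: "W \<in> F (ennreal s) \<rightarrow>\<^sub>M N"
  and V [measurable]: "V \<in> Borel (N \<Otimes>\<^sub>M (borel \<Otimes>\<^sub>M borel))"
 shows "(\<integral>\<^sup>+w. V (W w, X (s + h) w - X s w, C (s + h) w - C s w) \<partial>M)
  = (\<integral>\<^sup>+w. \<integral>\<^sup>+w1. \<integral>\<^sup>+w2. V (W w, X h w1, C h w2) \<partial>M \<partial>M \<partial>M)"
proof -
 define dX where "dX w = X (s + h) w - X s w" for w
 define dC where "dC w = C (s + h) w - C s w" for w
 have [measurable]: "X h \<in> Borel M" "C h \<in> Borel M"
  "dX \<in> Borel M" "dC \<in> Borel M"
  unfolding dX_def[abs_def] dC_def[abs_def] using s by auto
 have dC_M: "dC \<in> Borel M" by measurable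
 note [measurable] = X.F_to_M[OF W]
 define E where "E = {{w \<in> B. dX w \<in> A} | B A. B \<in> sets (F (ennreal s)) \<and> A \<in> sets borel}"
 have EI: "{w \<in> B. dX w \<in> A} \<in> E" if "B \<in> sets (F (ennreal s))" "A \<in> sets borel" for B A
  unfolding E_def using that by (intro CollectI exI[of _ B] exI[of _ A] conjI refl)
 define H where "H = {{w \<in> space M. dC w <= b} | b. True}"
 define G where "G = sigma (space M) E"
 have FM: "B \<in> sets M" "B \<subseteq> space M" if "B \<in> sets (F (ennreal s))" for B
  using that X.subalg sets.sets_into_space[of B M] by (auto simp: subalgebra_def)
 have EM: "E \<subseteq> sets M"
 proof
  fix e assume "e \<in> E"
  then obtain B A where e: "e = {w \<in> B. dX w \<in> A}" "B \<in> sets (F (ennreal s))" "A \<in> sets borel"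
   by (auto simp: E_def)
  note [measurable] = FM(1)[OF e(2)] e(3)
  have "e = B \<inter> {w \<in> space M. dX w \<in> A}" using FM[OF e(2)] e by auto
  also have "... \<in> sets M" by measurable
  finally show "e \<in> sets M" .
 qed
 then have Epow: "E \<subseteq> Pow (space M)" using sets.sets_into_space by blast
 have sG: "sets G = sigma_sets (space M) E" "space G = space M"
  using Epow by (auto simp: G_def)
 have Gsub: "subalgebra M G"
  using sets.sigma_sets_subset[OF EM] by (simp add: subalgebra_def sG)
 have HM: "H \<subseteq> sets M" by (auto simp: H_def)
 have "X.indep_set E H"
 proof (rule X.indep_setI[OF EM HM])
  fix e d assume "e \<in> E" "d \<in> H"
  then obtain B A b where e: "e = {w \<in> B. dX w \<in> A}" "B \<in> sets (F (ennreal s))" "A \<in> sets borel"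
   and d: "d = {w \<in> space M. dC w <= b}" by (auto simp: E_def H_def)
  note [measurable] = e(3)
  have 1: "measure M (e \<inter> d) = measure M B * measure M {w \<in> space M. X h w \<in> A} * measure M {w \<in> space M. C h w <= b}"
   unfolding e(1) d dX_def dC_def by (rule joint_increment_prob[OF s e(2,3)])
  have "dX -` A \<inter> space M \<in> {(\<lambda>w. X (s + h) w - X s w) -` B \<inter> space M |B. B \<in> sets borel}"
   using e(3) by (intro CollectI exI[of _ A]) (simp add: dX_def[abs_def])
  from X.indep_setD[OF X.increment_indep[OF s] e(2) this]
  have "measure M (B \<inter> (dX -` A \<inter> space M)) = measure M B * measure M (dX -` A \<inter> space M)" .
  moreover have "e = B \<inter> (dX -` A \<inter> space M)" using FM[OF e(2)] e by auto
  ultimately have "measure M e = measure M B * measure M (dX -` A \<inter> space M)" by simp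
  also have "measure M (dX -` A \<inter> space M) = measure M {w \<in> space M. X h w \<in> A}"
   using measure_distr[of dX M borel A] measure_distr[of "X h" M borel A] X.increment_distr[OF s] e(3)
   by (simp add: dX_def[symmetric, abs_def] vimage_def Int_def conj_commute)
  finally have 2: "measure M e = measure M B * measure M {w \<in> space M. X h w \<in> A}" .
  have "measure M d = measure M {w \<in> space M. C h w <= b}"
   using measure_distr[of dC M borel "{..b}"] measure_distr[of "C h" M borel "{..b}"] C.increment_distr[OF s]
   by (simp add: d dC_def[symmetric, abs_def] vimage_def Int_def conj_commute)
  with 1 2 show "measure M (e \<inter> d) = measure M e * measure M d" by simp
 qed
 moreover have "Int_stable E"
  unfolding Int_stable_def
 proof (intro ballI)
  fix e e' assume "e \<in> E" "e' \<in> E"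
  then obtain B A B' A' where e: "e = {w \<in> B. dX w \<in> A}" "B \<in> sets (F (ennreal s))" "A \<in> sets borel"
   and e': "e' = {w \<in> B'. dX w \<in> A'}" "B' \<in> sets (F (ennreal s))" "A' \<in> sets borel"
   by (auto simp: E_def)
  have "e \<inter> e' = {w \<in> B \<inter> B'. dX w \<in> A \<inter> A'}" by (auto simp: e(1) e'(1))
  moreover have "B \<inter> B' \<in> sets (F (ennreal s))" "A \<inter> A' \<in> sets borel" using e e' by auto
  ultimately show "e \<inter> e' \<in> E" using EI[of "B \<inter> B'" "A \<inter> A'"] by (simp only:)
 qed
 moreover have "Int_stable H"
  unfolding Int_stable_def
 proof (intro ballI)
  fix d d' assume "d \<in> H" "d' \<in> H"
  then obtain b b' where "d = {w \<in> space M. dC w <= b}" "d' = {w \<in> space M. dC w <= b'}"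
   by (auto simp: H_def)
  then have "d \<inter> d' = {w \<in> space M. dC w <= min b b'}" by auto
  then show "d \<inter> d' \<in> H" unfolding H_def by blast
 qed
 ultimately have ind: "X.indep_set (sigma_sets (space M) E) (sigma_sets (space M) H)"
  by (rule X.indep_set_sigma_sets)
 have dC_H: "dC \<in> Borel (sigma (space M) H)"
 proof (rule borel_measurableI_le)
  fix y
  have "H \<subseteq> Pow (space M)" using HM sets.sets_into_space by blast
  moreover have "{w \<in> space M. dC w <= y} \<in> H" unfolding H_def by blast
  ultimately show "{w \<in> space (sigma (space M) H). dC w <= y} \<in> sets (sigma (space M) H)"
   by simp
 qed
 have dC_sub: "{dC -` B \<inter> space M | B. B \<in> sets borel} \<subseteq> sigma_sets (space M) H"
 proof
  fix d assume "d \<in> {dC -` B \<inter> space M | B. B \<in> sets borel}"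
  then obtain B where d: "d = dC -` B \<inter> space M" "B \<in> sets borel" by blast
  have "H \<subseteq> Pow (space M)" using HM sets.sets_into_space by blast
  then have "space (sigma (space M) H) = space M" "sets (sigma (space M) H) = sigma_sets (space M) H"
   by simp_all
  with measurable_sets[OF dC_H d(2)] show "d \<in> sigma_sets (space M) H" by (simp only: d)
 qed
 have ind': "X.indep_set (sets G) {dC -` B \<inter> space M | B. B \<in> sets borel}"
 proof (rule X.indep_setI)
  show "sets G \<subseteq> sets M" using Gsub by (simp add: subalgebra_def)
  show "{dC -` B \<inter> space M | B. B \<in> sets borel} \<subseteq> sets M"
  proof
   fix d assume "d \<in> {dC -` B \<inter> space M | B. B \<in> sets borel}"
   then obtain B where "d = dC -` B \<inter> space M" "B \<in> sets borel" by blast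
   then show "d \<in> sets M" using dC_M by (simp only: measurable_sets)
  qed
  fix e d assume "e \<in> sets G" "d \<in> {dC -` B \<inter> space M | B. B \<in> sets borel}"
  then have "e \<in> sigma_sets (space M) E" "d \<in> sigma_sets (space M) H"
   using dC_sub by (simp_all only: sG subsetD)
  then show "measure M (e \<inter> d) = measure M e * measure M d"
   by (rule X.indep_setD[OF ind])
 qed
 have "sets (F (ennreal s)) \<subseteq> sets G"
 proof
  fix B assume B: "B \<in> sets (F (ennreal s))"
  from EI[OF B, of UNIV] have "B \<in> E" by simp
  then show "B \<in> sets G" by (simp add: sG)
 qed
 then have WG: "W \<in> G \<rightarrow>\<^sub>M N"
 proof (intro measurableI)
  show "W w \<in> space N" if "w \<in> space G" for w
   using measurable_space[OF W, of w] that by (simp add: sG X.space_F)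
  show "W -` A \<inter> space G \<in> sets G" if "A \<in> sets N" for A
   using measurable_sets[OF W that] \<open>sets (F (ennreal s)) \<subseteq> sets G\<close> by (auto simp: sG(2) X.space_F)
 qed
 have dXG: "dX \<in> G \<rightarrow>\<^sub>M borel"
 proof (rule measurableI)
  fix A :: "real set" assume "A \<in> sets borel"
  moreover have "space M \<in> sets (F (ennreal s))"
   using sets.top[of "F (ennreal s)"] by (simp add: X.space_F)
  ultimately have "{w \<in> space M. dX w \<in> A} \<in> E" by (intro EI)
  moreover have "{w \<in> space M. dX w \<in> A} = dX -` A \<inter> space G" by (auto simp: sG)
  ultimately show "dX -` A \<inter> space G \<in> sets G" by (simp add: sG)
 qed simp
 have WdX: "(\<lambda>w. (W w, dX w)) \<in> G \<rightarrow>\<^sub>M N \<Otimes>\<^sub>M borel" using WG dXG by measurable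
 have "(\<integral>\<^sup>+w. V (W w, dX w, dC w) \<partial>M) = (\<integral>\<^sup>+w. (\<lambda>(p, z). V (fst p, snd p, z)) ((W w, dX w), dC w) \<partial>M)"
  by simp
 also have "... = (\<integral>\<^sup>+w. \<integral>\<^sup>+w'. (\<lambda>(p, z). V (fst p, snd p, z)) ((W w, dX w), dC w') \<partial>M \<partial>M)"
  by (rule X.indep_set_nn_integral[OF Gsub WdX _ ind']) measurable
 also have "... = (\<integral>\<^sup>+w. \<integral>\<^sup>+w2. V (W w, dX w, C h w2) \<partial>M \<partial>M)"
 proof (rule nn_integral_cong)
  fix w assume w: "w \<in> space M"
  then have [measurable]: "(\<lambda>z. V (W w, dX w, z)) \<in> Borel borel"
   using measurable_space[OF X.F_to_M[OF W] w] by measurable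
  show "(\<integral>\<^sup>+w'. (\<lambda>(p, z). V (fst p, snd p, z)) ((W w, dX w), dC w') \<partial>M) = (\<integral>\<^sup>+w2. V (W w, dX w, C h w2) \<partial>M)"
   using nn_integral_distr[of dC M borel "\<lambda>z. V (W w, dX w, z)"]
    nn_integral_distr[of "C h" M borel "\<lambda>z. V (W w, dX w, z)"] C.increment_distr[OF s]
   by (simp add: dC_def[symmetric, abs_def])
 qed
 also have "... = (\<integral>\<^sup>+w. (\<lambda>(w, x). \<integral>\<^sup>+w2. V (w, x, C h w2) \<partial>M) (W w, X (s + h) w - X s w) \<partial>M)"
  by (simp add: dX_def)
 also have "... = (\<integral>\<^sup>+w. \<integral>\<^sup>+w1. (\<lambda>(w, x). \<integral>\<^sup>+w2. V (w, x, C h w2) \<partial>M) (W w, X h w1) \<partial>M \<partial>M)"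
  by (rule X.increment_nn_integral[OF s W]) measurable
 finally show ?thesis by (simp add: dX_def dC_def)
qed

text \<open>The state consists of both processes and of the running minimum of \<open>C + a X\<close> along a grid.\<close>

definition step :: "real => real \<times> real \<times> real => real \<times> real => real \<times> real \<times> real" where
 "step a st d = (fst st + fst d, fst (snd st) + snd d,
   min (snd (snd st)) (fst (snd st) + snd d + a * (fst st + fst d)))"

primrec run :: "real => real => real => real \<times> real \<times> real => nat => 'a => real \<times> real \<times> real" where
 "run a s h st 0 w = st"
| "run a s h st (Suc k) w = step a (run a s h st k w)
   (X (s + real k * h + h) w - X (s + real k * h) w, C (s + real k * h + h) w - C (s + real k * h) w)"

lemma step_measurable [measurable]:
 "(\<lambda>p. step a (fst p) (snd p)) \<in> (borel \<Otimes>\<^sub>M borel \<Otimes>\<^sub>M borel) \<Otimes>\<^sub>M (borel \<Otimes>\<^sub>M borel) \<rightarrow>\<^sub>M borel \<Otimes>\<^sub>M borel \<Otimes>\<^sub>M borel"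
 unfolding step_def by measurable

lemma run_F:
 assumes s: "0 <= s" "0 <= h" and S: "S \<in> F (ennreal s) \<rightarrow>\<^sub>M borel \<Otimes>\<^sub>M borel \<Otimes>\<^sub>M borel"
 shows "(\<lambda>w. run a s h (S w) k w) \<in> F (ennreal (s + real k * h)) \<rightarrow>\<^sub>M borel \<Otimes>\<^sub>M borel \<Otimes>\<^sub>M borel"
proof (induction k)
 case 0
 then show ?case using S by simp
next
 case (Suc k)
 let ?t = "s + real (Suc k) * h"
 have le: "s + real k * h <= ?t" "0 <= s + real k * h" "s + real k * h + h = ?t"
  using s by (auto simp: algebra_simps)
 have [measurable]: "(\<lambda>w. run a s h (S w) k w) \<in> F (ennreal ?t) \<rightarrow>\<^sub>M borel \<Otimes>\<^sub>M borel \<Otimes>\<^sub>M borel"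
  using le by (intro X.F_mono[OF _ _ Suc]) auto
 have [measurable]: "X (s + real k * h + h) \<in> Borel (F (ennreal ?t))" "X (s + real k * h) \<in> Borel (F (ennreal ?t))"
  "C (s + real k * h + h) \<in> Borel (F (ennreal ?t))" "C (s + real k * h) \<in> Borel (F (ennreal ?t))"
  using le s by (intro X.Z_F C.Z_F; linarith)+
 have "(\<lambda>w. (\<lambda>p. step a (fst p) (snd p)) (run a s h (S w) k w,
   (X (s + real k * h + h) w - X (s + real k * h) w, C (s + real k * h + h) w - C (s + real k * h) w)))
   \<in> F (ennreal ?t) \<rightarrow>\<^sub>M borel \<Otimes>\<^sub>M borel \<Otimes>\<^sub>M borel"
  by measurable
 then show ?case by simp
qed

text \<open>\<open>T\<close> is the one-step transition operator of the state. Both sides reduce to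
  the integral of its \<open>k\<close>-th iterate at the starting state, since the steps are
  stationary.\<close>

lemma run_markov:
 fixes V :: "real \<times> real \<times> real => ennreal"
 assumes s: "0 <= s" "0 <= h" and S: "S \<in> F (ennreal s) \<rightarrow>\<^sub>M borel \<Otimes>\<^sub>M borel \<Otimes>\<^sub>M borel"
  and B: "B \<in> sets (F (ennreal s))" and V: "V \<in> Borel (borel \<Otimes>\<^sub>M borel \<Otimes>\<^sub>M borel)"
 shows "(\<integral>\<^sup>+w. indicator B w * V (run a s h (S w) k w) \<partial>M)
  = (\<integral>\<^sup>+w. indicator B w * (\<integral>\<^sup>+w'. V (run a 0 h (S w) k w') \<partial>M) \<partial>M)"
proof -
 define T where "T V st = (\<integral>\<^sup>+w1. \<integral>\<^sup>+w2. V (step a st (X h w1, C h w2)) \<partial>M \<partial>M)"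
  for V :: "real \<times> real \<times> real => ennreal" and st
 have [measurable]: "X h \<in> Borel M" "C h \<in> Borel M" using s by auto
 have T_meas: "T V \<in> Borel (borel \<Otimes>\<^sub>M borel \<Otimes>\<^sub>M borel)"
  if [measurable]: "V \<in> Borel (borel \<Otimes>\<^sub>M borel \<Otimes>\<^sub>M borel)" for V
  unfolding T_def step_def by measurable
 have one: "(\<integral>\<^sup>+w. indicator B w * V (run a s h (S w) (Suc k) w) \<partial>M) = (\<integral>\<^sup>+w. indicator B w * T V (run a s h (S w) k w) \<partial>M)"
  if s: "0 <= s" and S: "S \<in> F (ennreal s) \<rightarrow>\<^sub>M borel \<Otimes>\<^sub>M borel \<Otimes>\<^sub>M borel" and B: "B \<in> sets (F (ennreal s))"
   and [measurable]: "V \<in> Borel (borel \<Otimes>\<^sub>M borel \<Otimes>\<^sub>M borel)" for s S B V k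
 proof -
  let ?t = "s + real k * h"
  let ?W = "\<lambda>w. (indicator B w :: ennreal, run a s h (S w) k w)"
  let ?V = "\<lambda>p :: (ennreal \<times> real \<times> real \<times> real) \<times> real \<times> real. fst (fst p) * V (step a (snd (fst p)) (snd p))"
  have t: "0 <= ?t" using s assms(2) by simp
  have "B \<in> sets (F (ennreal ?t))"
   using B X.sets_F_mono[of "ennreal s" "ennreal ?t"] s assms(2) by (auto simp: ennreal_leI)
  then have W: "?W \<in> F (ennreal ?t) \<rightarrow>\<^sub>M borel \<Otimes>\<^sub>M borel \<Otimes>\<^sub>M borel \<Otimes>\<^sub>M borel"
   using run_F[OF s assms(2) S] by measurable
  have V: "?V \<in> Borel ((borel \<Otimes>\<^sub>M borel \<Otimes>\<^sub>M borel \<Otimes>\<^sub>M borel) \<Otimes>\<^sub>M (borel \<Otimes>\<^sub>M borel))"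
   unfolding step_def by measurable
  have "(\<integral>\<^sup>+w1. \<integral>\<^sup>+w2. b * V (step a st (X h w1, C h w2)) \<partial>M \<partial>M) = b * T V st" for b st
  proof -
   have "(\<lambda>p. V (step a st p)) \<in> Borel (borel \<Otimes>\<^sub>M borel)"
    unfolding step_def by measurable
   then show ?thesis
    unfolding T_def by (simp add: nn_integral_cmult)
  qed
  with joint_nn_integral[OF t assms(2) W V] show ?thesis by simp
 qed
 have iter: "(\<integral>\<^sup>+w. indicator B w * V (run a s h (S w) k w) \<partial>M) = (\<integral>\<^sup>+w. indicator B w * (T ^^ k) V (S w) \<partial>M)"
  if s: "0 <= s" and S: "S \<in> F (ennreal s) \<rightarrow>\<^sub>M borel \<Otimes>\<^sub>M borel \<Otimes>\<^sub>M borel" and B: "B \<in> sets (F (ennreal s))"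
   and V: "V \<in> Borel (borel \<Otimes>\<^sub>M borel \<Otimes>\<^sub>M borel)" for s S B V
  using V
 proof (induction k arbitrary: V)
  case (Suc k)
  then show ?case
   using one[OF s S B Suc.prems, of k] Suc.IH[OF T_meas[OF Suc.prems]]
   by (simp add: funpow_swap1 del: run.simps)
 qed simp
 \<comment> \<open>The same iteration, started at time 0 from a constant state on the whole space,
   identifies the iterate.\<close>
 have "(T ^^ k) V st = (\<integral>\<^sup>+w'. V (run a 0 h st k w') \<partial>M)" for st
 proof -
  have top: "space M \<in> sets (F (ennreal 0))"
   using sets.top[of "F (ennreal 0)"] by (simp add: X.space_F del: ennreal_0)
  have "(\<integral>\<^sup>+w. indicator (space M) w * V (run a 0 h st k w) \<partial>M) = (\<integral>\<^sup>+w. indicator (space M) w * (T ^^ k) V st \<partial>M)"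
  proof (rule iter[OF _ _ top V])
   show "(\<lambda>w. st) \<in> F (ennreal 0) \<rightarrow>\<^sub>M borel \<Otimes>\<^sub>M borel \<Otimes>\<^sub>M borel"
    by (rule measurable_const) (simp add: space_pair_measure)
  qed simp
  then show ?thesis
   by (simp add: X.emeasure_space_1 cong: nn_integral_cong)
 qed
 then show ?thesis using iter[OF s(1) S B V] by simp
qed

text \<open>The premise, satisfied by a running minimum, means that the grid point
  \<open>j = 0\<close> contributes nothing new, so the minimum may include it.\<close>

lemma run_closed:
 assumes i: "i <= c + a * x"
 shows "run a s h (x, c, i) k w = (x + (X (s + real k * h) w - X s w), c + (C (s + real k * h) w - C s w),
  min i (MIN j\<in>{0..k}. c + (C (s + real j * h) w - C s w) + a * (x + (X (s + real j * h) w - X s w))))"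
proof (induction k)
 case 0
 then show ?case using i by (simp add: min_absorb1)
next
 case (Suc k)
 let ?g = "\<lambda>j. c + (C (s + real j * h) w - C s w) + a * (x + (X (s + real j * h) w - X s w))"
 have t: "s + real k * h + h = s + real (Suc k) * h" by (simp add: algebra_simps)
 have Min: "(MIN j\<in>{0..Suc k}. ?g j) = min (?g (Suc k)) (MIN j\<in>{0..k}. ?g j)"
  by (subst atLeast0_atMost_Suc) (simp del: of_nat_Suc)
 have m: "min (min i q) g = min i (min g q)" for q g :: real
  by (simp add: min.assoc min.commute[of g])
 have e: "x + (y - z) + (y' - y) = x + (y' - z)" for x y z y' :: real
  by simp
 show ?case
  unfolding run.simps Suc t step_def fst_conv snd_conv e Min m by (rule refl)
qed

end

section \<open>Measurability of right continuous processes\<close>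

text \<open>Sampling at the next grid point gives countably many pieces, each measurable in the
  outcome. Clipping the time with \<open>max 0\<close> produces a function on the whole product
  space.\<close>

lemma right_continuous_process_measurable:
 fixes Y :: "real => 'a => real"
 assumes m: "\<And>t. 0 <= t ==> Y t \<in> Borel M"
  and r: "\<And>w t. w \<in> space M ==> 0 <= t ==> continuous (at_right t) (\<lambda>t. Y t w)"
 shows "(\<lambda>p. Y (max 0 (snd p)) (fst p)) \<in> Borel (M \<Otimes>\<^sub>M borel)"
proof (rule borel_measurable_LIMSEQ_real)
 show "(\<lambda>n. Y (right_grid n (max 0 (snd p))) (fst p)) \<longlonglongrightarrow> Y (max 0 (snd p)) (fst p)"
  if "p \<in> space (M \<Otimes>\<^sub>M borel)" for p
  using that by (intro right_grid_tendsto[where f = "\<lambda>t. Y t (fst p)"] r) (auto simp: space_pair_measure)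
 fix n
 have [measurable]: "Y (real (k + 1) / real (Suc n)) \<in> Borel M" for k
  by (rule m) simp
 have "(\<lambda>p. (\<lambda>k p. Y (real (k + 1) / real (Suc n)) (fst p)) (nat \<lfloor>real (Suc n) * max 0 (snd p)\<rfloor>) p)
   \<in> Borel (M \<Otimes>\<^sub>M borel)"
  by (rule measurable_compose_countable) measurable
 then show "(\<lambda>p. Y (right_grid n (max 0 (snd p))) (fst p)) \<in> Borel (M \<Otimes>\<^sub>M borel)"
  by (simp add: right_grid_def)
qed

context filtered_prob_space
begin

lemma adaptedD: "adapted F Y ==> 0 <= t ==> Y t \<in> Borel M"
 using F_to_M by (auto simp: adapted_def)

lemma adapted_process_measurable:
 "adapted F Y ==> (\<And>w. w \<in> space M ==> cadlag (\<lambda>t. Y t w)) ==>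
  (\<lambda>p. Y (max 0 (snd p)) (fst p)) \<in> Borel (M \<Otimes>\<^sub>M borel)"
 by (rule right_continuous_process_measurable) (auto intro: adaptedD cadlag_right)

lemma adapted_compose2:
 assumes "adapted F Y" "adapted F Y'" "(\<lambda>p. h (fst p) (snd p)) \<in> Borel (borel \<Otimes>\<^sub>M borel)"
 shows "adapted F (\<lambda>t w. h (Y t w) (Y' t w))"
 unfolding adapted_def
proof (intro allI impI)
 fix t :: real assume "0 <= t"
 then have [measurable]: "Y t \<in> Borel (F (ennreal t))" "Y' t \<in> Borel (F (ennreal t))"
  using assms by (auto simp: adapted_def)
 have "(\<lambda>w. (\<lambda>p. h (fst p) (snd p)) (Y t w, Y' t w)) \<in> Borel (F (ennreal t))"
  by (rule measurable_compose[OF _ assms(3)]) measurable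
 then show "(\<lambda>w. h (Y t w) (Y' t w)) \<in> Borel (F (ennreal t))" by simp
qed

text \<open>The dyadic grid is scaled to \<open>{0..t}\<close>, so that every sampled value is known
  at time \<open>t\<close>.\<close>

lemma adapted_running_inf:
 assumes Y: "adapted F Y" and c: "\<And>w. w \<in> space M ==> cadlag (\<lambda>t. Y t w)"
 shows "adapted F (\<lambda>t w. running_inf (\<lambda>t. Y t w) t)"
 unfolding adapted_def
proof (intro allI impI)
 fix t :: real assume t: "0 <= t"
 show "(\<lambda>w. running_inf (\<lambda>t. Y t w) t) \<in> Borel (F (ennreal t))"
 proof (rule borel_measurable_LIMSEQ_real)
  show "(\<lambda>p. grid_min (\<lambda>t. Y t w) t p) \<longlonglongrightarrow> running_inf (\<lambda>t. Y t w) t" if "w \<in> space (F (ennreal t))" for w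
   using that by (intro grid_min_running_inf c t) (simp add: space_F)
  fix p
  have "Y (real j / 2 ^ p * t) \<in> Borel (F (ennreal t))" if j: "j <= 2 ^ p" for j :: nat
  proof (rule F_mono)
   have "real j <= 2 ^ p" using j of_nat_le_iff[of j "2 ^ p", where ?'a = real] by simp
   then show "real j / 2 ^ p * t <= t" using t by (intro mult_left_le_one_le) auto
   show "0 <= real j / 2 ^ p * t" using t by simp
   then show "Y (real j / 2 ^ p * t) \<in> Borel (F (ennreal (real j / 2 ^ p * t)))"
    using Y by (simp add: adapted_def)
  qed
  then show "(\<lambda>w. grid_min (\<lambda>t. Y t w) t p) \<in> Borel (F (ennreal t))"
   unfolding grid_min_def by (intro borel_measurable_Min) auto
 qed
qed

end

section \<open>The value of the discounted running minimum\<close>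

text \<open>\<open>X\<close> and \<open>C\<close> stand for the compensated processes.
  \<open>exp_C\<close> provides the dominating function in the limits below, \<open>exp_2C\<close>
  the square integrability for Doob's inequality.\<close>

locale discounted_levy_pair = levy_pair +
 fixes a r :: real
 assumes a: "0 < a" and r: "0 < r"
  and exp_C: "\<And>t. 0 <= t ==> (\<integral>\<^sup>+w. ennreal (exp (C t w)) \<partial>M) = 1"
  and exp_2C: "\<And>t. 0 <= t ==> (\<integral>\<^sup>+w. ennreal (exp (2 * C t w)) \<partial>M) < \<top>"
begin

lemma adapted_X: "adapted F X" and adapted_C: "adapted F C"
 by (rule X.Z_adapted, rule C.Z_adapted)

definition G :: "real => 'a => real" where "G t w = C t w + a * X t w"

definition R :: "real => 'a => real" where "R t w = running_inf (\<lambda>t. G t w) t"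

lemma adapted_G: "adapted F G"
 unfolding G_def[abs_def] by (rule X.adapted_compose2[OF adapted_C adapted_X]) measurable

lemma cadlag_G: "w \<in> space M ==> cadlag (\<lambda>t. G t w)"
 unfolding G_def by (intro cadlag_add cadlag_cmult X.Z_cadlag C.Z_cadlag)

lemma adapted_R: "adapted F R"
 unfolding R_def[abs_def] by (rule X.adapted_running_inf[OF adapted_G cadlag_G])

lemma cadlag_R: "w \<in> space M ==> cadlag (\<lambda>t. R t w)"
 unfolding R_def using cadlag_running_inf[OF cadlag_G, of w] by simp

lemma R_le_G: "w \<in> space M ==> 0 <= s ==> s <= t ==> R t w <= G s w"
 unfolding R_def by (rule running_inf_le[OF cadlag_G])

lemma R_antimono: "w \<in> space M ==> 0 <= s ==> s <= t ==> R t w <= R s w"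
 unfolding R_def by (rule running_inf_antimono[OF cadlag_G])

lemma G_0: "w \<in> space M ==> G 0 w = 0"
 by (simp add: G_def X.Z_0 C.Z_0)

lemma R_0: "w \<in> space M ==> R 0 w = 0"
 by (simp add: R_def G_0)

lemma R_nonpos: "w \<in> space M ==> 0 <= t ==> R t w <= 0"
 using R_le_G[of w 0 t] by (simp add: G_0)

lemma joint_measurable:
 "(\<lambda>p. X (max 0 (snd p)) (fst p)) \<in> Borel (M \<Otimes>\<^sub>M borel)"
 "(\<lambda>p. C (max 0 (snd p)) (fst p)) \<in> Borel (M \<Otimes>\<^sub>M borel)"
 "(\<lambda>p. G (max 0 (snd p)) (fst p)) \<in> Borel (M \<Otimes>\<^sub>M borel)"
 "(\<lambda>p. R (max 0 (snd p)) (fst p)) \<in> Borel (M \<Otimes>\<^sub>M borel)"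
 by (intro X.adapted_process_measurable adapted_X adapted_C adapted_G adapted_R
   X.Z_cadlag C.Z_cadlag cadlag_G cadlag_R; assumption)+

lemma process_measurable [measurable]:
 assumes [measurable]: "f \<in> N \<rightarrow>\<^sub>M M" "g \<in> Borel N"
 shows "(\<lambda>p. X (max 0 (g p)) (f p)) \<in> Borel N"
  "(\<lambda>p. C (max 0 (g p)) (f p)) \<in> Borel N"
  "(\<lambda>p. G (max 0 (g p)) (f p)) \<in> Borel N"
  "(\<lambda>p. R (max 0 (g p)) (f p)) \<in> Borel N"
proof -
 have [measurable]: "(\<lambda>p. (f p, g p)) \<in> N \<rightarrow>\<^sub>M M \<Otimes>\<^sub>M borel" by measurable
 show "(\<lambda>p. X (max 0 (g p)) (f p)) \<in> Borel N"
  "(\<lambda>p. C (max 0 (g p)) (f p)) \<in> Borel N"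
  "(\<lambda>p. G (max 0 (g p)) (f p)) \<in> Borel N"
  "(\<lambda>p. R (max 0 (g p)) (f p)) \<in> Borel N"
  using joint_measurable[THEN measurable_compose[rotated], of "\<lambda>p. (f p, g p)" N] by auto
qed

lemma R_M [measurable]: "0 <= t ==> R t \<in> Borel M"
 and G_M [measurable]: "0 <= t ==> G t \<in> Borel M"
 by (intro X.adaptedD adapted_R adapted_G; assumption)+

text \<open>The conditional value of a running minimum over a further period \<open>v\<close>, relative to \<open>exp C\<^sub>s\<close>, when
 the minimum reached so far lies at distance \<open>d\<close> from the present value.\<close>

definition \<phi> :: "real => real => ennreal" where
 "\<phi> v d = (\<integral>\<^sup>+w. ennreal (exp (- a * X v w + min d (R v w))) \<partial>M)"

text \<open>The minimum is at most \<open>G v w = C v w + a * X v w\<close>, and the terms with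
  \<open>X\<close> cancel. The same domination by \<open>exp (C v w)\<close> justifies the passages
  to the limit later on.\<close>

lemma \<phi>_le_1:
 assumes "0 <= v"
 shows "\<phi> v d <= 1"
proof -
 have "\<phi> v d <= (\<integral>\<^sup>+w. ennreal (exp (C v w)) \<partial>M)"
  unfolding \<phi>_def
 proof (intro nn_integral_mono ennreal_leI)
  fix w assume "w \<in> space M"
  from R_le_G[OF this assms order_refl]
  show "exp (- a * X v w + min d (R v w)) <= exp (C v w)" by (simp add: G_def)
 qed
 then show ?thesis using exp_C[OF assms] by simp
qed

text \<open>The statement for grid minima is \<open>run_markov\<close> for the state
  \<open>(X, C, R)\<close> at time \<open>s\<close>, where \<open>R s w <= G s w\<close> meets the
  premise of \<open>run_closed\<close>. Taking \<open>G s w\<close> out of the minimum leaves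
  \<open>exp (C s w)\<close> and the distance \<open>R s w - G s w\<close>. Refining the grid is
  dominated convergence under \<open>exp C\<close>.\<close>

lemma markov:
 assumes s: "0 <= s" and v: "0 <= v" and B: "B \<in> sets (F (ennreal s))"
 shows "(\<integral>\<^sup>+w. indicator B w * ennreal (exp (- a * X (s + v) w + R (s + v) w)) \<partial>M)
  = (\<integral>\<^sup>+w. indicator B w * (ennreal (exp (C s w)) * \<phi> v (R s w - G s w)) \<partial>M)"
proof -
 have [measurable]: "B \<in> sets M" using B X.subalg by (auto simp: subalgebra_def)
 define S where "S w = (X s w, C s w, R s w)" for w
 define V where "V st = ennreal (exp (- a * fst st + snd (snd st)))" for st :: "real \<times> real \<times> real"
 define h where "h p = v / 2 ^ p" for p :: nat
 define gm where "gm s p w = grid_min (\<lambda>u. G (s + u) w) v p" for s p w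
 define \<psi> where "\<psi> p d = (\<integral>\<^sup>+w. ennreal (exp (- a * X v w + min d (gm 0 p w))) \<partial>M)" for p d
 have h0: "0 <= h p" for p using v by (simp add: h_def)
 have hv: "real (2 ^ p) * h p = v" for p by (simp add: h_def)
 have [measurable]: "X s \<in> Borel M" "C s \<in> Borel M"
  "X v \<in> Borel M" "C v \<in> Borel M" "R s \<in> Borel M" "G s \<in> Borel M"
  "X (s + v) \<in> Borel M" "R (s + v) \<in> Borel M" "C (s + v) \<in> Borel M"
  "R v \<in> Borel M"
  using s v by auto
 have gm_meas [measurable]: "gm s p \<in> Borel M" if "0 <= s" for s p
  unfolding gm_def[abs_def] grid_min_def using that v by (intro borel_measurable_Min) (auto intro!: G_M)
 have gm_le: "gm s p w <= G (s + v) w" for s p w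
  using grid_min_le[of "2 ^ p" p "\<lambda>u. G (s + u) w" v] by (simp add: gm_def)
 have exp_gm: "exp (- a * X (s + v) w + min d (gm s p w)) <= exp (C (s + v) w)" for s d p w
 proof -
  have "min d (gm s p w) <= gm s p w" by simp
  with gm_le[of s p w] have "- a * X (s + v) w + min d (gm s p w) <= C (s + v) w"
   unfolding G_def by linarith
  then show ?thesis by simp
 qed
 have gm_lim: "(\<lambda>p. min (R s w) (gm s p w)) \<longlonglongrightarrow> R (s + v) w" if "0 <= s" "w \<in> space M" for s w
 proof -
  have "(\<lambda>p. gm s p w) \<longlonglongrightarrow> running_inf (\<lambda>u. G (s + u) w) v"
   unfolding gm_def using cadlag_shift[OF cadlag_G[OF that(2)] that(1)] v by (rule grid_min_running_inf)
  then have "(\<lambda>p. min (R s w) (gm s p w)) \<longlonglongrightarrow> min (R s w) (running_inf (\<lambda>u. G (s + u) w) v)"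
   by (intro tendsto_intros)
  then show ?thesis
   unfolding R_def running_inf_add[OF cadlag_G[OF that(2)] that(1) v] .
 qed
 have gm_lim0: "(\<lambda>p. gm 0 p w) \<longlonglongrightarrow> R v w" if "w \<in> space M" for w
  unfolding gm_def R_def using grid_min_running_inf[OF cadlag_G[OF that] v] by simp
 have SF: "S \<in> F (ennreal s) \<rightarrow>\<^sub>M borel \<Otimes>\<^sub>M borel \<Otimes>\<^sub>M borel"
  unfolding S_def using X.Z_F[OF s order_refl] C.Z_F[OF s order_refl] adapted_R s
  by (intro measurable_Pair) (auto simp: adapted_def)
 have VM: "V \<in> Borel (borel \<Otimes>\<^sub>M borel \<Otimes>\<^sub>M borel)"
  unfolding V_def by measurable
 have grid: "(MIN j\<in>{0..2 ^ p}. C (s + real j * h p) w + a * X (s + real j * h p) w) = gm s p w" for s p w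
  by (simp add: gm_def grid_min_def h_def G_def)
 have left: "V (run a s (h p) (S w) (2 ^ p) w) = ennreal (exp (- a * X (s + v) w + min (R s w) (gm s p w)))"
  if w: "w \<in> space M" for p w
  using R_le_G[OF w s order_refl] run_closed[of "R s w" "C s w" a "X s w" s "h p" "2 ^ p" w] grid[of s p w]
  by (simp only: S_def V_def fst_conv snd_conv hv G_def) (simp add: G_def)
 have right: "(\<integral>\<^sup>+w'. V (run a 0 (h p) (S w) (2 ^ p) w') \<partial>M) = ennreal (exp (C s w)) * \<psi> p (R s w - G s w)"
  if w: "w \<in> space M" for p w
 proof -
  have "V (run a 0 (h p) (S w) (2 ^ p) w')
    = ennreal (exp (C s w)) * ennreal (exp (- a * X v w' + min (R s w - G s w) (gm 0 p w')))"
   if w': "w' \<in> space M" for w'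
  proof -
   have "(MIN j\<in>{0..2 ^ p}. C s w + C (real j * h p) w' + a * (X s w + X (real j * h p) w')) = G s w + gm 0 p w'"
   proof -
    have "G s w + gm 0 p w' = (MIN y\<in>(\<lambda>j. C (0 + real j * h p) w' + a * X (0 + real j * h p) w') ` {0..2 ^ p}. G s w + y)"
     unfolding grid[of 0, symmetric] by (rule mono_Min_commute) (auto simp: mono_def)
    then show ?thesis by (simp add: image_image G_def algebra_simps)
   qed
   then have "V (run a 0 (h p) (S w) (2 ^ p) w')
     = ennreal (exp (- a * (X s w + X v w') + min (R s w) (G s w + gm 0 p w')))"
    using R_le_G[OF w s order_refl] run_closed[of "R s w" "C s w" a "X s w" 0 "h p" "2 ^ p" w']
    by (simp only: S_def V_def fst_conv snd_conv G_def hv add_0 X.Z_0[OF w'] C.Z_0[OF w'] diff_zero)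
   \<comment> \<open>Here \<open>G s w - a * X s w = C s w\<close> is what remains in front of the
     minimum.\<close>
   also have "- a * (X s w + X v w') + min (R s w) (G s w + gm 0 p w')
     = C s w + (- a * X v w' + min (R s w - G s w) (gm 0 p w'))"
    by (auto simp: min_def G_def algebra_simps)
   finally show ?thesis by (simp add: exp_add ennreal_mult)
  qed
  then show ?thesis
   unfolding \<psi>_def by (simp add: nn_integral_cmult gm_meas cong: nn_integral_cong)
 qed
 have \<psi>_meas [measurable]: "\<psi> p \<in> Borel borel" for p
  unfolding \<psi>_def using gm_meas[of 0 p] by measurable
 have \<psi>_le: "\<psi> p d <= 1" for p d
 proof -
  have "\<psi> p d <= (\<integral>\<^sup>+w. ennreal (exp (C v w)) \<partial>M)"
   unfolding \<psi>_def
  proof (intro nn_integral_mono ennreal_leI)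
   show "exp (- a * X v w + min d (gm 0 p w)) <= exp (C v w)" for w
    using exp_gm[of 0 w d p] by simp
  qed
  then show ?thesis using exp_C[OF v] by simp
 qed
 have \<psi>_lim: "(\<lambda>p. \<psi> p d) \<longlonglongrightarrow> \<phi> v d" for d
  unfolding \<psi>_def \<phi>_def
 proof (rule nn_integral_dominated_convergence[where w = "\<lambda>w. ennreal (exp (C v w))"])
  show "AE w in M. ennreal (exp (- a * X v w + min d (gm 0 p w))) <= ennreal (exp (C v w))" for p
   using exp_gm[of 0 _ d p] by (intro AE_I2 ennreal_leI) simp
  show "AE w in M. (\<lambda>p. ennreal (exp (- a * X v w + min d (gm 0 p w)))) \<longlonglongrightarrow> ennreal (exp (- a * X v w + min d (R v w)))"
   by (intro AE_I2 tendsto_intros gm_lim0)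
 qed (use exp_C[OF v] gm_meas[of 0] in auto)
 have "(\<lambda>p. \<integral>\<^sup>+w. indicator B w * ennreal (exp (- a * X (s + v) w + min (R s w) (gm s p w))) \<partial>M)
   \<longlonglongrightarrow> (\<integral>\<^sup>+w. indicator B w * ennreal (exp (- a * X (s + v) w + R (s + v) w)) \<partial>M)"
 proof (rule nn_integral_dominated_convergence[where w = "\<lambda>w. ennreal (exp (C (s + v) w))"])
  show "AE w in M. indicator B w * ennreal (exp (- a * X (s + v) w + min (R s w) (gm s p w))) <= ennreal (exp (C (s + v) w))" for p
   using ennreal_leI[OF exp_gm[of s _ "R s _" p]] by (intro AE_I2) (auto simp: indicator_def)
  show "AE w in M. (\<lambda>p. indicator B w * ennreal (exp (- a * X (s + v) w + min (R s w) (gm s p w))))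
    \<longlonglongrightarrow> indicator B w * ennreal (exp (- a * X (s + v) w + R (s + v) w))"
   by (intro AE_I2 ennreal_tendsto_cmult tendsto_intros gm_lim s) (auto simp: indicator_def)
 qed (use exp_C[of "s + v"] gm_meas[OF s] s v in auto)
 moreover have "(\<lambda>p. \<integral>\<^sup>+w. indicator B w * (ennreal (exp (C s w)) * \<psi> p (R s w - G s w)) \<partial>M)
   \<longlonglongrightarrow> (\<integral>\<^sup>+w. indicator B w * (ennreal (exp (C s w)) * \<phi> v (R s w - G s w)) \<partial>M)"
 proof (rule nn_integral_dominated_convergence[where w = "\<lambda>w. ennreal (exp (C s w))"])
  show "AE w in M. indicator B w * (ennreal (exp (C s w)) * \<psi> p (R s w - G s w)) <= ennreal (exp (C s w))" for p
   using mult_left_mono[OF \<psi>_le, of "ennreal _"] by (auto simp: indicator_def)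
  show "AE w in M. (\<lambda>p. indicator B w * (ennreal (exp (C s w)) * \<psi> p (R s w - G s w)))
    \<longlonglongrightarrow> indicator B w * (ennreal (exp (C s w)) * \<phi> v (R s w - G s w))"
   by (intro AE_I2 ennreal_tendsto_cmult \<psi>_lim) (auto simp: indicator_def)
  show "(\<lambda>w. indicator B w * (ennreal (exp (C s w)) * \<phi> v (R s w - G s w))) \<in> Borel M"
   unfolding \<phi>_def by measurable
 qed (use exp_C[OF s] in auto)
 moreover have "(\<integral>\<^sup>+w. indicator B w * ennreal (exp (- a * X (s + v) w + min (R s w) (gm s p w))) \<partial>M)
   = (\<integral>\<^sup>+w. indicator B w * (ennreal (exp (C s w)) * \<psi> p (R s w - G s w)) \<partial>M)" for p
  using run_markov[OF s h0 SF B VM, of a p "2 ^ p"] by (simp add: left right cong: nn_integral_cong)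
 ultimately show ?thesis
  using LIMSEQ_unique by simp
qed

end

section \<open>Doob's inequality\<close>

text \<open>The pathwise inequality \<open>m\<^sub>n\<^sup>2 <= 4 s\<^sub>n\<^sup>2 - 4 \<Sum> m\<^sub>k (s\<^sub>k\<^sub>+\<^sub>1 - s\<^sub>k)\<close> for a sequence \<open>s\<close> with running maximum \<open>m\<close>
 yields the maximal inequality upon integration.\<close>

lemma doob_pathwise:
 fixes s m :: "nat => real"
 assumes m0: "m 0 = s 0" and mS: "\<And>k. m (Suc k) = max (m k) (s (Suc k))"
 shows "(m n)\<^sup>2 + 4 * (\<Sum>k<n. m k * s (Suc k)) <= 4 * (s n)\<^sup>2 + 4 * (\<Sum>k<n. m k * s k)"
proof -
 have "(m n)\<^sup>2 <= 2 * m n * s n - 2 * ((\<Sum>k<n. m k * s (Suc k)) - (\<Sum>k<n. m k * s k))"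
 proof (induction n)
  case 0
  show ?case by (simp add: m0 power2_eq_square)
 next
  case (Suc n)
  show ?case
  proof (cases "s (Suc n) <= m n")
   case True
   then show ?thesis using Suc by (simp add: mS max_absorb1 algebra_simps)
  next
   case False
   then have "m (Suc n) = s (Suc n)" by (simp add: mS)
   moreover have "0 <= (s (Suc n) - m n)\<^sup>2" by simp
   ultimately show ?thesis using Suc by (simp add: algebra_simps power2_eq_square)
  qed
 qed
 moreover have "0 <= (m n - 2 * s n)\<^sup>2" by simp
 ultimately show ?thesis by (simp add: algebra_simps power2_eq_square)
qed

context levy_pair
begin

lemma doob_grid:
 assumes h: "0 <= h"
  and p: "1 <= (\<integral>\<^sup>+w. ennreal (exp (p * X h w)) \<partial>M)" and q: "1 <= (\<integral>\<^sup>+w. ennreal (exp (q * C h w)) \<partial>M)"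
  and fin: "\<And>t. 0 <= t ==> (\<integral>\<^sup>+w. ennreal (exp (2 * (p * X t w + q * C t w))) \<partial>M) < \<top>"
 shows "(\<integral>\<^sup>+w. ennreal (exp (- 2 * (MIN j\<in>{0..n}. - (p * X (real j * h) w + q * C (real j * h) w)))) \<partial>M)
  <= 4 * (\<integral>\<^sup>+w. ennreal (exp (2 * (p * X (real n * h) w + q * C (real n * h) w))) \<partial>M)"
proof -
 define L where "L k w = p * X (real k * h) w + q * C (real k * h) w" for k w
 define s where "s k w = exp (L k w)" for k w
 define m where "m k w = exp (- (MIN j\<in>{0..k}. - L j w))" for k w
 have LF: "L j \<in> Borel (F (ennreal (real k * h)))" if "j <= k" for j k
 proof -
  have "real j * h <= real k * h" using that h by (intro mult_right_mono) auto
  then have [measurable]: "X (real j * h) \<in> Borel (F (ennreal (real k * h)))"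
   "C (real j * h) \<in> Borel (F (ennreal (real k * h)))"
   using h by (auto intro!: X.Z_F C.Z_F)
  show ?thesis unfolding L_def by measurable
 qed
 have LM [measurable]: "L j \<in> Borel M" for j
  using X.F_to_M[OF LF[of j j]] by simp
 have sF: "s k \<in> Borel (F (ennreal (real k * h)))" for k
  using LF[of k k] unfolding s_def by measurable
 have mF: "m k \<in> Borel (F (ennreal (real k * h)))" for k
 proof -
  have "(\<lambda>w. MIN j\<in>{0..k}. - L j w) \<in> Borel (F (ennreal (real k * h)))"
   using LF[of _ k] by (intro borel_measurable_Min) auto
  then show ?thesis unfolding m_def by measurable
 qed
 have sM [measurable]: "s k \<in> Borel M" and mM [measurable]: "m k \<in> Borel M" for k
  using X.F_to_M[OF sF[of k]] X.F_to_M[OF mF[of k]] by auto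
 have pos: "0 < s k w" "0 < m k w" for k w by (simp_all add: s_def m_def)
 have ms_nonneg: "0 <= m j w * s k w" for j k w by (simp add: s_def m_def)
 have m0: "m 0 w = s 0 w" for w by (simp add: m_def s_def)
 have mS: "m (Suc k) w = max (m k w) (s (Suc k) w)" for k w
 proof -
  have "(MIN j\<in>{0..Suc k}. - L j w) = min (- L (Suc k) w) (MIN j\<in>{0..k}. - L j w)"
   by (subst atLeast0_atMost_Suc) simp
  then show ?thesis by (auto simp: m_def s_def min_def max_def)
 qed
 have sq: "(exp y)\<^sup>2 = exp (2 * y)" for y :: real by (simp add: exp_double)
 have s_fin: "(\<integral>\<^sup>+w. ennreal ((s k w)\<^sup>2) \<partial>M) < \<top>" for k
  unfolding s_def L_def sq using h by (intro fin) simp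
 \<comment> \<open>Finiteness is what permits cancelling the sum in \<open>ennreal\<close> at the
   end.\<close>
 have ms_fin: "(\<integral>\<^sup>+w. ennreal (m k w * s k w) \<partial>M) < \<top>" for k
 proof -
  have "m k w * s k w <= (\<Sum>j\<le>k. (s j w)\<^sup>2)" for w
  proof -
   have "s k w <= m k w" by (cases k) (auto simp: m0 mS)
   then have "m k w * s k w <= (m k w)\<^sup>2"
    using pos(2)[of k w] by (simp add: power2_eq_square)
   also have "... <= (\<Sum>j\<le>k. (s j w)\<^sup>2)"
   proof (induction k)
    case (Suc k)
    then show ?case by (auto simp: mS max_def intro: order_trans sum_nonneg)
   qed (simp add: m0)
   finally show ?thesis .
  qed
  then have "(\<integral>\<^sup>+w. ennreal (m k w * s k w) \<partial>M) <= (\<integral>\<^sup>+w. (\<Sum>j\<le>k. ennreal ((s j w)\<^sup>2)) \<partial>M)"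
   by (intro nn_integral_mono) (simp add: ennreal_leI)
  also have "... = (\<Sum>j\<le>k. \<integral>\<^sup>+w. ennreal ((s j w)\<^sup>2) \<partial>M)"
   by (rule nn_integral_sum) simp
  also have "... < \<top>" using s_fin by simp
  finally show ?thesis .
 qed
 have sub: "(\<integral>\<^sup>+w. ennreal (m k w * s k w) \<partial>M) <= (\<integral>\<^sup>+w. ennreal (m k w * s (Suc k) w) \<partial>M)" for k
 proof -
  let ?t = "real k * h"
  have t: "0 <= ?t" "?t + h = real (Suc k) * h" using h by (auto simp: algebra_simps)
  have [measurable]: "X h \<in> Borel M" "C h \<in> Borel M" using h by auto
  have W: "(\<lambda>w. ennreal (m k w * s k w)) \<in> Borel (F (ennreal ?t))"
   using mF[of k] sF[of k] by measurable
  define V where "V = (\<lambda>z::ennreal \<times> real \<times> real. fst z * (ennreal (exp (p * fst (snd z))) * ennreal (exp (q * snd (snd z)))))"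
  have V: "V \<in> Borel (borel \<Otimes>\<^sub>M borel \<Otimes>\<^sub>M borel)" unfolding V_def by measurable
  have "(\<integral>\<^sup>+w. ennreal (m k w * s (Suc k) w) \<partial>M)
    = (\<integral>\<^sup>+w. V (ennreal (m k w * s k w), X (?t + h) w - X ?t w, C (?t + h) w - C ?t w) \<partial>M)"
  proof (rule nn_integral_cong)
   fix w
   have "m k w * s (Suc k) w = (m k w * s k w) * (exp (p * (X (?t + h) w - X ?t w)) * exp (q * (C (?t + h) w - C ?t w)))"
    unfolding t(2) by (simp add: s_def L_def exp_add[symmetric] algebra_simps del: of_nat_Suc)
   then show "ennreal (m k w * s (Suc k) w) = V (ennreal (m k w * s k w), X (?t + h) w - X ?t w, C (?t + h) w - C ?t w)"
    using pos(1)[of k w] pos(2)[of k w] by (simp add: V_def ennreal_mult mult.assoc)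
  qed
  also have "... = (\<integral>\<^sup>+w. \<integral>\<^sup>+w1. \<integral>\<^sup>+w2. V (ennreal (m k w * s k w), X h w1, C h w2) \<partial>M \<partial>M \<partial>M)"
   by (rule joint_nn_integral[OF t(1) h W V])
  also have "... = (\<integral>\<^sup>+w. ennreal (m k w * s k w) * ((\<integral>\<^sup>+w. ennreal (exp (p * X h w)) \<partial>M) * (\<integral>\<^sup>+w. ennreal (exp (q * C h w)) \<partial>M)) \<partial>M)"
   unfolding V_def by (simp add: nn_integral_cmult nn_integral_multc)
  also have "(\<integral>\<^sup>+w. ennreal (m k w * s k w) * (1 * 1) \<partial>M) <= ..."
   using p q by (intro nn_integral_mono mult_mono) auto
  finally show ?thesis by simp
 qed
 let ?A = "\<Sum>k<n. \<integral>\<^sup>+w. ennreal (m k w * s k w) \<partial>M" and ?B = "\<Sum>k<n. \<integral>\<^sup>+w. ennreal (m k w * s (Suc k) w) \<partial>M"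
 have "(\<integral>\<^sup>+w. ennreal ((m n w)\<^sup>2) \<partial>M) + 4 * ?B
   = (\<integral>\<^sup>+w. ennreal ((m n w)\<^sup>2 + 4 * (\<Sum>k<n. m k w * s (Suc k) w)) \<partial>M)"
 proof -
  have "ennreal ((m n w)\<^sup>2 + 4 * (\<Sum>k<n. m k w * s (Suc k) w)) = ennreal ((m n w)\<^sup>2) + 4 * (\<Sum>k<n. ennreal (m k w * s (Suc k) w))" for w
   by (subst sum_ennreal) (simp_all add: ms_nonneg sum_nonneg ennreal_mult)
  then show ?thesis by (simp add: nn_integral_add nn_integral_cmult nn_integral_sum)
 qed
 also have "... <= (\<integral>\<^sup>+w. ennreal (4 * (s n w)\<^sup>2 + 4 * (\<Sum>k<n. m k w * s k w)) \<partial>M)"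
  using doob_pathwise[of "\<lambda>k. m k _" "\<lambda>k. s k _", OF m0 mS] by (intro nn_integral_mono ennreal_leI)
 also have "... = 4 * (\<integral>\<^sup>+w. ennreal ((s n w)\<^sup>2) \<partial>M) + 4 * ?A"
 proof -
  have "ennreal (4 * (s n w)\<^sup>2 + 4 * (\<Sum>k<n. m k w * s k w)) = 4 * ennreal ((s n w)\<^sup>2) + 4 * (\<Sum>k<n. ennreal (m k w * s k w))" for w
   by (subst sum_ennreal) (simp_all add: ms_nonneg sum_nonneg ennreal_mult)
  then show ?thesis by (simp add: nn_integral_add nn_integral_cmult nn_integral_sum)
 qed
 finally have le: "(\<integral>\<^sup>+w. ennreal ((m n w)\<^sup>2) \<partial>M) + 4 * ?B <= 4 * (\<integral>\<^sup>+w. ennreal ((s n w)\<^sup>2) \<partial>M) + 4 * ?A" .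
 have AB: "4 * ?A <= 4 * ?B" by (intro mult_left_mono sum_mono sub) simp
 have "4 * ?A + (\<integral>\<^sup>+w. ennreal ((m n w)\<^sup>2) \<partial>M) <= 4 * ?A + 4 * (\<integral>\<^sup>+w. ennreal ((s n w)\<^sup>2) \<partial>M)"
  using order_trans[OF add_left_mono[OF AB] le] by (simp only: add.commute)
 moreover have "4 * ?A \<noteq> \<top>"
  using ms_fin by (simp add: ennreal_mult_eq_top_iff less_top)
 ultimately have "(\<integral>\<^sup>+w. ennreal ((m n w)\<^sup>2) \<partial>M) <= 4 * (\<integral>\<^sup>+w. ennreal ((s n w)\<^sup>2) \<partial>M)"
  by (simp add: ennreal_add_left_cancel_le)
 moreover have "2 * - z = - 2 * z" for z :: real by simp
 ultimately show ?thesis unfolding m_def s_def L_def sq by (simp only:)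
qed

text \<open>Fatou's lemma along the grids: all of them end at \<open>N\<close>, so the bound is the
  same for each.\<close>

lemma doob:
 assumes N: "0 <= N"
  and p: "\<And>t. 0 <= t ==> 1 <= (\<integral>\<^sup>+w. ennreal (exp (p * X t w)) \<partial>M)"
  and q: "\<And>t. 0 <= t ==> 1 <= (\<integral>\<^sup>+w. ennreal (exp (q * C t w)) \<partial>M)"
  and fin: "\<And>t. 0 <= t ==> (\<integral>\<^sup>+w. ennreal (exp (2 * (p * X t w + q * C t w))) \<partial>M) < \<top>"
 shows "(\<integral>\<^sup>+w. ennreal (exp (- 2 * running_inf (\<lambda>t. - (p * X t w + q * C t w)) N)) \<partial>M)
  <= 4 * (\<integral>\<^sup>+w. ennreal (exp (2 * (p * X N w + q * C N w))) \<partial>M)"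
proof -
 let ?g = "\<lambda>n w. grid_min (\<lambda>t. - (p * X t w + q * C t w)) N n"
 let ?c = "4 * (\<integral>\<^sup>+w. ennreal (exp (2 * (p * X N w + q * C N w))) \<partial>M)"
 have lim: "(\<lambda>n. ennreal (exp (- 2 * ?g n w))) \<longlonglongrightarrow> ennreal (exp (- 2 * running_inf (\<lambda>t. - (p * X t w + q * C t w)) N))"
  if "w \<in> space M" for w
 proof -
  have "cadlag (\<lambda>t. - 1 * (p * X t w + q * C t w))"
   using that by (intro cadlag_cmult cadlag_add X.Z_cadlag C.Z_cadlag)
  then have "cadlag (\<lambda>t. - (p * X t w + q * C t w))" by simp
  from grid_min_running_inf[OF this N] show ?thesis by (intro tendsto_intros)
 qed
 have [measurable]: "?g n \<in> Borel M" for n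
  unfolding grid_min_def using N by (intro borel_measurable_Min) auto
 have "(\<integral>\<^sup>+w. ennreal (exp (- 2 * running_inf (\<lambda>t. - (p * X t w + q * C t w)) N)) \<partial>M)
   = (\<integral>\<^sup>+w. liminf (\<lambda>n. ennreal (exp (- 2 * ?g n w))) \<partial>M)"
  by (intro nn_integral_cong lim_imp_Liminf[symmetric] lim) auto
 also have "... <= liminf (\<lambda>n. \<integral>\<^sup>+w. ennreal (exp (- 2 * ?g n w)) \<partial>M)"
  by (intro nn_integral_liminf) measurable
 also have "... <= liminf (\<lambda>n. ?c)"
 proof (intro Liminf_mono always_eventually allI)
  fix n
  have h: "0 <= N / 2 ^ n" using N by simp
  show "(\<integral>\<^sup>+w. ennreal (exp (- 2 * ?g n w)) \<partial>M) <= ?c"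
   using doob_grid[OF h p[OF h] q[OF h] fin, of "2 ^ n"] by (simp add: grid_min_def)
 qed
 finally show ?thesis by (simp add: Liminf_const)
qed

end

section \<open>Processes evaluated at stopping times\<close>

context filtered_prob_space
begin

text \<open>On the event that \<tau> is at most \<open>u\<close>, the value is that at the truncated
  time, which is measurable at time \<open>u\<close> by approximation from the right. The event that
  \<tau> is infinite, where the value is 0 by convention, is handled at the index \<top>.\<close>

lemma stopped_value_pre_sigma:
 fixes Y :: "real => 'a => real"
 assumes Y: "adapted F Y" and c: "\<And>w. w \<in> space M ==> cadlag (\<lambda>t. Y t w)" and \<tau>: "stopping_time F \<tau>"
 shows "stopped_value Y \<tau> \<in> Borel (pre_sigma \<tau>)"
proof (rule borel_measurableI_le)
 fix x
 have fin: "{w \<in> space M. stopped_value Y \<tau> w <= x \<and> \<tau> w <= ennreal u} \<in> sets (F (ennreal u))" if u: "0 <= u" for u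
 proof -
  \<comment> \<open>The approximating grid times are truncated at \<open>u\<close> as well, so that
    no value from after \<open>u\<close> is sampled; when \<open>T w = u\<close> they are all equal
    to \<open>u\<close>.\<close>
  define T where "T w = enn2real (min (\<tau> w) (ennreal u))" for w
  have T: "0 <= T w" "T w <= u" for w
   using u by (auto simp: T_def intro!: enn2real_leI)
  have "(\<lambda>w. min (\<tau> w) (ennreal u)) \<in> Borel (F (ennreal u))"
  proof (rule borel_measurableI_le)
   fix y
   show "{w \<in> space (F (ennreal u)). min (\<tau> w) (ennreal u) <= y} \<in> sets (F (ennreal u))"
   proof (cases "ennreal u <= y")
    case True
    then have "{w \<in> space (F (ennreal u)). min (\<tau> w) (ennreal u) <= y} = space (F (ennreal u))"
     by (auto simp: min_le_iff_disj)
    then show ?thesis by simp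
   next
    case False
    then have "{w \<in> space (F (ennreal u)). min (\<tau> w) (ennreal u) <= y} = {w \<in> space (F (ennreal u)). \<tau> w <= y}"
     by (auto simp: min_le_iff_disj)
    also have "... \<in> sets (F (ennreal u))"
     using stopping_time_le_const[OF \<tau>, of y "ennreal u"] False by (auto simp: pred_def)
    finally show ?thesis .
   qed
  qed
  then have [measurable]: "T \<in> Borel (F (ennreal u))" unfolding T_def by measurable
  have [measurable]: "Y (min u (real (k + 1) / real (Suc n))) \<in> Borel (F (ennreal u))" for k n
  proof (rule F_mono)
   show "Y (min u (real (k + 1) / real (Suc n))) \<in> Borel (F (ennreal (min u (real (k + 1) / real (Suc n)))))"
    using Y u by (simp add: adapted_def)
  qed (use u in auto)
  have "(\<lambda>w. Y (T w) w) \<in> Borel (F (ennreal u))"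
  proof (rule borel_measurable_LIMSEQ_real)
   fix w assume "w \<in> space (F (ennreal u))"
   then have w: "w \<in> space M" by (simp add: space_F)
   show "(\<lambda>n. Y (min u (right_grid n (T w))) w) \<longlonglongrightarrow> Y (T w) w"
   proof (cases "T w = u")
    case True
    then have "min u (right_grid n (T w)) = T w" for n
     using right_grid_bounds(1)[OF T(1), of w n] by simp
    then show ?thesis by simp
   next
    case False
    then have "T w < u" using T(2)[of w] by simp
    have "(\<lambda>n. right_grid n (T w)) \<longlonglongrightarrow> T w"
     using T by (intro right_grid_tendsto[where f = "\<lambda>t. t"]) (auto intro: continuous_intros)
    then have "eventually (\<lambda>n. right_grid n (T w) < u) sequentially"
     using \<open>T w < u\<close> by (rule order_tendstoD)
    then have "eventually (\<lambda>n. Y (right_grid n (T w)) w = Y (min u (right_grid n (T w))) w) sequentially"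
     by eventually_elim (simp add: min_absorb2)
    moreover have "(\<lambda>n. Y (right_grid n (T w)) w) \<longlonglongrightarrow> Y (T w) w"
     using cadlag_right[OF c[OF w] T(1)] T(1) by (rule right_grid_tendsto)
    ultimately show ?thesis by (rule Lim_transform_eventually[rotated])
   qed
  next
   fix n
   have "(\<lambda>w. (\<lambda>k w. Y (min u (real (k + 1) / real (Suc n))) w) (nat \<lfloor>real (Suc n) * T w\<rfloor>) w) \<in> Borel (F (ennreal u))"
    by (rule measurable_compose_countable) measurable
   then show "(\<lambda>w. Y (min u (right_grid n (T w))) w) \<in> Borel (F (ennreal u))"
    by (simp add: right_grid_def)
  qed
  then have "{w \<in> space (F (ennreal u)). Y (T w) w <= x} \<inter> {w \<in> space (F (ennreal u)). \<tau> w <= ennreal u} \<in> sets (F (ennreal u))"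
   using stopping_timeD[OF \<tau>, of "ennreal u"] by (intro sets.Int) (auto simp: pred_def)
  also have "{w \<in> space (F (ennreal u)). Y (T w) w <= x} \<inter> {w \<in> space (F (ennreal u)). \<tau> w <= ennreal u}
    = {w \<in> space M. stopped_value Y \<tau> w <= x \<and> \<tau> w <= ennreal u}"
   by (auto simp: space_F stopped_value_def T_def min_absorb1 le_less_trans[OF _ ennreal_less_top])
  finally show ?thesis .
 qed
 show "{w \<in> space (pre_sigma \<tau>). stopped_value Y \<tau> w <= x} \<in> sets (pre_sigma \<tau>)"
 proof (rule sets_pre_sigmaI[OF \<tau>])
  fix t
  show "{w \<in> {w \<in> space (pre_sigma \<tau>). stopped_value Y \<tau> w <= x}. \<tau> w <= t} \<in> sets (F t)"
  proof (cases t)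
   case (real u)
   then show ?thesis using fin[of u] by (simp add: space_pre_sigma)
  next
   \<comment> \<open>A countable union over integer bounds covers the finite values of \<tau>; where
     \<tau> is infinite the default 0 decides.\<close>
   case top
   have "{w \<in> {w \<in> space (pre_sigma \<tau>). stopped_value Y \<tau> w <= x}. \<tau> w <= t}
    = (\<Union>n. {w \<in> space M. stopped_value Y \<tau> w <= x \<and> \<tau> w <= ennreal (real n)})
     \<union> (if 0 <= x then space (F \<top>) - {w \<in> space (F \<top>). \<tau> w < \<top>} else {})" (is "_ = ?rhs")
   proof (intro set_eqI iffI)
    fix w assume "w \<in> {w \<in> {w \<in> space (pre_sigma \<tau>). stopped_value Y \<tau> w <= x}. \<tau> w <= t}"
    then have w: "w \<in> space M" "stopped_value Y \<tau> w <= x" by (auto simp: space_pre_sigma)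
    show "w \<in> ?rhs"
    proof (cases "\<tau> w")
     case (real v)
     obtain n where "v <= real n" using real_arch_simple by blast
     then show ?thesis using w real by (auto intro!: exI[of _ n] ennreal_leI)
    next
     case top
     then show ?thesis using w by (auto simp: stopped_value_def space_F)
    qed
   next
    fix w assume "w \<in> ?rhs"
    then show "w \<in> {w \<in> {w \<in> space (pre_sigma \<tau>). stopped_value Y \<tau> w <= x}. \<tau> w <= t}"
     using top by (auto simp: space_pre_sigma stopped_value_def space_F split: if_splits)
   qed
   also have "... \<in> sets (F \<top>)"
   proof -
    have "{w \<in> space M. stopped_value Y \<tau> w <= x \<and> \<tau> w <= ennreal (real n)} \<in> sets (F \<top>)" for n
     using fin[of "real n"] sets_F_mono[of "ennreal (real n)" \<top>] by auto
    moreover have "{w \<in> space (F \<top>). \<tau> w < \<top>} \<in> sets (F \<top>)"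
     using stopping_time_less_const[OF \<tau>, of \<top>] by (simp add: pred_def)
    ultimately show ?thesis by auto
   qed
   finally show ?thesis using top by simp
  qed
 qed
qed

end

lemma suminf_single: "(\<Sum>k. if g = k then f k else 0) = (f g :: ennreal)" for g :: nat
 using suminf_finite[of "{g}" "\<lambda>k. if g = k then f k else 0"] by simp

lemma nn_integral_exp_discount:
 assumes "0 < (r::real)"
 shows "(\<integral>\<^sup>+v\<in>{0..}. ennreal (exp (- r * v)) \<partial>lborel) = ennreal (1 / r)"
proof -
 have "(\<integral>\<^sup>+v. ennreal (exp (- r * v)) * indicator {0..} v \<partial>lborel) = ennreal (0 - (- exp (- r * 0) / r))"
 proof (rule nn_integral_FTC_atLeast)
  show "((\<lambda>v. - exp (- r * v) / r) has_real_derivative exp (- r * v)) (at v)" for v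
   using assms by (auto intro!: derivative_eq_intros)
  have "((\<lambda>v. exp (- r * v)) \<longlongrightarrow> 0) at_top"
   using assms by (intro filterlim_compose[OF exp_at_bot] filterlim_tendsto_neg_mult_at_bot[OF tendsto_const])
    (auto simp: filterlim_ident)
  then have "((\<lambda>v. - exp (- r * v) / r) \<longlongrightarrow> - 0 / r) at_top"
   using assms by (intro tendsto_divide tendsto_minus tendsto_const) auto
  then show "((\<lambda>v. - exp (- r * v) / r) \<longlongrightarrow> 0) at_top" by simp
 qed auto
 then show ?thesis by simp
qed

section \<open>The conditional value of the discounted future\<close>

context discounted_levy_pair
begin

text \<open>The conditional value of the whole discounted future, relative to
  \<open>exp (- r * t + C t w)\<close>, as a function of the distance of the minimum from the
  present value of \<open>G\<close>.\<close>

definition \<Phi> :: "real => ennreal" where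
 "\<Phi> d = (\<integral>\<^sup>+v\<in>{0..}. ennreal (exp (- r * v)) * \<phi> (max 0 v) d \<partial>lborel)"

lemma \<phi>_measurable [measurable]:
 assumes [measurable]: "f \<in> Borel N" "g \<in> Borel N"
 shows "(\<lambda>p. \<phi> (max 0 (f p)) (g p)) \<in> Borel N"
 unfolding \<phi>_def by measurable

lemma \<Phi>_measurable [measurable]: "\<Phi> \<in> Borel borel"
 unfolding \<Phi>_def by measurable

lemma \<Phi>_le: "\<Phi> d <= ennreal (1 / r)"
proof -
 have "\<Phi> d <= (\<integral>\<^sup>+v\<in>{0..}. ennreal (exp (- r * v)) * 1 \<partial>lborel)"
  unfolding \<Phi>_def by (intro nn_integral_mono mult_right_mono mult_left_mono \<phi>_le_1) auto
 also have "... = ennreal (1 / r)"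
  using nn_integral_exp_discount[OF r] by simp
 finally show ?thesis .
qed

lemma \<Phi>_finite: "\<Phi> d < \<top>"
 using \<Phi>_le[of d] by (rule le_less_trans) simp

lemma \<Phi>_le_\<Phi>0: "\<Phi> d <= \<Phi> 0"
 unfolding \<Phi>_def \<phi>_def
 by (intro nn_integral_mono mult_right_mono mult_left_mono ennreal_leI) (use R_nonpos in auto)

lemma \<Phi>_pos: "0 < \<Phi> d"
proof -
 have \<phi>0: "\<phi> (max 0 v) d \<noteq> 0" for v
 proof
  have [measurable]: "X (max 0 v) \<in> Borel M" "R (max 0 v) \<in> Borel M" by auto
  assume "\<phi> (max 0 v) d = 0"
  then have "AE w in M. False"
   unfolding \<phi>_def by (subst (asm) nn_integral_0_iff_AE) auto
  then show False by simp
 qed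
 have "\<Phi> d \<noteq> 0"
 proof
  assume "\<Phi> d = 0"
  then have "AE v in lborel. ennreal (exp (- r * v)) * \<phi> (max 0 v) d * indicator {0..} v = 0"
   unfolding \<Phi>_def by (subst (asm) nn_integral_0_iff_AE) auto
  then have "AE v in lborel. v \<notin> {0::real..}"
   by eventually_elim (use \<phi>0 in \<open>auto simp: indicator_def\<close>)
  then have "emeasure lborel {0::real..} = 0"
   by (subst (asm) AE_iff_null_sets[symmetric]) auto
  moreover have "emeasure lborel {0..1::real} <= emeasure lborel {0::real..}"
   by (intro emeasure_mono) auto
  ultimately show False by simp
 qed
 then show ?thesis by (simp add: zero_less_iff_neq_zero)
qed

definition A\<^sub>0 :: real where "A\<^sub>0 = enn2real (\<Phi> 0)"

lemma A0_pos: "0 < A\<^sub>0"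
 unfolding A\<^sub>0_def using \<Phi>_pos \<Phi>_finite by (simp add: enn2real_positive_iff)

lemma \<Phi>_0: "\<Phi> 0 = ennreal A\<^sub>0"
 unfolding A\<^sub>0_def using \<Phi>_finite by simp

lemma \<Phi>_real: "\<Phi> d = ennreal (enn2real (\<Phi> d))" "enn2real (\<Phi> d) <= A\<^sub>0"
 using \<Phi>_finite[of d] \<Phi>_finite[of 0] \<Phi>_le_\<Phi>0[of d] by (auto simp: A\<^sub>0_def intro: enn2real_mono)

text \<open>Dominated convergence twice, under \<open>exp C\<close> over the outcomes and under the
  discount factor over the lag. Continuity is what makes \<open>Y\<close> cadlag.\<close>

lemma continuous_\<Phi>: "continuous_on UNIV (\<lambda>d. enn2real (\<Phi> d))"
 unfolding continuous_on_eq_continuous_at[OF open_UNIV]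
proof (intro ballI continuous_at_sequentially[THEN iffD2] allI impI)
 fix d :: real and f :: "nat => real" assume f: "f \<longlonglongrightarrow> d"
 have \<phi>_lim: "(\<lambda>n. \<phi> (max 0 v) (f n)) \<longlonglongrightarrow> \<phi> (max 0 v) d" for v
  unfolding \<phi>_def
 proof (rule nn_integral_dominated_convergence[where w = "\<lambda>w. ennreal (exp (C (max 0 v) w))"])
  show "AE w in M. ennreal (exp (- a * X (max 0 v) w + min (f n) (R (max 0 v) w))) <= ennreal (exp (C (max 0 v) w))" for n
  proof (intro AE_I2 ennreal_leI)
   fix w assume "w \<in> space M"
   then have "R (max 0 v) w <= G (max 0 v) w" by (intro R_le_G) auto
   then show "exp (- a * X (max 0 v) w + min (f n) (R (max 0 v) w)) <= exp (C (max 0 v) w)" by (simp add: G_def)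
  qed
  show "AE w in M. (\<lambda>n. ennreal (exp (- a * X (max 0 v) w + min (f n) (R (max 0 v) w))))
    \<longlonglongrightarrow> ennreal (exp (- a * X (max 0 v) w + min d (R (max 0 v) w)))"
   by (intro AE_I2 tendsto_intros f)
 qed (use exp_C[of "max 0 v"] in \<open>auto intro!: process_measurable\<close>)
 have meas: "(\<lambda>v. ennreal (exp (- r * v)) * \<phi> (max 0 v) y * indicator {0..} v) \<in> Borel lborel" for y
  by (intro borel_measurable_times_ennreal \<phi>_measurable borel_measurable_indicator) simp_all
 have meas': "(\<lambda>v. ennreal (exp (- r * v)) * indicator {0..} v) \<in> Borel lborel"
  by simp
 have "(\<lambda>n. \<Phi> (f n)) \<longlonglongrightarrow> \<Phi> d"
  unfolding \<Phi>_def
 proof (rule nn_integral_dominated_convergence[where w = "\<lambda>v. ennreal (exp (- r * v)) * indicator {0..} v"])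
  show "AE v in lborel. ennreal (exp (- r * v)) * \<phi> (max 0 v) (f n) * indicator {0..} v <= ennreal (exp (- r * v)) * indicator {0..} v" for n
  proof (intro AE_I2 mult_right_mono)
   fix v :: real
   show "ennreal (exp (- r * v)) * \<phi> (max 0 v) (f n) <= ennreal (exp (- r * v))"
    using mult_left_mono[OF \<phi>_le_1[of "max 0 v" "f n"], of "ennreal (exp (- r * v))"] by simp
  qed simp
  show "AE v in lborel. (\<lambda>n. ennreal (exp (- r * v)) * \<phi> (max 0 v) (f n) * indicator {0..} v)
    \<longlonglongrightarrow> ennreal (exp (- r * v)) * \<phi> (max 0 v) d * indicator {0..} v"
  proof (intro AE_I2)
   fix v :: real
   show "(\<lambda>n. ennreal (exp (- r * v)) * \<phi> (max 0 v) (f n) * indicator {0..} v)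
    \<longlonglongrightarrow> ennreal (exp (- r * v)) * \<phi> (max 0 v) d * indicator {0..} v"
    using \<phi>_lim[of v] by (auto simp: indicator_def intro!: ennreal_tendsto_cmult)
  qed
  show "(\<integral>\<^sup>+v\<in>{0..}. ennreal (exp (- r * v)) \<partial>lborel) < \<infinity>"
   using nn_integral_exp_discount[OF r] by simp
 qed (rule meas meas')+
 then show "((\<lambda>d. enn2real (\<Phi> d)) \<circ> f) \<longlonglongrightarrow> enn2real (\<Phi> d)"
  unfolding comp_def using \<Phi>_finite[of d] by (intro tendsto_enn2real) auto
qed

definition H :: "real => 'a => ennreal" where
 "H t w = (\<integral>\<^sup>+s\<in>{t..}. ennreal (exp (- r * s - a * X (max 0 s) w + R (max 0 s) w)) \<partial>lborel)"

text \<open>A cadlag version of the conditional expectation of \<open>H t\<close> given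
  \<open>F t\<close>; up to a factor it will be the optional projection in the first order
  conditions.\<close>

definition Y :: "real => 'a => real" where
 "Y t w = exp (- r * t + C t w) * enn2real (\<Phi> (R t w - G t w))"

lemma H_measurable [measurable]:
 assumes [measurable]: "f \<in> N \<rightarrow>\<^sub>M M" "g \<in> Borel N"
 shows "(\<lambda>p. H (g p) (f p)) \<in> Borel N"
proof -
 have "(\<lambda>p. \<integral>\<^sup>+s. ennreal (exp (- r * s - a * X (max 0 s) (f p) + R (max 0 s) (f p))) * (if g p <= s then 1 else 0) \<partial>lborel)
   \<in> Borel N" by measurable
 also have "(\<lambda>p. \<integral>\<^sup>+s. ennreal (exp (- r * s - a * X (max 0 s) (f p) + R (max 0 s) (f p))) * (if g p <= s then 1 else 0) \<partial>lborel)
   = (\<lambda>p. H (g p) (f p))"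
  unfolding H_def by (intro ext nn_integral_cong) (auto simp: indicator_def)
 finally show ?thesis .
qed

lemma adapted_Y: "adapted F Y"
 unfolding adapted_def
proof (intro allI impI)
 fix t :: real assume t: "0 <= t"
 have [measurable]: "C t \<in> Borel (F (ennreal t))" "R t \<in> Borel (F (ennreal t))" "G t \<in> Borel (F (ennreal t))"
  using adapted_C adapted_R adapted_G t by (auto simp: adapted_def)
 show "Y t \<in> Borel (F (ennreal t))" unfolding Y_def[abs_def] by measurable
qed

lemma cadlag_Y:
 assumes "w \<in> space M"
 shows "cadlag (\<lambda>t. Y t w)"
proof -
 have "cadlag (\<lambda>t. - r * t)" by (intro cadlag_continuous_on continuous_intros)
 from cadlag_add[OF this C.Z_cadlag[OF assms]]
 show ?thesis
  unfolding Y_def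
  by (intro cadlag_mult cadlag_exp cadlag_compose[OF _ continuous_\<Phi>] cadlag_diff cadlag_R cadlag_G assms)
qed

lemma Y_nonneg: "0 <= Y t w"
 by (simp add: Y_def)

lemma Y_le: "Y t w <= A\<^sub>0 * exp (- r * t + C t w)"
 unfolding Y_def using \<Phi>_real(2) by (simp add: mult.commute[of A\<^sub>0])

lemma Y_eq: "R t w = G t w ==> Y t w = A\<^sub>0 * exp (- r * t + C t w)"
 unfolding Y_def A\<^sub>0_def by simp

lemma H_antimono: "s <= t ==> H t w <= H s w"
 unfolding H_def by (intro nn_integral_mono) (auto simp: indicator_def)

text \<open>Fatou's lemma in the integration variable. The indicators of the tails fail to converge
  only at \<open>s = t\<close>, because grid times lie strictly to the right of \<open>t\<close>.
  The opposite comparison is \<open>H_antimono\<close>.\<close>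

lemma H_right_limit:
 assumes w: "w \<in> space M" and t: "0 <= t"
 shows "H t w <= liminf (\<lambda>n. H (right_grid n t) w)"
proof -
 let ?h = "\<lambda>s. ennreal (exp (- r * s - a * X (max 0 s) w + R (max 0 s) w))"
 have [measurable]: "?h \<in> Borel lborel"
  using w by measurable
 have "AE s in lborel. s \<noteq> t"
  by (rule AE_lborel_singleton)
 then have "AE s in lborel. ?h s * indicator {t..} s <= liminf (\<lambda>n. ?h s * indicator {right_grid n t..} s)"
 proof eventually_elim
  fix s assume "s \<noteq> t"
  show "?h s * indicator {t..} s <= liminf (\<lambda>n. ?h s * indicator {right_grid n t..} s)"
  proof (cases "t < s")
   case True
   have "(\<lambda>n. right_grid n t) \<longlonglongrightarrow> t"
    using t by (intro right_grid_tendsto[where f = "\<lambda>t. t"]) (auto intro: continuous_intros)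
   then have "eventually (\<lambda>n. right_grid n t < s) sequentially"
    using True by (rule order_tendstoD)
   then have "eventually (\<lambda>n. ?h s <= ?h s * indicator {right_grid n t..} s) sequentially"
    by eventually_elim simp
   then have "?h s <= liminf (\<lambda>n. ?h s * indicator {right_grid n t..} s)"
    by (rule Liminf_bounded)
   then show ?thesis using True by simp
  next
   case False
   then show ?thesis using \<open>s \<noteq> t\<close> by simp
  qed
 qed
 then have "H t w <= (\<integral>\<^sup>+s. liminf (\<lambda>n. ?h s * indicator {right_grid n t..} s) \<partial>lborel)"
  unfolding H_def by (rule nn_integral_mono_AE)
 also have "... <= liminf (\<lambda>n. H (right_grid n t) w)"
  unfolding H_def by (rule nn_integral_liminf) measurable
 finally show ?thesis .
qed

text \<open>After shifting the integration variable by \<open>s\<close>, Fubini reduces the claim to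
  \<open>markov\<close> at each lag \<open>v\<close>.\<close>

lemma H_markov:
 assumes s: "0 <= s" and B: "B \<in> sets (F (ennreal s))"
 shows "(\<integral>\<^sup>+w. indicator B w * H s w \<partial>M) = (\<integral>\<^sup>+w. indicator B w * ennreal (Y s w) \<partial>M)"
proof -
 interpret P: pair_sigma_finite M lborel
  by (intro pair_sigma_finite.intro X.sigma_finite_measure_axioms sigma_finite_lborel)
 have [measurable]: "B \<in> sets M" using B X.subalg by (auto simp: subalgebra_def)
 have [measurable]: "C s \<in> Borel M" "R s \<in> Borel M" "G s \<in> Borel M"
  using s by auto
 let ?h = "\<lambda>s w. ennreal (exp (- r * s - a * X (max 0 s) w + R (max 0 s) w))"
 have m1: "(\<lambda>(w, v). indicator B w * (?h (s + v) w * indicator {0..} v)) \<in> Borel (M \<Otimes>\<^sub>M lborel)"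
  by measurable
 have m2: "(\<lambda>(w, v). indicator B w * (ennreal (exp (- r * s + C s w)) *
   (ennreal (exp (- r * v)) * \<phi> (max 0 v) (R s w - G s w) * indicator {0..} v))) \<in> Borel (M \<Otimes>\<^sub>M lborel)"
  by measurable
 have shift: "H s w = (\<integral>\<^sup>+v. ?h (s + v) w * indicator {0..} v \<partial>lborel)" if w: "w \<in> space M" for w
 proof -
  have m: "(\<lambda>z. ?h z w * indicator {s..} z) \<in> Borel borel" using w by measurable
  have "H s w = (\<integral>\<^sup>+v. ?h (s + 1 * v) w * indicator {s..} (s + 1 * v) \<partial>lborel)"
   unfolding H_def using nn_integral_real_affine[OF m, of 1 s] by simp
  then show ?thesis by (simp add: indicator_def)
 qed
 have "(\<integral>\<^sup>+w. indicator B w * H s w \<partial>M)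
   = (\<integral>\<^sup>+w. \<integral>\<^sup>+v. indicator B w * (?h (s + v) w * indicator {0..} v) \<partial>lborel \<partial>M)"
 proof (rule nn_integral_cong)
  fix w assume w: "w \<in> space M"
  then have m: "(\<lambda>v. ?h (s + v) w * indicator {0..} v) \<in> Borel lborel" by measurable
  show "indicator B w * H s w = (\<integral>\<^sup>+v. indicator B w * (?h (s + v) w * indicator {0..} v) \<partial>lborel)"
   unfolding shift[OF w] by (rule nn_integral_cmult[OF m, symmetric])
 qed
 also have "... = (\<integral>\<^sup>+v. \<integral>\<^sup>+w. indicator B w * (?h (s + v) w * indicator {0..} v) \<partial>M \<partial>lborel)"
  by (rule P.Fubini'[OF m1, symmetric])
 also have "... = (\<integral>\<^sup>+v. \<integral>\<^sup>+w. indicator B w * (ennreal (exp (- r * s + C s w)) *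
   (ennreal (exp (- r * v)) * \<phi> (max 0 v) (R s w - G s w) * indicator {0..} v)) \<partial>M \<partial>lborel)"
 proof (rule nn_integral_cong)
  fix v :: real
  show "(\<integral>\<^sup>+w. indicator B w * (?h (s + v) w * indicator {0..} v) \<partial>M)
   = (\<integral>\<^sup>+w. indicator B w * (ennreal (exp (- r * s + C s w)) *
    (ennreal (exp (- r * v)) * \<phi> (max 0 v) (R s w - G s w) * indicator {0..} v)) \<partial>M)"
  proof (cases "0 <= v")
   case True
   have [measurable]: "X (s + v) \<in> Borel M" "R (s + v) \<in> Borel M"
    using s True by auto
   have "(\<lambda>d. \<phi> (max 0 v) d) \<in> Borel borel"
    by (rule \<phi>_measurable) simp_all
   then have [measurable]: "\<phi> v \<in> Borel borel"
    by (simp only: max_absorb2[OF True])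
   have "(\<integral>\<^sup>+w. indicator B w * (?h (s + v) w * indicator {0..} v) \<partial>M)
     = (\<integral>\<^sup>+w. ennreal (exp (- r * (s + v))) * (indicator B w * ennreal (exp (- a * X (s + v) w + R (s + v) w))) \<partial>M)"
    using True s by (intro nn_integral_cong)
     (auto simp: indicator_def max_absorb2 ennreal_mult[symmetric] exp_add[symmetric])
   also have "... = ennreal (exp (- r * (s + v))) * (\<integral>\<^sup>+w. indicator B w * ennreal (exp (- a * X (s + v) w + R (s + v) w)) \<partial>M)"
    by (rule nn_integral_cmult) measurable
   also have "... = ennreal (exp (- r * (s + v))) * (\<integral>\<^sup>+w. indicator B w * (ennreal (exp (C s w)) * \<phi> v (R s w - G s w)) \<partial>M)"
    by (simp only: markov[OF s True B])
   also have "... = (\<integral>\<^sup>+w. ennreal (exp (- r * (s + v))) * (indicator B w * (ennreal (exp (C s w)) * \<phi> v (R s w - G s w))) \<partial>M)"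
    by (rule nn_integral_cmult[symmetric]) measurable
   also have "... = (\<integral>\<^sup>+w. indicator B w * (ennreal (exp (- r * s + C s w)) *
    (ennreal (exp (- r * v)) * \<phi> (max 0 v) (R s w - G s w) * indicator {0..} v)) \<partial>M)"
   proof (rule nn_integral_cong)
    fix w
    have e: "ennreal (exp (- r * (s + v))) * ennreal (exp (C s w)) = ennreal (exp (- r * s + C s w)) * ennreal (exp (- r * v))"
     by (simp add: ennreal_mult[symmetric] exp_add[symmetric] algebra_simps)
    show "ennreal (exp (- r * (s + v))) * (indicator B w * (ennreal (exp (C s w)) * \<phi> v (R s w - G s w)))
     = indicator B w * (ennreal (exp (- r * s + C s w)) * (ennreal (exp (- r * v)) * \<phi> (max 0 v) (R s w - G s w) * indicator {0..} v))"
     using True e by (auto simp: indicator_def max_absorb2 mult.assoc[symmetric])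
   qed
   finally show ?thesis .
  qed simp
 qed
 also have "... = (\<integral>\<^sup>+w. \<integral>\<^sup>+v. indicator B w * (ennreal (exp (- r * s + C s w)) *
   (ennreal (exp (- r * v)) * \<phi> (max 0 v) (R s w - G s w) * indicator {0..} v)) \<partial>lborel \<partial>M)"
  by (rule P.Fubini'[OF m2])
 also have "... = (\<integral>\<^sup>+w. indicator B w * ennreal (Y s w) \<partial>M)"
 proof (rule nn_integral_cong)
  fix w
  have "(\<integral>\<^sup>+v. indicator B w * (ennreal (exp (- r * s + C s w)) *
   (ennreal (exp (- r * v)) * \<phi> (max 0 v) (R s w - G s w) * indicator {0..} v)) \<partial>lborel)
   = indicator B w * (ennreal (exp (- r * s + C s w)) * \<Phi> (R s w - G s w))"
   by (simp add: nn_integral_cmult \<Phi>_def)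
  also have "ennreal (exp (- r * s + C s w)) * \<Phi> (R s w - G s w) = ennreal (Y s w)"
   unfolding Y_def by (subst \<Phi>_real(1)) (simp add: ennreal_mult)
  finally show "(\<integral>\<^sup>+v. indicator B w * (ennreal (exp (- r * s + C s w)) *
   (ennreal (exp (- r * v)) * \<phi> (max 0 v) (R s w - G s w) * indicator {0..} v)) \<partial>lborel) = indicator B w * ennreal (Y s w)" .
 qed
 finally show ?thesis .
qed

end

section \<open>The strong Markov property\<close>

context discounted_levy_pair
begin

text \<open>The running supremum of \<open>exp C\<close> up to \<open>N\<close>, expressed through a
  running infimum.\<close>

definition sup_exp_C :: "real => 'a => real" where
 "sup_exp_C N w = exp (- running_inf (\<lambda>t. - C t w) N)"

lemma exp_C_le_sup: "w \<in> space M ==> 0 <= t ==> t <= N ==> exp (C t w) <= sup_exp_C N w"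
 unfolding sup_exp_C_def using running_inf_le[OF cadlag_cmult[OF C.Z_cadlag, of w "-1"], of t N] by simp

lemma sup_exp_C_measurable:
 assumes N: "0 <= N"
 shows "sup_exp_C N \<in> Borel M"
proof -
 have "adapted F (\<lambda>t w. - C t w)"
  using X.adapted_compose2[OF adapted_C adapted_C, of "\<lambda>x y. - x"] by simp
 then have "adapted F (\<lambda>t w. running_inf (\<lambda>t. - C t w) t)"
  using cadlag_cmult[OF C.Z_cadlag, of _ "-1"] by (intro X.adapted_running_inf) auto
 from X.adaptedD[OF this N] show ?thesis unfolding sup_exp_C_def[abs_def] by measurable
qed

text \<open>Doob's inequality with the weights 0 and 1 bounds the second moment; the first follows
  from \<open>y <= 1 + y\<^sup>2\<close>.\<close>

lemma sup_exp_C_finite: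
 assumes N: "0 <= N"
 shows "(\<integral>\<^sup>+w. ennreal (sup_exp_C N w) \<partial>M) < \<top>"
proof -
 note [measurable] = sup_exp_C_measurable[OF N]
 have "(\<integral>\<^sup>+w. ennreal ((sup_exp_C N w)\<^sup>2) \<partial>M)
   <= 4 * (\<integral>\<^sup>+w. ennreal (exp (2 * C N w)) \<partial>M)"
  using doob[OF N, of 0 1] exp_C exp_2C
  by (simp add: sup_exp_C_def exp_double[symmetric] X.emeasure_space_1)
 also have "... < \<top>" using exp_2C[OF N] by (simp add: ennreal_mult_less_top)
 finally have fin: "(\<integral>\<^sup>+w. ennreal ((sup_exp_C N w)\<^sup>2) \<partial>M) < \<top>" .
 have "(\<integral>\<^sup>+w. ennreal (sup_exp_C N w) \<partial>M) <= (\<integral>\<^sup>+w. 1 + ennreal ((sup_exp_C N w)\<^sup>2) \<partial>M)"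
 proof (rule nn_integral_mono)
  fix w
  have "y <= 1 + y\<^sup>2" if "0 <= y" for y :: real
   using that zero_le_power2[of "y - 1"] by (simp add: power2_diff)
  then have "sup_exp_C N w <= 1 + (sup_exp_C N w)\<^sup>2"
   by (simp add: sup_exp_C_def)
  then have "ennreal (sup_exp_C N w) <= ennreal (1 + (sup_exp_C N w)\<^sup>2)"
   by (rule ennreal_leI)
  then show "ennreal (sup_exp_C N w) <= 1 + ennreal ((sup_exp_C N w)\<^sup>2)"
   by simp
 qed
 also have "... < \<top>" using fin by (simp add: nn_integral_add X.emeasure_space_1)
 finally show ?thesis .
qed

text \<open>The Markov property extends from deterministic to stopping times by approximation with grid times
 from the right.  Dominated convergence applies on the side of \<open>Y\<close> only, Fatou's lemma and
 monotonicity take care of \<open>H\<close>.\<close>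

lemma grid_markov:
 assumes \<tau>: "stopping_time F \<tau>" and B: "B \<in> sets (X.pre_sigma \<tau>)" and fin: "\<And>w. w \<in> B ==> \<tau> w < \<top>"
 shows "(\<integral>\<^sup>+w. indicator B w * H (right_grid n (enn2real (\<tau> w))) w \<partial>M)
  = (\<integral>\<^sup>+w. indicator B w * ennreal (Y (right_grid n (enn2real (\<tau> w))) w) \<partial>M)"
proof -
 define t where "t k = real (k + 1) / real (Suc n)" for k
 define A where "A k = {w \<in> B. nat \<lfloor>real (Suc n) * enn2real (\<tau> w)\<rfloor> = k}" for k
 have t0: "0 <= t k" for k by (simp add: t_def)
 have Bsub: "B \<subseteq> space M"
  using sets.sets_into_space[OF B] by (simp add: X.space_pre_sigma)
 have AF: "A k \<in> sets (F (ennreal (t k)))" for k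
 proof -
  have le: "ennreal (real k / real (Suc n)) <= ennreal (t k)"
   by (intro ennreal_leI) (simp add: t_def divide_right_mono)
  have 1: "{w \<in> B. \<tau> w <= ennreal (t k)} \<in> sets (F (ennreal (t k)))"
   by (rule X.sets_pre_sigmaD[OF \<tau> B])
  have 2: "{w \<in> space M. \<tau> w < ennreal (t k)} \<in> sets (F (ennreal (t k)))"
   using X.stopping_time_less_const[OF \<tau>, of "ennreal (t k)"] by (simp add: pred_def X.space_F)
  have 3: "{w \<in> space M. \<tau> w < ennreal (real k / real (Suc n))} \<in> sets (F (ennreal (t k)))"
   using X.stopping_time_less_const[OF \<tau>, of "ennreal (real k / real (Suc n))"] X.sets_F_mono[OF le]
   by (auto simp: pred_def X.space_F)
  have "A k = {w \<in> B. \<tau> w <= ennreal (t k)} \<inter> {w \<in> space M. \<tau> w < ennreal (t k)} - {w \<in> space M. \<tau> w < ennreal (real k / real (Suc n))}"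
  proof (intro set_eqI)
   fix w
   show "w \<in> A k \<longleftrightarrow> w \<in> {w \<in> B. \<tau> w <= ennreal (t k)} \<inter> {w \<in> space M. \<tau> w < ennreal (t k)} - {w \<in> space M. \<tau> w < ennreal (real k / real (Suc n))}"
   proof (cases "w \<in> B")
    case True
    then obtain v where v: "\<tau> w = ennreal v" "0 <= v"
     using fin[OF True] by (cases "\<tau> w") auto
    have "nat \<lfloor>real (Suc n) * v\<rfloor> = k \<longleftrightarrow> real k <= real (Suc n) * v \<and> real (Suc n) * v < real k + 1"
     using v(2) by (simp add: nat_eq_iff floor_eq_iff del: of_nat_Suc)
    also have "... \<longleftrightarrow> real k / real (Suc n) <= v \<and> v < t k"
     by (simp add: t_def field_simps)
    finally show ?thesis
     using True Bsub v t0[of k] by (auto simp: A_def ennreal_less_iff)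
   qed (simp add: A_def)
  qed
  then show ?thesis using 1 2 3 by auto
 qed
 have AM: "A k \<in> sets M" for k
  using AF[of k] X.subalg by (auto simp: subalgebra_def)
 have dec: "(\<integral>\<^sup>+w. indicator B w * f (right_grid n (enn2real (\<tau> w))) w \<partial>M) = (\<Sum>k. \<integral>\<^sup>+w. indicator (A k) w * f (t k) w \<partial>M)"
  if f: "\<And>k. f (t k) \<in> Borel M" for f :: "real => 'a => ennreal"
 proof -
  have "indicator B w * f (right_grid n (enn2real (\<tau> w))) w = (\<Sum>k. indicator (A k) w * f (t k) w)" for w
  proof -
   let ?g = "nat \<lfloor>real (Suc n) * enn2real (\<tau> w)\<rfloor>"
   have "(\<Sum>k. indicator (A k) w * f (t k) w) = (\<Sum>k. if ?g = k then indicator B w * f (t k) w else 0)"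
    by (intro suminf_cong) (simp add: A_def indicator_def)
   also have "... = indicator B w * f (t ?g) w" by (rule suminf_single)
   also have "t ?g = right_grid n (enn2real (\<tau> w))" by (simp add: t_def right_grid_def)
   finally show ?thesis by simp
  qed
  then show ?thesis using f AM by (simp add: nn_integral_suminf)
 qed
 have "H (t k) \<in> Borel M" "Y (t k) \<in> Borel M" for k
  using X.adaptedD[OF adapted_Y t0] by auto
 then show ?thesis
  using dec[of H] dec[of "\<lambda>t w. ennreal (Y t w)"] H_markov[OF t0 AF] by simp
qed

lemma bounded_stopped_markov:
 assumes \<tau>: "stopping_time F \<tau>" and B: "B \<in> sets (X.pre_sigma \<tau>)" and bnd: "\<And>w. w \<in> B ==> \<tau> w <= ennreal (real N)"
 shows "(\<integral>\<^sup>+w. indicator B w * H (enn2real (\<tau> w)) w \<partial>M)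
  = (\<integral>\<^sup>+w. indicator B w * ennreal (Y (enn2real (\<tau> w)) w) \<partial>M)"
proof -
 have fin: "\<tau> w < \<top>" if "w \<in> B" for w
  using bnd[OF that] by (rule le_less_trans) simp
 have \<tau>M [measurable]: "\<tau> \<in> Borel M"
  using X.subalg by (intro measurable_stopping_time[OF \<tau>]) (auto simp: subalgebra_def)
 have BM [measurable]: "B \<in> sets M"
 proof -
  have "B = (\<Union>n. {w \<in> B. \<tau> w <= ennreal (real n)})" using bnd by auto
  moreover have "{w \<in> B. \<tau> w <= ennreal (real n)} \<in> sets M" for n
   using X.sets_pre_sigmaD[OF \<tau> B, of "ennreal (real n)"] X.subalg by (auto simp: subalgebra_def)
  ultimately show ?thesis by (metis (no_types, lifting) countable_Un_Int(1) image_subset_iff)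
 qed
 define T where "T w = enn2real (\<tau> w)" for w
 have [measurable]: "T \<in> Borel M" unfolding T_def by measurable
 have T0: "0 <= T w" for w by (simp add: T_def)
 have TN: "T w <= real N" if "w \<in> B" for w
  unfolding T_def using bnd[OF that] by (intro enn2real_leI) auto
 have gridN: "right_grid n (T w) <= real N + 1" if "w \<in> B" for n w
 proof -
  have "right_grid n (T w) <= T w + 1 / real (Suc n)" by (rule right_grid_bounds(2)[OF T0])
  moreover have "1 / real (Suc n) <= 1" by simp
  ultimately show ?thesis using TN[OF that] by linarith
 qed
 have [measurable]: "(\<lambda>w. right_grid n (T w)) \<in> Borel M" for n
  unfolding right_grid_def by measurable
 have Yg: "(\<lambda>w. Y (g w) w) \<in> Borel M" if g0: "\<And>w. 0 <= g w" and [measurable]: "g \<in> Borel M" for g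
 proof -
  have "(\<lambda>w. (\<lambda>p. Y (max 0 (snd p)) (fst p)) (w, g w)) \<in> Borel M"
   by (rule measurable_compose[OF _ X.adapted_process_measurable[OF adapted_Y cadlag_Y]]) auto
  then show ?thesis using g0 by (simp add: max_absorb2)
 qed
 have [measurable]: "(\<lambda>w. Y (T w) w) \<in> Borel M" "(\<lambda>w. Y (right_grid n (T w)) w) \<in> Borel M" for n
  using T0 by (auto intro!: Yg right_grid_nonneg)
 let ?EY = "\<lambda>n. \<integral>\<^sup>+w. indicator B w * ennreal (Y (right_grid n (T w)) w) \<partial>M"
 let ?EH = "\<lambda>n. \<integral>\<^sup>+w. indicator B w * H (right_grid n (T w)) w \<partial>M"
 have eq: "?EH n = ?EY n" for n
  unfolding T_def by (rule grid_markov[OF \<tau> B fin])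
 have lim: "?EY \<longlonglongrightarrow> (\<integral>\<^sup>+w. indicator B w * ennreal (Y (T w) w) \<partial>M)"
 proof (rule nn_integral_dominated_convergence[where w = "\<lambda>w. ennreal A\<^sub>0 * ennreal (sup_exp_C (real N + 1) w)"])
  show "AE w in M. indicator B w * ennreal (Y (right_grid n (T w)) w) <= ennreal A\<^sub>0 * ennreal (sup_exp_C (real N + 1) w)" for n
  proof (intro AE_I2)
   fix w assume w: "w \<in> space M"
   show "indicator B w * ennreal (Y (right_grid n (T w)) w) <= ennreal A\<^sub>0 * ennreal (sup_exp_C (real N + 1) w)"
   proof (cases "w \<in> B")
    case True
    let ?t = "right_grid n (T w)"
    have "exp (- r * ?t + C ?t w) <= exp (C ?t w)"
     using r right_grid_nonneg[of n "T w"] by simp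
    also have "... <= sup_exp_C (real N + 1) w"
     by (rule exp_C_le_sup[OF w right_grid_nonneg gridN[OF True]])
    finally have "Y ?t w <= A\<^sub>0 * sup_exp_C (real N + 1) w"
     using A0_pos by (intro order_trans[OF Y_le] mult_left_mono) auto
    then have "ennreal (Y ?t w) <= ennreal (A\<^sub>0 * sup_exp_C (real N + 1) w)" by (rule ennreal_leI)
    then show ?thesis using True A0_pos by (simp add: ennreal_mult sup_exp_C_def)
   qed simp
  qed
  show "AE w in M. (\<lambda>n. indicator B w * ennreal (Y (right_grid n (T w)) w)) \<longlonglongrightarrow> indicator B w * ennreal (Y (T w) w)"
  proof (intro AE_I2 ennreal_tendsto_cmult tendsto_intros)
   fix w assume "w \<in> space M"
   from right_grid_tendsto[OF cadlag_right[OF cadlag_Y[OF this] T0] T0]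
   show "(\<lambda>n. Y (right_grid n (T w)) w) \<longlonglongrightarrow> Y (T w) w" .
  qed (simp add: indicator_def)
  show "(\<integral>\<^sup>+w. ennreal A\<^sub>0 * ennreal (sup_exp_C (real N + 1) w) \<partial>M) < \<infinity>"
   using sup_exp_C_finite[of "real N + 1"] sup_exp_C_measurable[of "real N + 1"]
   by (simp add: nn_integral_cmult ennreal_mult_less_top)
 qed (use sup_exp_C_measurable[of "real N + 1"] in measurable)
 have "(\<integral>\<^sup>+w. indicator B w * H (T w) w \<partial>M) = (\<integral>\<^sup>+w. indicator B w * ennreal (Y (T w) w) \<partial>M)"
 proof (rule antisym)
  have "(\<integral>\<^sup>+w. indicator B w * H (T w) w \<partial>M) <= (\<integral>\<^sup>+w. liminf (\<lambda>n. indicator B w * H (right_grid n (T w)) w) \<partial>M)"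
   using H_right_limit[OF _ T0] by (intro nn_integral_mono) (auto simp: indicator_def)
  also have "... <= liminf ?EH" by (rule nn_integral_liminf) measurable
  also have "liminf ?EH = (\<integral>\<^sup>+w. indicator B w * ennreal (Y (T w) w) \<partial>M)"
   unfolding eq by (rule lim_imp_Liminf[OF _ lim]) simp
  finally show "(\<integral>\<^sup>+w. indicator B w * H (T w) w \<partial>M) <= (\<integral>\<^sup>+w. indicator B w * ennreal (Y (T w) w) \<partial>M)" .
  show "(\<integral>\<^sup>+w. indicator B w * ennreal (Y (T w) w) \<partial>M) <= (\<integral>\<^sup>+w. indicator B w * H (T w) w \<partial>M)"
  proof (rule LIMSEQ_le_const2[OF lim], intro exI allI impI)
   fix n
   show "?EY n <= (\<integral>\<^sup>+w. indicator B w * H (T w) w \<partial>M)"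
    unfolding eq[symmetric]
    by (intro nn_integral_mono mult_left_mono H_antimono less_imp_le[OF right_grid_bounds(1)[OF T0]]) simp
  qed
 qed
 then show ?thesis by (simp add: T_def)
qed

text \<open>Cutting along the integer part of \<tau> reduces to bounded stopping times. Where \<tau>
  is infinite, both sides carry the default value 0 of \<open>stopped_value\<close>.\<close>

lemma stopped_markov:
 assumes \<tau>: "stopping_time F \<tau>" and B: "B \<in> sets (X.pre_sigma \<tau>)"
 shows "(\<integral>\<^sup>+w. indicator B w * stopped_value H \<tau> w \<partial>M) = (\<integral>\<^sup>+w. indicator B w * ennreal (stopped_value Y \<tau> w) \<partial>M)"
proof -
 define A where "A N = {w \<in> B. \<tau> w < \<top> \<and> nat \<lfloor>enn2real (\<tau> w)\<rfloor> = N}" for N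
 have [measurable]: "\<tau> \<in> Borel (X.pre_sigma \<tau>)" by (rule X.measurable_stopping_time_pre_sigma[OF \<tau>])
 have BM: "B \<in> sets M" if "B \<in> sets (X.pre_sigma \<tau>)" for B
  using X.sets_pre_sigmaD[OF \<tau> that, of \<top>] X.subalg by (auto simp: subalgebra_def)
 have AB: "A N \<in> sets (X.pre_sigma \<tau>)" for N
 proof -
  have "A N = B \<inter> {w \<in> space (X.pre_sigma \<tau>). \<tau> w < \<top> \<and> nat \<lfloor>enn2real (\<tau> w)\<rfloor> = N}"
   using sets.sets_into_space[OF B] by (auto simp: A_def)
  also have "... \<in> sets (X.pre_sigma \<tau>)" using B by measurable
  finally show ?thesis .
 qed
 have AM: "A N \<in> sets M" for N using BM[OF AB] .
 have le: "\<tau> w <= ennreal (real (Suc N))" if "w \<in> A N" for w N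
 proof -
  have "\<tau> w \<noteq> \<top>" using that by (auto simp: A_def)
  then obtain v where v: "\<tau> w = ennreal v" "0 <= v" by (cases "\<tau> w") auto
  then have "v <= real (Suc N)" using that by (simp add: A_def nat_eq_iff floor_eq_iff)
  then show ?thesis using v by (simp add: ennreal_leI del: of_nat_Suc)
 qed
 have dec: "(\<integral>\<^sup>+w. indicator B w * (if \<tau> w < \<top> then f (enn2real (\<tau> w)) w else 0) \<partial>M)
   = (\<Sum>N. \<integral>\<^sup>+w. indicator (A N) w * f (enn2real (\<tau> w)) w \<partial>M)"
  if f: "(\<lambda>w. f (enn2real (\<tau> w)) w) \<in> Borel M" for f :: "real => 'a => ennreal"
 proof -
  have "indicator B w * (if \<tau> w < \<top> then f (enn2real (\<tau> w)) w else 0) = (\<Sum>N. indicator (A N) w * f (enn2real (\<tau> w)) w)" for w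
  proof -
   have "(\<Sum>N. indicator (A N) w * f (enn2real (\<tau> w)) w)
     = (\<Sum>N. if nat \<lfloor>enn2real (\<tau> w)\<rfloor> = N then indicator B w * (if \<tau> w < \<top> then f (enn2real (\<tau> w)) w else 0) else 0)"
    by (intro suminf_cong) (simp add: A_def indicator_def)
   then show ?thesis by (simp add: suminf_single)
  qed
  then have "(\<integral>\<^sup>+w. indicator B w * (if \<tau> w < \<top> then f (enn2real (\<tau> w)) w else 0) \<partial>M)
    = (\<integral>\<^sup>+w. (\<Sum>N. indicator (A N) w * f (enn2real (\<tau> w)) w) \<partial>M)"
   by (simp only:)
  also have "... = (\<Sum>N. \<integral>\<^sup>+w. indicator (A N) w * f (enn2real (\<tau> w)) w \<partial>M)"
   using f AM by (intro nn_integral_suminf) auto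
  finally show ?thesis .
 qed
 have \<tau>M [measurable]: "\<tau> \<in> Borel M"
  using X.subalg by (intro measurable_stopping_time[OF \<tau>]) (auto simp: subalgebra_def)
 have "(\<lambda>w. (\<lambda>p. Y (max 0 (snd p)) (fst p)) (w, enn2real (\<tau> w))) \<in> Borel M"
  by (rule measurable_compose[OF _ X.adapted_process_measurable[OF adapted_Y cadlag_Y]]) auto
 then have Ym: "(\<lambda>w. ennreal (Y (enn2real (\<tau> w)) w)) \<in> Borel M" by (simp add: max_absorb2)
 have Hm: "(\<lambda>w. H (enn2real (\<tau> w)) w) \<in> Borel M" by measurable
 have Ys: "ennreal (stopped_value Y \<tau> w) = (if \<tau> w < \<top> then ennreal (Y (enn2real (\<tau> w)) w) else 0)" for w
  by (simp add: stopped_value_def)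
 show ?thesis
  unfolding Ys stopped_value_def[of H] dec[of H, OF Hm] dec[of "\<lambda>t w. ennreal (Y t w)", OF Ym]
  using bounded_stopped_markov[OF \<tau> AB le] by simp
qed

text \<open>A right continuous nondecreasing process \<open>c\<close> is split into its levels \<open>y\<close>, each of which is reached at a
 stopping time: \<open>\<integral> h(t) c(t) dt\<close> and \<open>\<integral> f dc\<close> both become integrals over \<open>y\<close>.\<close>

definition reach_time :: "(real => 'a => real) => real => 'a => ennreal" where
 "reach_time c y w = (if \<exists>t\<ge>0. y <= c t w then ennreal (first_reach (\<lambda>t. c t w) y) else \<top>)"

end

section \<open>Contribution processes and the stopping times of their levels\<close>

locale contribution = discounted_levy_pair +
 fixes c :: "real => 'a => real"
 assumes path: "\<And>w. w \<in> space M ==> nondecreasing_path (\<lambda>t. c t w)" and c_adapted: "adapted F c"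
begin

lemma reach_time_le_iff:
 assumes w: "w \<in> space M" and t: "0 <= t"
 shows "reach_time c y w <= ennreal t \<longleftrightarrow> y <= c t w"
 using nondecreasing_path.first_reach_le_iff[OF path[OF w] _ t, of y] t
 by (auto simp: reach_time_def top_unique)

lemma reach_time_finite:
 "\<exists>t\<ge>0. y <= c t w ==> w \<in> space M ==> enn2real (reach_time c y w) = first_reach (\<lambda>t. c t w) y \<and> reach_time c y w < \<top>"
 using nondecreasing_path.first_reach_nonneg[OF path, of w y] by (simp add: reach_time_def)

lemma stopping_time_reach: "stopping_time F (reach_time c y)"
proof (rule stopping_timeI)
 fix t
 show "Measurable.pred (F t) (\<lambda>w. reach_time c y w <= t)"
 proof (cases t)
  case (real u)
  have [measurable]: "c u \<in> Borel (F (ennreal u))"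
   using c_adapted real by (simp add: adapted_def)
  have "Measurable.pred (F (ennreal u)) (\<lambda>w. y <= c u w)" by measurable
  moreover have "Measurable.pred (F (ennreal u)) (\<lambda>w. reach_time c y w <= ennreal u) \<longleftrightarrow> Measurable.pred (F (ennreal u)) (\<lambda>w. y <= c u w)"
   using real by (intro measurable_cong) (simp add: X.space_F reach_time_le_iff)
  ultimately show ?thesis using real by simp
 qed simp
qed

lemma reach_time_measurable: "(\<lambda>p. reach_time c (snd p) (fst p)) \<in> Borel (M \<Otimes>\<^sub>M lborel)"
proof (rule borel_measurableI_le)
 fix t
 show "{p \<in> space (M \<Otimes>\<^sub>M lborel). reach_time c (snd p) (fst p) <= t} \<in> sets (M \<Otimes>\<^sub>M lborel)"
 proof (cases t)
  case (real u)
  have [measurable]: "c u \<in> Borel M"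
   using X.adaptedD[OF c_adapted] real by simp
  have "{p \<in> space (M \<Otimes>\<^sub>M lborel). reach_time c (snd p) (fst p) <= t} = {p \<in> space (M \<Otimes>\<^sub>M lborel). snd p <= c u (fst p)}"
   using real by (auto simp: space_pair_measure reach_time_le_iff)
  also have "... \<in> sets (M \<Otimes>\<^sub>M lborel)" by measurable
  finally show ?thesis .
 next
  case top
  show ?thesis unfolding top by (simp only: top_greatest simp_thms Collect_mem_eq sets.top)
 qed
qed

text \<open>Layer cake: \<open>c t w\<close> is the measure of the levels reached by time
  \<open>t\<close>. After exchanging the integrals, the times at which a level has been reached form
  a half-line starting at its reach time.\<close>

lemma level_H:
 assumes w: "w \<in> space M"
 shows "(\<integral>\<^sup>+t\<in>{0..}. ennreal (exp (- r * t - a * X (max 0 t) w + R (max 0 t) w)) * ennreal (c t w) \<partial>lborel)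
  = (\<integral>\<^sup>+y\<in>{0<..}. stopped_value H (reach_time c y) w \<partial>lborel)"
proof -
 interpret c: nondecreasing_path "\<lambda>t. c t w" by (rule path[OF w])
 let ?h = "\<lambda>t. ennreal (exp (- r * t - a * X (max 0 t) w + R (max 0 t) w))"
 have h [measurable]: "?h \<in> Borel lborel" using w by measurable
 have "mono (\<lambda>t. c (max 0 t) w)" by (auto simp: mono_def intro!: c.le)
 then have cm [measurable]: "(\<lambda>t. c (max 0 t) w) \<in> Borel borel" by (rule borel_measurable_mono)
 have m: "(\<lambda>(t, y). ?h t * indicator {0..} t * (if 0 < y \<and> y <= c (max 0 t) w then 1 else 0)) \<in> Borel (lborel \<Otimes>\<^sub>M lborel)"
  by measurable
 have "(\<integral>\<^sup>+t\<in>{0..}. ?h t * ennreal (c t w) \<partial>lborel)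
   = (\<integral>\<^sup>+t. \<integral>\<^sup>+y. ?h t * indicator {0..} t * (if 0 < y \<and> y <= c (max 0 t) w then 1 else 0) \<partial>lborel \<partial>lborel)"
 proof (rule nn_integral_cong)
  fix t :: real
  show "?h t * ennreal (c t w) * indicator {0..} t
   = (\<integral>\<^sup>+y. ?h t * indicator {0..} t * (if 0 < y \<and> y <= c (max 0 t) w then 1 else 0) \<partial>lborel)"
  proof (cases "0 <= t")
   case True
   have "(\<integral>\<^sup>+y. ?h t * indicator {0..} t * (if 0 < y \<and> y <= c (max 0 t) w then 1 else 0) \<partial>lborel)
     = (\<integral>\<^sup>+y. ?h t * indicator {0<..c t w} y \<partial>lborel)"
    using True by (intro nn_integral_cong) (auto simp: indicator_def max_absorb2)
   also have "... = ?h t * ennreal (c t w)"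
    using c.nonneg[OF True] by (simp add: nn_integral_cmult_indicator)
   finally show ?thesis using True by simp
  qed simp
 qed
 also have "... = (\<integral>\<^sup>+y. \<integral>\<^sup>+t. ?h t * indicator {0..} t * (if 0 < y \<and> y <= c (max 0 t) w then 1 else 0) \<partial>lborel \<partial>lborel)"
  by (rule lborel_pair.Fubini'[OF m, symmetric])
 also have "... = (\<integral>\<^sup>+y\<in>{0<..}. stopped_value H (reach_time c y) w \<partial>lborel)"
 proof (rule nn_integral_cong)
  fix y :: real
  show "(\<integral>\<^sup>+t. ?h t * indicator {0..} t * (if 0 < y \<and> y <= c (max 0 t) w then 1 else 0) \<partial>lborel)
   = stopped_value H (reach_time c y) w * indicator {0<..} y"
  proof (cases "0 < y \<and> (\<exists>s\<ge>0. y <= c s w)")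
   case True
   then have ex: "\<exists>s\<ge>0. y <= c s w" by blast
   have "?h t * indicator {0..} t * (if 0 < y \<and> y <= c (max 0 t) w then 1 else 0) = ?h t * indicator {first_reach (\<lambda>t. c t w) y..} t" for t
    using c.first_reach_le_iff[OF ex, of t] c.first_reach_nonneg[OF ex] True
    by (auto simp: indicator_def max_absorb2)
   then show ?thesis
    using reach_time_finite[OF ex w] True by (simp add: stopped_value_def H_def)
  next
   case False
   then have "?h t * indicator {0..} t * (if 0 < y \<and> y <= c (max 0 t) w then 1 else 0) = 0" for t
    by (auto simp: indicator_def max_absorb2)
   then have 0: "(\<integral>\<^sup>+t. ?h t * indicator {0..} t * (if 0 < y \<and> y <= c (max 0 t) w then 1 else 0) \<partial>lborel) = 0"
    by (simp only: nn_integral_const) simp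
   show ?thesis
    unfolding 0 using False by (auto simp: stopped_value_def reach_time_def indicator_def)
  qed
 qed
 finally show ?thesis .
qed

lemma stieltjes_eq:
 assumes w: "w \<in> space M"
 shows "stieltjes c w = interval_measure (nondecreasing_path.ext (\<lambda>t. c t w))"
 unfolding stieltjes_def nondecreasing_path.ext_def[OF path[OF w], abs_def] ..

lemma level_stieltjes:
 assumes w: "w \<in> space M" and f: "cadlag (\<lambda>t. f t w)"
 shows "(\<integral>\<^sup>+t\<in>{0..}. ennreal (f t w) \<partial>stieltjes c w) = (\<integral>\<^sup>+y\<in>{0<..}. ennreal (stopped_value f (reach_time c y) w) \<partial>lborel)"
proof -
 interpret c: nondecreasing_path "\<lambda>t. c t w" by (rule path[OF w])
 \<comment> \<open>A single path is viewed as a process on a one-point space, so that the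
   measurability of right continuous processes applies to it.\<close>
 have "(\<lambda>t. f (max 0 t) w) \<in> Borel borel"
  using right_continuous_process_measurable[of "\<lambda>t _. f t w" "count_space {()}", THEN measurable_compose[rotated], of "\<lambda>t. ((), t)" borel]
   cadlag_right[OF f] by (simp add: measurable_Pair)
 then have "(\<lambda>t. ennreal (f (max 0 t) w) * indicator {0..} t) \<in> Borel borel" by measurable
 also have "(\<lambda>t. ennreal (f (max 0 t) w) * indicator {0..} t) = (\<lambda>t. ennreal (f t w) * indicator {0..} t)"
  by (auto simp: indicator_def max_absorb2 fun_eq_iff)
 finally have m: "(\<lambda>t. ennreal (f t w) * indicator {0..} t) \<in> Borel borel" .
 have "(\<integral>\<^sup>+t\<in>{0..}. ennreal (f t w) \<partial>stieltjes c w)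
   = (\<integral>\<^sup>+y. (if y \<in> c.levels then ennreal (f (first_reach (\<lambda>t. c t w) y) w) else 0) \<partial>lborel)"
  unfolding stieltjes_eq[OF w] by (rule c.nn_integral_ext[OF m])
 also have "... = (\<integral>\<^sup>+y\<in>{0<..}. ennreal (stopped_value f (reach_time c y) w) \<partial>lborel)"
 proof (rule nn_integral_cong)
  fix y
  show "(if y \<in> c.levels then ennreal (f (first_reach (\<lambda>t. c t w) y) w) else 0) = ennreal (stopped_value f (reach_time c y) w) * indicator {0<..} y"
   using reach_time_finite[OF _ w, of y]
   by (cases "\<exists>s\<ge>0. y <= c s w") (auto simp: c.levels_def stopped_value_def reach_time_def[of c y w] indicator_def)
 qed
 finally show ?thesis .
qed

lemma stopped_measurable:
 "(\<lambda>(w, y). stopped_value H (reach_time c y) w * indicator {0<..} y) \<in> Borel (M \<Otimes>\<^sub>M lborel)"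
 "adapted F f ==> (\<And>w. w \<in> space M ==> cadlag (\<lambda>t. f t w)) ==>
  (\<lambda>(w, y). ennreal (stopped_value f (reach_time c y) w) * indicator {0<..} y) \<in> Borel (M \<Otimes>\<^sub>M lborel)"
proof -
 note [measurable] = reach_time_measurable
 show "(\<lambda>(w, y). stopped_value H (reach_time c y) w * indicator {0<..} y) \<in> Borel (M \<Otimes>\<^sub>M lborel)"
  unfolding stopped_value_def case_prod_unfold by measurable
 assume f: "adapted F f" "\<And>w. w \<in> space M ==> cadlag (\<lambda>t. f t w)"
 have "(\<lambda>p. (\<lambda>p. f (max 0 (snd p)) (fst p)) (fst p, enn2real (reach_time c (snd p) (fst p)))) \<in> Borel (M \<Otimes>\<^sub>M lborel)"
  by (rule measurable_compose[OF _ X.adapted_process_measurable[OF f]]) auto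
 then have [measurable]: "(\<lambda>p. f (enn2real (reach_time c (snd p) (fst p))) (fst p)) \<in> Borel (M \<Otimes>\<^sub>M lborel)"
  by (simp add: max_absorb2)
 show "(\<lambda>(w, y). ennreal (stopped_value f (reach_time c y) w) * indicator {0<..} y) \<in> Borel (M \<Otimes>\<^sub>M lborel)"
  unfolding stopped_value_def case_prod_unfold by measurable
qed

lemma stieltjes_measurable:
 assumes "adapted F f" "\<And>w. w \<in> space M ==> cadlag (\<lambda>t. f t w)"
 shows "(\<lambda>w. \<integral>\<^sup>+t\<in>{0..}. ennreal (f t w) \<partial>stieltjes c w) \<in> Borel M"
proof -
 have "(\<lambda>w. \<integral>\<^sup>+y. ennreal (stopped_value f (reach_time c y) w) * indicator {0<..} y \<partial>lborel) \<in> Borel M"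
  using lborel.borel_measurable_nn_integral_fst[OF stopped_measurable(2)[OF assms]] by simp
 then show ?thesis
  by (subst measurable_cong[OF level_stieltjes]) (auto intro: assms)
qed

text \<open>Level by level, the strong Markov property at the reach time replaces the future
  integral \<open>H\<close> by \<open>Y\<close>. Thus the marginal value of a contribution becomes
  linear in its increments.\<close>

lemma value_eq_stieltjes_Y:
 "(\<integral>\<^sup>+w. (\<integral>\<^sup>+t\<in>{0..}. ennreal (exp (- r * t - a * X (max 0 t) w + R (max 0 t) w)) * ennreal (c t w) \<partial>lborel) \<partial>M)
  = (\<integral>\<^sup>+w. (\<integral>\<^sup>+t\<in>{0..}. ennreal (Y t w) \<partial>stieltjes c w) \<partial>M)"
proof -
 interpret P: pair_sigma_finite M lborel
  by (intro pair_sigma_finite.intro X.sigma_finite_measure_axioms sigma_finite_lborel)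
 have top: "space M \<in> sets (X.pre_sigma \<tau>)" for \<tau>
  using sets.top[of "X.pre_sigma \<tau>"] by (simp add: X.space_pre_sigma)
 have proj: "(\<integral>\<^sup>+w. stopped_value H (reach_time c y) w \<partial>M) = (\<integral>\<^sup>+w. ennreal (stopped_value Y (reach_time c y) w) \<partial>M)" for y
  using stopped_markov[OF stopping_time_reach top, of y] by (simp cong: nn_integral_cong)
 have "(\<integral>\<^sup>+w. (\<integral>\<^sup>+t\<in>{0..}. ennreal (exp (- r * t - a * X (max 0 t) w + R (max 0 t) w)) * ennreal (c t w) \<partial>lborel) \<partial>M)
   = (\<integral>\<^sup>+w. \<integral>\<^sup>+y. stopped_value H (reach_time c y) w * indicator {0<..} y \<partial>lborel \<partial>M)"
  by (intro nn_integral_cong level_H)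
 also have "... = (\<integral>\<^sup>+y. \<integral>\<^sup>+w. stopped_value H (reach_time c y) w * indicator {0<..} y \<partial>M \<partial>lborel)"
  by (rule P.Fubini'[OF stopped_measurable(1), symmetric])
 also have "... = (\<integral>\<^sup>+y. \<integral>\<^sup>+w. ennreal (stopped_value Y (reach_time c y) w) * indicator {0<..} y \<partial>M \<partial>lborel)"
 proof (rule nn_integral_cong)
  fix y :: real
  show "(\<integral>\<^sup>+w. stopped_value H (reach_time c y) w * indicator {0<..} y \<partial>M)
   = (\<integral>\<^sup>+w. ennreal (stopped_value Y (reach_time c y) w) * indicator {0<..} y \<partial>M)"
   using proj[of y] by (cases "0 < y") auto
 qed
 also have "... = (\<integral>\<^sup>+w. \<integral>\<^sup>+y. ennreal (stopped_value Y (reach_time c y) w) * indicator {0<..} y \<partial>lborel \<partial>M)"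
  by (rule P.Fubini'[OF stopped_measurable(2)[OF adapted_Y cadlag_Y]])
 also have "... = (\<integral>\<^sup>+w. (\<integral>\<^sup>+t\<in>{0..}. ennreal (Y t w) \<partial>stieltjes c w) \<partial>M)"
  by (intro nn_integral_cong level_stieltjes[symmetric] cadlag_Y)
 finally show ?thesis .
qed

text \<open>Together with \<open>value_eq_stieltjes_Y\<close>, this prices an arbitrary
  contribution: its marginal value is at most \<open>A\<^sub>0\<close> times its cost.\<close>

lemma stieltjes_Y_le:
 "(\<integral>\<^sup>+w. (\<integral>\<^sup>+t\<in>{0..}. ennreal (Y t w) \<partial>stieltjes c w) \<partial>M)
  <= ennreal A\<^sub>0 * (\<integral>\<^sup>+w. (\<integral>\<^sup>+t\<in>{0..}. ennreal (exp (- r * t + C t w)) \<partial>stieltjes c w) \<partial>M)"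
proof -
 have ad: "adapted F (\<lambda>t w. exp (- r * t + C t w))"
  unfolding adapted_def
 proof (intro allI impI)
  fix t :: real assume "0 <= t"
  then have [measurable]: "C t \<in> Borel (F (ennreal t))" using adapted_C by (auto simp: adapted_def)
  show "(\<lambda>w. exp (- r * t + C t w)) \<in> Borel (F (ennreal t))" by measurable
 qed
 have cad: "cadlag (\<lambda>t. exp (- r * t + C t w))" if "w \<in> space M" for w
 proof -
  have "cadlag (\<lambda>t. - r * t)" by (intro cadlag_continuous_on continuous_intros)
  from cadlag_add[OF this C.Z_cadlag[OF that]] show ?thesis by (rule cadlag_exp)
 qed
 have "(\<integral>\<^sup>+t\<in>{0..}. ennreal (Y t w) \<partial>stieltjes c w) <= ennreal A\<^sub>0 * (\<integral>\<^sup>+t\<in>{0..}. ennreal (exp (- r * t + C t w)) \<partial>stieltjes c w)"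
  if w: "w \<in> space M" for w
 proof -
  have "(\<integral>\<^sup>+t\<in>{0..}. ennreal (Y t w) \<partial>stieltjes c w) <= (\<integral>\<^sup>+y. ennreal A\<^sub>0 * (ennreal (stopped_value (\<lambda>t w. exp (- r * t + C t w)) (reach_time c y) w) * indicator {0<..} y) \<partial>lborel)"
   unfolding level_stieltjes[of w Y, OF w cadlag_Y[OF w]]
  proof (rule nn_integral_mono)
   fix y
   show "ennreal (stopped_value Y (reach_time c y) w) * indicator {0<..} y
    <= ennreal A\<^sub>0 * (ennreal (stopped_value (\<lambda>t w. exp (- r * t + C t w)) (reach_time c y) w) * indicator {0<..} y)"
    using ennreal_leI[OF Y_le[of "enn2real (reach_time c y w)" w]] A0_pos
    by (auto simp: indicator_def stopped_value_def ennreal_mult)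
  qed
  also have "... = ennreal A\<^sub>0 * (\<integral>\<^sup>+y\<in>{0<..}. ennreal (stopped_value (\<lambda>t w. exp (- r * t + C t w)) (reach_time c y) w) \<partial>lborel)"
   using measurable_compose_Pair1[OF w stopped_measurable(2)[OF ad cad]]
   by (intro nn_integral_cmult) auto
  finally show ?thesis unfolding level_stieltjes[of w "\<lambda>t w. exp (- r * t + C t w)", OF w cad[OF w]] .
 qed
 then have "(\<integral>\<^sup>+w. (\<integral>\<^sup>+t\<in>{0..}. ennreal (Y t w) \<partial>stieltjes c w) \<partial>M)
   <= (\<integral>\<^sup>+w. ennreal A\<^sub>0 * (\<integral>\<^sup>+t\<in>{0..}. ennreal (exp (- r * t + C t w)) \<partial>stieltjes c w) \<partial>M)"
  by (rule nn_integral_mono)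
 also have "... = ennreal A\<^sub>0 * (\<integral>\<^sup>+w. (\<integral>\<^sup>+t\<in>{0..}. ennreal (exp (- r * t + C t w)) \<partial>stieltjes c w) \<partial>M)"
  by (rule nn_integral_cmult[OF stieltjes_measurable[OF ad cad]])
 finally show ?thesis .
qed

end

section \<open>Time reversal\<close>

lemma filterlim_reflect:
 fixes v s :: real
 shows "filterlim (\<lambda>s. v - s) (at_left (v - s)) (at_right s)"
  and "filterlim (\<lambda>s. v - s) (at_right (v - s)) (at_left s)"
 unfolding filterlim_at
proof safe
 show "((\<lambda>s. v - s) \<longlongrightarrow> v - s) (at_right s)" "((\<lambda>s. v - s) \<longlongrightarrow> v - s) (at_left s)"
  by (intro tendsto_intros)+
 show "eventually (\<lambda>x. v - x \<in> {..<v - s} \<and> v - x \<noteq> v - s) (at_right s)"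
  using eventually_at_right_less[of s] by eventually_elim simp
 show "eventually (\<lambda>x. v - x \<in> {v - s<..} \<and> v - x \<noteq> v - s) (at_left s)"
  unfolding eventually_at_left_field by (intro exI[of _ "s - 1"]) simp
qed

lemma (in prob_space) indep_var_nn_integral:
 assumes ind: "indep_var S U T V" and f: "f \<in> Borel (S \<Otimes>\<^sub>M T)"
 shows "(\<integral>\<^sup>+w. f (U w, V w) \<partial>M) = (\<integral>\<^sup>+w'. \<integral>\<^sup>+w. f (U w, V w') \<partial>M \<partial>M)"
proof -
 have U [measurable]: "U \<in> M \<rightarrow>\<^sub>M S" and V [measurable]: "V \<in> M \<rightarrow>\<^sub>M T"
  and eq: "distr M S U \<Otimes>\<^sub>M distr M T V = distr M (S \<Otimes>\<^sub>M T) (\<lambda>w. (U w, V w))"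
  using ind unfolding indep_var_distribution_eq by auto
 note [measurable] = f
 interpret U: prob_space "distr M S U" by (rule prob_space_distr) fact
 interpret V: prob_space "distr M T V" by (rule prob_space_distr) fact
 interpret P: pair_prob_space "distr M S U" "distr M T V" ..
 have "(\<integral>\<^sup>+w. f (U w, V w) \<partial>M) = (\<integral>\<^sup>+p. f p \<partial>(distr M S U \<Otimes>\<^sub>M distr M T V))"
  unfolding eq by (subst nn_integral_distr) auto
 also have "... = (\<integral>\<^sup>+v. \<integral>\<^sup>+u. f (u, v) \<partial>distr M S U \<partial>distr M T V)"
  by (subst P.nn_integral_snd[symmetric]) auto
 also have "... = (\<integral>\<^sup>+w'. \<integral>\<^sup>+w. f (U w, V w') \<partial>M \<partial>M)"
 proof -
  have "(\<lambda>p. f (snd p, fst p)) \<in> Borel (T \<Otimes>\<^sub>M distr M S U)" by measurable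
  then have "(\<lambda>v. \<integral>\<^sup>+u. f (u, v) \<partial>distr M S U) \<in> Borel T"
   using U.borel_measurable_nn_integral_fst[of "\<lambda>p. f (snd p, fst p)" T] by simp
  then have "(\<integral>\<^sup>+v. \<integral>\<^sup>+u. f (u, v) \<partial>distr M S U \<partial>distr M T V) = (\<integral>\<^sup>+w'. \<integral>\<^sup>+u. f (u, V w') \<partial>distr M S U \<partial>M)"
   by (intro nn_integral_distr[OF V]) simp
  also have "... = (\<integral>\<^sup>+w'. \<integral>\<^sup>+w. f (U w, V w') \<partial>M \<partial>M)"
  proof (rule nn_integral_cong)
   fix w' assume "w' \<in> space M"
   then have "(\<lambda>u. f (u, V w')) \<in> Borel S"
    by (intro measurable_compose[OF measurable_Pair2' f] measurable_space[OF V])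
   then show "(\<integral>\<^sup>+u. f (u, V w') \<partial>distr M S U) = (\<integral>\<^sup>+w. f (U w, V w') \<partial>M)"
    by (intro nn_integral_distr[OF U]) simp
  qed
  finally show ?thesis .
 qed
 finally show ?thesis .
qed

context levy
begin

definition increments :: "real => nat => 'a => nat => real" where
 "increments h m w = (\<lambda>k\<in>{..<m}. Z (real (Suc k) * h) w - Z (real k * h) w)"

lemma increments_measurable:
 assumes "0 <= h"
 shows "increments h m \<in> M \<rightarrow>\<^sub>M Pi\<^sub>M {..<m} (\<lambda>_. borel)"
 unfolding increments_def using assms by (intro measurable_restrict borel_measurable_diff Z_M) auto

text \<open>Induction on the number of increments: an event about the first \<open>n\<close> of them
  is known at time \<open>n * h\<close>, hence independent of the next one.\<close>

lemma distr_increments: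
 assumes h: "0 <= h"
 shows "distr M (Pi\<^sub>M {..<m} (\<lambda>_. borel)) (increments h m) = Pi\<^sub>M {..<m} (\<lambda>_. distr M borel (Z h))"
proof -
 have Zh [measurable]: "Z h \<in> Borel M" using h by simp
 interpret \<mu>: prob_space "distr M borel (Z h)" by (rule prob_space_distr) fact
 interpret PS: product_sigma_finite "\<lambda>_::nat. distr M borel (Z h)"
  by (intro product_sigma_finite.intro) (rule \<mu>.sigma_finite_measure_axioms)
 show ?thesis
 proof (rule PS.PiM_eqI)
  show "sets (distr M (Pi\<^sub>M {..<m} (\<lambda>_. borel)) (increments h m)) = sets (Pi\<^sub>M {..<m} (\<lambda>_. distr M borel (Z h)))"
   by (simp cong: sets_PiM_cong)
  fix A :: "nat => real set" assume "\<And>i. i \<in> {..<m} ==> A i \<in> sets (distr M borel (Z h))"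
  then have A: "A i \<in> sets borel" if "i < m" for i using that by simp
  have "measure M {w \<in> space M. \<forall>k<n. Z (real (Suc k) * h) w - Z (real k * h) w \<in> A k} = (\<Prod>k<n. measure M (Z h -` A k \<inter> space M))
    \<and> {w \<in> space M. \<forall>k<n. Z (real (Suc k) * h) w - Z (real k * h) w \<in> A k} \<in> sets (F (ennreal (real n * h)))" if "n <= m" for n
   using that
  proof (induction n)
   case 0
   then show ?case using sets.top[of "F 0"] by (simp add: space_F prob_space)
  next
   case (Suc n)
   let ?B = "\<lambda>n. {w \<in> space M. \<forall>k<n. Z (real (Suc k) * h) w - Z (real k * h) w \<in> A k}"
   let ?D = "\<lambda>w. Z (real n * h + h) w - Z (real n * h) w"
   have t: "0 <= real n * h" "real n * h + h = real (Suc n) * h" using h by (auto simp: algebra_simps)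
   have An: "A n \<in> sets borel" using A Suc.prems by simp
   have B: "?B (Suc n) = ?B n \<inter> (?D -` A n \<inter> space M)"
    by (auto simp: t(2) less_Suc_eq simp del: of_nat_Suc)
   have DA: "?D -` A n \<inter> space M \<in> {?D -` A \<inter> space M | A. A \<in> sets borel}" using An by blast
   have "n <= m" using Suc.prems by simp
   note IH = conjunct1[OF Suc.IH[OF this]] conjunct2[OF Suc.IH[OF this]]
   have "measure M (?B (Suc n)) = measure M (?B n) * measure M (?D -` A n \<inter> space M)"
    unfolding B by (rule indep_setD[OF increment_indep[OF t(1) h] IH(2) DA])
   also have "measure M (?D -` A n \<inter> space M) = measure M (Z h -` A n \<inter> space M)"
    using measure_distr[of ?D M borel "A n"] measure_distr[of "Z h" M borel "A n"] increment_distr[OF t(1) h] An t h by simp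
   finally have 1: "measure M (?B (Suc n)) = (\<Prod>k<Suc n. measure M (Z h -` A k \<inter> space M))"
    using IH(1) by simp
   have [measurable]: "Z (real n * h + h) \<in> Borel (F (ennreal (real (Suc n) * h)))"
    "Z (real n * h) \<in> Borel (F (ennreal (real (Suc n) * h)))"
    using t h by (intro Z_F; linarith)+
   have D: "?D -` A n \<inter> space (F (ennreal (real (Suc n) * h))) \<in> sets (F (ennreal (real (Suc n) * h)))"
    by (rule measurable_sets[OF _ An]) measurable
   have le: "ennreal (real n * h) <= ennreal (real (Suc n) * h)" using t h by (intro ennreal_leI) linarith
   have 2: "?B (Suc n) \<in> sets (F (ennreal (real (Suc n) * h)))"
    unfolding B by (rule sets.Int[OF subsetD[OF sets_F_mono[OF le] IH(2)] D[unfolded space_F]])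
   show ?case using 1 2 by blast
  qed
  then have m: "measure M {w \<in> space M. \<forall>k<m. Z (real (Suc k) * h) w - Z (real k * h) w \<in> A k} = (\<Prod>k<m. measure M (Z h -` A k \<inter> space M))" by blast
  have "emeasure (distr M (Pi\<^sub>M {..<m} (\<lambda>_. borel)) (increments h m)) (Pi\<^sub>E {..<m} A)
    = emeasure M (increments h m -` Pi\<^sub>E {..<m} A \<inter> space M)"
   using A by (intro emeasure_distr increments_measurable h sets_PiM_I_finite) auto
  also have "increments h m -` Pi\<^sub>E {..<m} A \<inter> space M = {w \<in> space M. \<forall>k<m. Z (real (Suc k) * h) w - Z (real k * h) w \<in> A k}"
   unfolding increments_def vimage_def restrict_PiE_iff lessThan_iff Ball_def by blast
  also have "emeasure M ... = (\<Prod>k<m. emeasure M (Z h -` A k \<inter> space M))"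
   by (simp add: emeasure_eq_measure m prod_ennreal del: of_nat_Suc)
  also have "... = (\<Prod>i\<in>{..<m}. emeasure (distr M borel (Z h)) (A i))"
   using A by (intro prod.cong refl) (simp add: emeasure_distr)
  finally show "emeasure (distr M (Pi\<^sub>M {..<m} (\<lambda>_. borel)) (increments h m)) (Pi\<^sub>E {..<m} A)
    = (\<Prod>i\<in>{..<m}. emeasure (distr M borel (Z h)) (A i))" .
 qed simp
qed

text \<open>A product measure with equal factors is invariant under permutations of the
  coordinates.\<close>

lemma increments_reverse:
 assumes h: "0 <= h" and f: "f \<in> Borel (Pi\<^sub>M {..<m} (\<lambda>_. borel))"
 shows "(\<integral>\<^sup>+w. f (increments h m w) \<partial>M) = (\<integral>\<^sup>+w. f (\<lambda>k\<in>{..<m}. increments h m w (m - 1 - k)) \<partial>M)"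
proof -
 have Zh [measurable]: "Z h \<in> Borel M" using h by simp
 interpret \<mu>: prob_space "distr M borel (Z h)" by (rule prob_space_distr) fact
 let ?P = "Pi\<^sub>M {..<m} (\<lambda>_. distr M borel (Z h))"
 let ?rev = "\<lambda>u. \<lambda>k\<in>{..<m}. u (m - 1 - k) :: real"
 have sets: "sets ?P = sets (Pi\<^sub>M {..<m} (\<lambda>_. borel))" by (simp cong: sets_PiM_cong)
 have fP: "f \<in> Borel ?P" using f by (simp cong: measurable_cong_sets add: sets)
 have "distr ?P ?P ?rev = ?P"
  by (rule distr_PiM_reindex[where f = "\<lambda>k. m - 1 - k" and M = "\<lambda>_. distr M borel (Z h)"])
   (auto simp: inj_on_def \<mu>.prob_space_axioms)
 then have "(\<integral>\<^sup>+u. f u \<partial>?P) = (\<integral>\<^sup>+u. f u \<partial>distr ?P ?P ?rev)" by simp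
 also have "... = (\<integral>\<^sup>+u. f (?rev u) \<partial>?P)"
  using fP by (intro nn_integral_distr measurable_restrict measurable_component_singleton) auto
 finally have "(\<integral>\<^sup>+u. f u \<partial>distr M (Pi\<^sub>M {..<m} (\<lambda>_. borel)) (increments h m))
   = (\<integral>\<^sup>+u. f (?rev u) \<partial>distr M (Pi\<^sub>M {..<m} (\<lambda>_. borel)) (increments h m))"
  unfolding distr_increments[OF h] .
 moreover have "(\<lambda>u. f (?rev u)) \<in> Borel (Pi\<^sub>M {..<m} (\<lambda>_. borel))"
  by (rule measurable_compose[OF _ f], intro measurable_restrict measurable_component_singleton) auto
 ultimately show ?thesis
  using nn_integral_distr[OF increments_measurable[OF h, of m], of f]
   nn_integral_distr[OF increments_measurable[OF h, of m], of "\<lambda>u. f (?rev u)"] f by simp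
qed

lemma sum_increments:
 assumes "w \<in> space M" "j <= m"
 shows "(\<Sum>k<j. increments h m w k) = Z (real j * h) w"
  "(\<Sum>k=j..<m. increments h m w k) = Z (real m * h) w - Z (real j * h) w"
proof -
 have "(\<Sum>k<j. increments h m w k) = (\<Sum>k<j. Z (real (Suc k) * h) w - Z (real k * h) w)"
  using assms(2) by (intro sum.cong) (auto simp: increments_def)
 also have "... = Z (real j * h) w"
  using sum_lessThan_telescope[of "\<lambda>k. Z (real k * h) w" j] Z_0[OF assms(1)] by simp
 finally show "(\<Sum>k<j. increments h m w k) = Z (real j * h) w" .
 have "(\<Sum>k=j..<m. increments h m w k) = (\<Sum>k=j..<m. Z (real (Suc k) * h) w - Z (real k * h) w)"
  by (intro sum.cong) (auto simp: increments_def)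
 also have "... = Z (real m * h) w - Z (real j * h) w"
  using sum_Suc_diff'[OF assms(2), of "\<lambda>k. Z (real k * h) w"] by simp
 finally show "(\<Sum>k=j..<m. increments h m w k) = Z (real m * h) w - Z (real j * h) w" .
qed

end

text \<open>Independence allows freezing the path of \<open>C\<close> while the increments of
  \<open>X\<close> are reversed. The sum \<open>s1 j\<close> of the first \<open>m - j\<close>
  increments then turns into the sum \<open>s2 j\<close> of the last \<open>m - j\<close>.\<close>

lemma (in levy_pair) reverse_grid:
 assumes h: "0 <= h"
 shows "(\<integral>\<^sup>+w. ennreal (exp (MIN j\<in>{0..m}. C (real j * h) w - a * X (real (m - j) * h) w)) \<partial>M)
  = (\<integral>\<^sup>+w. ennreal (exp (MIN j\<in>{0..m}. C (real j * h) w - a * (X (real m * h) w - X (real j * h) w))) \<partial>M)"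
proof -
 let ?S = "Pi\<^sub>M {..<m} (\<lambda>_. borel :: real measure)" and ?T = "Pi\<^sub>M {0..m} (\<lambda>_. borel :: real measure)"
 define V where "V w = (\<lambda>k\<in>{0..m}. C (real k * h) w)" for w
 define g where "g s p = ennreal (exp (MIN j\<in>{0..m}. snd p j - a * s j (fst p)))"
  for s :: "nat => (nat => real) => real" and p :: "(nat => real) \<times> (nat => real)"
 define s1 where "s1 j u = (\<Sum>k<m - j. u k)" for j and u :: "nat => real"
 define s2 where "s2 j u = (\<Sum>k=j..<m. u k)" for j and u :: "nat => real"
 have comp: "(\<lambda>p. fst p k) \<in> Borel (?S \<Otimes>\<^sub>M ?T)" if "k < m" for k
  using that by (intro measurable_compose[OF measurable_fst measurable_component_singleton]) auto
 have comp2: "(\<lambda>p. snd p k) \<in> Borel (?S \<Otimes>\<^sub>M ?T)" if "k <= m" for k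
  using that by (intro measurable_compose[OF measurable_snd measurable_component_singleton]) auto
 have gm: "g s \<in> Borel (?S \<Otimes>\<^sub>M ?T)" if "\<And>j. j <= m ==> (\<lambda>p. s j (fst p)) \<in> Borel (?S \<Otimes>\<^sub>M ?T)" for s
 proof -
  have "(\<lambda>p. MIN j\<in>{0..m}. snd p j - a * s j (fst p)) \<in> Borel (?S \<Otimes>\<^sub>M ?T)"
   using that comp2 by (intro borel_measurable_Min borel_measurable_diff borel_measurable_times) auto
  then show ?thesis unfolding g_def[abs_def] by measurable
 qed
 have g1: "g s1 \<in> Borel (?S \<Otimes>\<^sub>M ?T)"
  unfolding s1_def by (intro gm borel_measurable_sum comp) auto
 have g2: "g s2 \<in> Borel (?S \<Otimes>\<^sub>M ?T)"
  unfolding s2_def by (intro gm borel_measurable_sum comp) auto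
 have VM: "V \<in> M \<rightarrow>\<^sub>M ?T"
  unfolding V_def using h by (intro measurable_restrict C.Z_M) auto
 have "X.indep_var ?S ((\<lambda>p. \<lambda>k\<in>{..<m}. p (real (Suc k) * h) - p (real k * h)) \<circ> (\<lambda>w. \<lambda>t\<in>{0..}. X t w))
   ?T ((\<lambda>p. \<lambda>k\<in>{0..m}. p (real k * h)) \<circ> (\<lambda>w. \<lambda>t\<in>{0..}. C t w))"
  using h by (intro X.indep_var_compose[OF independent[unfolded independent_processes_def]] measurable_restrict
    borel_measurable_diff measurable_component_singleton) auto
 also have "(\<lambda>p. \<lambda>k\<in>{..<m}. p (real (Suc k) * h) - p (real k * h)) \<circ> (\<lambda>w. \<lambda>t\<in>{0..}. X t w) = X.increments h m"
  using h by (auto simp: fun_eq_iff X.increments_def restrict_def)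
 also have "(\<lambda>p. \<lambda>k\<in>{0..m}. p (real k * h)) \<circ> (\<lambda>w. \<lambda>t\<in>{0..}. C t w) = V"
  using h by (auto simp: fun_eq_iff V_def restrict_def)
 finally have ind: "X.indep_var ?S (X.increments h m) ?T V" .
 have 1: "(\<integral>\<^sup>+w. ennreal (exp (MIN j\<in>{0..m}. C (real j * h) w - a * X (real (m - j) * h) w)) \<partial>M)
   = (\<integral>\<^sup>+w. g s1 (X.increments h m w, V w) \<partial>M)"
  by (intro nn_integral_cong) (simp add: g_def s1_def V_def X.sum_increments cong: image_cong_simp)
 have 2: "(\<integral>\<^sup>+w. ennreal (exp (MIN j\<in>{0..m}. C (real j * h) w - a * (X (real m * h) w - X (real j * h) w))) \<partial>M)
   = (\<integral>\<^sup>+w. g s2 (X.increments h m w, V w) \<partial>M)"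
  by (intro nn_integral_cong) (simp add: g_def s2_def V_def X.sum_increments cong: image_cong_simp)
 have rev: "g s1 (\<lambda>k\<in>{..<m}. u (m - 1 - k), c) = g s2 (u, c)" for u c
 proof -
  have "s1 j (\<lambda>k\<in>{..<m}. u (m - 1 - k)) = s2 j u" if "j <= m" for j
   unfolding s1_def s2_def using that
   by (intro sum.reindex_bij_witness[of _ "\<lambda>k. m - 1 - k" "\<lambda>k. m - 1 - k"]) auto
  then show ?thesis by (simp add: g_def cong: image_cong_simp)
 qed
 have "(\<integral>\<^sup>+w. g s1 (X.increments h m w, V w) \<partial>M) = (\<integral>\<^sup>+w'. \<integral>\<^sup>+w. g s1 (X.increments h m w, V w') \<partial>M \<partial>M)"
  by (rule X.indep_var_nn_integral[OF ind g1])
 also have "... = (\<integral>\<^sup>+w'. \<integral>\<^sup>+w. g s2 (X.increments h m w, V w') \<partial>M \<partial>M)"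
 proof (rule nn_integral_cong)
  fix w' assume "w' \<in> space M"
  then have "(\<lambda>u. g s1 (u, V w')) \<in> Borel ?S"
   by (intro measurable_compose[OF measurable_Pair2' g1] measurable_space[OF VM])
  from X.increments_reverse[OF h this]
  show "(\<integral>\<^sup>+w. g s1 (X.increments h m w, V w') \<partial>M) = (\<integral>\<^sup>+w. g s2 (X.increments h m w, V w') \<partial>M)"
   unfolding rev .
 qed
 also have "... = (\<integral>\<^sup>+w. g s2 (X.increments h m w, V w) \<partial>M)"
  by (rule X.indep_var_nn_integral[OF ind g2, symmetric])
 finally show ?thesis unfolding 1 2 .
qed

section \<open>Reversed infima and the constant of the theorem\<close>

context discounted_levy_pair
begin

definition reversed_min :: "real => 'a => nat => real" where
 "reversed_min v w p = grid_min (\<lambda>s. C s w - a * X (v - s) w) v p"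

text \<open>The infimum over dyadic points only, which is measurable in the outcome and in
  \<open>v\<close>; it may exceed the full infimum for exceptional \<open>v\<close>.\<close>

definition reversed_inf :: "real => 'a => real" where
 "reversed_inf v w = (INF p. reversed_min v w p)"

lemma reversed_bounded:
 assumes w: "w \<in> space M" and v: "0 <= v"
 shows "\<exists>K. \<forall>s\<in>{0..v}. K <= C s w - a * X (v - s) w"
proof -
 obtain K where K: "\<And>s. s \<in> {0..v} ==> \<bar>C s w\<bar> <= K" using cadlag_bounded[OF C.Z_cadlag[OF w]] by blast
 obtain L where L: "\<And>s. s \<in> {0..v} ==> \<bar>X s w\<bar> <= L" using cadlag_bounded[OF X.Z_cadlag[OF w]] by blast
 have "- K - a * L <= C s w - a * X (v - s) w" if "s \<in> {0..v}" for s
 proof -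
  have "X (v - s) w <= L" using L[of "v - s"] that by auto
  then have "a * X (v - s) w <= a * L" using a by (intro mult_left_mono) auto
  then show ?thesis using K[OF that] by linarith
 qed
 then show ?thesis by blast
qed

lemma grid_point:
 assumes "j <= 2 ^ p" "0 <= (v::real)"
 shows "0 <= real j / 2 ^ p * v" "real j / 2 ^ p * v <= v"
proof -
 have "real j <= 2 ^ p" using assms(1) of_nat_le_iff[of j "2 ^ p", where ?'a = real] by simp
 then show "real j / 2 ^ p * v <= v" using assms(2) by (intro mult_left_le_one_le) auto
qed (use assms in auto)

lemma reversed_min_tendsto:
 assumes w: "w \<in> space M" and v: "0 <= v"
 shows "reversed_min v w \<longlonglongrightarrow> reversed_inf v w"
proof -
 obtain K where K: "\<And>s. s \<in> {0..v} ==> K <= C s w - a * X (v - s) w"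
  using reversed_bounded[OF w v] by blast
 have "K <= reversed_min v w p" for p
  unfolding reversed_min_def grid_min_def using K grid_point[OF _ v] by auto
 then have "bdd_below (range (reversed_min v w))" by (intro bdd_belowI2)
 moreover have "decseq (reversed_min v w)"
  unfolding reversed_min_def[abs_def] by (rule grid_min_decseq)
 ultimately show ?thesis
  unfolding reversed_inf_def by (rule LIMSEQ_decseq_INF)
qed

text \<open>The reversed path is only one-sided continuous.  Where \<open>C\<close> and the reversed \<open>X\<close> do not jump simultaneously,
 the function is continuous from one side, and simultaneous jumps occur for countably many \<open>v\<close> only.\<close>

lemma reversed_inf_eq:
 assumes w: "w \<in> space M"
 shows "\<exists>N. countable N \<and> (\<forall>v\<ge>0. v \<notin> N \<longrightarrow> exp (reversed_inf v w) = (INF s\<in>{0..v}. exp (C s w - a * X (v - s) w)))"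
proof -
 define JC where "JC = {t. 0 < t \<and> \<not> continuous (at_left t) (\<lambda>t. C t w)}"
 define JX where "JX = {t. 0 < t \<and> \<not> continuous (at_left t) (\<lambda>t. X t w)}"
 define N where "N = (\<lambda>(s, u). s + u) ` (JC \<times> JX)"
 have "countable N"
  unfolding N_def JC_def JX_def
  by (intro countable_image countable_SIGMA countable_left_jumps X.Z_cadlag C.Z_cadlag w)
 moreover have "exp (reversed_inf v w) = (INF s\<in>{0..v}. exp (C s w - a * X (v - s) w))" if v: "0 <= v" "v \<notin> N" for v
 proof -
  let ?f = "\<lambda>s. C s w - a * X (v - s) w"
  obtain K where K: "\<And>s. s \<in> {0..v} ==> K <= ?f s" using reversed_bounded[OF w v(1)] by blast
  have bdd: "bdd_below (?f ` {0..v})" using K by (intro bdd_belowI2)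
  have cont: "continuous (at_right s) ?f \<or> continuous (at_left s) ?f" if s: "0 < s" "s < v" for s
  proof (cases "s \<in> JC")
   case True
   then have "v - s \<notin> JX" using v(2) by (force simp: N_def)
   then have "((\<lambda>t. X t w) \<longlongrightarrow> X (v - s) w) (at_left (v - s))" using s by (simp add: JX_def continuous_within)
   then have "((\<lambda>s. X (v - s) w) \<longlongrightarrow> X (v - s) w) (at_right s)"
    using filterlim_reflect(1) by (rule filterlim_compose)
   moreover have "((\<lambda>s. C s w) \<longlongrightarrow> C s w) (at_right s)"
    using cadlag_right[OF C.Z_cadlag[OF w], of s] s by (simp add: continuous_within)
   ultimately show ?thesis
    unfolding continuous_within by (intro disjI1 tendsto_intros)
  next
   case False
   then have "((\<lambda>s. C s w) \<longlongrightarrow> C s w) (at_left s)" using s by (simp add: JC_def continuous_within)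
   moreover have "((\<lambda>t. X t w) \<longlongrightarrow> X (v - s) w) (at_right (v - s))"
    using cadlag_right[OF X.Z_cadlag[OF w], of "v - s"] s by (simp add: continuous_within)
   then have "((\<lambda>s. X (v - s) w) \<longlongrightarrow> X (v - s) w) (at_left s)"
    using filterlim_reflect(2) by (rule filterlim_compose)
   ultimately show ?thesis
    unfolding continuous_within by (intro disjI2 tendsto_intros)
  qed
  have "reversed_min v w \<longlonglongrightarrow> (INF s\<in>{0..v}. ?f s)"
   unfolding reversed_min_def[abs_def] by (rule grid_min_tendsto[OF v(1) bdd cont])
  then have "reversed_inf v w = (INF s\<in>{0..v}. ?f s)"
   using reversed_min_tendsto[OF w v(1)] LIMSEQ_unique by blast
  also have "exp (INF s\<in>{0..v}. ?f s) = (INF y\<in>?f ` {0..v}. exp y)"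
  proof (rule continuous_at_Inf_mono)
   show "mono (exp :: real => real)" by (simp add: mono_def)
   show "continuous (at_right (INF s\<in>{0..v}. ?f s)) exp"
    by (rule continuous_at_imp_continuous_at_within[OF isCont_exp])
   show "?f ` {0..v} \<noteq> {}" using v(1) by simp
  qed (rule bdd)
  finally show ?thesis by (simp add: image_image)
 qed
 ultimately show ?thesis by blast
qed

lemma reversed_min_measurable:
 assumes [measurable]: "f \<in> N \<rightarrow>\<^sub>M M" "g \<in> Borel N"
 shows "(\<lambda>p. reversed_min (max 0 (g p)) (f p) n) \<in> Borel N"
proof -
 have "(\<lambda>p. C (real j / 2 ^ n * max 0 (g p)) (f p) - a * X (max 0 (g p) - real j / 2 ^ n * max 0 (g p)) (f p)) \<in> Borel N"
  if j: "j <= 2 ^ n" for j :: nat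
 proof -
  have "(\<lambda>p. C (max 0 (real j / 2 ^ n * max 0 (g p))) (f p) - a * X (max 0 (max 0 (g p) - real j / 2 ^ n * max 0 (g p))) (f p)) \<in> Borel N"
   by measurable
  moreover have "max 0 (real j / 2 ^ n * y) = real j / 2 ^ n * y" "max 0 (y - real j / 2 ^ n * y) = y - real j / 2 ^ n * y" if "0 <= y" for y
   using grid_point[OF j that] by auto
  ultimately show ?thesis by simp
 qed
 then show ?thesis
  unfolding reversed_min_def grid_min_def by (intro borel_measurable_Min) auto
qed

lemma reversed_inf_measurable [measurable]:
 assumes f [measurable]: "f \<in> N \<rightarrow>\<^sub>M M" and g [measurable]: "g \<in> Borel N"
 shows "(\<lambda>p. reversed_inf (max 0 (g p)) (f p)) \<in> Borel N"
proof (rule borel_measurable_LIMSEQ_real)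
 show "(\<lambda>n. reversed_min (max 0 (g p)) (f p) n) \<longlonglongrightarrow> reversed_inf (max 0 (g p)) (f p)" if "p \<in> space N" for p
  using reversed_min_tendsto[OF measurable_space[OF f that], of "max 0 (g p)"] by simp
qed (rule reversed_min_measurable[OF f g])

text \<open>Reversal on each grid, followed by dominated convergence on both sides. At the last grid
  point \<open>s = v\<close> the reversed path is at \<open>X 0 w = 0\<close>, which yields the
  bound \<open>exp (C v w)\<close>.\<close>

lemma reversed_value:
 assumes v: "0 <= v"
 shows "(\<integral>\<^sup>+w. ennreal (exp (reversed_inf v w)) \<partial>M) = \<phi> v 0"
proof -
 have [measurable]: "X v \<in> Borel M" "C v \<in> Borel M" "R v \<in> Borel M" using v by auto
 have rm [measurable]: "(\<lambda>w. reversed_min v w p) \<in> Borel M" for p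
  using reversed_min_measurable[of "\<lambda>w. w" M "\<lambda>_. v" p] v by (simp add: max_absorb2)
 have ri [measurable]: "reversed_inf v \<in> Borel M"
  using reversed_inf_measurable[of "\<lambda>w. w" M "\<lambda>_. v"] v by (simp add: max_absorb2)
 have gm [measurable]: "(\<lambda>w. grid_min (\<lambda>t. G t w) v p) \<in> Borel M" for p
  unfolding grid_min_def using grid_point(1)[OF _ v] by (intro borel_measurable_Min) auto
 have eq: "(\<integral>\<^sup>+w. ennreal (exp (reversed_min v w p)) \<partial>M) = (\<integral>\<^sup>+w. ennreal (exp (- a * X v w + grid_min (\<lambda>t. G t w) v p)) \<partial>M)" for p
 proof -
  let ?h = "v / 2 ^ p" and ?m = "2 ^ p :: nat"
  have 1: "reversed_min v w p = (MIN j\<in>{0..?m}. C (real j * ?h) w - a * X (real (?m - j) * ?h) w)" for w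
   unfolding reversed_min_def grid_min_def
   by (intro arg_cong[where f = Min] image_cong refl) (simp add: of_nat_diff diff_divide_distrib left_diff_distrib)
  have 2: "- a * X v w + grid_min (\<lambda>t. G t w) v p = (MIN j\<in>{0..?m}. C (real j * ?h) w - a * (X (real ?m * ?h) w - X (real j * ?h) w))" for w
  proof -
   have "- a * X v w + grid_min (\<lambda>t. G t w) v p = (MIN y\<in>(\<lambda>j. G (real j / 2 ^ p * v) w) ` {0..2 ^ p}. - a * X v w + y)"
    unfolding grid_min_def by (rule mono_Min_commute) (auto simp: mono_def)
   also have "... = (MIN j\<in>{0..?m}. C (real j * ?h) w - a * (X (real ?m * ?h) w - X (real j * ?h) w))"
    unfolding image_image by (intro arg_cong[where f = Min] image_cong refl) (simp add: G_def algebra_simps)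
   finally show ?thesis .
  qed
  show ?thesis unfolding 1 2 using v by (intro reverse_grid) simp
 qed
 have "(\<lambda>p. \<integral>\<^sup>+w. ennreal (exp (reversed_min v w p)) \<partial>M) \<longlonglongrightarrow> (\<integral>\<^sup>+w. ennreal (exp (reversed_inf v w)) \<partial>M)"
 proof (rule nn_integral_dominated_convergence[where w = "\<lambda>w. ennreal (exp (C v w))"])
  show "AE w in M. ennreal (exp (reversed_min v w p)) <= ennreal (exp (C v w))" for p
  proof (intro AE_I2 ennreal_leI)
   fix w assume "w \<in> space M"
   then show "exp (reversed_min v w p) <= exp (C v w)"
    using grid_min_le[of "2 ^ p" p "\<lambda>s. C s w - a * X (v - s) w" v] by (simp add: reversed_min_def X.Z_0)
  qed
  show "AE w in M. (\<lambda>p. ennreal (exp (reversed_min v w p))) \<longlonglongrightarrow> ennreal (exp (reversed_inf v w))"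
   using v by (intro AE_I2 tendsto_intros reversed_min_tendsto)
 qed (use exp_C[OF v] in auto)
 moreover have "(\<lambda>p. \<integral>\<^sup>+w. ennreal (exp (- a * X v w + grid_min (\<lambda>t. G t w) v p)) \<partial>M) \<longlonglongrightarrow> (\<integral>\<^sup>+w. ennreal (exp (- a * X v w + R v w)) \<partial>M)"
 proof (rule nn_integral_dominated_convergence[where w = "\<lambda>w. ennreal (exp (C v w))"])
  show "AE w in M. ennreal (exp (- a * X v w + grid_min (\<lambda>t. G t w) v p)) <= ennreal (exp (C v w))" for p
  proof (intro AE_I2 ennreal_leI)
   fix w
   show "exp (- a * X v w + grid_min (\<lambda>t. G t w) v p) <= exp (C v w)"
    using grid_min_le[of "2 ^ p" p "\<lambda>t. G t w" v] by (simp add: G_def)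
  qed
  show "AE w in M. (\<lambda>p. ennreal (exp (- a * X v w + grid_min (\<lambda>t. G t w) v p))) \<longlonglongrightarrow> ennreal (exp (- a * X v w + R v w))"
   unfolding R_def by (intro AE_I2 tendsto_intros grid_min_running_inf cadlag_G v)
 qed (use exp_C[OF v] in auto)
 ultimately have "(\<integral>\<^sup>+w. ennreal (exp (reversed_inf v w)) \<partial>M) = (\<integral>\<^sup>+w. ennreal (exp (- a * X v w + R v w)) \<partial>M)"
  unfolding eq using LIMSEQ_unique by blast
 also have "... = \<phi> v 0"
  unfolding \<phi>_def using R_nonpos v by (intro nn_integral_cong) (simp add: min_absorb2)
 finally show ?thesis .
qed

text \<open>For each outcome the exceptional \<open>v\<close> are countable, hence do not affect the
  inner integral; Fubini and \<open>reversed_value\<close> then produce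
  \<open>\<Phi> 0\<close>.\<close>

lemma A0_reversed:
 assumes "0 <= \<delta>"
 shows "(LINT w|M. (LINT v:{0..}|lborel. \<delta> * exp (- r * v) * (INF s\<in>{0..v}. exp (C s w - a * X (v - s) w)))) = \<delta> * A\<^sub>0"
proof -
 interpret P: pair_sigma_finite M lborel
  by (intro pair_sigma_finite.intro X.sigma_finite_measure_axioms sigma_finite_lborel)
 define q where "q w v = indicator {0..} v * (exp (- r * v) * exp (reversed_inf (max 0 v) w))" for w v
 have q [measurable]: "(\<lambda>(w, v). q w v) \<in> Borel (M \<Otimes>\<^sub>M lborel)"
  unfolding q_def by measurable
 have qv [measurable]: "(\<lambda>v. q w v) \<in> Borel lborel" if "w \<in> space M" for w
  using measurable_compose_Pair1[OF that q] by simp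
 have q0: "0 <= q w v" for w v by (simp add: q_def)
 define J where "J w = (\<integral>\<^sup>+v. ennreal (q w v) \<partial>lborel)" for w
 have Jm [measurable]: "J \<in> Borel M"
  unfolding J_def by measurable
 have "(\<integral>\<^sup>+w. J w \<partial>M) = (\<integral>\<^sup>+v. \<integral>\<^sup>+w. ennreal (q w v) \<partial>M \<partial>lborel)"
  unfolding J_def by (rule P.Fubini'[symmetric]) measurable
 also have "... = (\<integral>\<^sup>+v. ennreal (exp (- r * v)) * \<phi> (max 0 v) 0 * indicator {0..} v \<partial>lborel)"
 proof (rule nn_integral_cong)
  fix v :: real
  have [measurable]: "reversed_inf (max 0 v) \<in> Borel M"
   using reversed_inf_measurable[of "\<lambda>w. w" M "\<lambda>_. v"] by simp
  have "(\<integral>\<^sup>+w. ennreal (q w v) \<partial>M) = (\<integral>\<^sup>+w. (indicator {0..} v * ennreal (exp (- r * v))) * ennreal (exp (reversed_inf (max 0 v) w)) \<partial>M)"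
   by (intro nn_integral_cong) (auto simp: q_def ennreal_mult indicator_def)
  also have "... = indicator {0..} v * ennreal (exp (- r * v)) * \<phi> (max 0 v) 0"
   by (simp add: nn_integral_cmult reversed_value)
  finally show "(\<integral>\<^sup>+w. ennreal (q w v) \<partial>M) = ennreal (exp (- r * v)) * \<phi> (max 0 v) 0 * indicator {0..} v"
   by (simp add: mult_ac)
 qed
 also have "... = \<Phi> 0" by (simp add: \<Phi>_def)
 finally have J: "(\<integral>\<^sup>+w. J w \<partial>M) = ennreal A\<^sub>0" by (simp add: \<Phi>_0)
 \<comment> \<open>Where \<open>J w\<close> is infinite, the Bochner integral is 0 by default, in
   agreement with \<open>enn2real\<close>; outside a null set nothing is lost.\<close>
 have fin: "AE w in M. J w \<noteq> \<infinity>"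
  using J by (intro nn_integral_PInf_AE) auto
 have inner: "(LINT v:{0..}|lborel. \<delta> * exp (- r * v) * (INF s\<in>{0..v}. exp (C s w - a * X (v - s) w))) = \<delta> * enn2real (J w)"
  if w: "w \<in> space M" for w
 proof -
  obtain N where N: "countable N" "\<And>v. 0 <= v ==> v \<notin> N ==> exp (reversed_inf v w) = (INF s\<in>{0..v}. exp (C s w - a * X (v - s) w))"
   using reversed_inf_eq[OF w] by blast
  have "(LINT v:{0..}|lborel. \<delta> * exp (- r * v) * (INF s\<in>{0..v}. exp (C s w - a * X (v - s) w))) = (LINT v|lborel. \<delta> * q w v)"
   unfolding set_lebesgue_integral_def
  proof (rule integral_discrete_difference[OF N(1)])
   fix v assume "v \<notin> N"
   then show "indicator {0..} v *\<^sub>R (\<delta> * exp (- r * v) * (INF s\<in>{0..v}. exp (C s w - a * X (v - s) w))) = \<delta> * q w v"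
    using N(2)[of v] by (cases "0 <= v") (auto simp: q_def max_absorb2)
  qed auto
  also have "... = \<delta> * enn2real (J w)"
   unfolding J_def using qv[OF w] q0 by (simp add: integral_eq_nn_integral)
  finally show ?thesis .
 qed
 have "(LINT w|M. (LINT v:{0..}|lborel. \<delta> * exp (- r * v) * (INF s\<in>{0..v}. exp (C s w - a * X (v - s) w)))) = (LINT w|M. \<delta> * enn2real (J w))"
  by (intro Bochner_Integration.integral_cong inner refl)
 also have "... = \<delta> * enn2real (\<integral>\<^sup>+w. ennreal (enn2real (J w)) \<partial>M)"
  by (simp add: integral_eq_nn_integral)
 also have "(\<integral>\<^sup>+w. ennreal (enn2real (J w)) \<partial>M) = (\<integral>\<^sup>+w. J w \<partial>M)"
  using fin by (intro nn_integral_cong_AE) (auto simp: less_top)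
 finally show ?thesis using J A0_pos by simp
qed

section \<open>Finiteness of the equilibrium expenditure\<close>

text \<open>The factors \<open>exp (- a * X)\<close> and \<open>exp (- b * R)\<close> are not
  independent and are separated by a weighted inequality between their squares. The square of the
  second is controlled by Doob's inequality, since \<open>- b * R\<close> is the running maximum of
  \<open>- b * G\<close>. The resulting growth rate is the mean of \<open>p\<close> and
  \<open>q\<close>.\<close>

lemma value_finite:
 fixes b p q :: real
 assumes b: "0 < b"
  and p: "\<And>t. 0 <= t ==> (\<integral>\<^sup>+w. ennreal (exp (- 2 * a * X t w)) \<partial>M) = ennreal (exp (t * p))"
  and q: "\<And>t. 0 <= t ==> (\<integral>\<^sup>+w. ennreal (exp (- 2 * b * G t w)) \<partial>M) = ennreal (exp (t * q))"
  and subX: "\<And>t. 0 <= t ==> 1 <= (\<integral>\<^sup>+w. ennreal (exp (- b * a * X t w)) \<partial>M)"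
  and subC: "\<And>t. 0 <= t ==> 1 <= (\<integral>\<^sup>+w. ennreal (exp (- b * C t w)) \<partial>M)"
  and rate: "(p + q) / 2 < r"
 shows "(\<integral>\<^sup>+w. (\<integral>\<^sup>+t\<in>{0..}. ennreal (exp (- r * t - a * X (max 0 t) w - b * R (max 0 t) w)) \<partial>lborel) \<partial>M) < \<top>"
proof -
 interpret P: pair_sigma_finite M lborel
  by (intro pair_sigma_finite.intro X.sigma_finite_measure_axioms sigma_finite_lborel)
 have bound: "(\<integral>\<^sup>+w. ennreal (exp (- a * X t w - b * R t w)) \<partial>M) <= ennreal (5 * exp (t * ((p + q) / 2)))" if t: "0 <= t" for t
 proof -
  have [measurable]: "X t \<in> Borel M" "R t \<in> Borel M" using t by auto
  \<comment> \<open>The weight balances the two squares: \<open>k * exp (t * p)\<close> and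
    \<open>exp (t * q) / k\<close> both equal \<open>exp (t * (p + q) / 2)\<close>. The constant 5
    is 1 plus Doob's 4.\<close>
  define k where "k = exp (t * ((q - p) / 2))"
  have k: "0 < k" by (simp add: k_def)
  have "(\<integral>\<^sup>+w. ennreal (exp (- 2 * b * R t w)) \<partial>M)
    <= (\<integral>\<^sup>+w. ennreal (exp (- 2 * running_inf (\<lambda>t. - (- b * a * X t w + - b * C t w)) t)) \<partial>M)"
  proof (intro nn_integral_mono ennreal_leI)
   fix w assume w: "w \<in> space M"
   have eq: "(\<lambda>t. - (- b * a * X t w + - b * C t w)) = (\<lambda>t. b * G t w)"
    by (simp add: G_def algebra_simps)
   have "running_inf (\<lambda>t. b * G t w) t / b <= R t w"
    unfolding R_def
   proof (rule running_inf_greatest[OF t])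
    fix s assume "0 <= s" "s <= t"
    then show "running_inf (\<lambda>t. b * G t w) t / b <= G s w"
     using running_inf_le[OF cadlag_cmult[OF cadlag_G[OF w]], of s t b] b by (simp add: field_simps)
   qed
   then have "running_inf (\<lambda>t. b * G t w) t <= b * R t w" using b by (simp add: field_simps)
   then show "exp (- 2 * b * R t w) <= exp (- 2 * running_inf (\<lambda>t. - (- b * a * X t w + - b * C t w)) t)"
    unfolding eq by simp
  qed
  also have "... <= 4 * (\<integral>\<^sup>+w. ennreal (exp (2 * (- b * a * X t w + - b * C t w))) \<partial>M)"
  proof (rule doob[OF t subX subC])
   show "(\<integral>\<^sup>+w. ennreal (exp (2 * (- b * a * X t w + - b * C t w))) \<partial>M) < \<top>" if "0 <= t" for t
    using q[OF that] by (simp add: G_def algebra_simps)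
  qed
  also have "... = 4 * ennreal (exp (t * q))"
   using q[OF t] by (simp add: G_def algebra_simps)
  finally have R2: "(\<integral>\<^sup>+w. ennreal (exp (- 2 * b * R t w)) \<partial>M) <= 4 * ennreal (exp (t * q))" .
  have "(\<integral>\<^sup>+w. ennreal (exp (- a * X t w - b * R t w)) \<partial>M)
    <= (\<integral>\<^sup>+w. ennreal k * ennreal (exp (- 2 * a * X t w)) + ennreal (1 / k) * ennreal (exp (- 2 * b * R t w)) \<partial>M)"
  proof (rule nn_integral_mono)
   fix w
   define x y where "x = exp (- a * X t w)" and "y = exp (- b * R t w)"
   have xy: "exp (- a * X t w - b * R t w) = x * y" "exp (- 2 * a * X t w) = x\<^sup>2" "exp (- 2 * b * R t w) = y\<^sup>2"
    by (simp_all add: x_def y_def exp_add[symmetric] exp_double[symmetric] algebra_simps)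
   have pos: "0 < x" "0 < y" by (simp_all add: x_def y_def)
   have "0 <= (k * x - y)\<^sup>2" by simp
   then have "2 * (k * x * y) <= k\<^sup>2 * x\<^sup>2 + y\<^sup>2"
    by (simp add: power2_diff power_mult_distrib)
   moreover have "0 < k * x * y" using k pos by simp
   ultimately have "k * x * y <= k\<^sup>2 * x\<^sup>2 + y\<^sup>2" by linarith
   also have "... = k * (k * x\<^sup>2 + 1 / k * y\<^sup>2)"
    using k by (simp add: power2_eq_square algebra_simps)
   finally have "k * (x * y) <= k * (k * x\<^sup>2 + 1 / k * y\<^sup>2)" by (simp only: mult.assoc)
   then have "x * y <= k * x\<^sup>2 + 1 / k * y\<^sup>2" using k by simp
   then show "ennreal (exp (- a * X t w - b * R t w)) <= ennreal k * ennreal (exp (- 2 * a * X t w)) + ennreal (1 / k) * ennreal (exp (- 2 * b * R t w))"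
    unfolding xy using k by (simp add: ennreal_mult[symmetric] ennreal_plus[symmetric] ennreal_leI del: ennreal_plus)
  qed
  also have "... = ennreal k * ennreal (exp (t * p)) + ennreal (1 / k) * (\<integral>\<^sup>+w. ennreal (exp (- 2 * b * R t w)) \<partial>M)"
   using p[OF t] by (simp add: nn_integral_add nn_integral_cmult)
  also have "... <= ennreal k * ennreal (exp (t * p)) + ennreal (1 / k) * (4 * ennreal (exp (t * q)))"
   by (intro add_left_mono mult_left_mono R2) simp
  also have "4 * ennreal (exp (t * q)) = ennreal (4 * exp (t * q))"
   by (simp add: ennreal_mult)
  also have "ennreal (1 / k) * ennreal (4 * exp (t * q)) = ennreal (1 / k * (4 * exp (t * q)))"
   using k by (intro ennreal_mult[symmetric]) auto
  also have "ennreal k * ennreal (exp (t * p)) = ennreal (k * exp (t * p))"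
   using k by (intro ennreal_mult[symmetric]) auto
  also have "ennreal (k * exp (t * p)) + ennreal (1 / k * (4 * exp (t * q))) = ennreal (k * exp (t * p) + 1 / k * (4 * exp (t * q)))"
   using k by (intro ennreal_plus[symmetric]) auto
  also have "k * exp (t * p) + 1 / k * (4 * exp (t * q)) = 5 * exp (t * ((p + q) / 2))"
  proof -
   have "k * exp (t * p) = exp (t * ((p + q) / 2))" "1 / k * exp (t * q) = exp (t * ((p + q) / 2))"
    by (simp_all add: k_def exp_add[symmetric] exp_diff[symmetric] field_simps)
   then show ?thesis by simp
  qed
  finally show ?thesis .
 qed
 have "(\<integral>\<^sup>+w. (\<integral>\<^sup>+t\<in>{0..}. ennreal (exp (- r * t - a * X (max 0 t) w - b * R (max 0 t) w)) \<partial>lborel) \<partial>M)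
   = (\<integral>\<^sup>+t. \<integral>\<^sup>+w. ennreal (exp (- r * t - a * X (max 0 t) w - b * R (max 0 t) w)) * indicator {0..} t \<partial>M \<partial>lborel)"
  by (rule P.Fubini'[symmetric]) measurable
 also have "... <= (\<integral>\<^sup>+t. ennreal 5 * (ennreal (exp (- (r - (p + q) / 2) * t)) * indicator {0..} t) \<partial>lborel)"
 proof (rule nn_integral_mono)
  fix t :: real
  show "(\<integral>\<^sup>+w. ennreal (exp (- r * t - a * X (max 0 t) w - b * R (max 0 t) w)) * indicator {0..} t \<partial>M)
   <= ennreal 5 * (ennreal (exp (- (r - (p + q) / 2) * t)) * indicator {0..} t)"
  proof (cases "0 <= t")
   case True
   have [measurable]: "X t \<in> Borel M" "R t \<in> Borel M" using True by auto
   have "(\<integral>\<^sup>+w. ennreal (exp (- r * t - a * X (max 0 t) w - b * R (max 0 t) w)) * indicator {0..} t \<partial>M)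
     = (\<integral>\<^sup>+w. ennreal (exp (- r * t)) * ennreal (exp (- a * X t w - b * R t w)) \<partial>M)"
    using True by (intro nn_integral_cong) (simp add: max_absorb2 ennreal_mult[symmetric] exp_add[symmetric])
   also have "... = ennreal (exp (- r * t)) * (\<integral>\<^sup>+w. ennreal (exp (- a * X t w - b * R t w)) \<partial>M)"
    by (rule nn_integral_cmult) measurable
   also have "... <= ennreal (exp (- r * t)) * ennreal (5 * exp (t * ((p + q) / 2)))"
    by (intro mult_left_mono bound True) simp
   also have "... = ennreal (exp (- r * t) * (5 * exp (t * ((p + q) / 2))))"
    by (intro ennreal_mult[symmetric]) auto
   also have "exp (- r * t) * (5 * exp (t * ((p + q) / 2))) = 5 * exp (- (r - (p + q) / 2) * t)"
    by (simp add: exp_add[symmetric] algebra_simps)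
   also have "ennreal ... = ennreal 5 * ennreal (exp (- (r - (p + q) / 2) * t))"
    by (intro ennreal_mult) auto
   finally show ?thesis using True by simp
  qed simp
 qed
 also have "... = ennreal 5 * ennreal (1 / (r - (p + q) / 2))"
  using nn_integral_exp_discount[of "r - (p + q) / 2"] rate by (subst nn_integral_cmult) auto
 also have "... < \<top>" by (simp add: ennreal_mult_less_top)
 finally show ?thesis .
qed

end

section \<open>Optional processes\<close>

context filtered_prob_space
begin

text \<open>Optional processes are measurable on outcomes with nonnegative times only, so this
  subspace carries the static game.\<close>

definition time_space :: "('a \<times> real) measure" where
 "time_space = restrict_space (M \<Otimes>\<^sub>M lborel) (space M \<times> {0..})"

lemma space_time_space: "space time_space = space M \<times> {0..}"
 by (auto simp: time_space_def space_restrict_space space_pair_measure)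

lemma time_set [measurable]: "space M \<times> {0::real..} \<in> sets (M \<Otimes>\<^sub>M lborel)"
 by (rule pair_measureI) auto

lemma nn_integral_time_space:
 assumes f: "(\<lambda>p. f (fst p) (snd p)) \<in> Borel time_space"
 shows "(\<integral>\<^sup>+w. (\<integral>\<^sup>+t\<in>{0..}. f w t \<partial>lborel) \<partial>M) = (\<integral>\<^sup>+p. f (fst p) (snd p) \<partial>time_space)"
proof -
 have m: "(\<lambda>p. f (fst p) (snd p) * indicator (space M \<times> {0..}) p) \<in> Borel (M \<Otimes>\<^sub>M lborel)"
  using f unfolding time_space_def by (subst (asm) borel_measurable_restrict_space_iff_ennreal) auto
 have "(\<integral>\<^sup>+p. f (fst p) (snd p) \<partial>time_space) = (\<integral>\<^sup>+p. f (fst p) (snd p) * indicator (space M \<times> {0..}) p \<partial>(M \<Otimes>\<^sub>M lborel))"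
  unfolding time_space_def by (intro nn_integral_restrict_space) auto
 also have "... = (\<integral>\<^sup>+w. \<integral>\<^sup>+t. f w t * indicator (space M \<times> {0..}) (w, t) \<partial>lborel \<partial>M)"
  using lborel.nn_integral_fst[OF m] by simp
 also have "... = (\<integral>\<^sup>+w. (\<integral>\<^sup>+t\<in>{0..}. f w t \<partial>lborel) \<partial>M)"
  by (intro nn_integral_cong) (auto simp: indicator_def)
 finally show ?thesis ..
qed

lemma AE_time_space:
 "(AE p in time_space. P (fst p) (snd p)) \<longleftrightarrow> (AE (w, t) in M \<Otimes>\<^sub>M lborel. 0 <= t \<longrightarrow> P w t)"
 unfolding time_space_def
 by (subst AE_restrict_space_iff) (auto simp: case_prod_unfold space_pair_measure intro!: AE_cong)

lemma measurable_time_space: "f \<in> Borel (M \<Otimes>\<^sub>M borel) ==> f \<in> Borel time_space"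
 unfolding time_space_def by (intro measurable_restrict_space1) (simp cong: measurable_cong_sets)

lemma right_continuous_time_space:
 assumes m: "\<And>t. 0 <= t ==> Y t \<in> Borel M"
  and r: "\<And>w t. w \<in> space M ==> 0 <= t ==> continuous (at_right t) (\<lambda>t. Y t w)"
 shows "(\<lambda>p. Y (snd p) (fst p) :: real) \<in> Borel time_space"
proof -
 have "(\<lambda>p. Y (max 0 (snd p)) (fst p)) \<in> Borel time_space"
  by (intro measurable_time_space right_continuous_process_measurable m r)
 then show ?thesis
  by (subst measurable_cong[of time_space _ "\<lambda>p. Y (max 0 (snd p)) (fst p)"]) (auto simp: space_time_space max_absorb2)
qed

lemma space_optional_algebra: "space (optional_algebra M F) = space M \<times> {0..}"
 and sets_optional_algebra: "sets (optional_algebra M F) = sigma_sets (space M \<times> {0..})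
   {{(w, t) \<in> space M \<times> {0..}. X t w \<in> B} | X B.
    adapted F X \<and> (\<forall>w\<in>space M. cadlag (\<lambda>t. X t w)) \<and> B \<in> sets borel}"
 unfolding optional_algebra_def by (rule space_measure_of, force) (rule sets_measure_of, force)

lemma optional_cadlag:
 assumes "adapted F Y" "\<And>w. w \<in> space M ==> cadlag (\<lambda>t. Y t w)"
 shows "optional_process M F Y"
 unfolding optional_process_def
proof (rule measurableI)
 fix B :: "real set" assume "B \<in> sets borel"
 then have "{(w, t) \<in> space M \<times> {0..}. Y t w \<in> B} \<in> sets (optional_algebra M F)"
  unfolding sets_optional_algebra using assms by (intro sigma_sets.Basic) blast
 also have "{(w, t) \<in> space M \<times> {0..}. Y t w \<in> B} = (\<lambda>(w, t). Y t w) -` B \<inter> space (optional_algebra M F)"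
  by (auto simp: space_optional_algebra)
 finally show "(\<lambda>(w, t). Y t w) -` B \<inter> space (optional_algebra M F) \<in> sets (optional_algebra M F)" .
qed simp

lemma optional_time_space:
 assumes "optional_process M F Y"
 shows "(\<lambda>p. Y (snd p) (fst p)) \<in> Borel time_space"
proof -
 have "sets (optional_algebra M F) \<subseteq> sets time_space"
  unfolding sets_optional_algebra space_time_space[symmetric]
 proof (rule sets.sigma_sets_subset, safe)
  fix Y :: "real => 'a => real" and B :: "real set"
  assume Y: "adapted F Y" "\<forall>w\<in>space M. cadlag (\<lambda>t. Y t w)" and B: "B \<in> sets borel"
  have "(\<lambda>p. Y (snd p) (fst p)) \<in> Borel time_space"
   using Y by (intro right_continuous_time_space adaptedD cadlag_right) auto
  from measurable_sets[OF this B]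
  have "(\<lambda>p. Y (snd p) (fst p)) -` B \<inter> space time_space \<in> sets time_space" .
  moreover have "(\<lambda>p. Y (snd p) (fst p)) -` B \<inter> space time_space = {(w, t). (w, t) \<in> space time_space \<and> Y t w \<in> B}"
   by auto
  ultimately show "{(w, t). (w, t) \<in> space time_space \<and> Y t w \<in> B} \<in> sets time_space" by simp
 qed
 then have "(\<lambda>(w, t). Y t w) \<in> Borel time_space"
  using assms unfolding optional_process_def measurable_def
  by (auto simp: space_optional_algebra space_time_space)
 then show ?thesis by (simp add: case_prod_unfold)
qed

text \<open>Sections at a fixed time map the generators of the optional sigma-algebra into the
  filtration. For an admissible contribution this makes the reach times stopping times.\<close>

lemma optional_adapted:
 assumes "optional_process M F Y"
 shows "adapted F Y"
 unfolding adapted_def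
proof (intro allI impI)
 fix t :: real assume t: "0 <= t"
 have "(\<lambda>w. (w, t)) \<in> F (ennreal t) \<rightarrow>\<^sub>M optional_algebra M F"
  unfolding optional_algebra_def
 proof (rule measurable_measure_of)
  fix A assume "A \<in> {{(w, t) \<in> space M \<times> {0..}. X t w \<in> B} | X B.
    adapted F X \<and> (\<forall>w\<in>space M. cadlag (\<lambda>t. X t w)) \<and> B \<in> sets borel}"
  then obtain X B where A: "A = {(w, t) \<in> space M \<times> {0..}. X t w \<in> B}" "adapted F X" "B \<in> sets borel" by blast
  have "X t -` B \<inter> space (F (ennreal t)) \<in> sets (F (ennreal t))"
   using A t by (intro measurable_sets) (auto simp: adapted_def)
  also have "X t -` B \<inter> space (F (ennreal t)) = (\<lambda>w. (w, t)) -` A \<inter> space (F (ennreal t))"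
   using t by (auto simp: A(1) space_F)
  finally show "(\<lambda>w. (w, t)) -` A \<inter> space (F (ennreal t)) \<in> sets (F (ennreal t))" .
 qed (use t in \<open>auto simp: space_F\<close>)
 from measurable_compose[OF this assms[unfolded optional_process_def]]
 show "Y t \<in> Borel (F (ennreal t))" by simp
qed

end

section \<open>Cobb-Douglas utility\<close>

text \<open>Weighted arithmetic-geometric inequality with weights \<open>\<alpha>\<close>, \<open>\<beta>\<close>, \<open>1 - \<alpha> - \<beta>\<close>.\<close>

lemma powr_tangent:
 fixes p q \<alpha> \<beta> :: real
 assumes ab: "0 < \<alpha>" "0 < \<beta>" "\<alpha> + \<beta> < 1" and pq: "0 <= p" "0 <= q"
 shows "p powr \<alpha> * q powr \<beta> <= (1 - \<alpha> - \<beta>) + \<alpha> * p + \<beta> * q"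
  and "p powr \<alpha> * q powr \<beta> = (1 - \<alpha> - \<beta>) + \<alpha> * p + \<beta> * q ==> p = 1 \<and> q = 1"
proof -
 define s where "s = (1 - \<alpha> - \<beta>) + \<alpha> * p + \<beta> * q"
 have s: "0 < s" using ab pq by (auto simp: s_def intro!: add_pos_nonneg)
 have main: "p powr \<alpha> * q powr \<beta> <= s \<and> (p powr \<alpha> * q powr \<beta> = s \<longrightarrow> p = 1 \<and> q = 1)"
 proof (cases "p = 0 \<or> q = 0")
  case True
  then show ?thesis using s by auto
 next
  case False
  then have pos: "0 < p" "0 < q" using pq by auto
  have lnle: "ln y <= y - 1" if "0 < y" for y :: real
   using ln_le_minus_one[OF that] .
  \<comment> \<open>Division by the weighted mean \<open>s\<close> gives the three arguments the
    mean 1, so the tangents to \<open>ln\<close> at 1 add up to 0. Equality overall forces equality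
    in each tangent.\<close>
  have "\<alpha> * ln (p / s) + \<beta> * ln (q / s) + (1 - \<alpha> - \<beta>) * ln (1 / s)
    <= \<alpha> * (p / s - 1) + \<beta> * (q / s - 1) + (1 - \<alpha> - \<beta>) * (1 / s - 1)"
   using ab pos s by (intro add_mono mult_left_mono lnle) auto
  also have "... = (\<alpha> * p + \<beta> * q + (1 - \<alpha> - \<beta>)) / s - 1"
   by (simp add: add_divide_distrib diff_divide_distrib algebra_simps)
  also have "... = 0" using s by (simp add: s_def add.commute add.left_commute)
  finally have le0: "\<alpha> * ln (p / s) + \<beta> * ln (q / s) + (1 - \<alpha> - \<beta>) * ln (1 / s) <= 0" .
  have lhs: "\<alpha> * ln (p / s) + \<beta> * ln (q / s) + (1 - \<alpha> - \<beta>) * ln (1 / s) = \<alpha> * ln p + \<beta> * ln q - ln s"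
   using pos s by (simp add: ln_div algebra_simps)
  have pw: "p powr \<alpha> * q powr \<beta> = exp (\<alpha> * ln p + \<beta> * ln q)"
   using pos by (simp add: powr_def exp_add)
  have "exp (\<alpha> * ln p + \<beta> * ln q) <= exp (ln s)" using le0 lhs by simp
  then have 1: "p powr \<alpha> * q powr \<beta> <= s" using s pw by simp
  moreover have "p = 1 \<and> q = 1" if eq: "p powr \<alpha> * q powr \<beta> = s"
  proof -
   have "ln s = \<alpha> * ln p + \<beta> * ln q" using eq pw by (metis ln_exp)
   then have sum0: "\<alpha> * (p / s - 1 - ln (p / s)) + \<beta> * (q / s - 1 - ln (q / s)) + (1 - \<alpha> - \<beta>) * (1 / s - 1 - ln (1 / s)) = 0"
    using lhs \<open>\<alpha> * (p / s - 1) + \<beta> * (q / s - 1) + (1 - \<alpha> - \<beta>) * (1 / s - 1) = _\<close> \<open>(\<alpha> * p + \<beta> * q + (1 - \<alpha> - \<beta>)) / s - 1 = 0\<close>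
    by (simp add: right_diff_distrib)
   have nn: "0 <= y - 1 - ln y" if "0 < y" for y :: real using lnle[OF that] by simp
   have "0 <= \<alpha> * (p / s - 1 - ln (p / s))" "0 <= \<beta> * (q / s - 1 - ln (q / s))" "0 <= (1 - \<alpha> - \<beta>) * (1 / s - 1 - ln (1 / s))"
    using ab pos s by (auto intro!: mult_nonneg_nonneg nn)
   then have "\<alpha> * (p / s - 1 - ln (p / s)) = 0" "\<beta> * (q / s - 1 - ln (q / s)) = 0" "(1 - \<alpha> - \<beta>) * (1 / s - 1 - ln (1 / s)) = 0"
    using sum0 by linarith+
   then have "ln (p / s) = p / s - 1" "ln (q / s) = q / s - 1" "ln (1 / s) = 1 / s - 1"
    using ab by auto
   then have "p / s = 1" "q / s = 1" "1 / s = 1"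
    using ln_eq_minus_one[of "p / s"] ln_eq_minus_one[of "q / s"] ln_eq_minus_one[of "1 / s"] pos s by simp_all
   then show ?thesis using s by simp
  qed
  ultimately show ?thesis by blast
 qed
 then show "p powr \<alpha> * q powr \<beta> <= (1 - \<alpha> - \<beta>) + \<alpha> * p + \<beta> * q"
  and "p powr \<alpha> * q powr \<beta> = (1 - \<alpha> - \<beta>) + \<alpha> * p + \<beta> * q ==> p = 1 \<and> q = 1"
  by (auto simp: s_def)
qed

text \<open>The supporting hyperplane at \<open>(x, c)\<close>, obtained from
  \<open>powr_tangent\<close> by scaling. The equality case is the strict concavity on which
  uniqueness rests.\<close>

lemma cobb_douglas_tangent:
 fixes x c y d \<alpha> \<beta> :: real
 assumes ab: "0 < \<alpha>" "0 < \<beta>" "\<alpha> + \<beta> < 1" and pos: "0 < x" "0 < c" and nn: "0 <= y" "0 <= d"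
 shows "cobb_douglas \<alpha> \<beta> y d <= cobb_douglas \<alpha> \<beta> x c * ((1 - \<alpha> - \<beta>) + \<alpha> * (y / x) + \<beta> * (d / c))"
  and "cobb_douglas \<alpha> \<beta> y d = cobb_douglas \<alpha> \<beta> x c * ((1 - \<alpha> - \<beta>) + \<alpha> * (y / x) + \<beta> * (d / c)) ==> y = x \<and> d = c"
proof -
 have u: "0 < cobb_douglas \<alpha> \<beta> x c" using pos ab by (simp add: cobb_douglas_def)
 have eq: "cobb_douglas \<alpha> \<beta> y d = cobb_douglas \<alpha> \<beta> x c * ((y / x) powr \<alpha> * (d / c) powr \<beta>)"
  using pos nn by (simp add: cobb_douglas_def powr_divide)
 have nn': "0 <= y / x" "0 <= d / c" using pos nn by auto
 show "cobb_douglas \<alpha> \<beta> y d <= cobb_douglas \<alpha> \<beta> x c * ((1 - \<alpha> - \<beta>) + \<alpha> * (y / x) + \<beta> * (d / c))"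
  unfolding eq using u by (intro mult_left_mono powr_tangent(1)[OF ab nn']) simp
 assume "cobb_douglas \<alpha> \<beta> y d = cobb_douglas \<alpha> \<beta> x c * ((1 - \<alpha> - \<beta>) + \<alpha> * (y / x) + \<beta> * (d / c))"
 then have "(y / x) powr \<alpha> * (d / c) powr \<beta> = (1 - \<alpha> - \<beta>) + \<alpha> * (y / x) + \<beta> * (d / c)"
  unfolding eq using u by simp
 then show "y = x \<and> d = c" using powr_tangent(2)[OF ab nn'] pos by simp
qed

section \<open>Additivity of Stieltjes measures\<close>

text \<open>The sum measure is identified on half-open intervals; induction over measurable
  functions carries additivity over to integrals.\<close>

lemma nn_integral_interval_measure_add:
 assumes F: "\<And>x y. x <= y ==> F x <= F y" "\<And>a. continuous (at_right a) F"
  and G: "\<And>x y. x <= y ==> G x <= G y" "\<And>a. continuous (at_right a) G"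
  and f: "f \<in> Borel borel"
 shows "(\<integral>\<^sup>+t. f t \<partial>interval_measure (\<lambda>t. F t + G t)) = (\<integral>\<^sup>+t. f t \<partial>interval_measure F) + (\<integral>\<^sup>+t. f t \<partial>interval_measure G)"
proof -
 define N where "N = measure_of UNIV (sets borel) (\<lambda>A. emeasure (interval_measure F) A + emeasure (interval_measure G) A)"
 have sets_N: "sets N = sets borel" and space_N: "space N = UNIV"
  unfolding N_def by (simp_all add: sets_measure_of_conv space_measure_of_conv sets.sigma_sets_eq[of borel, simplified])
 have em: "emeasure N A = emeasure (interval_measure F) A + emeasure (interval_measure G) A" if "A \<in> sets borel" for A
 proof (rule emeasure_measure_of[OF N_def])
  show "countably_additive (sets N) (\<lambda>A. emeasure (interval_measure F) A + emeasure (interval_measure G) A)"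
   unfolding countably_additive_def sets_N
   by (auto simp: suminf_add[symmetric] suminf_emeasure)
 qed (use that in \<open>auto simp: positive_def sets_N\<close>)
 have eq: "interval_measure (\<lambda>t. F t + G t) = N"
 proof (rule interval_measure_eqI)
  show "emeasure N {a<..b} = ennreal (F b + G b - (F a + G a))" if "a <= b" for a b
   using that F(1)[OF that] G(1)[OF that]
   by (simp add: em emeasure_interval_measure_Ioc[OF _ F] emeasure_interval_measure_Ioc[OF _ G] ennreal_plus[symmetric] algebra_simps del: ennreal_plus)
 qed (auto intro!: add_mono F G continuous_intros sets_N)
 have "f \<in> Borel N" using f sets_N by (simp cong: measurable_cong_sets)
 then have "(\<integral>\<^sup>+t. f t \<partial>N) = (\<integral>\<^sup>+t. f t \<partial>interval_measure F) + (\<integral>\<^sup>+t. f t \<partial>interval_measure G)"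
 proof (induction rule: borel_measurable_induct)
  case (cong f g)
  have "f = g" using cong(3) space_N by auto
  then show ?case using cong(4) by simp
 next
  case (set A)
  then have "A \<in> sets borel" by (simp add: sets_N)
  then show ?case using set by (simp add: em)
 next
  case (mult u c)
  then have "u \<in> Borel borel" using sets_N by (simp cong: measurable_cong_sets)
  then show ?case using mult by (simp add: nn_integral_cmult distrib_left)
 next
  case (add u v)
  then have "u \<in> Borel borel" "v \<in> Borel borel" using sets_N by (simp_all cong: measurable_cong_sets)
  then show ?case using add by (simp add: nn_integral_add algebra_simps)
 next
  case (seq U)
  have U: "U i \<in> Borel borel" for i using seq(1)[of i] sets_N by (simp cong: measurable_cong_sets)
  have inc: "incseq (\<lambda>i. \<integral>\<^sup>+x. U i x \<partial>interval_measure F)" "incseq (\<lambda>i. \<integral>\<^sup>+x. U i x \<partial>interval_measure G)"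
   using seq(3) by (auto intro!: incseq_SucI nn_integral_mono simp: incseq_Suc_iff le_fun_def)
  have "(\<integral>\<^sup>+x. (SUP i. U i) x \<partial>K) = (SUP i. \<integral>\<^sup>+x. U i x \<partial>K)" if "sets K = sets borel" for K :: "real measure"
   using U seq(3) that unfolding SUP_apply by (intro nn_integral_monotone_convergence_SUP) (auto cong: measurable_cong_sets)
  then show ?case using seq.IH inc by (simp add: sets_N ennreal_SUP_add image_comp)
 qed
 then show ?thesis by (simp add: eq)
qed

section \<open>First order conditions and equilibrium\<close>

text \<open>If a concave perturbation of the weight never raises its integral, then its derivative at \<open>0\<close>
 has nonpositive integral; the difference quotients are bounded below, so Fatou applies.\<close>

lemma nn_integral_perturbation_le:
 fixes T :: "'b measure" and g \<xi> :: "'b => real" and \<rho> s :: real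
 assumes \<rho>: "0 < \<rho>" "\<rho> < 1" and s: "0 < s" "s <= 1"
  and g: "g \<in> Borel T" and \<xi>: "\<xi> \<in> Borel T"
  and nn: "\<And>p. p \<in> space T ==> 0 <= g p" "\<And>p. p \<in> space T ==> 0 <= \<xi> p"
  and fin: "(\<integral>\<^sup>+p. ennreal (g p) \<partial>T) < \<top>"
  and le: "\<And>q. 0 < q ==> q < 1 ==> (\<integral>\<^sup>+p. ennreal (g p * (1 - q * s + q * s * \<xi> p) powr \<rho>) \<partial>T) <= (\<integral>\<^sup>+p. ennreal (g p) \<partial>T)"
 shows "(\<integral>\<^sup>+p. ennreal (g p * \<xi> p) \<partial>T) <= (\<integral>\<^sup>+p. ennreal (g p) \<partial>T)"
proof -
 define U where "U = enn2real (\<integral>\<^sup>+p. ennreal (g p) \<partial>T)"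
 have U: "(\<integral>\<^sup>+p. ennreal (g p) \<partial>T) = ennreal U" and U0: "0 <= U" using fin by (auto simp: U_def)
 \<comment> \<open>The shift by 2 keeps the step strictly between 0 and 1.\<close>
 define q where "q i = 1 / real (i + 2)" for i :: nat
 have q: "0 < q i" "q i < 1" for i by (auto simp: q_def field_simps)
 have q0: "q \<longlonglongrightarrow> 0" unfolding q_def by real_asymp
 \<comment> \<open>The comparison value is that for \<open>\<xi> p = 0\<close> instead of 1. This
   makes the quotient nonnegative; the difference of the two baselines is a constant whose quotient
   converges to \<open>\<rho> * s\<close>.\<close>
 define f where "f i p = ((1 - q i * s + q i * s * \<xi> p) powr \<rho> - (1 - q i * s) powr \<rho>) / q i" for i p
 have qs: "q i * s < 1" for i
 proof -
  have "q i * s <= q i * 1" using q[of i] s by (intro mult_left_mono) auto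
  also have "... < 1" using q[of i] by simp
  finally show ?thesis .
 qed
 have f0: "0 <= f i p" if "p \<in> space T" for i p
  unfolding f_def using q[of i] qs[of i] s nn(2)[OF that] \<rho> by (intro divide_nonneg_pos) (auto intro!: powr_mono2)
 have lim: "(\<lambda>i. f i p) \<longlonglongrightarrow> \<rho> * s * \<xi> p" if "p \<in> space T" for p
 proof -
  have "((\<lambda>x. (1 - x * s + x * s * \<xi> p) powr \<rho> - (1 - x * s) powr \<rho>) has_real_derivative \<rho> * s * \<xi> p) (at 0)"
   by (auto intro!: derivative_eq_intros simp: algebra_simps)
  then have "((\<lambda>h. ((1 - h * s + h * s * \<xi> p) powr \<rho> - (1 - h * s) powr \<rho>) / h) \<longlongrightarrow> \<rho> * s * \<xi> p) (at 0)"
   by (simp add: DERIV_def)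
  moreover have "filterlim q (at 0) sequentially"
   using q0 q by (auto simp: filterlim_at intro!: always_eventually less_imp_neq[THEN not_sym])
  ultimately show ?thesis unfolding f_def by (rule filterlim_compose)
 qed
 have "ennreal (\<rho> * s) * (\<integral>\<^sup>+p. ennreal (g p * \<xi> p) \<partial>T) = (\<integral>\<^sup>+p. ennreal (g p * (\<rho> * s * \<xi> p)) \<partial>T)"
  using g \<xi> \<rho> s nn by (subst nn_integral_cmult[symmetric])
    (auto intro!: nn_integral_cong simp: ennreal_mult[symmetric] algebra_simps)
 also have "... = (\<integral>\<^sup>+p. liminf (\<lambda>i. ennreal (g p * f i p)) \<partial>T)"
 proof (intro nn_integral_cong)
  fix p assume "p \<in> space T"
  then have "(\<lambda>i. ennreal (g p * f i p)) \<longlonglongrightarrow> ennreal (g p * (\<rho> * s * \<xi> p))"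
   by (intro tendsto_ennrealI tendsto_mult tendsto_const lim)
  from lim_imp_Liminf[OF _ this]
  show "ennreal (g p * (\<rho> * s * \<xi> p)) = liminf (\<lambda>i. ennreal (g p * f i p))" by simp
 qed
 also have "... <= liminf (\<lambda>i. \<integral>\<^sup>+p. ennreal (g p * f i p) \<partial>T)"
  using g \<xi> by (intro nn_integral_liminf) (auto simp: f_def)
 also have "... <= liminf (\<lambda>i. ennreal (U * ((1 - (1 - q i * s) powr \<rho>) / q i)))"
 proof (intro Liminf_mono always_eventually allI)
  fix i
  let ?c = "(1 - q i * s) powr \<rho>"
  have c: "0 <= ?c" "?c <= 1" using qs[of i] q[of i] s \<rho> by (auto intro!: powr_le1)
  have "ennreal (q i) * (\<integral>\<^sup>+p. ennreal (g p * f i p) \<partial>T) + ennreal (?c * U)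
   = (\<integral>\<^sup>+p. ennreal (q i) * ennreal (g p * f i p) \<partial>T) + (\<integral>\<^sup>+p. ennreal ?c * ennreal (g p) \<partial>T)"
   using g \<xi> c by (simp add: nn_integral_cmult f_def U ennreal_mult[OF c(1) U0])
  also have "... = (\<integral>\<^sup>+p. ennreal (q i) * ennreal (g p * f i p) + ennreal ?c * ennreal (g p) \<partial>T)"
   using g \<xi> by (intro nn_integral_add[symmetric]) (auto simp: f_def)
  also have "... = (\<integral>\<^sup>+p. ennreal (g p * (1 - q i * s + q i * s * \<xi> p) powr \<rho>) \<partial>T)"
  proof (intro nn_integral_cong)
   fix p assume p: "p \<in> space T"
   have "ennreal (q i) * ennreal (g p * f i p) + ennreal ?c * ennreal (g p) = ennreal (q i * (g p * f i p) + ?c * g p)"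
    using q[of i] nn(1)[OF p] f0[OF p, of i] c by (simp add: ennreal_mult[symmetric] ennreal_plus[symmetric] del: ennreal_plus)
   also have "q i * (g p * f i p) + ?c * g p = g p * (1 - q i * s + q i * s * \<xi> p) powr \<rho>"
    using q[of i] by (simp add: f_def field_simps)
   finally show "ennreal (q i) * ennreal (g p * f i p) + ennreal ?c * ennreal (g p) = ennreal (g p * (1 - q i * s + q i * s * \<xi> p) powr \<rho>)" .
  qed
  also have "... <= ennreal U" using le[OF q] by (simp add: U)
  finally have *: "ennreal (q i) * (\<integral>\<^sup>+p. ennreal (g p * f i p) \<partial>T) + ennreal (?c * U) <= ennreal U" .
  have "(\<integral>\<^sup>+p. ennreal (g p * f i p) \<partial>T) \<noteq> \<top>"
  proof
   assume "(\<integral>\<^sup>+p. ennreal (g p * f i p) \<partial>T) = \<top>"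
   with * q[of i] show False by (simp add: ennreal_mult_top top_unique)
  qed
  then obtain I where I: "(\<integral>\<^sup>+p. ennreal (g p * f i p) \<partial>T) = ennreal I" "0 <= I"
   by (cases "(\<integral>\<^sup>+p. ennreal (g p * f i p) \<partial>T)") auto
  have "q i * I + ?c * U <= U"
   using * I(2) q[of i] c U0 unfolding I(1) by (simp add: ennreal_mult[symmetric] ennreal_plus[symmetric] del: ennreal_plus)
  then have "I <= U * ((1 - ?c) / q i)"
   using q[of i] by (simp add: field_simps)
  then show "(\<integral>\<^sup>+p. ennreal (g p * f i p) \<partial>T) <= ennreal (U * ((1 - ?c) / q i))"
   unfolding I(1) by (rule ennreal_leI)
 qed
 also have "... = ennreal (U * (\<rho> * s))"
 proof -
  have "((\<lambda>x. - ((1 - x * s) powr \<rho>)) has_real_derivative \<rho> * s) (at 0)"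
   by (auto intro!: derivative_eq_intros)
  then have "((\<lambda>h. (1 - (1 - h * s) powr \<rho>) / h) \<longlongrightarrow> \<rho> * s) (at 0)"
   by (simp add: DERIV_def)
  moreover have "filterlim q (at 0) sequentially"
   using q0 q by (auto simp: filterlim_at intro!: always_eventually less_imp_neq[THEN not_sym])
  ultimately have "(\<lambda>i. (1 - (1 - q i * s) powr \<rho>) / q i) \<longlonglongrightarrow> \<rho> * s" by (rule filterlim_compose)
  then have "(\<lambda>i. ennreal (U * ((1 - (1 - q i * s) powr \<rho>) / q i))) \<longlonglongrightarrow> ennreal (U * (\<rho> * s))"
   by (intro tendsto_ennrealI tendsto_mult tendsto_const)
  from lim_imp_Liminf[OF _ this] show ?thesis by simp
 qed
 also have "... = ennreal (\<rho> * s) * ennreal U" using U0 \<rho> s by (simp add: ennreal_mult[symmetric] mult.commute)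
 finally show ?thesis using \<rho> s unfolding U by (simp add: ennreal_mult_le_mult_iff)
qed

section \<open>Scaling of Cobb-Douglas payoffs and budget shares\<close>

lemma cobb_douglas_nonneg: "0 < \<alpha> ==> 0 < \<beta> ==> 0 <= cobb_douglas \<alpha> \<beta> x c"
 by (simp add: cobb_douglas_def)

lemma cobb_douglas_mono:
 "0 < \<alpha> ==> 0 < \<beta> ==> 0 <= x ==> x <= y ==> 0 <= c ==> c <= d ==> cobb_douglas \<alpha> \<beta> x c <= cobb_douglas \<alpha> \<beta> y d"
 unfolding cobb_douglas_def by (intro divide_right_mono mult_mono powr_mono2) auto

lemma cobb_douglas_pos: "0 < \<alpha> ==> 0 < \<beta> ==> 0 < x ==> 0 < c ==> 0 < cobb_douglas \<alpha> \<beta> x c"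
 by (simp add: cobb_douglas_def)

lemma cobb_douglas_scale:
 "0 <= p ==> 0 <= q ==> 0 <= x ==> 0 <= c ==> cobb_douglas \<alpha> \<beta> (p * x) (q * c) = p powr \<alpha> * q powr \<beta> * cobb_douglas \<alpha> \<beta> x c"
 by (simp add: cobb_douglas_def powr_mult)

lemma cobb_douglas_measurable [measurable]:
 assumes [measurable]: "x \<in> Borel T" "c \<in> Borel T"
 shows "(\<lambda>p. cobb_douglas \<alpha> \<beta> (x p) (c p)) \<in> Borel T"
 unfolding cobb_douglas_def by measurable

text \<open>Rescaling one's own consumption by \<open>p\<close> and contribution by
  \<open>q\<close>, while the other \<open>n - 1\<close> equal contributions stay, multiplies the
  payoff by the expression in \<open>opt\<close>. Optimality of \<open>p = q = 1\<close> exhausts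
  the budget and forces the derivative along the budget line to vanish.\<close>

lemma cobb_douglas_budget_shares:
 fixes \<alpha> \<beta> n wealth bx bc :: real
 assumes ab: "0 < \<alpha>" "0 < \<beta>" and n: "1 < n" and wealth: "0 < wealth" and b: "0 <= bx" "0 <= bc" "bx + bc <= wealth"
  and opt: "\<And>p q. 0 <= p ==> 0 <= q ==> p * bx + q * bc <= wealth ==> p powr \<alpha> * ((q + n - 1) / n) powr \<beta> <= 1"
 shows "bx + bc = wealth" and "n * \<alpha> * bc = \<beta> * bx"
proof -
 have "bx \<noteq> 0"
 proof
  assume "bx = 0"
  then have "2 powr \<alpha> * ((1 + n - 1) / n) powr \<beta> <= 1" using b by (intro opt) auto
  moreover have "1 < 2 powr \<alpha>" using ab by simp
  ultimately show False using n by simp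
 qed
 have "bc \<noteq> 0"
 proof
  assume "bc = 0"
  then have "1 powr \<alpha> * ((2 + n - 1) / n) powr \<beta> <= 1" using b by (intro opt) auto
  moreover have "1 < ((2 + n - 1) / n) powr \<beta>" using ab n by (intro gr_one_powr) (auto simp: field_simps)
  ultimately show False by simp
 qed
 have bx: "0 < bx" and bc: "0 < bc" using b \<open>bx \<noteq> 0\<close> \<open>bc \<noteq> 0\<close> by auto
 show sum: "bx + bc = wealth"
 proof (rule ccontr)
  assume "bx + bc \<noteq> wealth"
  then have "bx < wealth - bc" using b by simp
  then have p: "1 < (wealth - bc) / bx" using bx by simp
  have "((wealth - bc) / bx) powr \<alpha> * ((1 + n - 1) / n) powr \<beta> <= 1"
   using p bx bc by (intro opt) auto
  moreover have "1 < ((wealth - bc) / bx) powr \<alpha>" using p ab by (intro gr_one_powr) auto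
  ultimately show False using n by simp
 qed
 \<comment> \<open>Raising \<open>p\<close> at rate \<open>bc\<close> and lowering \<open>q\<close>
   at rate \<open>bx\<close> leaves expenditure unchanged.\<close>
 define f where "f s = (1 + s * bc) powr \<alpha> * ((1 - s * bx + n - 1) / n) powr \<beta>" for s
 have "(f has_real_derivative \<alpha> * bc - \<beta> * bx / n) (at 0)"
  unfolding f_def using n by (auto intro!: derivative_eq_intros simp: field_simps)
 moreover have "\<forall>s. \<bar>0 - s\<bar> < 1 / wealth \<longrightarrow> f s <= f 0"
 proof (intro allI impI)
  fix s :: real assume "\<bar>0 - s\<bar> < 1 / wealth"
  then have s: "\<bar>s\<bar> * wealth < 1" using wealth by (simp add: field_simps)
  have "\<bar>s * bx\<bar> <= \<bar>s\<bar> * wealth" "\<bar>s * bc\<bar> <= \<bar>s\<bar> * wealth"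
   using sum bx bc by (auto simp: abs_mult intro!: mult_left_mono)
  then have "0 <= 1 + s * bc" "0 <= 1 - s * bx" using s by linarith+
  moreover have "(1 + s * bc) * bx + (1 - s * bx) * bc <= wealth" using sum by (simp add: algebra_simps)
  ultimately have "f s <= 1" unfolding f_def by (rule opt)
  also have "1 = f 0" using n by (simp add: f_def)
  finally show "f s <= f 0" .
 qed
 ultimately have "\<alpha> * bc - \<beta> * bx / n = 0" using wealth by (intro DERIV_local_max[of f _ 0 "1 / wealth"]) auto
 then show "n * \<alpha> * bc = \<beta> * bx" using n by (simp add: field_simps)
qed

text \<open>The static core of the game: points \<open>p\<close> stand for pairs of an outcome and a time, \<open>l\<close> for the
 multiplier of the candidate \<open>(X, C)\<close> and \<open>m * h\<close> for its marginal utility of the public good, which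
 prices contributions at most at \<open>l * cost\<close>.\<close>

locale public_good_game =
 fixes T :: "'b measure" and e \<psi> h X C :: "'b => real" and \<alpha> \<beta> l m wealth :: real and n :: nat
  and consumption contribution :: "('b => real) => bool" and cost :: "('b => real) => ennreal"
 assumes exponents: "0 < \<alpha>" "0 < \<beta>" "\<alpha> + \<beta> < 1" and n: "1 < n" and wealth: "0 < wealth" and l: "0 < l" and m: "0 < m"
  and measurable_prices [measurable]: "e \<in> Borel T" "\<psi> \<in> Borel T" "h \<in> Borel T"
  and prices: "\<And>p. p \<in> space T ==> 0 < e p" "\<And>p. p \<in> space T ==> 0 <= \<psi> p" "\<And>p. p \<in> space T ==> 0 <= h p"
  and consumption_measurable: "\<And>x. consumption x ==> x \<in> Borel T"
  and consumption_nonneg: "\<And>x p. consumption x ==> p \<in> space T ==> 0 <= x p"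
  and consumption_add: "\<And>x y s t. consumption x ==> consumption y ==> 0 <= s ==> 0 <= t ==> consumption (\<lambda>p. s * x p + t * y p)"
  and contribution_measurable: "\<And>c. contribution c ==> c \<in> Borel T"
  and contribution_nonneg: "\<And>c p. contribution c ==> p \<in> space T ==> 0 <= c p"
  and contribution_add: "\<And>c d s t. contribution c ==> contribution d ==> 0 <= s ==> 0 <= t ==> contribution (\<lambda>p. s * c p + t * d p)"
  and cost_add: "\<And>c d s t. contribution c ==> contribution d ==> 0 <= s ==> 0 <= t ==>
   cost (\<lambda>p. s * c p + t * d p) = ennreal s * cost c + ennreal t * cost d"
  and shadow: "\<And>c. contribution c ==> ennreal m * (\<integral>\<^sup>+p. ennreal (h p * c p) \<partial>T) <= ennreal l * cost c"
  and X: "consumption X" and C: "contribution C"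
  and pos: "\<And>p. p \<in> space T ==> 0 < X p" "\<And>p. p \<in> space T ==> 0 < C p"
  and shadow_C: "ennreal m * (\<integral>\<^sup>+p. ennreal (h p * C p) \<partial>T) = ennreal l * cost C"
  and foc_X: "\<And>p. p \<in> space T ==> \<alpha> * (e p * cobb_douglas \<alpha> \<beta> (X p) (real n * C p)) = l * (\<psi> p * X p)"
  and foc_C: "\<And>p. p \<in> space T ==> \<beta> * (e p * cobb_douglas \<alpha> \<beta> (X p) (real n * C p)) = m * (h p * (real n * C p))"
  and budget: "(\<integral>\<^sup>+p. ennreal (\<psi> p * X p) \<partial>T) + cost C = ennreal wealth"
begin

abbreviation "u \<equiv> cobb_douglas \<alpha> \<beta>"

definition V :: "('b => real) => ('b => real) => ennreal" where
 "V x c = (\<integral>\<^sup>+p. ennreal (e p * u (x p) (c p)) \<partial>T)"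

definition feasible :: "('b => real) => ('b => real) => bool" where
 "feasible x c \<longleftrightarrow> consumption x \<and> contribution c \<and> (\<integral>\<^sup>+p. ennreal (\<psi> p * x p) \<partial>T) + cost c <= ennreal wealth"

lemma XC_measurable [measurable]: "X \<in> Borel T" "C \<in> Borel T"
 using consumption_measurable[OF X] contribution_measurable[OF C] by auto

lemma payoff_nonneg: "p \<in> space T ==> 0 <= e p * u x c"
 by (intro mult_nonneg_nonneg cobb_douglas_nonneg less_imp_le[OF prices(1)] exponents)

text \<open>The first order conditions turn the slopes of the supporting hyperplane at the candidate
  into the prices \<open>l * \<psi> p\<close> and \<open>m * h p\<close>.\<close>

lemma tangent:
 assumes p: "p \<in> space T" and nn: "0 <= y" "0 <= d"
 shows "e p * u y d <= (1 - \<alpha> - \<beta>) * (e p * u (X p) (real n * C p)) + l * (\<psi> p * y) + m * (h p * d)"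
  and "e p * u y d = (1 - \<alpha> - \<beta>) * (e p * u (X p) (real n * C p)) + l * (\<psi> p * y) + m * (h p * d) ==> y = X p \<and> d = real n * C p"
proof -
 let ?uXC = "u (X p) (real n * C p)"
 have P: "0 < X p" "0 < real n * C p" using pos[OF p] n by auto
 have "e p * (?uXC * ((1 - \<alpha> - \<beta>) + \<alpha> * (y / X p) + \<beta> * (d / (real n * C p))))
  = (1 - \<alpha> - \<beta>) * (e p * ?uXC) + (\<alpha> * (e p * ?uXC)) * (y / X p) + (\<beta> * (e p * ?uXC)) * (d / (real n * C p))"
  by (simp add: algebra_simps)
 also have "... = (1 - \<alpha> - \<beta>) * (e p * ?uXC) + l * (\<psi> p * y) + m * (h p * d)"
 proof -
  have "X p \<noteq> 0" using P(1) by simp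
  moreover have "real n * C p \<noteq> 0" using P(2) by (rule less_imp_neq[THEN not_sym])
  ultimately
  show ?thesis unfolding foc_X[OF p] foc_C[OF p] by (simp add: nonzero_mult_div_cancel_right del: mult_eq_0_iff)
 qed
 finally have eq: "e p * (?uXC * ((1 - \<alpha> - \<beta>) + \<alpha> * (y / X p) + \<beta> * (d / (real n * C p))))
  = (1 - \<alpha> - \<beta>) * (e p * ?uXC) + l * (\<psi> p * y) + m * (h p * d)" .
 show "e p * u y d <= (1 - \<alpha> - \<beta>) * (e p * ?uXC) + l * (\<psi> p * y) + m * (h p * d)"
  unfolding eq[symmetric] using prices(1)[OF p]
  by (intro mult_left_mono cobb_douglas_tangent(1)[OF exponents P nn]) simp
 assume "e p * u y d = (1 - \<alpha> - \<beta>) * (e p * ?uXC) + l * (\<psi> p * y) + m * (h p * d)"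
 then have "u y d = ?uXC * ((1 - \<alpha> - \<beta>) + \<alpha> * (y / X p) + \<beta> * (d / (real n * C p)))"
  unfolding eq[symmetric] using prices(1)[OF p] by simp
 then show "y = X p \<and> d = real n * C p" by (rule cobb_douglas_tangent(2)[OF exponents P nn])
qed

lemma nn_integral_tangent:
 assumes [measurable]: "y \<in> Borel T" "d \<in> Borel T"
  and nn: "\<And>p. p \<in> space T ==> 0 <= y p" "\<And>p. p \<in> space T ==> 0 <= d p"
 shows "(\<integral>\<^sup>+p. ennreal ((1 - \<alpha> - \<beta>) * (e p * u (X p) (real n * C p)) + l * (\<psi> p * y p) + m * (h p * d p)) \<partial>T)
  = ennreal (1 - \<alpha> - \<beta>) * V X (\<lambda>p. real n * C p) + ennreal l * (\<integral>\<^sup>+p. ennreal (\<psi> p * y p) \<partial>T) + ennreal m * (\<integral>\<^sup>+p. ennreal (h p * d p) \<partial>T)"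
proof -
 have "(\<integral>\<^sup>+p. ennreal ((1 - \<alpha> - \<beta>) * (e p * u (X p) (real n * C p)) + l * (\<psi> p * y p) + m * (h p * d p)) \<partial>T)
  = (\<integral>\<^sup>+p. ennreal (1 - \<alpha> - \<beta>) * ennreal (e p * u (X p) (real n * C p)) + ennreal l * ennreal (\<psi> p * y p) + ennreal m * ennreal (h p * d p) \<partial>T)"
  using exponents l m prices(2,3) nn payoff_nonneg
  by (intro nn_integral_cong) (simp add: ennreal_plus ennreal_mult)
 also have "... = ennreal (1 - \<alpha> - \<beta>) * V X (\<lambda>p. real n * C p) + ennreal l * (\<integral>\<^sup>+p. ennreal (\<psi> p * y p) \<partial>T) + ennreal m * (\<integral>\<^sup>+p. ennreal (h p * d p) \<partial>T)"
  by (simp add: nn_integral_add nn_integral_cmult V_def)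
 finally show ?thesis .
qed

lemma feasible_budget:
 assumes "feasible x c"
 obtains bx bc where "(\<integral>\<^sup>+p. ennreal (\<psi> p * x p) \<partial>T) = ennreal bx" "cost c = ennreal bc" "0 <= bx" "0 <= bc" "bx + bc <= wealth"
proof -
 let ?x = "\<integral>\<^sup>+p. ennreal (\<psi> p * x p) \<partial>T"
 have le: "?x + cost c <= ennreal wealth" using assms by (simp add: feasible_def)
 then have "?x + cost c < \<top>" by (rule order_le_less_trans) simp
 then have fin: "?x < \<top>" "cost c < \<top>" by (simp_all add: ennreal_add_less_top)
 then obtain bx bc where b: "?x = ennreal bx" "cost c = ennreal bc" "0 <= bx" "0 <= bc"
  by (cases ?x; cases "cost c") auto
 with le wealth have "bx + bc <= wealth" by (simp add: ennreal_plus[symmetric] del: ennreal_plus)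
 with b show thesis by (rule that)
qed

lemma feasible_XC: "feasible X C"
 using X C budget by (simp add: feasible_def)

text \<open>Integrating the two first order conditions expresses both expenditures through the value
  \<open>v\<close>. Finite expenditure then makes \<open>v\<close> finite, and a vanishing
  \<open>v\<close> would contradict positive wealth.\<close>

lemma shares:
 obtains v bX bC where "V X (\<lambda>p. real n * C p) = ennreal v" "0 <= v" "0 < bX" "0 < bC"
  "(\<integral>\<^sup>+p. ennreal (\<psi> p * X p) \<partial>T) = ennreal bX" "cost C = ennreal bC" "bX + bC = wealth"
  "\<alpha> * v = l * bX" "\<beta> * v = real n * (l * bC)"
proof -
 let ?V = "V X (\<lambda>p. real n * C p)"
 obtain bX bC where b: "(\<integral>\<^sup>+p. ennreal (\<psi> p * X p) \<partial>T) = ennreal bX" "cost C = ennreal bC" "0 <= bX" "0 <= bC" "bX + bC <= wealth"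
  by (rule feasible_budget[OF feasible_XC])
 have sum: "bX + bC = wealth" using budget b wealth by (simp add: ennreal_plus[symmetric] del: ennreal_plus)
 have a: "ennreal \<alpha> * ?V = ennreal l * ennreal bX"
  unfolding V_def b(1)[symmetric] using exponents l
  by (simp add: nn_integral_cmult[symmetric] ennreal_mult''[symmetric] ennreal_mult'[symmetric] foc_X cong: nn_integral_cong_simp)
 have "ennreal \<beta> * ?V = (\<integral>\<^sup>+p. ennreal (real n) * (ennreal m * ennreal (h p * C p)) \<partial>T)"
  unfolding V_def using exponents m n
  by (subst nn_integral_cmult[symmetric]) (auto simp: ennreal_mult'[symmetric] foc_C mult.left_commute intro!: nn_integral_cong)
 also have "... = ennreal (real n) * (ennreal l * ennreal bC)"
  using shadow_C b(2) by (simp add: nn_integral_cmult)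
 finally have c: "ennreal \<beta> * ?V = ennreal (real n) * (ennreal l * ennreal bC)" .
 have "?V \<noteq> \<top>"
 proof
  assume "?V = \<top>"
  with a exponents have "ennreal l * ennreal bX = \<top>" by (simp add: ennreal_mult_top)
  then show False by (simp add: ennreal_mult_eq_top_iff)
 qed
 then obtain v where v: "?V = ennreal v" "0 <= v" by (cases ?V) auto
 have av: "\<alpha> * v = l * bX" using a v b(3) l exponents by (simp add: ennreal_mult[symmetric])
 have bv: "\<beta> * v = real n * (l * bC)" using c v b(4) l exponents n by (simp add: ennreal_mult[symmetric])
 have "v \<noteq> 0" using av bv l n sum wealth by auto
 then have "0 < \<alpha> * v" "0 < \<beta> * v" using v exponents by auto
 then have "0 < bX" "0 < bC" using av bv l n by (auto simp: zero_less_mult_iff)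
 with v b sum av bv show thesis by (intro that)
qed

text \<open>The integrated tangent inequality, with \<open>shadow\<close> replacing the marginal
  value of contributions by their cost. It bounds values by quantities linear in
  expenditure.\<close>

lemma V_le:
 assumes x: "consumption x" and c: "contribution c" "contribution d" and s: "0 <= s" "0 <= t"
 shows "V x (\<lambda>p. s * c p + t * d p) <= ennreal (1 - \<alpha> - \<beta>) * V X (\<lambda>p. real n * C p)
  + ennreal l * (\<integral>\<^sup>+p. ennreal (\<psi> p * x p) \<partial>T) + ennreal l * (ennreal s * cost c + ennreal t * cost d)"
proof -
 have cd: "contribution (\<lambda>p. s * c p + t * d p)" by (rule contribution_add[OF c s])
 note [measurable] = consumption_measurable[OF x] contribution_measurable[OF cd]
 have "V x (\<lambda>p. s * c p + t * d p)
  <= (\<integral>\<^sup>+p. ennreal ((1 - \<alpha> - \<beta>) * (e p * u (X p) (real n * C p)) + l * (\<psi> p * x p) + m * (h p * (s * c p + t * d p))) \<partial>T)"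
  unfolding V_def by (intro nn_integral_mono ennreal_leI tangent(1) consumption_nonneg[OF x] contribution_nonneg[OF cd])
 also have "... = ennreal (1 - \<alpha> - \<beta>) * V X (\<lambda>p. real n * C p) + ennreal l * (\<integral>\<^sup>+p. ennreal (\<psi> p * x p) \<partial>T)
   + ennreal m * (\<integral>\<^sup>+p. ennreal (h p * (s * c p + t * d p)) \<partial>T)"
  by (intro nn_integral_tangent consumption_nonneg[OF x] contribution_nonneg[OF cd]) measurable
 also have "... <= ennreal (1 - \<alpha> - \<beta>) * V X (\<lambda>p. real n * C p) + ennreal l * (\<integral>\<^sup>+p. ennreal (\<psi> p * x p) \<partial>T)
   + ennreal l * (ennreal s * cost c + ennreal t * cost d)"
  using shadow[OF cd] unfolding cost_add[OF c s] by (rule add_left_mono)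
 finally show ?thesis .
qed

text \<open>In \<open>V_le\<close> the others' contributions enter with cost
  \<open>(real n - 1) * bC\<close>. By \<open>shares\<close>, the bound equals \<open>v\<close> when
  the deviating agent spends the whole wealth, however it is divided between the goods.\<close>

lemma nash:
 assumes "feasible x c"
 shows "V x (\<lambda>p. c p + (real n - 1) * C p) <= V X (\<lambda>p. real n * C p)"
proof -
 obtain v bX bC where v: "V X (\<lambda>p. real n * C p) = ennreal v" "0 <= v" "0 < bX" "0 < bC"
  "(\<integral>\<^sup>+p. ennreal (\<psi> p * X p) \<partial>T) = ennreal bX" "cost C = ennreal bC" "bX + bC = wealth"
  "\<alpha> * v = l * bX" "\<beta> * v = real n * (l * bC)" by (rule shares)
 obtain bx bc where b: "(\<integral>\<^sup>+p. ennreal (\<psi> p * x p) \<partial>T) = ennreal bx" "cost c = ennreal bc" "0 <= bx" "0 <= bc" "bx + bc <= wealth"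
  by (rule feasible_budget[OF assms])
 have "V x (\<lambda>p. 1 * c p + (real n - 1) * C p) <= ennreal (1 - \<alpha> - \<beta>) * V X (\<lambda>p. real n * C p)
  + ennreal l * (\<integral>\<^sup>+p. ennreal (\<psi> p * x p) \<partial>T) + ennreal l * (ennreal 1 * cost c + ennreal (real n - 1) * cost C)"
  using assms C n by (intro V_le) (auto simp: feasible_def)
 also have "... = ennreal ((1 - \<alpha> - \<beta>) * v + l * bx + l * (bc + (real n - 1) * bC))"
  using v(1,2,4,6) b(1-4) exponents l n by (simp add: ennreal_mult[symmetric] ennreal_plus[symmetric] del: ennreal_plus)
 also have "... <= ennreal v"
 proof (rule ennreal_leI)
  have "l * (bx + bc) <= l * (bX + bC)" using b(5) v(7) l by simp
  moreover have "(1 - \<alpha> - \<beta>) * v = v - \<alpha> * v - \<beta> * v" by (simp add: algebra_simps)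
  ultimately show "(1 - \<alpha> - \<beta>) * v + l * bx + l * (bc + (real n - 1) * bC) <= v"
   unfolding v(8,9) by (simp add: algebra_simps)
 qed
 finally show ?thesis by (simp add: v(1))
qed

lemma spend_mix:
 assumes "consumption x" "consumption y" "0 <= s" "0 <= t"
 shows "(\<integral>\<^sup>+p. ennreal (\<psi> p * (s * x p + t * y p)) \<partial>T) = ennreal s * (\<integral>\<^sup>+p. ennreal (\<psi> p * x p) \<partial>T) + ennreal t * (\<integral>\<^sup>+p. ennreal (\<psi> p * y p) \<partial>T)"
proof -
 note [measurable] = consumption_measurable[OF assms(1)] consumption_measurable[OF assms(2)]
 have "(\<integral>\<^sup>+p. ennreal (\<psi> p * (s * x p + t * y p)) \<partial>T) = (\<integral>\<^sup>+p. ennreal s * ennreal (\<psi> p * x p) + ennreal t * ennreal (\<psi> p * y p) \<partial>T)"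
  using assms(3,4) prices(2) consumption_nonneg[OF assms(1)] consumption_nonneg[OF assms(2)]
  by (intro nn_integral_cong) (simp add: ennreal_mult[symmetric] ennreal_plus[symmetric] algebra_simps del: ennreal_plus)
 then show ?thesis by (simp add: nn_integral_add nn_integral_cmult)
qed

lemma feasible_mix:
 assumes f: "feasible x c" "feasible y d" and q: "0 < q" "q < 1"
 shows "feasible (\<lambda>p. (1 - q) * x p + q * y p) (\<lambda>p. (1 - q) * c p + q * d p)"
proof -
 obtain bx bc where b: "(\<integral>\<^sup>+p. ennreal (\<psi> p * x p) \<partial>T) = ennreal bx" "cost c = ennreal bc" "0 <= bx" "0 <= bc" "bx + bc <= wealth"
  by (rule feasible_budget[OF f(1)])
 obtain b'x b'c where b': "(\<integral>\<^sup>+p. ennreal (\<psi> p * y p) \<partial>T) = ennreal b'x" "cost d = ennreal b'c" "0 <= b'x" "0 <= b'c" "b'x + b'c <= wealth"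
  by (rule feasible_budget[OF f(2)])
 have fs: "consumption x" "contribution c" "consumption y" "contribution d" using f by (auto simp: feasible_def)
 have "(1 - q) * (bx + bc) + q * (b'x + b'c) <= (1 - q) * wealth + q * wealth"
  using b(5) b'(5) q by (intro add_mono mult_left_mono) auto
 then have "((1 - q) * bx + q * b'x) + ((1 - q) * bc + q * b'c) <= wealth" by (simp add: algebra_simps)
 moreover have "(\<integral>\<^sup>+p. ennreal (\<psi> p * ((1 - q) * x p + q * y p)) \<partial>T) = ennreal ((1 - q) * bx + q * b'x)"
  using q b b' by (simp add: spend_mix fs ennreal_mult[symmetric] ennreal_plus[symmetric] del: ennreal_plus)
 moreover have "cost (\<lambda>p. (1 - q) * c p + q * d p) = ennreal ((1 - q) * bc + q * b'c)"
  using q b b' by (simp add: cost_add fs ennreal_mult[symmetric] ennreal_plus[symmetric] del: ennreal_plus)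
 moreover have "consumption (\<lambda>p. (1 - q) * x p + q * y p)" "contribution (\<lambda>p. (1 - q) * c p + q * d p)"
  using q by (auto intro: consumption_add[OF fs(1,3)] contribution_add[OF fs(2,4)])
 ultimately show ?thesis
  unfolding feasible_def using q b(3,4) b'(3,4)
  by (simp add: ennreal_plus[symmetric] ennreal_leI del: ennreal_plus)
qed

text \<open>Concavity is used at both profiles: the tangent at the equilibrium shows that its value
  is at least \<open>v\<close>, the tangent at the candidate shows that it is at most
  \<open>v\<close>. Equality in the second one then holds almost everywhere.\<close>

lemma unique:
 assumes f: "feasible x c"
  and best: "\<And>y d. feasible y d ==> V y (\<lambda>p. d p + (real n - 1) * c p) <= V x (\<lambda>p. real n * c p)"
 shows "AE p in T. x p = X p \<and> c p = C p"
proof -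
 obtain v bX bC where v: "V X (\<lambda>p. real n * C p) = ennreal v" "0 <= v" "0 < bX" "0 < bC"
  "(\<integral>\<^sup>+p. ennreal (\<psi> p * X p) \<partial>T) = ennreal bX" "cost C = ennreal bC" "bX + bC = wealth"
  "\<alpha> * v = l * bX" "\<beta> * v = real n * (l * bC)" by (rule shares)
 obtain bx bc where b: "(\<integral>\<^sup>+p. ennreal (\<psi> p * x p) \<partial>T) = ennreal bx" "cost c = ennreal bc" "0 <= bx" "0 <= bc" "bx + bc <= wealth"
  by (rule feasible_budget[OF f])
 have fs: "consumption x" "contribution c" using f by (auto simp: feasible_def)
 note [measurable] = consumption_measurable[OF fs(1)] contribution_measurable[OF fs(2)]
 have nn: "0 <= x p" "0 <= c p" if "p \<in> space T" for p
  using that consumption_nonneg[OF fs(1)] contribution_nonneg[OF fs(2)] by auto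
 have v0: "0 < v"
 proof -
  have "0 < \<alpha> * v" unfolding v(8) using l v(3) by simp
  then show ?thesis using exponents by (simp add: zero_less_mult_iff)
 qed
 have upper: "V x (\<lambda>p. real n * c p) <= ennreal ((1 - \<alpha> - \<beta>) * v + l * (bx + real n * bc))"
 proof -
  have "V x (\<lambda>p. real n * c p) = V x (\<lambda>p. 1 * c p + (real n - 1) * c p)" by (simp add: algebra_simps)
  also have "... <= ennreal (1 - \<alpha> - \<beta>) * V X (\<lambda>p. real n * C p)
   + ennreal l * (\<integral>\<^sup>+p. ennreal (\<psi> p * x p) \<partial>T) + ennreal l * (ennreal 1 * cost c + ennreal (real n - 1) * cost c)"
   using n by (intro V_le fs) auto
  also have "... = ennreal ((1 - \<alpha> - \<beta>) * v + l * bx + l * (bc + (real n - 1) * bc))"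
   using v(1,2) b exponents l n by (simp add: ennreal_mult[symmetric] ennreal_plus[symmetric] del: ennreal_plus)
  finally show ?thesis by (simp add: algebra_simps)
 qed
 then have "V x (\<lambda>p. real n * c p) < \<top>" by (rule order_le_less_trans) simp
 then obtain U where U: "V x (\<lambda>p. real n * c p) = ennreal U" "0 <= U"
  by (cases "V x (\<lambda>p. real n * c p)") auto
 define g where "g p = e p * u (x p) (real n * c p)" for p
 have g_M [measurable]: "g \<in> Borel T" unfolding g_def by measurable
 have g0: "0 <= g p" if "p \<in> space T" for p using that unfolding g_def by (rule payoff_nonneg)
 have gU: "(\<integral>\<^sup>+p. ennreal (g p) \<partial>T) = ennreal U" using U unfolding V_def g_def by simp
 \<comment> \<open>The deviation to the candidate yields at least the payoff from its own
   contribution alone, which is a positive multiple of \<open>v\<close>.\<close>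
 have U0: "0 < U"
 proof -
  have "ennreal ((1 / real n) powr \<beta>) * V X (\<lambda>p. real n * C p) = (\<integral>\<^sup>+p. ennreal ((1 / real n) powr \<beta>) * ennreal (e p * u (X p) (real n * C p)) \<partial>T)"
   unfolding V_def by (subst nn_integral_cmult) auto
  also have "... = (\<integral>\<^sup>+p. ennreal (e p * u (X p) (C p)) \<partial>T)"
  proof (intro nn_integral_cong)
   fix p assume p: "p \<in> space T"
   have "u (1 * X p) (1 / real n * (real n * C p)) = 1 powr \<alpha> * (1 / real n) powr \<beta> * u (X p) (real n * C p)"
    using pos[OF p] n by (intro cobb_douglas_scale) auto
   then have "u (X p) (C p) = (1 / real n) powr \<beta> * u (X p) (real n * C p)"
    using n by simp
   then show "ennreal ((1 / real n) powr \<beta>) * ennreal (e p * u (X p) (real n * C p)) = ennreal (e p * u (X p) (C p))"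
    by (simp add: ennreal_mult'[symmetric] mult.left_commute)
  qed
  also have "... <= V X (\<lambda>p. C p + (real n - 1) * c p)"
   unfolding V_def using n
   by (intro nn_integral_mono ennreal_leI mult_left_mono cobb_douglas_mono exponents less_imp_le[OF prices(1)] less_imp_le[OF pos(1)] less_imp_le[OF pos(2)])
     (auto simp: nn)
  also have "... <= ennreal U" using best[OF feasible_XC] U by simp
  finally have "(1 / real n) powr \<beta> * v <= U" using v(1,2) U(2) by (simp add: ennreal_mult'[symmetric])
  moreover have "0 < (1 / real n) powr \<beta> * v" using v0 n by simp
  ultimately show ?thesis by simp
 qed
 \<comment> \<open>Division by \<open>x\<close> and \<open>c\<close> below requires positivity. On
   \<open>N\<close> the payoff is 0; mixing in a fraction \<open>q\<close> of the candidate gains at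
   least \<open>q powr \<rho> * k p\<close> there and loses at most the fraction \<open>q\<close> of
   the payoff elsewhere. As \<rho> is less than 1, small \<open>q\<close> would be profitable unless
   \<open>k\<close> vanishes.\<close>
 have xc_pos: "AE p in T. 0 < x p \<and> 0 < c p"
 proof -
  define N where "N = {p \<in> space T. x p = 0 \<or> c p = 0}"
  have N [measurable]: "N \<in> sets T" unfolding N_def by measurable
  define k where "k p = indicator N p * (e p * u (X p) (C p))" for p
  have k_M [measurable]: "k \<in> Borel T" unfolding k_def by measurable
  have k0: "0 <= k p" if "p \<in> space T" for p unfolding k_def using payoff_nonneg[OF that] by simp
  define \<rho> where "\<rho> = \<alpha> + \<beta>"
  have \<rho>: "0 < \<rho>" "\<rho> < 1" using exponents by (auto simp: \<rho>_def)
  have le: "ennreal (1 - q) * ennreal U + ennreal (q powr \<rho>) * (\<integral>\<^sup>+p. ennreal (k p) \<partial>T) <= ennreal U" if q: "0 < q" "q < 1" for q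
  proof -
   have "ennreal (1 - q) * ennreal U + ennreal (q powr \<rho>) * (\<integral>\<^sup>+p. ennreal (k p) \<partial>T)
    = (\<integral>\<^sup>+p. ennreal ((1 - q) * g p + q powr \<rho> * k p) \<partial>T)"
   proof -
    have "(\<integral>\<^sup>+p. ennreal ((1 - q) * g p + q powr \<rho> * k p) \<partial>T) = (\<integral>\<^sup>+p. ennreal (1 - q) * ennreal (g p) + ennreal (q powr \<rho>) * ennreal (k p) \<partial>T)"
     using q g0 k0 by (intro nn_integral_cong) (simp add: ennreal_mult ennreal_plus)
    then show ?thesis by (simp add: nn_integral_add nn_integral_cmult gU)
   qed
   also have "... <= V (\<lambda>p. (1 - q) * x p + q * X p) (\<lambda>p. ((1 - q) * c p + q * C p) + (real n - 1) * c p)"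
    unfolding V_def
   proof (intro nn_integral_mono ennreal_leI)
    fix p assume p: "p \<in> space T"
    have ep: "0 < e p" by (rule prices(1)[OF p])
    note P = nn[OF p] pos[OF p]
    let ?y = "(1 - q) * x p + q * X p" and ?d = "((1 - q) * c p + q * C p) + (real n - 1) * c p"
    have dge: "(1 - q) * (real n * c p) <= ?d" 
    proof -
     have "0 <= q * C p + q * ((real n - 1) * c p)" using q P n by auto
     then show ?thesis by (simp add: algebra_simps)
    qed
    have dge': "q * C p <= ?d" using q P n by auto
    have yge: "(1 - q) * x p <= ?y" "q * X p <= ?y" using q P by auto
    show "(1 - q) * g p + q powr \<rho> * k p <= e p * u ?y ?d"
    proof (cases "p \<in> N")
     case True
     then have "g p = 0" using exponents by (auto simp: N_def g_def cobb_douglas_def)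
     moreover have "q powr \<rho> * u (X p) (C p) = u (q * X p) (q * C p)"
      using q P by (simp add: cobb_douglas_scale \<rho>_def powr_add)
     moreover have "... <= u ?y ?d"
      using q P yge dge' by (intro cobb_douglas_mono exponents) auto
     ultimately show ?thesis using True ep by (simp add: k_def mult.left_commute)
    next
     case False
     have "(1 - q) * u (x p) (real n * c p) <= (1 - q) powr \<rho> * u (x p) (real n * c p)"
     proof (intro mult_right_mono cobb_douglas_nonneg exponents)
      have "(1 - q) powr 1 <= (1 - q) powr \<rho>" using q \<rho> by (intro powr_mono') auto
      then show "1 - q <= (1 - q) powr \<rho>" using q by simp
     qed
     also have "... = u ((1 - q) * x p) ((1 - q) * (real n * c p))"
      using q P n by (subst cobb_douglas_scale) (auto simp: \<rho>_def powr_add)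
     also have "... <= u ?y ?d"
      using q P yge dge by (intro cobb_douglas_mono exponents) auto
     finally show ?thesis using False ep by (simp add: k_def g_def mult.left_commute)
    qed
   qed
   also have "... <= ennreal U" using best[OF feasible_mix[OF f feasible_XC q]] U by simp
   finally show ?thesis .
  qed
  have fin: "(\<integral>\<^sup>+p. ennreal (k p) \<partial>T) \<noteq> \<top>"
  proof
   assume "(\<integral>\<^sup>+p. ennreal (k p) \<partial>T) = \<top>"
   with le[of "1 / 2"] show False by (simp add: ennreal_mult_top top_unique)
  qed
  then obtain K where K: "(\<integral>\<^sup>+p. ennreal (k p) \<partial>T) = ennreal K" "0 <= K"
   by (cases "\<integral>\<^sup>+p. ennreal (k p) \<partial>T") auto
  have Kle: "K <= (1 / real (i + 2)) powr (1 - \<rho>) * U" for i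
  proof -
   define q where "q = 1 / real (i + 2)"
   have q: "0 < q" "q < 1" by (auto simp: q_def field_simps)
   have "(1 - q) * U + q powr \<rho> * K <= U"
    using le[OF q] q K U(2) by (simp add: ennreal_mult[symmetric] ennreal_plus[symmetric] del: ennreal_plus)
   then have "q powr \<rho> * K <= q * U" by (simp add: algebra_simps)
   then have "K <= q * U / q powr \<rho>" using q by (simp add: field_simps)
   also have "... = q powr (1 - \<rho>) * U" using q by (simp add: powr_diff)
   finally show ?thesis by (simp add: q_def)
  qed
  have "(\<lambda>i. (1 / real (i + 2)) powr (1 - \<rho>) * U) \<longlonglongrightarrow> 0"
  proof -
   have "(\<lambda>i. 1 / real (i + 2)) \<longlonglongrightarrow> 0" by real_asymp
   then have "(\<lambda>i. (1 / real (i + 2)) powr (1 - \<rho>)) \<longlonglongrightarrow> 0 powr (1 - \<rho>)"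
    using \<rho> by (intro tendsto_powr' tendsto_const) auto
   then show ?thesis by (intro tendsto_mult_left_zero) simp
  qed
  then have "K <= 0" by (rule LIMSEQ_le_const) (use Kle in blast)
  then have "(\<integral>\<^sup>+p. ennreal (k p) \<partial>T) = 0" using K by simp
  then have "AE p in T. ennreal (k p) = 0" by (subst (asm) nn_integral_0_iff_AE) auto
  then show ?thesis
  proof (rule AE_mp, intro AE_I2 impI)
   fix p assume p: "p \<in> space T" and "ennreal (k p) = 0"
   then have "k p = 0" using k0[OF p] by simp
   moreover have "0 < e p * u (X p) (C p)"
    using prices(1)[OF p] pos[OF p] exponents by (simp add: cobb_douglas_pos)
   ultimately have "p \<notin> N" by (auto simp: k_def)
   then show "0 < x p \<and> 0 < c p" using p nn[OF p] by (auto simp: N_def)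
  qed
 qed
 have sh: "s powr \<alpha> * ((t + real n - 1) / real n) powr \<beta> <= 1" if st: "0 <= s" "0 <= t" "s * bx + t * bc <= wealth" for s t
 proof -
  have "consumption (\<lambda>p. s * x p + 0 * x p)" "contribution (\<lambda>p. t * c p + 0 * c p)"
   by (intro consumption_add contribution_add fs st order_refl)+
  then have st_adm: "consumption (\<lambda>p. s * x p)" "contribution (\<lambda>p. t * c p)" by simp_all
  have "cost (\<lambda>p. t * c p + 0 * c p) = ennreal t * cost c + ennreal 0 * cost c"
   by (intro cost_add fs st order_refl)
  then have 1: "cost (\<lambda>p. t * c p) = ennreal (t * bc)" using b st by (simp add: ennreal_mult)
  have "(\<integral>\<^sup>+p. ennreal (\<psi> p * (s * x p)) \<partial>T) = ennreal s * (\<integral>\<^sup>+p. ennreal (\<psi> p * x p) \<partial>T)"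
   using st by (simp add: nn_integral_cmult[symmetric] ennreal_mult'[symmetric] mult.left_commute)
  then have 2: "(\<integral>\<^sup>+p. ennreal (\<psi> p * (s * x p)) \<partial>T) = ennreal (s * bx)" using b st by (simp add: ennreal_mult)
  have "feasible (\<lambda>p. s * x p) (\<lambda>p. t * c p)"
   unfolding feasible_def 1 2 using st_adm st b wealth by (simp add: ennreal_plus[symmetric] del: ennreal_plus)
  from best[OF this] have le: "V (\<lambda>p. s * x p) (\<lambda>p. t * c p + (real n - 1) * c p) <= ennreal U" by (simp add: U)
  define z where "z = s powr \<alpha> * ((t + real n - 1) / real n) powr \<beta>"
  have "V (\<lambda>p. s * x p) (\<lambda>p. t * c p + (real n - 1) * c p) = (\<integral>\<^sup>+p. ennreal z * ennreal (g p) \<partial>T)"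
   unfolding V_def
  proof (intro nn_integral_cong)
   fix p assume p: "p \<in> space T"
   have "(t + real n - 1) / real n * (real n * c p) = (t + real n - 1) * c p" using n by simp
   then have eq: "t * c p + (real n - 1) * c p = (t + real n - 1) / real n * (real n * c p)"
    by (simp add: algebra_simps)
   have "u (s * x p) (t * c p + (real n - 1) * c p) = z * u (x p) (real n * c p)"
    unfolding z_def eq by (rule cobb_douglas_scale) (use st n nn[OF p] in auto)
   moreover have "0 <= z" by (simp add: z_def)
   ultimately show "ennreal (e p * u (s * x p) (t * c p + (real n - 1) * c p)) = ennreal z * ennreal (g p)"
    using g0[OF p] by (simp add: g_def ennreal_mult[symmetric] mult.left_commute)
  qed
  also have "... = ennreal (z * U)" by (simp add: nn_integral_cmult gU ennreal_mult' z_def)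
  finally have "z * U <= 1 * U" using le U(2) by simp
  then show ?thesis using U0 unfolding z_def by (rule mult_right_le_imp_le)
 qed
 have n1: "1 < real n" using n by simp
 note bsh = cobb_douglas_budget_shares[OF exponents(1,2) n1 wealth b(3-5) sh]
 \<comment> \<open>Both pairs of expenditures solve the same two linear equations, the budget and
   the proportion of the shares.\<close>
 have eqb: "bx = bX \<and> bc = bC"
 proof -
  have "real n * \<alpha> * bC * v = \<beta> * bX * v"
  proof -
   have "real n * \<alpha> * bC * v = real n * bC * (\<alpha> * v)" by (simp add: algebra_simps)
   also have "... = bX * (\<beta> * v)" unfolding v(8,9) by (simp add: algebra_simps)
   finally show ?thesis by (simp add: algebra_simps)
  qed
  then have e1: "real n * \<alpha> * bC = \<beta> * bX" using v0 by simp
  have p: "0 < \<beta> + real n * \<alpha>" using exponents n by (simp add: add_pos_pos)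
  have "(\<beta> + real n * \<alpha>) * bc = \<beta> * (bx + bc)" using bsh(2) by (simp add: algebra_simps)
  then have "(\<beta> + real n * \<alpha>) * bc = \<beta> * wealth" using bsh(1) by simp
  have "(\<beta> + real n * \<alpha>) * bC = \<beta> * (bX + bC)" using e1 by (simp add: algebra_simps)
  then have "(\<beta> + real n * \<alpha>) * bC = \<beta> * wealth" using v(7) by simp
  with \<open>(\<beta> + real n * \<alpha>) * bc = \<beta> * wealth\<close> have "(\<beta> + real n * \<alpha>) * bc = (\<beta> + real n * \<alpha>) * bC" by simp
  then have "bc = bC" using p by simp
  then show ?thesis using bsh(1) v(7) by simp
 qed
 \<comment> \<open>Only consumption moves towards the candidate, which is affordable because both
   consumption plans cost the same.\<close>
 have dx: "(\<integral>\<^sup>+p. ennreal (g p * (X p / x p)) \<partial>T) <= ennreal U"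
  unfolding gU[symmetric]
 proof (rule nn_integral_perturbation_le[where \<rho> = \<alpha> and s = 1])
  fix q :: real assume q: "0 < q" "q < 1"
  let ?y = "\<lambda>p. (1 - q) * x p + q * X p"
  have "(\<integral>\<^sup>+p. ennreal (g p * (1 - q * 1 + q * 1 * (X p / x p)) powr \<alpha>) \<partial>T) = V ?y (\<lambda>p. c p + (real n - 1) * c p)"
   unfolding V_def
  proof (rule nn_integral_cong_AE, rule AE_mp[OF xc_pos], intro AE_I2 impI)
   fix p assume p: "p \<in> space T" and "0 < x p \<and> 0 < c p"
   then have xp: "0 < x p" "0 < c p" by auto
   have eq: "?y p = (1 - q * 1 + q * 1 * (X p / x p)) * x p" "c p + (real n - 1) * c p = 1 * (real n * c p)"
    using xp by (simp_all add: algebra_simps)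
   have "u (?y p) (c p + (real n - 1) * c p) = (1 - q * 1 + q * 1 * (X p / x p)) powr \<alpha> * 1 powr \<beta> * u (x p) (real n * c p)"
    unfolding eq by (rule cobb_douglas_scale) (use q xp pos[OF p] in auto)
   then show "ennreal (g p * (1 - q * 1 + q * 1 * (X p / x p)) powr \<alpha>) = ennreal (e p * u (?y p) (c p + (real n - 1) * c p))"
    by (simp only: powr_one_eq_one mult_1_right mult_1_left g_def mult.assoc mult.commute mult.left_commute)
  qed
  also have "... <= V x (\<lambda>p. real n * c p)"
  proof (rule best)
   have "(\<integral>\<^sup>+p. ennreal (\<psi> p * ?y p) \<partial>T) = ennreal ((1 - q) * bx + q * bX)"
    using q b v(3,5) by (simp add: spend_mix fs X ennreal_mult[symmetric] ennreal_plus[symmetric] del: ennreal_plus)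
   also have "(1 - q) * bx + q * bX = bx" using eqb by (simp add: algebra_simps)
   finally have "(\<integral>\<^sup>+p. ennreal (\<psi> p * ?y p) \<partial>T) = ennreal bx" .
   moreover have "consumption ?y" using q by (auto intro: consumption_add[OF fs(1) X])
   ultimately show "feasible ?y c" unfolding feasible_def using b(2-5) fs(2)
    by (simp add: ennreal_plus[symmetric] ennreal_leI del: ennreal_plus)
  qed
  also have "... = (\<integral>\<^sup>+p. ennreal (g p) \<partial>T)" using U gU by simp
  finally show "(\<integral>\<^sup>+p. ennreal (g p * (1 - q * 1 + q * 1 * (X p / x p)) powr \<alpha>) \<partial>T) <= (\<integral>\<^sup>+p. ennreal (g p) \<partial>T)" .
 qed (use exponents g0 nn pos in \<open>auto simp: gU less_imp_le\<close>)
 \<comment> \<open>Here \<open>s = 1 / real n\<close> is the agent's share in the aggregate. It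
   affects the speed of the perturbation but not the resulting inequality.\<close>
 have dc: "(\<integral>\<^sup>+p. ennreal (g p * (C p / c p)) \<partial>T) <= ennreal U"
  unfolding gU[symmetric]
 proof (rule nn_integral_perturbation_le[where \<rho> = \<beta> and s = "1 / real n"])
  fix q :: real assume q: "0 < q" "q < 1"
  let ?d = "\<lambda>p. (1 - q) * c p + q * C p"
  have "(\<integral>\<^sup>+p. ennreal (g p * (1 - q * (1 / real n) + q * (1 / real n) * (C p / c p)) powr \<beta>) \<partial>T) = V x (\<lambda>p. ?d p + (real n - 1) * c p)"
   unfolding V_def
  proof (rule nn_integral_cong_AE, rule AE_mp[OF xc_pos], intro AE_I2 impI)
   fix p assume p: "p \<in> space T" and "0 < x p \<and> 0 < c p"
   then have xp: "0 < x p" "0 < c p" by auto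
   let ?t = "1 - q * (1 / real n) + q * (1 / real n) * (C p / c p)"
   have "q * (1 / real n) <= 1" using q n by (simp add: field_simps)
   then have t0: "0 <= ?t" using q xp pos[OF p] by simp
   have "?t * (real n * c p) = real n * c p - q * c p + q * C p" using xp n by (simp add: field_simps)
   then have eq: "?d p + (real n - 1) * c p = ?t * (real n * c p)" by (simp add: algebra_simps)
   have "u (1 * x p) (?d p + (real n - 1) * c p) = 1 powr \<alpha> * ?t powr \<beta> * u (x p) (real n * c p)"
    unfolding eq by (rule cobb_douglas_scale) (use t0 xp in auto)
   then show "ennreal (g p * ?t powr \<beta>) = ennreal (e p * u (x p) (?d p + (real n - 1) * c p))"
    by (simp only: powr_one_eq_one mult_1_right mult_1_left g_def mult.assoc mult.commute mult.left_commute)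
  qed
  also have "... <= V x (\<lambda>p. real n * c p)"
  proof (rule best)
   have "cost ?d = ennreal ((1 - q) * bc + q * bC)"
    using q b v(4,6) by (simp add: cost_add fs C ennreal_mult[symmetric] ennreal_plus[symmetric] del: ennreal_plus)
   also have "(1 - q) * bc + q * bC = bc" using eqb by (simp add: algebra_simps)
   finally have "cost ?d = ennreal bc" .
   moreover have "contribution ?d" using q by (auto intro: contribution_add[OF fs(2) C])
   ultimately show "feasible x ?d" unfolding feasible_def using b(1,3-5) fs(1)
    by (simp add: ennreal_plus[symmetric] ennreal_leI del: ennreal_plus)
  qed
  also have "... = (\<integral>\<^sup>+p. ennreal (g p) \<partial>T)" using U gU by simp
  finally show "(\<integral>\<^sup>+p. ennreal (g p * (1 - q * (1 / real n) + q * (1 / real n) * (C p / c p)) powr \<beta>) \<partial>T) <= (\<integral>\<^sup>+p. ennreal (g p) \<partial>T)" .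
 qed (use exponents g0 nn pos n in \<open>auto simp: gU less_imp_le\<close>)
 \<comment> \<open>The tangent at the equilibrium has the weights \<alpha>, \<beta> and
   \<open>1 - \<alpha> - \<beta>\<close>; after \<open>dx\<close> and \<open>dc\<close> these
   weights of \<open>U\<close> add up to 1.\<close>
 have "v <= U"
 proof -
  have "V X (\<lambda>p. real n * C p) <= (\<integral>\<^sup>+p. ennreal (1 - \<alpha> - \<beta>) * ennreal (g p) + ennreal \<alpha> * ennreal (g p * (X p / x p)) + ennreal \<beta> * ennreal (g p * (C p / c p)) \<partial>T)"
   unfolding V_def
  proof (rule nn_integral_mono_AE, rule AE_mp[OF xc_pos], intro AE_I2 impI)
   fix p assume p: "p \<in> space T" and "0 < x p \<and> 0 < c p"
   then have xp: "0 < x p" "0 < real n * c p" using n by auto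
   have P: "0 <= X p" "0 <= real n * C p" using pos[OF p] by auto
   have "e p * u (X p) (real n * C p) <= e p * (u (x p) (real n * c p) * ((1 - \<alpha> - \<beta>) + \<alpha> * (X p / x p) + \<beta> * ((real n * C p) / (real n * c p))))"
    using prices(1)[OF p] by (intro mult_left_mono cobb_douglas_tangent(1)[OF exponents xp P]) simp
   also have "... = (1 - \<alpha> - \<beta>) * g p + \<alpha> * (g p * (X p / x p)) + \<beta> * (g p * (C p / c p))"
    using n by (simp add: g_def algebra_simps)
   finally have "ennreal (e p * u (X p) (real n * C p)) <= ennreal ((1 - \<alpha> - \<beta>) * g p + \<alpha> * (g p * (X p / x p)) + \<beta> * (g p * (C p / c p)))"
    by (rule ennreal_leI)
   also have "... = ennreal (1 - \<alpha> - \<beta>) * ennreal (g p) + ennreal \<alpha> * ennreal (g p * (X p / x p)) + ennreal \<beta> * ennreal (g p * (C p / c p))"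
   proof -
    have "0 <= g p * (X p / x p)" "0 <= g p * (C p / c p)" "0 <= g p" using g0[OF p] nn[OF p] pos[OF p] by auto
    moreover have "0 <= 1 - \<alpha> - \<beta>" "0 <= \<alpha>" "0 <= \<beta>" using exponents by auto
    ultimately show ?thesis by (simp only: ennreal_plus ennreal_mult mult_nonneg_nonneg add_nonneg_nonneg)
   qed
   finally show "ennreal (e p * u (X p) (real n * C p)) <= ennreal (1 - \<alpha> - \<beta>) * ennreal (g p) + ennreal \<alpha> * ennreal (g p * (X p / x p)) + ennreal \<beta> * ennreal (g p * (C p / c p))" .
  qed
  also have "... = ennreal (1 - \<alpha> - \<beta>) * ennreal U + ennreal \<alpha> * (\<integral>\<^sup>+p. ennreal (g p * (X p / x p)) \<partial>T) + ennreal \<beta> * (\<integral>\<^sup>+p. ennreal (g p * (C p / c p)) \<partial>T)"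
   by (simp add: nn_integral_add nn_integral_cmult gU)
  also have "... <= ennreal (1 - \<alpha> - \<beta>) * ennreal U + ennreal \<alpha> * ennreal U + ennreal \<beta> * ennreal U"
   by (intro add_mono mult_left_mono dx dc order_refl) auto
  also have "... = ennreal ((1 - \<alpha> - \<beta>) * U + \<alpha> * U + \<beta> * U)"
   using exponents U(2) by (simp add: ennreal_mult ennreal_plus)
  also have "(1 - \<alpha> - \<beta>) * U + \<alpha> * U + \<beta> * U = U" by (simp add: algebra_simps)
  finally show ?thesis using v(1) U(2) by simp
 qed
 have opt: "(1 - \<alpha> - \<beta>) * v + l * (bX + real n * bC) = v"
  using v(8,9) by (simp add: algebra_simps)
 \<comment> \<open>The tangent at the candidate dominates \<open>g\<close> pointwise, while its
   integral is at most \<open>v\<close> and hence at most the integral of \<open>g\<close>.\<close>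
 let ?t = "\<lambda>p. (1 - \<alpha> - \<beta>) * (e p * u (X p) (real n * C p)) + l * (\<psi> p * x p) + m * (h p * (real n * c p))"
 have t_le: "g p <= ?t p" if "p \<in> space T" for p
  unfolding g_def using nn[OF that] by (intro tangent(1)[OF that]) auto
 have "(\<integral>\<^sup>+p. ennreal (?t p) \<partial>T) <= ennreal v"
 proof -
  have cn: "contribution (\<lambda>p. real n * c p + 0 * c p)" by (intro contribution_add fs) auto
  have costn: "cost (\<lambda>p. real n * c p + 0 * c p) = ennreal (real n * bc)"
   using cost_add[OF fs(2) fs(2), of "real n" 0] b(2,4) by (simp add: ennreal_mult)
  have "(\<integral>\<^sup>+p. ennreal (?t p) \<partial>T) = ennreal (1 - \<alpha> - \<beta>) * V X (\<lambda>p. real n * C p) + ennreal l * (\<integral>\<^sup>+p. ennreal (\<psi> p * x p) \<partial>T) + ennreal m * (\<integral>\<^sup>+p. ennreal (h p * (real n * c p)) \<partial>T)"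
   by (rule nn_integral_tangent) (auto simp: nn)
  also have "... <= ennreal (1 - \<alpha> - \<beta>) * ennreal v + ennreal l * ennreal bx + ennreal l * ennreal (real n * bc)"
   using shadow[OF cn] unfolding costn by (intro add_mono) (auto simp: v(1) b(1))
  also have "... = ennreal ((1 - \<alpha> - \<beta>) * v + l * bx + l * (real n * bc))"
   using exponents v(2) l b by (simp add: ennreal_mult[symmetric] ennreal_plus[symmetric] del: ennreal_plus)
  also have "(1 - \<alpha> - \<beta>) * v + l * bx + l * (real n * bc) = v" using opt eqb by (simp add: algebra_simps)
  finally show ?thesis .
 qed
 then have "(\<integral>\<^sup>+p. ennreal (?t p) \<partial>T) - (\<integral>\<^sup>+p. ennreal (g p) \<partial>T) = 0"
  unfolding gU using \<open>v <= U\<close> by (intro diff_eq_0_ennreal) (auto intro: order_trans ennreal_leI order_le_less_trans)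
 then have "(\<integral>\<^sup>+p. ennreal (?t p) - ennreal (g p) \<partial>T) = 0"
  using t_le by (subst nn_integral_diff) (auto simp: gU intro!: ennreal_leI)
 then have "AE p in T. ennreal (?t p) - ennreal (g p) = 0"
  by (subst (asm) nn_integral_0_iff_AE) auto
 then show ?thesis
 proof (rule AE_mp, intro AE_I2 impI)
  fix p assume p: "p \<in> space T" and "ennreal (?t p) - ennreal (g p) = 0"
  then have "?t p - g p <= 0" using g0[OF p] by (simp add: ennreal_minus ennreal_eq_0_iff)
  then have "e p * u (x p) (real n * c p) = ?t p" using t_le[OF p] by (simp add: g_def)
  then have "x p = X p \<and> real n * c p = real n * C p"
   using nn[OF p] by (intro tangent(2)[OF p]) auto
  then show "x p = X p \<and> c p = C p" using n by simp
 qed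
qed

end

section \<open>The candidate equilibrium\<close>

lemma nn_integral_nondecreasing_path_add:
 assumes c: "nondecreasing_path c" and d: "nondecreasing_path d" and st: "0 <= s" "0 <= t"
  and f: "f \<in> Borel borel"
 shows "(\<integral>\<^sup>+u. f u \<partial>interval_measure (\<lambda>u. if u < 0 then 0 else s * c u + t * d u))
  = ennreal s * (\<integral>\<^sup>+u. f u \<partial>interval_measure (nondecreasing_path.ext c))
  + ennreal t * (\<integral>\<^sup>+u. f u \<partial>interval_measure (nondecreasing_path.ext d))"
proof -
 interpret c: nondecreasing_path c by fact
 interpret d: nondecreasing_path d by fact
 have "(\<lambda>u. if u < 0 then 0 else s * c u + t * d u) = (\<lambda>u. s * c.ext u + t * d.ext u)"
  by (auto simp: c.ext_def d.ext_def)
 then have "(\<integral>\<^sup>+u. f u \<partial>interval_measure (\<lambda>u. if u < 0 then 0 else s * c u + t * d u))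
   = (\<integral>\<^sup>+u. f u \<partial>interval_measure (\<lambda>u. s * c.ext u + t * d.ext u))" by simp
 also have "... = (\<integral>\<^sup>+u. f u \<partial>interval_measure (\<lambda>u. s * c.ext u)) + (\<integral>\<^sup>+u. f u \<partial>interval_measure (\<lambda>u. t * d.ext u))"
  using f st by (intro nn_integral_interval_measure_add mult_left_mono c.ext_mono d.ext_mono continuous_mult continuous_const c.ext_right d.ext_right)
 also have "(\<integral>\<^sup>+u. f u \<partial>interval_measure (\<lambda>u. s * c.ext u)) = ennreal s * (\<integral>\<^sup>+u. f u \<partial>interval_measure c.ext)"
  using f st by (simp add: interval_measure_cmult c.ext_mono c.ext_right nn_integral_scale_measure)
 also have "(\<integral>\<^sup>+u. f u \<partial>interval_measure (\<lambda>u. t * d.ext u)) = ennreal t * (\<integral>\<^sup>+u. f u \<partial>interval_measure d.ext)"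
  using f st by (simp add: interval_measure_cmult d.ext_mono d.ext_right nn_integral_scale_measure)
 finally show ?thesis .
qed

section \<open>The cost of contributions that follow the running minimum\<close>

context discounted_levy_pair
begin

definition cost :: "(real => 'a => real) => ennreal" where
 "cost c = (\<integral>\<^sup>+w. (\<integral>\<^sup>+t\<in>{0..}. ennreal (exp (- r * t + C t w)) \<partial>stieltjes c w) \<partial>M)"

lemma time_space_not_null: "\<not> (AE p in X.time_space. False)"
proof
 assume "AE p in X.time_space. False"
 then have "(\<integral>\<^sup>+p. ennreal (exp (- r * snd p)) \<partial>X.time_space) = (\<integral>\<^sup>+p. 0 \<partial>X.time_space)"
  by (intro nn_integral_cong_AE) auto
 moreover have "(\<integral>\<^sup>+w. (\<integral>\<^sup>+t\<in>{0..}. ennreal (exp (- r * t)) \<partial>lborel) \<partial>M) = (\<integral>\<^sup>+p. ennreal (exp (- r * snd p)) \<partial>X.time_space)"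
  by (rule X.nn_integral_time_space[where f = "\<lambda>w t. ennreal (exp (- r * t))"]) (intro X.measurable_time_space, measurable)
 ultimately show False using r nn_integral_exp_discount[OF r] by (simp add: X.emeasure_space_1)
qed

lemma time_space_measurable [measurable]:
 "(\<lambda>p. X (snd p) (fst p)) \<in> Borel X.time_space"
 "(\<lambda>p. C (snd p) (fst p)) \<in> Borel X.time_space"
 "(\<lambda>p. R (snd p) (fst p)) \<in> Borel X.time_space"
 "snd \<in> Borel X.time_space"
proof -
 show "(\<lambda>p. X (snd p) (fst p)) \<in> Borel X.time_space"
  by (intro X.right_continuous_time_space X.adaptedD adapted_X cadlag_right X.Z_cadlag)
 show "(\<lambda>p. C (snd p) (fst p)) \<in> Borel X.time_space"
  by (intro X.right_continuous_time_space X.adaptedD adapted_C cadlag_right C.Z_cadlag)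
 show "(\<lambda>p. R (snd p) (fst p)) \<in> Borel X.time_space"
  by (intro X.right_continuous_time_space X.adaptedD adapted_R cadlag_right cadlag_R)
 show "snd \<in> Borel X.time_space" by (intro X.measurable_time_space) simp
qed

lemma price_measurable:
 assumes "w \<in> space M"
 shows "(\<lambda>t. ennreal (exp (- r * t + C t w)) * indicator {0..} t) \<in> Borel borel"
proof -
 have "(\<lambda>t. ennreal (exp (- r * t + C (max 0 t) w)) * indicator {0..} t) \<in> Borel borel"
  using assms by measurable
 also have "(\<lambda>t. ennreal (exp (- r * t + C (max 0 t) w)) * indicator {0..} t) = (\<lambda>t. ennreal (exp (- r * t + C t w)) * indicator {0..} t)"
  by (auto simp: fun_eq_iff indicator_def max_absorb2)
 finally show ?thesis .
qed

lemma adapted_price: "adapted F (\<lambda>t w. exp (- r * t + C t w))"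
 unfolding adapted_def
proof (intro allI impI)
 fix t :: real assume "0 <= t"
 then have [measurable]: "C t \<in> Borel (F (ennreal t))" using adapted_C by (simp add: adapted_def)
 show "(\<lambda>w. exp (- r * t + C t w)) \<in> Borel (F (ennreal t))" by measurable
qed

lemma cadlag_price: "w \<in> space M ==> cadlag (\<lambda>t. exp (- r * t + C t w))"
proof -
 assume "w \<in> space M"
 moreover have "cadlag (\<lambda>t. - r * t)" by (intro cadlag_continuous_on continuous_intros)
 ultimately show ?thesis by (intro cadlag_exp cadlag_add C.Z_cadlag)
qed

lemma cost_measurable:
 assumes "contribution M F X C a r c"
 shows "(\<lambda>w. \<integral>\<^sup>+t\<in>{0..}. ennreal (exp (- r * t + C t w)) \<partial>stieltjes c w) \<in> Borel M"
 by (rule contribution.stieltjes_measurable[OF assms adapted_price cadlag_price])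

lemma cost_add:
 assumes c: "contribution M F X C a r c" and d: "contribution M F X C a r d" and st: "0 <= s" "0 <= t"
 shows "cost (\<lambda>u w. s * c u w + t * d u w) = ennreal s * cost c + ennreal t * cost d"
proof -
 have "cost (\<lambda>u w. s * c u w + t * d u w)
  = (\<integral>\<^sup>+w. ennreal s * (\<integral>\<^sup>+t\<in>{0..}. ennreal (exp (- r * t + C t w)) \<partial>stieltjes c w)
    + ennreal t * (\<integral>\<^sup>+t\<in>{0..}. ennreal (exp (- r * t + C t w)) \<partial>stieltjes d w) \<partial>M)"
  unfolding cost_def
 proof (intro nn_integral_cong)
  fix w assume w: "w \<in> space M"
  have eq: "stieltjes (\<lambda>u w. s * c u w + t * d u w) w = interval_measure (\<lambda>u. if u < 0 then 0 else s * c u w + t * d u w)"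
   by (simp add: stieltjes_def)
  show "(\<integral>\<^sup>+u\<in>{0..}. ennreal (exp (- r * u + C u w)) \<partial>stieltjes (\<lambda>u w. s * c u w + t * d u w) w)
   = ennreal s * (\<integral>\<^sup>+t\<in>{0..}. ennreal (exp (- r * t + C t w)) \<partial>stieltjes c w)
    + ennreal t * (\<integral>\<^sup>+t\<in>{0..}. ennreal (exp (- r * t + C t w)) \<partial>stieltjes d w)"
   unfolding eq contribution.stieltjes_eq[OF c w] contribution.stieltjes_eq[OF d w]
   by (rule nn_integral_nondecreasing_path_add[OF contribution.path[OF c w] contribution.path[OF d w] st price_measurable[OF w]])
 qed
 also have "... = ennreal s * cost c + ennreal t * cost d"
  unfolding cost_def using cost_measurable[OF c] cost_measurable[OF d]
  by (simp add: nn_integral_add nn_integral_cmult)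
 finally show ?thesis .
qed

lemma value_time_space:
 assumes c: "contribution M F X C a r c"
 shows "(\<integral>\<^sup>+w. (\<integral>\<^sup>+t\<in>{0..}. ennreal (exp (- r * t - a * X (max 0 t) w + R (max 0 t) w)) * ennreal (c t w) \<partial>lborel) \<partial>M)
  = (\<integral>\<^sup>+p. ennreal (exp (- r * snd p - a * X (snd p) (fst p) + R (snd p) (fst p)) * c (snd p) (fst p)) \<partial>X.time_space)"
proof -
 note path = contribution.path[OF c]
 have "(\<lambda>p. c (snd p) (fst p)) \<in> Borel X.time_space"
  by (intro X.right_continuous_time_space X.adaptedD contribution.c_adapted[OF c] nondecreasing_path.right[OF path])
 then have "(\<lambda>p. ennreal (exp (- r * snd p - a * X (snd p) (fst p) + R (snd p) (fst p)) * c (snd p) (fst p))) \<in> Borel X.time_space"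
  by measurable
 from X.nn_integral_time_space[where f = "\<lambda>w t. ennreal (exp (- r * t - a * X t w + R t w) * c t w)", OF this]
 have "(\<integral>\<^sup>+p. ennreal (exp (- r * snd p - a * X (snd p) (fst p) + R (snd p) (fst p)) * c (snd p) (fst p)) \<partial>X.time_space)
  = (\<integral>\<^sup>+w. (\<integral>\<^sup>+t\<in>{0..}. ennreal (exp (- r * t - a * X t w + R t w) * c t w) \<partial>lborel) \<partial>M)" by (rule sym)
 also have "... = (\<integral>\<^sup>+w. (\<integral>\<^sup>+t\<in>{0..}. ennreal (exp (- r * t - a * X (max 0 t) w + R (max 0 t) w)) * ennreal (c t w) \<partial>lborel) \<partial>M)"
  by (intro nn_integral_cong) (auto simp: indicator_def max_absorb2 ennreal_mult' split: if_splits)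
 finally show ?thesis by (rule sym)
qed

lemma value_le_cost:
 assumes c: "contribution M F X C a r c"
 shows "(\<integral>\<^sup>+p. ennreal (exp (- r * snd p - a * X (snd p) (fst p) + R (snd p) (fst p)) * c (snd p) (fst p)) \<partial>X.time_space)
  <= ennreal A\<^sub>0 * cost c"
 unfolding value_time_space[OF c, symmetric] cost_def contribution.value_eq_stieltjes_Y[OF c]
 by (rule contribution.stieltjes_Y_le[OF c])

context
 fixes k q :: real
 assumes k: "0 < k" and q: "0 < q"
begin

lemma contribution_track: "contribution M F X C a r (\<lambda>t w. q * exp (- k * R t w))"
proof (intro contribution.intro contribution_axioms.intro discounted_levy_pair_axioms)
 show "nondecreasing_path (\<lambda>t. q * exp (- k * R t w))" if w: "w \<in> space M" for w
 proof unfold_locales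
  show "mono_on {0..} (\<lambda>t. q * exp (- k * R t w))"
   using k q R_antimono[OF w] by (intro mono_onI) auto
  show "continuous (at_right t) (\<lambda>t. q * exp (- k * R t w))" if "0 <= t" for t
   by (intro continuous_intros cadlag_right[OF cadlag_R[OF w] that])
 qed (use q in simp)
 show "adapted F (\<lambda>t w. q * exp (- k * R t w))"
  unfolding adapted_def
 proof (intro allI impI)
  fix t :: real assume "0 <= t"
  then have [measurable]: "R t \<in> Borel (F (ennreal t))" using adapted_R by (simp add: adapted_def)
  show "(\<lambda>w. q * exp (- k * R t w)) \<in> Borel (F (ennreal t))" by measurable
 qed
qed

text \<open>The contribution process only grows at times when \<open>G\<close> is at its running minimum.\<close>

lemma AE_track:
 assumes w: "w \<in> space M"
 shows "AE t in stieltjes (\<lambda>t w. q * exp (- k * R t w)) w. 0 <= t \<longrightarrow> R t w = G t w"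
proof -
 interpret c: nondecreasing_path "\<lambda>t. q * exp (- k * R t w)" by (rule contribution.path[OF contribution_track w])
 define B where "B = {t. 0 <= t \<and> R (max 0 t) w < G (max 0 t) w}"
 have B: "B \<in> sets borel" unfolding B_def using w by measurable
 have BD: "0 < t" "R t w < G t w" if "t \<in> B" for t
 proof -
  show "R t w < G t w" using that by (auto simp: B_def max_absorb2)
  then have "t \<noteq> 0" using R_0[OF w] G_0[OF w] by auto
  then show "0 < t" using that by (auto simp: B_def)
 qed
 have "AE t in interval_measure c.ext. t \<notin> B"
 proof (rule c.AE_not_in_flat[OF B])
  fix t assume t: "t \<in> B"
  have "((\<lambda>t. G t w) \<longlongrightarrow> G t w) (at_right t)"
   using cadlag_right[OF cadlag_G[OF w], of t] BD(1)[OF t] by (simp add: continuous_within)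
  then have "eventually (\<lambda>s. R t w < G s w) (at_right t)" using BD(2)[OF t] by (rule order_tendstoD)
  then obtain u where u: "t < u" "\<And>s. t < s ==> s < u ==> R t w < G s w"
   unfolding eventually_at_right_field by blast
  define v where "v = (t + u) / 2"
  have v: "t < v" "v < u" using u(1) by (auto simp: v_def)
  \<comment> \<open>By right continuity \<open>G\<close> stays above the current minimum for a
    while, so the minimum is constant on an interval to the right of \<open>t\<close>.\<close>
  have "R t w <= R v w"
   unfolding R_def[of v]
  proof (rule running_inf_greatest)
   show "R t w <= G s w" if "0 <= s" "s <= v" for s
   proof (cases "s <= t")
    case False
    then show ?thesis using u(2)[of s] that v by simp
   qed (use R_le_G[OF w] that in auto)
  qed (use BD(1)[OF t] v in simp)
  moreover have "R v w <= R t w" using R_antimono[OF w, of t v] BD(1)[OF t] v by simp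
  ultimately show "0 <= t \<and> (\<exists>u>t. q * exp (- k * R u w) = q * exp (- k * R t w))"
   using BD(1)[OF t] v(1) by (intro conjI exI[of _ v]) auto
 next
  fix t y assume t: "t \<in> B" and y: "y < q * exp (- k * R t w)"
  show "\<exists>s\<ge>0. s < t \<and> y <= q * exp (- k * R s w)"
  proof (rule ccontr)
   assume "\<not> ?thesis"
   then have neg: "q * exp (- k * R s w) < y" if "0 <= s" "s < t" for s using that by (meson not_le)
   have y0: "0 < y" using neg[of 0] BD(1)[OF t] q by (simp add: less_trans[rotated])
   \<comment> \<open>The value of \<open>R\<close> at which the contribution equals
     \<open>y\<close>. If \<open>y\<close> were not reached before \<open>t\<close>, then
     \<open>R\<close> would stay above \<rho> until \<open>t\<close> and fall below it only by a new
     minimum of \<open>G\<close> at \<open>t\<close> itself, contrary to the choice of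
     \<open>B\<close>.\<close>
   define \<rho> where "\<rho> = - ln (y / q) / k"
   have yq: "y = q * exp (- k * \<rho>)" using y0 q k by (simp add: \<rho>_def)
   have "\<rho> <= R s w" if "0 <= s" "s < t" for s
    using neg[OF that] k q unfolding yq by simp
   moreover have "R t w < \<rho>" using y k q unfolding yq by simp
   ultimately have "min \<rho> (G t w) <= R t w"
    unfolding R_def[of t]
   proof (intro running_inf_greatest)
    fix s assume *: "\<And>s. 0 <= s ==> s < t ==> \<rho> <= R s w" and s: "0 <= s" "s <= t"
    show "min \<rho> (G t w) <= G s w"
    proof (cases "s = t")
     case False
     then show ?thesis using *[of s] R_le_G[OF w, of s s] s by simp
    qed simp
   qed (use BD(1)[OF t] in auto)
   with \<open>R t w < \<rho>\<close> BD(2)[OF t] show False by simp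
  qed
 qed
 then show ?thesis
  unfolding contribution.stieltjes_eq[OF contribution_track w]
 proof (rule AE_mp, intro AE_I2 impI)
  fix t assume "t \<notin> B" "0 <= t"
  then have "G t w <= R t w" by (auto simp: B_def max_absorb2)
  then show "R t w = G t w" using R_le_G[OF w \<open>0 <= t\<close> order_refl] by simp
 qed
qed

text \<open>By \<open>AE_track\<close>, the bound \<open>Y_le\<close> holds with equality wherever
  this contribution grows.\<close>

lemma value_eq_cost:
 "(\<integral>\<^sup>+p. ennreal (exp (- r * snd p - a * X (snd p) (fst p) + R (snd p) (fst p)) * (q * exp (- k * R (snd p) (fst p)))) \<partial>X.time_space)
  = ennreal A\<^sub>0 * cost (\<lambda>t w. q * exp (- k * R t w))"
proof -
 let ?c = "\<lambda>t w. q * exp (- k * R t w)"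
 note c = contribution_track
 have "(\<integral>\<^sup>+p. ennreal (exp (- r * snd p - a * X (snd p) (fst p) + R (snd p) (fst p)) * (q * exp (- k * R (snd p) (fst p)))) \<partial>X.time_space)
  = (\<integral>\<^sup>+w. (\<integral>\<^sup>+t\<in>{0..}. ennreal (Y t w) \<partial>stieltjes ?c w) \<partial>M)"
  using value_time_space[OF c] contribution.value_eq_stieltjes_Y[OF c] by simp
 also have "... = (\<integral>\<^sup>+w. ennreal A\<^sub>0 * (\<integral>\<^sup>+t\<in>{0..}. ennreal (exp (- r * t + C t w)) \<partial>stieltjes ?c w) \<partial>M)"
 proof (intro nn_integral_cong)
  fix w assume w: "w \<in> space M"
  have m: "(\<lambda>t. ennreal (exp (- r * t + C t w)) * indicator {0..} t) \<in> Borel (stieltjes ?c w)"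
   using price_measurable[OF w] by (simp add: stieltjes_def)
  have "(\<integral>\<^sup>+t\<in>{0..}. ennreal (Y t w) \<partial>stieltjes ?c w) = (\<integral>\<^sup>+t. ennreal A\<^sub>0 * (ennreal (exp (- r * t + C t w)) * indicator {0..} t) \<partial>stieltjes ?c w)"
   by (rule nn_integral_cong_AE, rule AE_mp[OF AE_track[OF w]])
     (use A0_pos in \<open>auto simp: indicator_def Y_eq ennreal_mult'\<close>)
  then show "(\<integral>\<^sup>+t\<in>{0..}. ennreal (Y t w) \<partial>stieltjes ?c w) = ennreal A\<^sub>0 * (\<integral>\<^sup>+t\<in>{0..}. ennreal (exp (- r * t + C t w)) \<partial>stieltjes ?c w)"
   using m by (simp add: nn_integral_cmult)
 qed
 also have "... = ennreal A\<^sub>0 * cost ?c"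
  unfolding cost_def by (rule nn_integral_cmult[OF cost_measurable[OF c]])
 finally show ?thesis .
qed

end

end

section \<open>The economy and its candidate equilibrium\<close>

locale public_good_economy = discounted_levy_pair M F X C "\<alpha> / (1 - \<alpha>)" r
 for M :: "'a measure" and F :: "ennreal => 'a measure" and X C :: "real => 'a => real" and \<alpha> r :: real +
 fixes \<beta> wealth :: real and n :: nat
 assumes \<alpha>: "0 < \<alpha>" and \<beta>: "0 < \<beta>" and \<alpha>\<beta>: "\<alpha> + \<beta> < 1" and n: "1 < n" and wealth: "0 < wealth"
  and value_lt_top: "(\<integral>\<^sup>+w. (\<integral>\<^sup>+t\<in>{0..}. ennreal (exp (- r * t - \<alpha> / (1 - \<alpha>) * X (max 0 t) w
   - \<beta> / (1 - \<alpha> - \<beta>) * R (max 0 t) w)) \<partial>lborel) \<partial>M) < \<top>"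
begin

definition k :: real where "k = (1 - \<alpha>) / (1 - \<alpha> - \<beta>)"

definition A :: real where "A = \<beta> / \<alpha> * ((\<alpha> + \<beta>) / \<alpha>) powr (- (1 / (1 - \<alpha>))) * A\<^sub>0"

definition \<theta> :: "real => 'a => real" where "\<theta> t w = exp (- k * R t w)"

definition \<gamma> :: "real => 'a => real" where
 "\<gamma> t w = ((\<alpha> + \<beta>) / \<alpha>) powr (- (1 / (1 - \<alpha>))) / A * exp (- (1 / (1 - \<alpha>)) * (X t w + \<beta> * k * R t w))"

text \<open>Discounted payoff, consumption expenditure and shadow value of the contribution are all
  constant multiples of this density at the candidate. The exponent of \<open>- R\<close> is
  \<open>k - 1\<close>.\<close>

definition value_density :: "real => 'a => real" where
 "value_density t w = exp (- r * t - \<alpha> / (1 - \<alpha>) * X t w - \<beta> / (1 - \<alpha> - \<beta>) * R t w)"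

definition J :: real where "J = enn2real (\<integral>\<^sup>+p. ennreal (value_density (snd p) (fst p)) \<partial>X.time_space)"

text \<open>An agent's expenditure at the candidate for \<open>\<kappa> = 1\<close>; it agrees with
  the denominator in the theorem by \<open>unit_cost_eq\<close>.\<close>

definition unit_cost :: real where "unit_cost = \<alpha> / (\<beta> * A\<^sub>0) * J + 1 / real n * (J / A\<^sub>0)"

definition \<kappa> :: real where "\<kappa> = wealth / unit_cost"

definition multiplier :: real where "multiplier = A powr (1 - \<alpha>) * \<kappa> powr (\<alpha> + \<beta> - 1)"

lemma weight_pos: "0 < ((\<alpha> + \<beta>) / \<alpha>) powr (- (1 / (1 - \<alpha>)))"
 using \<alpha> \<beta> by simp

lemma k_pos: "0 < k" using \<alpha> \<beta> \<alpha>\<beta> by (simp add: k_def)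

lemma A_pos: "0 < A" using weight_pos \<alpha> \<beta> A0_pos by (simp add: A_def)

lemma weight_A: "((\<alpha> + \<beta>) / \<alpha>) powr (- (1 / (1 - \<alpha>))) / A = \<alpha> / (\<beta> * A\<^sub>0)"
 using weight_pos \<alpha> \<beta> A0_pos by (simp add: A_def divide_simps)

lemma value_density_measurable [measurable]: "(\<lambda>p. value_density (snd p) (fst p)) \<in> Borel X.time_space"
 unfolding value_density_def by measurable

lemma J: "(\<integral>\<^sup>+p. ennreal (value_density (snd p) (fst p)) \<partial>X.time_space) = ennreal J" "0 < J"
proof -
 let ?I = "\<integral>\<^sup>+p. ennreal (value_density (snd p) (fst p)) \<partial>X.time_space"
 have "?I = (\<integral>\<^sup>+w. (\<integral>\<^sup>+t\<in>{0..}. ennreal (value_density t w) \<partial>lborel) \<partial>M)"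
  by (rule X.nn_integral_time_space[where f = "\<lambda>w t. ennreal (value_density t w)", symmetric]) measurable
 also have "... = (\<integral>\<^sup>+w. (\<integral>\<^sup>+t\<in>{0..}. ennreal (exp (- r * t - \<alpha> / (1 - \<alpha>) * X (max 0 t) w
   - \<beta> / (1 - \<alpha> - \<beta>) * R (max 0 t) w)) \<partial>lborel) \<partial>M)"
  unfolding value_density_def by (intro nn_integral_cong) (auto simp: indicator_def max_absorb2)
 finally have fin: "?I < \<top>" using value_lt_top by simp
 then show eq: "?I = ennreal J" by (simp add: J_def)
 have "?I \<noteq> 0"
 proof
  assume "?I = 0"
  then have "AE p in X.time_space. ennreal (value_density (snd p) (fst p)) = 0"
   by (subst (asm) nn_integral_0_iff_AE) auto
  then have "AE p in X.time_space. False"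
   by eventually_elim (simp add: value_density_def not_le)
  with time_space_not_null show False by simp
 qed
 then show "0 < J" unfolding eq by (simp add: ennreal_eq_0_iff not_le)
qed

lemma unit_cost_pos: "0 < unit_cost"
 unfolding unit_cost_def using J(2) A0_pos \<alpha> \<beta> n by (intro add_pos_pos) auto

lemma \<kappa>_pos: "0 < \<kappa>"
 using unit_cost_pos wealth by (simp add: \<kappa>_def)

lemma multiplier_pos: "0 < multiplier"
 using A_pos \<kappa>_pos by (simp add: multiplier_def)

lemma \<gamma>_pos: "0 < \<gamma> t w" and \<theta>_pos: "0 < \<theta> t w"
 using weight_pos A_pos by (auto simp: \<gamma>_def \<theta>_def)

lemma shadow_\<theta>: "exp (- r * t - \<alpha> / (1 - \<alpha>) * X t w + R t w) * \<theta> t w = value_density t w"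
proof -
 have "1 - k = - (\<beta> / (1 - \<alpha> - \<beta>))" using \<alpha>\<beta> by (simp add: k_def field_simps)
 then have "R t w - k * R t w = - (\<beta> / (1 - \<alpha> - \<beta>)) * R t w" by (metis left_diff_distrib mult_1)
 then have "- r * t - \<alpha> / (1 - \<alpha>) * X t w + R t w + - k * R t w = - r * t - \<alpha> / (1 - \<alpha>) * X t w - \<beta> / (1 - \<alpha> - \<beta>) * R t w"
  by linarith
 then show ?thesis unfolding \<theta>_def value_density_def exp_add[symmetric] by (rule arg_cong)
qed

lemma price_\<gamma>: "exp (- r * t + X t w) * \<gamma> t w = \<alpha> / (\<beta> * A\<^sub>0) * value_density t w"
proof -
 have "\<beta> * k / (1 - \<alpha>) = \<beta> / (1 - \<alpha> - \<beta>)" using \<alpha> \<beta> \<alpha>\<beta> by (simp add: k_def)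
 moreover have "- (1 / (1 - \<alpha>)) * (X t w + \<beta> * k * R t w) = - (X t w / (1 - \<alpha>)) - \<beta> * k / (1 - \<alpha>) * R t w"
  by (simp add: add_divide_distrib)
 moreover have "X t w - X t w / (1 - \<alpha>) = - (\<alpha> / (1 - \<alpha>) * X t w)"
  using \<alpha>\<beta> \<beta> by (simp add: field_simps)
 ultimately have "- r * t + X t w + - (1 / (1 - \<alpha>)) * (X t w + \<beta> * k * R t w) = - r * t - \<alpha> / (1 - \<alpha>) * X t w - \<beta> / (1 - \<alpha> - \<beta>) * R t w"
  by simp
 then have "exp (- r * t + X t w) * exp (- (1 / (1 - \<alpha>)) * (X t w + \<beta> * k * R t w)) = value_density t w"
  unfolding value_density_def exp_add[symmetric] by (rule arg_cong)
 then show ?thesis unfolding \<gamma>_def weight_A by (simp add: mult.left_commute)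
qed

text \<open>The marginal utility is homogeneous of degree \<open>\<alpha> + \<beta> - 1\<close>,
  whence the power of \<kappa> in the multiplier; the normalization \<open>1 / A\<close> in \<gamma>
  contributes \<open>A powr (1 - \<alpha>)\<close>.\<close>

lemma foc_consumption:
 "\<alpha> * (exp (- r * t) * cobb_douglas \<alpha> \<beta> (\<kappa> * \<gamma> t w) (\<kappa> * \<theta> t w))
  = multiplier * (exp (- r * t + X t w) * (\<kappa> * \<gamma> t w))"
proof -
 have ln\<gamma>: "(\<alpha> - 1) * ln (\<gamma> t w) = ln ((\<alpha> + \<beta>) / \<alpha>) + (1 - \<alpha>) * ln A + X t w + \<beta> * k * R t w"
 proof -
  have "ln (\<gamma> t w) = - (1 / (1 - \<alpha>)) * ln ((\<alpha> + \<beta>) / \<alpha>) - ln A + - (1 / (1 - \<alpha>)) * (X t w + \<beta> * k * R t w)"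
   unfolding \<gamma>_def using weight_pos A_pos \<alpha> \<beta> by (simp add: ln_mult ln_div ln_powr)
  moreover have "(\<alpha> - 1) * (c * P - L + c * Q) = (\<alpha> - 1) * c * P + (1 - \<alpha>) * L + (\<alpha> - 1) * c * Q" for c P L Q :: real
   by (simp add: algebra_simps)
  moreover have "(\<alpha> - 1) * - (1 / (1 - \<alpha>)) = 1" using \<alpha>\<beta> \<beta> by (simp add: divide_simps)
  ultimately show ?thesis by (simp only: mult_1 add.assoc)
 qed
 have "\<gamma> t w powr (\<alpha> - 1) = exp ((\<alpha> - 1) * ln (\<gamma> t w))"
  using \<gamma>_pos[of t w] by (simp add: powr_def)
 also have "... = (\<alpha> + \<beta>) / \<alpha> * A powr (1 - \<alpha>) * exp (X t w) * exp (\<beta> * k * R t w)"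
  unfolding ln\<gamma> using A_pos \<alpha> \<beta> by (simp add: exp_add powr_def exp_diff ln_div)
 finally have g: "\<gamma> t w powr \<alpha> = (\<alpha> + \<beta>) / \<alpha> * A powr (1 - \<alpha>) * exp (X t w) * exp (\<beta> * k * R t w) * \<gamma> t w"
  using \<gamma>_pos[of t w] by (simp add: powr_diff field_simps)
 have th: "\<theta> t w powr \<beta> * exp (\<beta> * k * R t w) = 1"
  by (simp add: \<theta>_def powr_def exp_add[symmetric])
 have kk: "\<kappa> powr \<alpha> * \<kappa> powr \<beta> = \<kappa> powr (\<alpha> + \<beta> - 1) * \<kappa>"
  using \<kappa>_pos by (simp add: powr_diff powr_add)
 have "\<alpha> * (exp (- r * t) * cobb_douglas \<alpha> \<beta> (\<kappa> * \<gamma> t w) (\<kappa> * \<theta> t w))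
  = \<alpha> / (\<alpha> + \<beta>) * exp (- r * t) * (\<kappa> powr \<alpha> * \<kappa> powr \<beta>) * (\<gamma> t w powr \<alpha> * \<theta> t w powr \<beta>)"
  using \<kappa>_pos \<gamma>_pos[of t w] \<theta>_pos[of t w] by (simp add: cobb_douglas_def powr_mult)
 also have "\<gamma> t w powr \<alpha> * \<theta> t w powr \<beta> = (\<alpha> + \<beta>) / \<alpha> * A powr (1 - \<alpha>) * exp (X t w) * \<gamma> t w * (\<theta> t w powr \<beta> * exp (\<beta> * k * R t w))"
  unfolding g by (simp add: algebra_simps)
 also have "\<alpha> / (\<alpha> + \<beta>) * exp (- r * t) * (\<kappa> powr \<alpha> * \<kappa> powr \<beta>) * ... = multiplier * (exp (- r * t + X t w) * (\<kappa> * \<gamma> t w))"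
  unfolding th kk multiplier_def exp_add using \<alpha> \<beta> by simp
 finally show ?thesis .
qed

text \<open>Both sides are multiples of \<open>value_density\<close>, by
  \<open>price_\<gamma>\<close> and \<open>shadow_\<theta>\<close>, so this follows from the
  condition for consumption.\<close>

lemma foc_contribution:
 "\<beta> * (exp (- r * t) * cobb_douglas \<alpha> \<beta> (\<kappa> * \<gamma> t w) (\<kappa> * \<theta> t w))
  = multiplier / A\<^sub>0 * (exp (- r * t - \<alpha> / (1 - \<alpha>) * X t w + R t w) * (\<kappa> * \<theta> t w))"
proof -
 let ?u = "exp (- r * t) * cobb_douglas \<alpha> \<beta> (\<kappa> * \<gamma> t w) (\<kappa> * \<theta> t w)"
 have "\<beta> * ?u = \<beta> / \<alpha> * (\<alpha> * ?u)" using \<alpha> by simp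
 also have "... = \<beta> / \<alpha> * (multiplier * \<kappa> * (exp (- r * t + X t w) * \<gamma> t w))"
  unfolding foc_consumption by (simp add: algebra_simps)
 also have "... = multiplier / A\<^sub>0 * \<kappa> * value_density t w"
  unfolding price_\<gamma> using \<alpha> \<beta> A0_pos by simp
 also have "... = multiplier / A\<^sub>0 * (exp (- r * t - \<alpha> / (1 - \<alpha>) * X t w + R t w) * (\<kappa> * \<theta> t w))"
  unfolding shadow_\<theta>[symmetric] by (simp add: algebra_simps)
 finally show ?thesis .
qed

lemma contribution_\<theta>: "0 < q ==> contribution M F X C (\<alpha> / (1 - \<alpha>)) r (\<lambda>t w. q * \<theta> t w)"
 unfolding \<theta>_def by (rule contribution_track[OF k_pos])

text \<open>The value identity determines the cost after division by \<open>A\<^sub>0\<close>, once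
  the cost is known to be finite.\<close>

lemma cost_\<theta>:
 assumes "0 < q"
 shows "cost (\<lambda>t w. q * \<theta> t w) = ennreal (q * (J / A\<^sub>0))"
proof -
 have "ennreal A\<^sub>0 * cost (\<lambda>t w. q * \<theta> t w)
  = (\<integral>\<^sup>+p. ennreal (exp (- r * snd p - \<alpha> / (1 - \<alpha>) * X (snd p) (fst p) + R (snd p) (fst p)) * (q * \<theta> (snd p) (fst p))) \<partial>X.time_space)"
  unfolding \<theta>_def by (rule value_eq_cost[OF k_pos assms, symmetric])
 also have "... = (\<integral>\<^sup>+p. ennreal q * ennreal (value_density (snd p) (fst p)) \<partial>X.time_space)"
  unfolding shadow_\<theta>[symmetric] using assms by (simp add: ennreal_mult'[symmetric] mult.left_commute)
 also have "... = ennreal (q * J)" using assms J by (simp add: nn_integral_cmult ennreal_mult)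
 finally have eq: "ennreal A\<^sub>0 * cost (\<lambda>t w. q * \<theta> t w) = ennreal (q * J)" .
 then have "cost (\<lambda>t w. q * \<theta> t w) \<noteq> \<top>" using A0_pos by (auto simp: ennreal_mult_top)
 then obtain x where x: "cost (\<lambda>t w. q * \<theta> t w) = ennreal x" "0 <= x"
  by (cases "cost (\<lambda>t w. q * \<theta> t w)") auto
 have "A\<^sub>0 * x = q * J" using eq x A0_pos assms J(2) by (simp add: ennreal_mult[symmetric])
 then have "x = q * (J / A\<^sub>0)" using A0_pos by (simp add: field_simps)
 then show ?thesis using x by simp
qed

lemma consumption_cost_\<gamma>:
 assumes "0 < q"
 shows "(\<integral>\<^sup>+p. ennreal (exp (- r * snd p + X (snd p) (fst p)) * (q * \<gamma> (snd p) (fst p))) \<partial>X.time_space) = ennreal (q * (\<alpha> / (\<beta> * A\<^sub>0) * J))"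
proof -
 have "(\<integral>\<^sup>+p. ennreal (exp (- r * snd p + X (snd p) (fst p)) * (q * \<gamma> (snd p) (fst p))) \<partial>X.time_space)
  = (\<integral>\<^sup>+p. ennreal (q * (\<alpha> / (\<beta> * A\<^sub>0))) * ennreal (value_density (snd p) (fst p)) \<partial>X.time_space)"
 proof (intro nn_integral_cong)
  fix p
  have "exp (- r * snd p + X (snd p) (fst p)) * (q * \<gamma> (snd p) (fst p)) = q * (exp (- r * snd p + X (snd p) (fst p)) * \<gamma> (snd p) (fst p))"
   by (simp add: algebra_simps)
  also have "... = q * (\<alpha> / (\<beta> * A\<^sub>0)) * value_density (snd p) (fst p)" unfolding price_\<gamma> by simp
  finally show "ennreal (exp (- r * snd p + X (snd p) (fst p)) * (q * \<gamma> (snd p) (fst p))) = ennreal (q * (\<alpha> / (\<beta> * A\<^sub>0))) * ennreal (value_density (snd p) (fst p))"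
   by (simp only: ennreal_mult'' value_density_def exp_ge_zero)
 qed
 also have "... = ennreal (q * (\<alpha> / (\<beta> * A\<^sub>0))) * ennreal J" by (simp only: J(1)[symmetric]) (rule nn_integral_cmult, measurable)
 also have "... = ennreal (q * (\<alpha> / (\<beta> * A\<^sub>0) * J))"
  using assms \<alpha> \<beta> A0_pos J(2) by (simp add: ennreal_mult[symmetric])
 finally show ?thesis .
qed

definition consumption :: "('a \<times> real => real) => bool" where
 "consumption x \<longleftrightarrow> optional_process M F (\<lambda>t w. x (w, t)) \<and> (\<forall>w\<in>space M. \<forall>t\<ge>0. 0 <= x (w, t))"

definition contributes :: "('a \<times> real => real) => bool" where
 "contributes c \<longleftrightarrow> optional_process M F (\<lambda>t w. c (w, t)) \<and> (\<forall>w\<in>space M. nondecreasing_path (\<lambda>t. c (w, t)))"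

lemma contributes_contribution: "contributes c ==> contribution M F X C (\<alpha> / (1 - \<alpha>)) r (\<lambda>t w. c (w, t))"
 unfolding contributes_def
 by (intro contribution.intro contribution_axioms.intro discounted_levy_pair_axioms X.optional_adapted) auto

lemma optional_add:
 "optional_process M F (\<lambda>t w. x (w, t)) ==> optional_process M F (\<lambda>t w. y (w, t)) ==>
  optional_process M F (\<lambda>t w. p * x (w, t) + q * y (w, t))"
 unfolding optional_process_def case_prod_unfold
 by (intro borel_measurable_add borel_measurable_times borel_measurable_const)

lemma nondecreasing_path_add:
 assumes "nondecreasing_path c" "nondecreasing_path d" "0 <= p" "0 <= q"
 shows "nondecreasing_path (\<lambda>t. p * c t + q * d t)"
proof -
 interpret c: nondecreasing_path c by fact
 interpret d: nondecreasing_path d by fact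
 show ?thesis
 proof unfold_locales
  show "0 <= p * c t + q * d t" if "0 <= t" for t
   using assms(3,4) c.nonneg[OF that] d.nonneg[OF that] by simp
  show "mono_on {0..} (\<lambda>t. p * c t + q * d t)"
   using assms(3,4) by (intro mono_onI add_mono mult_left_mono c.le d.le) auto
  show "continuous (at_right t) (\<lambda>t. p * c t + q * d t)" if "0 <= t" for t
   by (intro continuous_add continuous_mult continuous_const c.right d.right that)
 qed
qed

lemma cadlag_\<gamma>: "w \<in> space M ==> cadlag (\<lambda>t. q * \<gamma> t w)"
 unfolding \<gamma>_def by (intro cadlag_cmult cadlag_exp cadlag_add X.Z_cadlag cadlag_R)

lemma cadlag_\<theta>: "w \<in> space M ==> cadlag (\<lambda>t. q * \<theta> t w)"
 unfolding \<theta>_def by (intro cadlag_cmult cadlag_exp cadlag_R)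

lemma adapted_\<gamma>: "adapted F (\<lambda>t w. q * \<gamma> t w)"
 unfolding \<gamma>_def by (rule X.adapted_compose2[OF adapted_X adapted_R]) measurable

lemma optional_candidate:
 "optional_process M F (\<lambda>t w. q * \<gamma> t w)" "0 < q ==> optional_process M F (\<lambda>t w. q * \<theta> t w)"
 by (intro X.optional_cadlag adapted_\<gamma> cadlag_\<gamma>; assumption)
   (intro X.optional_cadlag contribution.c_adapted[OF contribution_\<theta>] cadlag_\<theta>; assumption)

text \<open>The factor \<open>multiplier / A\<^sub>0\<close> is such that the conditional future
  value of the priced marginal utility, at most \<open>A\<^sub>0 * \<psi>c\<close>, becomes at most
  \<open>multiplier * \<psi>c\<close>.\<close>

sublocale game: public_good_game X.time_space "\<lambda>p. exp (- r * snd p)" "\<lambda>p. exp (- r * snd p + X (snd p) (fst p))"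
 "\<lambda>p. exp (- r * snd p - \<alpha> / (1 - \<alpha>) * X (snd p) (fst p) + R (snd p) (fst p))"
 "\<lambda>p. \<kappa> * \<gamma> (snd p) (fst p)" "\<lambda>p. \<kappa> / real n * \<theta> (snd p) (fst p)" \<alpha> \<beta> multiplier "multiplier / A\<^sub>0" wealth n
 consumption contributes "\<lambda>c. cost (\<lambda>t w. c (w, t))"
proof
 have nC: "real n * (\<kappa> / real n * x) = \<kappa> * x" for x using n by simp
 have qn: "0 < \<kappa> / real n" using n \<kappa>_pos by simp
 show "0 < \<alpha>" "0 < \<beta>" "\<alpha> + \<beta> < 1" "1 < n" "0 < wealth" by (fact \<alpha> \<beta> \<alpha>\<beta> n wealth)+
 show "0 < multiplier" "0 < multiplier / A\<^sub>0" using multiplier_pos A0_pos by auto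
 show "(\<lambda>p. exp (- r * snd p)) \<in> Borel X.time_space"
  "(\<lambda>p. exp (- r * snd p + X (snd p) (fst p))) \<in> Borel X.time_space"
  "(\<lambda>p. exp (- r * snd p - \<alpha> / (1 - \<alpha>) * X (snd p) (fst p) + R (snd p) (fst p))) \<in> Borel X.time_space"
  by measurable
 show "x \<in> Borel X.time_space" if "consumption x" for x
  using X.optional_time_space[of "\<lambda>t w. x (w, t)"] that by (simp add: consumption_def)
 show "x \<in> Borel X.time_space" if "contributes x" for x
  using X.optional_time_space[of "\<lambda>t w. x (w, t)"] that by (simp add: contributes_def)
 show "0 <= x p" if "consumption x" "p \<in> space X.time_space" for x p
  using that by (cases p) (auto simp: consumption_def X.space_time_space)
 show "0 <= x p" if "contributes x" "p \<in> space X.time_space" for x p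
  using that nondecreasing_path.nonneg[of "\<lambda>t. x (fst p, t)" "snd p"]
  by (auto simp: contributes_def X.space_time_space)
 show "consumption (\<lambda>p. s * x p + t * y p)" if "consumption x" "consumption y" "0 <= s" "0 <= t" for x y s t
  using that by (auto simp: consumption_def intro: optional_add)
 show "contributes (\<lambda>p. s * x p + t * y p)" if "contributes x" "contributes y" "0 <= s" "0 <= t" for x y s t
  using that by (auto simp: contributes_def intro: optional_add nondecreasing_path_add)
 show "cost (\<lambda>u w. s * c (w, u) + t * d (w, u)) = ennreal s * cost (\<lambda>t w. c (w, t)) + ennreal t * cost (\<lambda>t w. d (w, t))"
  if "contributes c" "contributes d" "0 <= s" "0 <= t" for c d s t
  by (rule cost_add[OF contributes_contribution[OF that(1)] contributes_contribution[OF that(2)] that(3,4)])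
 show "ennreal (multiplier / A\<^sub>0) * (\<integral>\<^sup>+p. ennreal (exp (- r * snd p - \<alpha> / (1 - \<alpha>) * X (snd p) (fst p) + R (snd p) (fst p)) * c p) \<partial>X.time_space)
  <= ennreal multiplier * cost (\<lambda>t w. c (w, t))" if c: "contributes c" for c
 proof -
  have "ennreal (multiplier / A\<^sub>0) * (\<integral>\<^sup>+p. ennreal (exp (- r * snd p - \<alpha> / (1 - \<alpha>) * X (snd p) (fst p) + R (snd p) (fst p)) * c p) \<partial>X.time_space)
   <= ennreal (multiplier / A\<^sub>0) * (ennreal A\<^sub>0 * cost (\<lambda>t w. c (w, t)))"
   using value_le_cost[OF contributes_contribution[OF c]] by (intro mult_left_mono) auto
  also have "... = ennreal multiplier * cost (\<lambda>t w. c (w, t))"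
   using A0_pos multiplier_pos by (simp add: mult.assoc[symmetric] ennreal_mult[symmetric])
  finally show ?thesis .
 qed
 show "consumption (\<lambda>p. \<kappa> * \<gamma> (snd p) (fst p))"
  using optional_candidate(1) \<kappa>_pos \<gamma>_pos by (auto simp: consumption_def intro: less_imp_le)
 show "contributes (\<lambda>p. \<kappa> / real n * \<theta> (snd p) (fst p))"
  using optional_candidate(2)[OF qn] contribution.path[OF contribution_\<theta>[OF qn]] by (simp add: contributes_def)
 show "0 < \<kappa> * \<gamma> (snd p) (fst p)" "0 < \<kappa> / real n * \<theta> (snd p) (fst p)" for p :: "'a \<times> real"
  using \<kappa>_pos \<gamma>_pos \<theta>_pos n by auto
 show "ennreal (multiplier / A\<^sub>0) * (\<integral>\<^sup>+p. ennreal (exp (- r * snd p - \<alpha> / (1 - \<alpha>) * X (snd p) (fst p) + R (snd p) (fst p)) * (\<kappa> / real n * \<theta> (snd p) (fst p))) \<partial>X.time_space)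
  = ennreal multiplier * cost (\<lambda>t w. \<kappa> / real n * \<theta> (snd (w, t)) (fst (w, t)))"
  using value_eq_cost[OF k_pos qn] A0_pos multiplier_pos
  by (simp add: \<theta>_def mult.assoc[symmetric] ennreal_mult[symmetric])
 show "\<alpha> * (exp (- r * snd p) * cobb_douglas \<alpha> \<beta> (\<kappa> * \<gamma> (snd p) (fst p)) (real n * (\<kappa> / real n * \<theta> (snd p) (fst p))))
  = multiplier * (exp (- r * snd p + X (snd p) (fst p)) * (\<kappa> * \<gamma> (snd p) (fst p)))" for p
  unfolding nC by (rule foc_consumption)
 show "\<beta> * (exp (- r * snd p) * cobb_douglas \<alpha> \<beta> (\<kappa> * \<gamma> (snd p) (fst p)) (real n * (\<kappa> / real n * \<theta> (snd p) (fst p))))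
  = multiplier / A\<^sub>0 * (exp (- r * snd p - \<alpha> / (1 - \<alpha>) * X (snd p) (fst p) + R (snd p) (fst p)) * (real n * (\<kappa> / real n * \<theta> (snd p) (fst p))))" for p
  unfolding nC by (rule foc_contribution)
 have "(\<integral>\<^sup>+p. ennreal (exp (- r * snd p + X (snd p) (fst p)) * (\<kappa> * \<gamma> (snd p) (fst p))) \<partial>X.time_space) + cost (\<lambda>t w. \<kappa> / real n * \<theta> t w)
  = ennreal (\<kappa> * (\<alpha> / (\<beta> * A\<^sub>0) * J)) + ennreal (\<kappa> / real n * (J / A\<^sub>0))"
  unfolding consumption_cost_\<gamma>[OF \<kappa>_pos] cost_\<theta>[OF qn] ..
 also have "... = ennreal (\<kappa> * unit_cost)"
  using \<kappa>_pos \<alpha> \<beta> A0_pos J(2) n by (subst ennreal_plus[symmetric]) (auto simp: unit_cost_def algebra_simps)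
 also have "\<kappa> * unit_cost = wealth" using unit_cost_pos by (simp add: \<kappa>_def)
 finally show "(\<integral>\<^sup>+p. ennreal (exp (- r * snd p + X (snd p) (fst p)) * (\<kappa> * \<gamma> (snd p) (fst p))) \<partial>X.time_space)
   + cost (\<lambda>t w. \<kappa> / real n * \<theta> (snd (w, t)) (fst (w, t))) = ennreal wealth" by simp
qed auto

end

section \<open>Nash equilibrium and Lagrange multipliers\<close>

lemma (in filtered_prob_space) time_space_section_measurable:
 assumes f: "(\<lambda>p. f (fst p) (snd p)) \<in> Borel time_space"
 shows "(\<lambda>w. \<integral>\<^sup>+t\<in>{0..}. f w t \<partial>lborel) \<in> Borel M"
proof -
 have m: "(\<lambda>p. f (fst p) (snd p) * indicator (space M \<times> {0..}) p) \<in> Borel (M \<Otimes>\<^sub>M lborel)"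
  using f unfolding time_space_def by (subst (asm) borel_measurable_restrict_space_iff_ennreal) auto
 have "(\<integral>\<^sup>+t\<in>{0..}. f w t \<partial>lborel) = (\<integral>\<^sup>+t. f (fst (w, t)) (snd (w, t)) * indicator (space M \<times> {0..}) (w, t) \<partial>lborel)"
  if "w \<in> space M" for w
  using that by (intro nn_integral_cong) (auto simp: indicator_def)
 then show ?thesis
  using lborel.borel_measurable_nn_integral_fst[OF m] by (subst measurable_cong) auto
qed

text \<open>A difference at \<open>t\<close> would persist on an interval of positive length to its
  right. This upgrades equality of contributions for almost every time to equality at all
  times.\<close>

lemma right_continuous_eq:
 fixes f g :: "real => real"
 assumes f: "continuous (at_right t) f" and g: "continuous (at_right t) g" and t: "0 <= t"
  and eq: "AE s in lborel. 0 <= s \<longrightarrow> f s = g s"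
 shows "f t = g t"
proof (rule ccontr)
 assume "f t \<noteq> g t"
 then have pos: "0 < \<bar>f t - g t\<bar>" by simp
 have "((\<lambda>s. \<bar>f s - g s\<bar>) \<longlongrightarrow> \<bar>f t - g t\<bar>) (at_right t)"
  using f g unfolding continuous_within by (intro tendsto_intros)
 then have "eventually (\<lambda>s. 0 < \<bar>f s - g s\<bar>) (at_right t)" using pos by (rule order_tendstoD)
 then obtain u where u: "t < u" "\<And>s. t < s ==> s < u ==> 0 < \<bar>f s - g s\<bar>"
  unfolding eventually_at_right_field by blast
 have "AE s in lborel. s \<notin> {t<..<u}"
  using eq by (rule AE_mp) (use u(2) t in \<open>auto intro!: AE_I2\<close>)
 then have "emeasure lborel {t<..<u} = 0" by (subst (asm) AE_iff_null_sets[symmetric]) auto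
 then show False using u(1) by simp
qed

lemma deriv_cobb_douglas_left:
 assumes "0 < \<alpha>" "0 < \<beta>" "0 < x"
 shows "deriv (\<lambda>y. cobb_douglas \<alpha> \<beta> y c) x = \<alpha> * cobb_douglas \<alpha> \<beta> x c / x"
proof (rule DERIV_imp_deriv)
 have "((\<lambda>y. y powr \<alpha> * c powr \<beta> / (\<alpha> + \<beta>)) has_real_derivative \<alpha> * x powr (\<alpha> - 1) * c powr \<beta> / (\<alpha> + \<beta>)) (at x)"
  using assms by (auto intro!: derivative_eq_intros)
 also have "\<alpha> * x powr (\<alpha> - 1) * c powr \<beta> / (\<alpha> + \<beta>) = \<alpha> * (x powr \<alpha> * c powr \<beta> / (\<alpha> + \<beta>)) / x"
  using assms by (simp add: powr_diff mult.commute mult.left_commute)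
 finally show "((\<lambda>y. cobb_douglas \<alpha> \<beta> y c) has_real_derivative \<alpha> * cobb_douglas \<alpha> \<beta> x c / x) (at x)"
  by (simp add: cobb_douglas_def)
qed

lemma cobb_douglas_commute: "cobb_douglas \<alpha> \<beta> x c = cobb_douglas \<beta> \<alpha> c x"
 by (simp add: cobb_douglas_def mult.commute add.commute)

lemma deriv_cobb_douglas_right:
 assumes "0 < \<alpha>" "0 < \<beta>" "0 < c"
 shows "deriv (\<lambda>d. cobb_douglas \<alpha> \<beta> x d) c = \<beta> * cobb_douglas \<alpha> \<beta> x c / c"
 unfolding cobb_douglas_commute[of \<alpha> \<beta>] by (rule deriv_cobb_douglas_left[OF assms(2,1,3)])

text \<open>\<open>stopped_markov\<close> is exactly the defining property of the conditional
  expectation at a stopping time; optionality comes from \<open>Y\<close> being adapted and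
  cadlag.\<close>

lemma (in discounted_levy_pair) optional_projection_Y:
 assumes m: "0 <= m" and U: "\<And>w t. w \<in> space M ==> 0 <= t ==> U t w = ennreal m * H t w"
 shows "optional_projection M F U (\<lambda>t w. m * Y t w)"
 unfolding optional_projection_def cond_exp_at_def
proof (intro conjI allI impI ballI)
 show "optional_process M F (\<lambda>t w. m * Y t w)"
  by (rule X.optional_cadlag) (rule X.adapted_compose2[OF adapted_Y adapted_Y], measurable, intro cadlag_cmult cadlag_Y)
 show "0 <= m * Y t w" for t w using m Y_nonneg by simp
 fix \<tau> :: "'a => ennreal" assume \<tau>: "stopping_time F \<tau>"
 have sub: "subalgebra M (X.pre_sigma \<tau>)"
 proof -
  have "B \<in> sets M" if "B \<in> sets (X.pre_sigma \<tau>)" for B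
   using X.sets_pre_sigmaD[OF \<tau> that, of \<top>] X.subalg by (auto simp: subalgebra_def)
  then show ?thesis by (auto simp: subalgebra_def X.space_pre_sigma)
 qed
 interpret finite_measure_subalgebra M "X.pre_sigma \<tau>" by unfold_locales (rule sub)
 have [measurable]: "\<tau> \<in> Borel M"
  using X.subalg by (intro measurable_stopping_time[OF \<tau>]) (auto simp: subalgebra_def)
 have H_M: "stopped_value H \<tau> \<in> Borel M"
  unfolding stopped_value_def[abs_def] by measurable
 have U_eq: "stopped_value U \<tau> w = ennreal m * stopped_value H \<tau> w" if "w \<in> space M" for w
  using that by (simp add: stopped_value_def U)
 have Y_eq: "ennreal (stopped_value (\<lambda>t w. m * Y t w) \<tau> w) = ennreal m * ennreal (stopped_value Y \<tau> w)" for w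
  using m Y_nonneg by (simp add: stopped_value_def ennreal_mult)
 have Y_M: "(\<lambda>w. ennreal (stopped_value Y \<tau> w)) \<in> Borel (X.pre_sigma \<tau>)"
  using X.stopped_value_pre_sigma[OF adapted_Y cadlag_Y \<tau>] by measurable
 show "AE w in M. ennreal (stopped_value (\<lambda>t w. m * Y t w) \<tau> w) = nn_cond_exp M (X.pre_sigma \<tau>) (stopped_value U \<tau>) w"
  unfolding Y_eq
 proof (rule nn_cond_exp_charact)
  show "(\<integral>\<^sup>+w\<in>B. stopped_value U \<tau> w \<partial>M) = (\<integral>\<^sup>+w\<in>B. ennreal m * ennreal (stopped_value Y \<tau> w) \<partial>M)"
   if B: "B \<in> sets (X.pre_sigma \<tau>)" for B
  proof -
   have [measurable]: "B \<in> sets M" using B sub by (auto simp: subalgebra_def)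
   have Y_M': "(\<lambda>w. ennreal (stopped_value Y \<tau> w)) \<in> Borel M"
    by (rule measurable_from_subalg[OF sub Y_M])
   have "(\<integral>\<^sup>+w\<in>B. stopped_value U \<tau> w \<partial>M) = (\<integral>\<^sup>+w. ennreal m * (indicator B w * stopped_value H \<tau> w) \<partial>M)"
    by (intro nn_integral_cong) (simp add: U_eq algebra_simps)
   also have "... = ennreal m * (\<integral>\<^sup>+w. indicator B w * ennreal (stopped_value Y \<tau> w) \<partial>M)"
    using H_M stopped_markov[OF \<tau> B] by (simp add: nn_integral_cmult)
   also have "... = (\<integral>\<^sup>+w. ennreal m * (indicator B w * ennreal (stopped_value Y \<tau> w)) \<partial>M)"
    using Y_M' by (simp add: nn_integral_cmult)
   finally show ?thesis by (simp add: algebra_simps)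
  qed
  show "stopped_value U \<tau> \<in> Borel M"
   using H_M by (subst measurable_cong[OF U_eq]) auto
  show "(\<lambda>w. ennreal m * ennreal (stopped_value Y \<tau> w)) \<in> Borel (X.pre_sigma \<tau>)"
   using Y_M by measurable
 qed
qed

section \<open>From the static game back to processes\<close>

context public_good_economy
begin

abbreviation "\<psi>x \<equiv> \<lambda>t w. exp (- r * t + X t w)"
abbreviation "\<psi>c \<equiv> \<lambda>t w. exp (- r * t + C t w)"
abbreviation "utility \<equiv> cobb_douglas \<alpha> \<beta>"

lemma spending_eq:
 assumes x: "(\<lambda>p. x (snd p) (fst p)) \<in> Borel X.time_space"
  and c: "contribution M F X C (\<alpha> / (1 - \<alpha>)) r c"
 shows "spending M \<psi>x \<psi>c x c = (\<integral>\<^sup>+p. ennreal (\<psi>x (snd p) (fst p) * x (snd p) (fst p)) \<partial>X.time_space) + cost c"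
proof -
 have m: "(\<lambda>p. ennreal (\<psi>x (snd p) (fst p) * x (snd p) (fst p))) \<in> Borel X.time_space"
  using x by measurable
 show ?thesis
  unfolding spending_def cost_def
  using X.nn_integral_time_space[where f = "\<lambda>w t. ennreal (\<psi>x t w * x t w)", OF m]
  by (subst nn_integral_add[OF X.time_space_section_measurable[where f = "\<lambda>w t. ennreal (\<psi>x t w * x t w)", OF m] cost_measurable[OF c]]) simp
qed

lemma budget_iff:
 "(x, c) \<in> budget_set M F \<psi>x \<psi>c wealth \<longleftrightarrow> game.feasible (\<lambda>p. x (snd p) (fst p)) (\<lambda>p. c (snd p) (fst p))"
proof -
 have eq: "(x, c) \<in> budget_set M F \<psi>x \<psi>c wealth \<longleftrightarrow>
  consumption (\<lambda>p. x (snd p) (fst p)) \<and> contributes (\<lambda>p. c (snd p) (fst p)) \<and> spending M \<psi>x \<psi>c x c <= ennreal wealth"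
  unfolding budget_set_def consumption_def contributes_def nondecreasing_path_def by auto
 have "spending M \<psi>x \<psi>c x c = (\<integral>\<^sup>+p. ennreal (\<psi>x (snd p) (fst p) * x (snd p) (fst p)) \<partial>X.time_space) + cost c"
  if "consumption (\<lambda>p. x (snd p) (fst p))" "contributes (\<lambda>p. c (snd p) (fst p))"
  using game.consumption_measurable[OF that(1)] contributes_contribution[OF that(2)] by (intro spending_eq) simp_all
 then show ?thesis unfolding eq game.feasible_def by auto
qed

lemma payoff_eq:
 assumes [measurable]: "(\<lambda>p. x (snd p) (fst p)) \<in> Borel X.time_space"
  "(\<lambda>p. c (snd p) (fst p)) \<in> Borel X.time_space" "(\<lambda>p. D (snd p) (fst p)) \<in> Borel X.time_space"
 shows "payoff M r utility x c D = game.V (\<lambda>p. x (snd p) (fst p)) (\<lambda>p. c (snd p) (fst p) + D (snd p) (fst p))"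
proof -
 have "(\<lambda>p. ennreal (exp (- r * snd p) * utility (x (snd p) (fst p)) (c (snd p) (fst p) + D (snd p) (fst p)))) \<in> Borel X.time_space"
  by measurable
 from X.nn_integral_time_space[where f = "\<lambda>w t. ennreal (exp (- r * t) * utility (x t w) (c t w + D t w))", OF this]
 show ?thesis unfolding payoff_def game.V_def .
qed

lemma budget_measurable:
 assumes "(x, c) \<in> budget_set M F \<psi>x \<psi>c wealth"
 shows "(\<lambda>p. x (snd p) (fst p)) \<in> Borel X.time_space" "(\<lambda>p. c (snd p) (fst p)) \<in> Borel X.time_space"
 using assms X.optional_time_space unfolding budget_set_def by auto

lemma candidate_budget: "(\<lambda>t w. \<kappa> * \<gamma> t w, \<lambda>t w. \<kappa> / real n * \<theta> t w) \<in> budget_set M F \<psi>x \<psi>c wealth"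
 unfolding budget_iff by (rule game.feasible_XC)

lemma V_cong: "(\<And>p. p \<in> space X.time_space ==> c p = d p) ==> game.V x c = game.V x d"
 unfolding game.V_def by (intro nn_integral_cong) simp

lemma others: "i \<in> {1..n} ==> (\<Sum>j\<in>{1..n} - {i}. x) = (real n - 1) * x" for x :: real
 using n by (simp add: of_nat_diff)

lemma nash_candidate:
 "nash_equilibrium M F \<psi>x \<psi>c r utility wealth n (\<lambda>i t w. \<kappa> * \<gamma> t w) (\<lambda>i t w. \<kappa> / real n * \<theta> t w)"
 unfolding nash_equilibrium_def
proof (intro ballI conjI candidate_budget, safe)
 fix i x c assume i: "i \<in> {1..n}" and xc: "(x, c) \<in> budget_set M F \<psi>x \<psi>c wealth"
 note cb = budget_measurable[OF candidate_budget]
 have D: "(\<lambda>p. (real n - 1) * (\<kappa> / real n * \<theta> (snd p) (fst p))) \<in> Borel X.time_space"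
  using cb(2) by measurable
 have "payoff M r utility x c (\<lambda>t w. (real n - 1) * (\<kappa> / real n * \<theta> t w))
  <= game.V (\<lambda>p. \<kappa> * \<gamma> (snd p) (fst p)) (\<lambda>p. real n * (\<kappa> / real n * \<theta> (snd p) (fst p)))"
  unfolding payoff_eq[OF budget_measurable[OF xc] D]
  using xc unfolding budget_iff by (rule game.nash)
 also have "... = payoff M r utility (\<lambda>t w. \<kappa> * \<gamma> t w) (\<lambda>t w. \<kappa> / real n * \<theta> t w) (\<lambda>t w. (real n - 1) * (\<kappa> / real n * \<theta> t w))"
 proof -
  have "real n * z = z + (real n - 1) * z" for z by (simp add: algebra_simps)
  then show ?thesis unfolding payoff_eq[OF cb D] by (intro V_cong)
 qed
 finally show "payoff M r utility x c (\<lambda>t w. \<Sum>j\<in>{1..n} - {i}. \<kappa> / real n * \<theta> t w)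
  <= payoff M r utility (\<lambda>t w. \<kappa> * \<gamma> t w) (\<lambda>t w. \<kappa> / real n * \<theta> t w) (\<lambda>t w. \<Sum>j\<in>{1..n} - {i}. \<kappa> / real n * \<theta> t w)"
  unfolding others[OF i] .
qed

text \<open>Symmetry turns the others' contributions into \<open>real n - 1\<close> copies of the
  agent's own, the form required by the static game. Consumption is determined only almost
  everywhere in time; contributions are right continuous and hence determined at all times.\<close>

lemma unique_candidate:
 assumes nash: "nash_equilibrium M F \<psi>x \<psi>c r utility wealth n xs Cs" and sym: "symmetric_profile M n xs Cs" and i: "i \<in> {1..n}"
 shows "AE (w, t) in M \<Otimes>\<^sub>M lborel. 0 <= t \<longrightarrow> xs i t w = \<kappa> * \<gamma> t w"
  and "AE w in M. \<forall>t\<ge>0. Cs i t w = \<kappa> / real n * \<theta> t w"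
proof -
 interpret P: pair_sigma_finite M lborel
  by (intro pair_sigma_finite.intro X.sigma_finite_measure_axioms sigma_finite_lborel)
 have bud: "(xs j, Cs j) \<in> budget_set M F \<psi>x \<psi>c wealth" if "j \<in> {1..n}" for j
  using nash that by (auto simp: nash_equilibrium_def)
 note bi = budget_measurable[OF bud[OF i]]
 have D: "(\<lambda>p. \<Sum>j\<in>{1..n} - {i}. Cs j (snd p) (fst p)) \<in> Borel X.time_space"
  by (intro borel_measurable_sum budget_measurable(2)[OF bud]) auto
 have Deq: "(\<Sum>j\<in>{1..n} - {i}. Cs j (snd p) (fst p)) = (real n - 1) * Cs i (snd p) (fst p)" if "p \<in> space X.time_space" for p
 proof -
  have "0 <= snd p" "fst p \<in> space M" using that by (auto simp: X.space_time_space)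
  then have "Cs j (snd p) (fst p) = Cs i (snd p) (fst p)" if "j \<in> {1..n}" for j
   using sym[unfolded symmetric_profile_def, THEN bspec, OF that, THEN bspec, OF i] by blast
  then have "(\<Sum>j\<in>{1..n} - {i}. Cs j (snd p) (fst p)) = (\<Sum>j\<in>{1..n} - {i}. Cs i (snd p) (fst p))"
   by (intro sum.cong) auto
  then show ?thesis using others[OF i] by simp
 qed
 have *: "AE p in X.time_space. xs i (snd p) (fst p) = \<kappa> * \<gamma> (snd p) (fst p) \<and> Cs i (snd p) (fst p) = \<kappa> / real n * \<theta> (snd p) (fst p)"
 proof (rule game.unique)
  show "game.feasible (\<lambda>p. xs i (snd p) (fst p)) (\<lambda>p. Cs i (snd p) (fst p))"
   using bud[OF i] unfolding budget_iff .
  fix y d assume f: "game.feasible y d"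
  then have yd: "(\<lambda>t w. y (w, t), \<lambda>t w. d (w, t)) \<in> budget_set M F \<psi>x \<psi>c wealth"
   unfolding budget_iff by (simp only: fst_conv snd_conv prod.collapse)
  have "game.V y (\<lambda>p. d p + (real n - 1) * Cs i (snd p) (fst p)) = game.V y (\<lambda>p. d p + (\<Sum>j\<in>{1..n} - {i}. Cs j (snd p) (fst p)))"
   by (rule V_cong) (simp only: Deq)
  also have "... = payoff M r utility (\<lambda>t w. y (w, t)) (\<lambda>t w. d (w, t)) (\<lambda>t w. \<Sum>j\<in>{1..n} - {i}. Cs j t w)"
   unfolding payoff_eq[OF budget_measurable[OF yd] D] by (simp only: prod.collapse)
  also have "... <= payoff M r utility (xs i) (Cs i) (\<lambda>t w. \<Sum>j\<in>{1..n} - {i}. Cs j t w)"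
   using nash i yd unfolding nash_equilibrium_def by fast
  also have "... = game.V (\<lambda>p. xs i (snd p) (fst p)) (\<lambda>p. real n * Cs i (snd p) (fst p))"
   unfolding payoff_eq[OF bi D] by (rule V_cong) (simp only: Deq left_diff_distrib mult_1 add_diff_cancel_left' add.commute diff_add_cancel)
  finally show "game.V y (\<lambda>p. d p + (real n - 1) * Cs i (snd p) (fst p)) <= game.V (\<lambda>p. xs i (snd p) (fst p)) (\<lambda>p. real n * Cs i (snd p) (fst p))" .
 qed
 then have "AE p in X.time_space. xs i (snd p) (fst p) = \<kappa> * \<gamma> (snd p) (fst p)" by eventually_elim simp
 then show "AE (w, t) in M \<Otimes>\<^sub>M lborel. 0 <= t \<longrightarrow> xs i t w = \<kappa> * \<gamma> t w"
  by (subst (asm) X.AE_time_space[where P = "\<lambda>w t. xs i t w = \<kappa> * \<gamma> t w"])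
 from * have "AE p in X.time_space. Cs i (snd p) (fst p) = \<kappa> / real n * \<theta> (snd p) (fst p)" by eventually_elim simp
 then have "AE (w, t) in M \<Otimes>\<^sub>M lborel. 0 <= t \<longrightarrow> Cs i t w = \<kappa> / real n * \<theta> t w"
  by (subst (asm) X.AE_time_space[where P = "\<lambda>w t. Cs i t w = \<kappa> / real n * \<theta> t w"])
 from P.AE_pair[OF this]
 have "AE w in M. AE t in lborel. 0 <= t \<longrightarrow> Cs i t w = \<kappa> / real n * \<theta> t w" by simp
 then show "AE w in M. \<forall>t\<ge>0. Cs i t w = \<kappa> / real n * \<theta> t w"
 proof (rule AE_mp, intro AE_I2 impI allI)
  fix w t assume w: "w \<in> space M" and eq: "AE t in lborel. 0 <= t \<longrightarrow> Cs i t w = \<kappa> / real n * \<theta> t w" and t: "(0::real) <= t"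
  have "continuous (at_right t) (\<lambda>t. Cs i t w)"
   using bud[OF i] w t by (auto simp: budget_set_def)
  then show "Cs i t w = \<kappa> / real n * \<theta> t w"
   by (rule right_continuous_eq[OF _ cadlag_right[OF cadlag_\<theta>[OF w] t] t eq])
 qed
qed

lemma marginal_consumption:
 "exp (- r * t) * deriv (\<lambda>y. utility y (\<kappa> * \<theta> t w)) (\<kappa> * \<gamma> t w) = multiplier * \<psi>x t w"
proof -
 have g: "0 < \<kappa> * \<gamma> t w" using \<kappa>_pos \<gamma>_pos by simp
 have "exp (- r * t) * deriv (\<lambda>y. utility y (\<kappa> * \<theta> t w)) (\<kappa> * \<gamma> t w)
  = \<alpha> * (exp (- r * t) * utility (\<kappa> * \<gamma> t w) (\<kappa> * \<theta> t w)) / (\<kappa> * \<gamma> t w)"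
  unfolding deriv_cobb_douglas_left[OF \<alpha> \<beta> g] by simp
 also have "... = multiplier * \<psi>x t w" unfolding foc_consumption using \<kappa>_pos \<gamma>_pos[of t w] by simp
 finally show ?thesis .
qed

lemma marginal_contribution:
 "exp (- r * t) * deriv (\<lambda>c. utility (\<kappa> * \<gamma> t w) c) (\<kappa> * \<theta> t w)
  = multiplier / A\<^sub>0 * exp (- r * t - \<alpha> / (1 - \<alpha>) * X t w + R t w)"
proof -
 have g: "0 < \<kappa> * \<theta> t w" using \<kappa>_pos \<theta>_pos by simp
 have "exp (- r * t) * deriv (\<lambda>c. utility (\<kappa> * \<gamma> t w) c) (\<kappa> * \<theta> t w)
  = \<beta> * (exp (- r * t) * utility (\<kappa> * \<gamma> t w) (\<kappa> * \<theta> t w)) / (\<kappa> * \<theta> t w)"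
  unfolding deriv_cobb_douglas_right[OF \<alpha> \<beta> g] by simp
 also have "... = multiplier / A\<^sub>0 * exp (- r * t - \<alpha> / (1 - \<alpha>) * X t w + R t w)"
  unfolding foc_contribution using \<kappa>_pos \<theta>_pos[of t w] by simp
 finally show ?thesis .
qed

lemma future_marginal_utility_candidate:
 assumes w: "w \<in> space M" and t: "0 <= t"
 shows "future_marginal_utility r utility (\<lambda>t w. \<kappa> * \<gamma> t w) (\<lambda>t w. \<kappa> * \<theta> t w) t w = ennreal (multiplier / A\<^sub>0) * H t w"
proof -
 have [measurable]: "(\<lambda>s. ennreal (exp (- r * s - \<alpha> / (1 - \<alpha>) * X (max 0 s) w + R (max 0 s) w))) \<in> Borel lborel"
  using w by measurable
 have "future_marginal_utility r utility (\<lambda>t w. \<kappa> * \<gamma> t w) (\<lambda>t w. \<kappa> * \<theta> t w) t w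
  = (\<integral>\<^sup>+s. ennreal (multiplier / A\<^sub>0) * (ennreal (exp (- r * s - \<alpha> / (1 - \<alpha>) * X (max 0 s) w + R (max 0 s) w)) * indicator {t..} s) \<partial>lborel)"
  unfolding future_marginal_utility_def marginal_contribution using t multiplier_pos A0_pos
  by (intro nn_integral_cong) (auto simp: indicator_def max_absorb2 ennreal_mult'[symmetric])
 also have "... = ennreal (multiplier / A\<^sub>0) * H t w"
  unfolding H_def by (rule nn_integral_cmult) measurable
 finally show ?thesis .
qed

text \<open>Uniqueness is read off the condition for consumption. For existence, complementary
  slackness holds path by path: the integrand vanishes almost everywhere for the measure of the
  contribution, which grows only where \<open>R = G\<close>.\<close>

lemma lagrange:
 "lagrange_multiplier M F \<psi>x \<psi>c r utility wealth (\<lambda>t w. \<kappa> * \<gamma> t w) (\<lambda>t w. \<kappa> / real n * \<theta> t w) (\<lambda>t w. \<kappa> * \<theta> t w) l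
  \<longleftrightarrow> l = multiplier"
proof
 assume "lagrange_multiplier M F \<psi>x \<psi>c r utility wealth (\<lambda>t w. \<kappa> * \<gamma> t w) (\<lambda>t w. \<kappa> / real n * \<theta> t w) (\<lambda>t w. \<kappa> * \<theta> t w) l"
 then have "AE (w, t) in M \<Otimes>\<^sub>M lborel. 0 <= t \<longrightarrow> multiplier * \<psi>x t w = l * \<psi>x t w"
  unfolding lagrange_multiplier_def marginal_consumption by simp
 then have "AE p in X.time_space. multiplier * \<psi>x (snd p) (fst p) = l * \<psi>x (snd p) (fst p)"
  by (subst X.AE_time_space[where P = "\<lambda>w t. multiplier * \<psi>x t w = l * \<psi>x t w"])
 then have "AE p in X.time_space. l = multiplier" by eventually_elim simp
 then show "l = multiplier" using time_space_not_null by (cases "l = multiplier") auto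
next
 let ?m = "multiplier / A\<^sub>0"
 assume l: "l = multiplier"
 have qn: "0 < \<kappa> / real n" using n \<kappa>_pos by simp
 have m: "0 <= ?m" "?m * A\<^sub>0 = multiplier" using multiplier_pos A0_pos by auto
 let ?U = "future_marginal_utility r utility (\<lambda>t w. \<kappa> * \<gamma> t w) (\<lambda>t w. \<kappa> * \<theta> t w)"
 have proj: "optional_projection M F ?U (\<lambda>t w. ?m * Y t w)"
  by (rule optional_projection_Y[OF m(1) future_marginal_utility_candidate])
 have le: "?m * Y t w <= multiplier * \<psi>c t w" for t w
  using mult_left_mono[OF Y_le[of t w] m(1)] unfolding mult.assoc[symmetric] m(2) .
 have zero: "AE t in stieltjes (\<lambda>t w. \<kappa> / real n * \<theta> t w) w. indicator {0..} t *\<^sub>R (?m * Y t w - multiplier * \<psi>c t w) = 0"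
  if w: "w \<in> space M" for w
  using AE_track[OF k_pos qn w] unfolding \<theta>_def
 proof (rule AE_mp, intro AE_I2 impI)
  fix t assume *: "0 <= t \<longrightarrow> R t w = G t w"
  show "indicator {0..} t *\<^sub>R (?m * Y t w - multiplier * \<psi>c t w) = 0"
  proof (cases "0 <= t")
   case True
   then have "?m * Y t w = ?m * A\<^sub>0 * \<psi>c t w" using Y_eq[of t w] * by simp
   then show ?thesis unfolding m(2) by simp
  qed simp
 qed
 have zero_M: "(\<lambda>t. indicator {0..} t *\<^sub>R (?m * Y t w - multiplier * \<psi>c t w)) \<in> Borel (stieltjes (\<lambda>t w. \<kappa> / real n * \<theta> t w) w)"
  if w: "w \<in> space M" for w
 proof -
  have "cadlag (\<lambda>t. ?m * Y t w - multiplier * \<psi>c t w)"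
   by (intro cadlag_diff cadlag_cmult cadlag_Y cadlag_price w)
  \<comment> \<open>Again a single path is treated as a process on a one-point space.\<close>
  then have m: "(\<lambda>p. (\<lambda>t _. ?m * Y t w - multiplier * \<psi>c t w) (max 0 (snd p)) (fst p)) \<in> Borel (count_space {()} \<Otimes>\<^sub>M borel)"
   by (intro right_continuous_process_measurable) (auto dest: cadlag_right)
  have "(\<lambda>t. ?m * Y (max 0 t) w - multiplier * \<psi>c (max 0 t) w) \<in> Borel borel"
   using measurable_compose[OF _ m, of "\<lambda>t. ((), t)" borel] by simp
  then have "(\<lambda>t. indicator {0..} t *\<^sub>R (?m * Y (max 0 t) w - multiplier * \<psi>c (max 0 t) w)) \<in> Borel borel"
   by (intro borel_measurable_scaleR borel_measurable_indicator) auto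
  also have "(\<lambda>t. indicator {0..} t *\<^sub>R (?m * Y (max 0 t) w - multiplier * \<psi>c (max 0 t) w)) = (\<lambda>t. indicator {0..} t *\<^sub>R (?m * Y t w - multiplier * \<psi>c t w))"
   by (auto simp: fun_eq_iff indicator_def max_absorb2)
  finally show ?thesis by (simp add: stieltjes_def)
 qed
 have int0: "(LINT t:{0..}|stieltjes (\<lambda>t w. \<kappa> / real n * \<theta> t w) w. ?m * Y t w - multiplier * \<psi>c t w) = 0"
  if w: "w \<in> space M" for w
  unfolding set_lebesgue_integral_def by (rule integral_eq_zero_AE[OF zero[OF w]])
 show "lagrange_multiplier M F \<psi>x \<psi>c r utility wealth (\<lambda>t w. \<kappa> * \<gamma> t w) (\<lambda>t w. \<kappa> / real n * \<theta> t w) (\<lambda>t w. \<kappa> * \<theta> t w) l"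
  unfolding lagrange_multiplier_def l marginal_consumption
 proof (intro conjI allI impI exI[of _ "\<lambda>t w. ?m * Y t w"] proj)
  show "0 < multiplier" by (rule multiplier_pos)
  show "spending M \<psi>x \<psi>c (\<lambda>t w. \<kappa> * \<gamma> t w) (\<lambda>t w. \<kappa> / real n * \<theta> t w) = ennreal wealth"
   unfolding spending_eq[OF budget_measurable(1)[OF candidate_budget] contribution_\<theta>[OF qn]] using game.budget by simp
  show "AE w in M. cond_exp_at M F ?U \<tau> w <= ennreal (multiplier * stopped_value \<psi>c \<tau> w)" if \<tau>: "stopping_time F \<tau>" for \<tau>
  proof -
   have "AE w in M. ennreal (stopped_value (\<lambda>t w. ?m * Y t w) \<tau> w) = cond_exp_at M F ?U \<tau> w"
    using proj \<tau> unfolding optional_projection_def by simp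
   then show ?thesis
   proof (rule AE_mp, intro AE_I2 impI)
    fix w assume eq: "ennreal (stopped_value (\<lambda>t w. ?m * Y t w) \<tau> w) = cond_exp_at M F ?U \<tau> w"
    have "stopped_value (\<lambda>t w. ?m * Y t w) \<tau> w <= multiplier * stopped_value \<psi>c \<tau> w"
     using le[of "enn2real (\<tau> w)" w] by (simp add: stopped_value_def)
    then show "cond_exp_at M F ?U \<tau> w <= ennreal (multiplier * stopped_value \<psi>c \<tau> w)"
     unfolding eq[symmetric] by (rule ennreal_leI)
   qed
  qed
  show "AE w in M. set_integrable (stieltjes (\<lambda>t w. \<kappa> / real n * \<theta> t w) w) {0..} (\<lambda>t. ?m * Y t w - multiplier * \<psi>c t w)"
   unfolding set_integrable_def
  proof (rule AE_I2)
   fix w assume w: "w \<in> space M"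
   show "integrable (stieltjes (\<lambda>t w. \<kappa> / real n * \<theta> t w) w) (\<lambda>t. indicator {0..} t *\<^sub>R (?m * Y t w - multiplier * \<psi>c t w))"
    by (subst integrable_cong_AE[OF zero_M[OF w] _ zero[OF w]]) auto
  qed
  show "integrable M (\<lambda>w. LINT t:{0..}|stieltjes (\<lambda>t w. \<kappa> / real n * \<theta> t w) w. ?m * Y t w - multiplier * \<psi>c t w)"
   by (subst Bochner_Integration.integrable_cong[OF refl int0]) auto
  show "(LINT w|M. (LINT t:{0..}|stieltjes (\<lambda>t w. \<kappa> / real n * \<theta> t w) w. ?m * Y t w - multiplier * \<psi>c t w)) = 0"
   by (subst Bochner_Integration.integral_cong[OF refl int0]) auto
 qed auto
qed

end

section \<open>Dependence on the values at nonnegative times\<close>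

text \<open>The formulas of the theorem take extrema over \<open>{0..t}\<close>, which is empty for
  negative \<open>t\<close>, and their simplified exponential forms are available only for outcomes
  in the space. The economic notions do not see these differences.\<close>

definition agree :: "'a measure => (real => 'a => real) => (real => 'a => real) => bool" where
 "agree M x y \<longleftrightarrow> (\<forall>w\<in>space M. \<forall>t\<ge>0. x t w = y t w)"

lemma agreeD: "agree M x y ==> w \<in> space M ==> 0 <= t ==> x t w = y t w"
 by (simp add: agree_def)

lemma stieltjes_cong: "agree M c c' ==> w \<in> space M ==> stieltjes c w = stieltjes c' w"
 unfolding stieltjes_def by (intro arg_cong[of _ _ interval_measure]) (auto simp: agree_def)

lemma optional_process_cong: "agree M x x' ==> optional_process M F x \<longleftrightarrow> optional_process M F x'"
 unfolding optional_process_def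
 by (intro measurable_cong) (auto simp: agree_def optional_algebra_def space_measure_of_conv)

lemma spending_cong:
 assumes "agree M x x'" "agree M c c'"
 shows "spending M \<psi>x \<psi>c x c = spending M \<psi>x \<psi>c x' c'"
 unfolding spending_def
 by (intro nn_integral_cong arg_cong2[of _ _ _ _ "(+)"])
   (auto simp: stieltjes_cong[OF assms(2)] indicator_def agreeD[OF assms(1)])

lemma budget_set_cong:
 assumes x: "agree M x x'" and c: "agree M c c'"
 shows "(x, c) \<in> budget_set M F \<psi>x \<psi>c wealth \<longleftrightarrow> (x', c') \<in> budget_set M F \<psi>x \<psi>c wealth"
proof -
 have "mono_on {0..} (\<lambda>t. c t w) \<longleftrightarrow> mono_on {0..} (\<lambda>t. c' t w)" if "w \<in> space M" for w
  using that by (auto simp: mono_on_def agreeD[OF c])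
 moreover have "continuous (at_right t) (\<lambda>t. c t w) \<longleftrightarrow> continuous (at_right t) (\<lambda>t. c' t w)" if "w \<in> space M" "0 <= t" for w t
  unfolding continuous_within agreeD[OF c that]
  using that by (intro tendsto_cong) (auto simp: eventually_at_filter agreeD[OF c] intro!: always_eventually)
 ultimately show ?thesis
  unfolding budget_set_def
  by (simp add: optional_process_cong[OF x] optional_process_cong[OF c] spending_cong[OF x c] agreeD[OF x] agreeD[OF c])
qed

lemma payoff_cong:
 assumes "agree M x x'" "agree M c c'" "agree M D D'"
 shows "payoff M r u x c D = payoff M r u x' c' D'"
 unfolding payoff_def
 by (intro nn_integral_cong) (auto simp: indicator_def agreeD[OF assms(1)] agreeD[OF assms(2)] agreeD[OF assms(3)])

lemma nash_equilibrium_cong: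
 assumes x: "\<And>i. agree M (xs i) (xs' i)" and c: "\<And>i. agree M (Cs i) (Cs' i)"
 shows "nash_equilibrium M F \<psi>x \<psi>c r u wealth n xs Cs \<longleftrightarrow> nash_equilibrium M F \<psi>x \<psi>c r u wealth n xs' Cs'"
proof -
 have D: "agree M (\<lambda>t w. \<Sum>j\<in>J. Cs j t w) (\<lambda>t w. \<Sum>j\<in>J. Cs' j t w)" for J :: "nat set"
  using c by (auto simp: agree_def)
 have refl: "agree M y y" for y by (simp add: agree_def)
 show ?thesis
  unfolding nash_equilibrium_def budget_set_cong[OF x c] payoff_cong[OF refl refl D]
  unfolding payoff_cong[OF x c refl] ..
qed

lemma nn_cond_exp_cong_space:
 assumes "\<And>w. w \<in> space M ==> f w = g w"
 shows "nn_cond_exp M N f = nn_cond_exp M N g"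
proof -
 have M: "f \<in> Borel M \<longleftrightarrow> g \<in> Borel M" by (rule measurable_cong[OF assms])
 show ?thesis
 proof (cases "f \<in> Borel M")
  case True
  have "density M f = density M g" by (rule density_cong) (use True M assms in auto)
  then show ?thesis using True M unfolding nn_cond_exp_def by simp
 next
  case False
  then show ?thesis using M unfolding nn_cond_exp_def by simp
 qed
qed

lemma lagrange_multiplier_cong:
 assumes x: "agree M x x'" and c: "agree M c c'" and C: "agree M C C'"
 shows "lagrange_multiplier M F \<psi>x \<psi>c r u wealth x c C l \<longleftrightarrow> lagrange_multiplier M F \<psi>x \<psi>c r u wealth x' c' C' l"
proof -
 have U: "future_marginal_utility r u x C t w = future_marginal_utility r u x' C' t w" if "w \<in> space M" "0 <= t" for w t
  unfolding future_marginal_utility_def using that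
  by (intro nn_integral_cong) (auto simp: indicator_def agreeD[OF x] agreeD[OF C])
 have ce: "cond_exp_at M F (future_marginal_utility r u x C) = cond_exp_at M F (future_marginal_utility r u x' C')"
  unfolding cond_exp_at_def by (intro ext nn_cond_exp_cong_space[THEN fun_cong]) (simp add: stopped_value_def U)
 have st: "stieltjes c w = stieltjes c' w" if "w \<in> space M" for w
  by (rule stieltjes_cong[OF c that])
 have 1: "(AE w in M. set_integrable (stieltjes c w) {0..} (f w)) \<longleftrightarrow> (AE w in M. set_integrable (stieltjes c' w) {0..} (f w))"
  for f :: "_ => real => real"
  by (intro AE_cong) (simp add: st)
 have 2: "integrable M (\<lambda>w. LINT t:{0..}|stieltjes c w. f w t) \<longleftrightarrow> integrable M (\<lambda>w. LINT t:{0..}|stieltjes c' w. f w t)"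
  for f :: "_ => real => real"
  by (intro Bochner_Integration.integrable_cong refl) (simp add: st)
 have 3: "(LINT w|M. (LINT t:{0..}|stieltjes c w. f w t)) = (LINT w|M. (LINT t:{0..}|stieltjes c' w. f w t))"
  for f :: "_ => real => real"
  by (intro Bochner_Integration.integral_cong refl) (simp add: st)
 have 4: "(AE (w, t) in M \<Otimes>\<^sub>M lborel. 0 <= t \<longrightarrow> exp (- r * t) * deriv (\<lambda>y. u y (C t w)) (x t w) = l * \<psi>x t w)
  \<longleftrightarrow> (AE (w, t) in M \<Otimes>\<^sub>M lborel. 0 <= t \<longrightarrow> exp (- r * t) * deriv (\<lambda>y. u y (C' t w)) (x' t w) = l * \<psi>x t w)"
  by (intro AE_cong) (auto simp: space_pair_measure agreeD[OF x] agreeD[OF C])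
 show ?thesis
  unfolding lagrange_multiplier_def optional_projection_def ce spending_cong[OF x c] 1 2 3 4 ..
qed

section \<open>Compensated Levy processes\<close>

text \<open>A deterministic drift shifts every increment by a constant, so events about the
  increments remain events about the original ones.\<close>

lemma (in levy) levy_process_drift: "levy_process M F (\<lambda>t w. Z t w - m * t)"
 unfolding levy_process_def
proof (intro conjI ballI allI impI)
 show "adapted F (\<lambda>t w. Z t w - m * t)"
  using Z_adapted unfolding adapted_def by (auto intro!: borel_measurable_diff borel_measurable_const)
 show "Z 0 w - m * 0 = 0" if "w \<in> space M" for w using Z_0[OF that] by simp
 show "cadlag (\<lambda>t. Z t w - m * t)" if "w \<in> space M" for w
  by (intro cadlag_diff Z_cadlag that cadlag_continuous_on continuous_intros)
 fix s t :: real assume st: "0 <= s \<and> s <= t"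
 have [measurable]: "Z t \<in> Borel M" "Z s \<in> Borel M" "Z (t - s) \<in> Borel M"
  using st by auto
 have inc: "Z t w - m * t - (Z s w - m * s) = (Z t w - Z s w) - m * (t - s)" for w
  by (simp add: algebra_simps)
 have ind: "indep_set (sets (F (ennreal s))) {(\<lambda>w. Z t w - Z s w) -` B \<inter> space M | B. B \<in> sets borel}"
  using levy st unfolding levy_process_def by simp
 have sub: "{(\<lambda>w. Z t w - m * t - (Z s w - m * s)) -` B \<inter> space M | B. B \<in> sets borel}
  \<subseteq> {(\<lambda>w. Z t w - Z s w) -` B \<inter> space M | B. B \<in> sets borel}"
 proof
  fix E assume "E \<in> {(\<lambda>w. Z t w - m * t - (Z s w - m * s)) -` B \<inter> space M | B. B \<in> sets borel}"
  then obtain B where B: "B \<in> sets borel" "E = (\<lambda>w. Z t w - m * t - (Z s w - m * s)) -` B \<inter> space M" by blast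
  have "(\<lambda>x. x - m * (t - s)) -` B \<inter> space borel \<in> sets borel"
   by (rule measurable_sets[OF _ B(1)]) measurable
  moreover have "E = (\<lambda>w. Z t w - Z s w) -` ((\<lambda>x. x - m * (t - s)) -` B \<inter> space borel) \<inter> space M"
   unfolding B(2) inc by auto
  ultimately show "E \<in> {(\<lambda>w. Z t w - Z s w) -` B \<inter> space M | B. B \<in> sets borel}"
   by (intro CollectI exI conjI)
 qed
 show "indep_set (sets (F (ennreal s))) {(\<lambda>w. Z t w - m * t - (Z s w - m * s)) -` B \<inter> space M | B. B \<in> sets borel}"
  unfolding indep_sets2_eq
 proof (intro conjI ballI)
  show "{(\<lambda>w. Z t w - m * t - (Z s w - m * s)) -` B \<inter> space M | B. B \<in> sets borel} \<subseteq> events"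
   using ind sub unfolding indep_sets2_eq by (meson order_trans)
  show "sets (F (ennreal s)) \<subseteq> events" using ind unfolding indep_sets2_eq by (rule conjunct1)
  fix a b assume a: "a \<in> sets (F (ennreal s))" and b: "b \<in> {(\<lambda>w. Z t w - m * t - (Z s w - m * s)) -` B \<inter> space M | B. B \<in> sets borel}"
  show "prob (a \<inter> b) = prob a * prob b"
   using ind[unfolded indep_sets2_eq, THEN conjunct2, THEN conjunct2, THEN bspec, OF a, THEN bspec, OF subsetD[OF sub b]] .
 qed
 have d: "distr M borel (\<lambda>w. Y w - m * (t - s)) = distr (distr M borel Y) borel (\<lambda>x. x - m * (t - s))"
  if [measurable]: "Y \<in> Borel M" for Y
  by (subst distr_distr) (auto simp: comp_def)
 have "distr M borel (\<lambda>w. Z t w - Z s w) = distr M borel (Z (t - s))"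
  using levy st unfolding levy_process_def by simp
 then show "distr M borel (\<lambda>w. Z t w - m * t - (Z s w - m * s)) = distr M borel (\<lambda>w. Z (t - s) w - m * (t - s))"
  unfolding inc by (simp add: d)
qed

lemma (in prob_space) independent_processes_drift:
 assumes "independent_processes M X Y"
 shows "independent_processes M (\<lambda>t w. X t w - p * t) (\<lambda>t w. Y t w - q * t)"
proof -
 let ?f = "\<lambda>m x. \<lambda>t\<in>{0..}. x t - m * t :: real"
 have f: "?f m \<in> Pi\<^sub>M {0..} (\<lambda>_. borel) \<rightarrow>\<^sub>M Pi\<^sub>M {0..} (\<lambda>_. borel)" for m
  by (intro measurable_restrict borel_measurable_diff measurable_component_singleton borel_measurable_const) auto
 have "?f m \<circ> (\<lambda>w. \<lambda>t\<in>{0..}. X t w) = (\<lambda>w. \<lambda>t\<in>{0..}. X t w - m * t)" for m and X :: "real => 'a => real"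
  by (auto simp: fun_eq_iff restrict_def)
 with indep_var_compose[OF assms[unfolded independent_processes_def] f[of p] f[of q]]
 show ?thesis unfolding independent_processes_def by simp
qed

lemma (in levy) exp_moment_drift:
 assumes "integrable M (\<lambda>w. exp (\<xi> * Z 1 w))" and t: "0 <= t"
 shows "(\<integral>\<^sup>+w. ennreal (exp (\<xi> * (Z t w - m * t))) \<partial>M) = ennreal (exp (t * (laplace_exponent M Z \<xi> - \<xi> * m)))"
proof -
 have [measurable]: "Z t \<in> Borel M" using t by auto
 have e: "exp (\<xi> * (Z t w - m * t)) = exp (- (t * (\<xi> * m))) * exp (\<xi> * Z t w)" for w
  unfolding exp_add[symmetric] by (simp add: algebra_simps)
 have "(\<integral>\<^sup>+w. ennreal (exp (\<xi> * (Z t w - m * t))) \<partial>M) = ennreal (exp (- (t * (\<xi> * m)))) * (\<integral>\<^sup>+w. ennreal (exp (\<xi> * Z t w)) \<partial>M)"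
  unfolding e by (simp add: ennreal_mult nn_integral_cmult)
 also have "... = ennreal (exp (- (t * (\<xi> * m))) * exp (t * laplace_exponent M Z \<xi>))"
  unfolding exp_moment[OF assms] by (simp add: ennreal_mult)
 also have "exp (- (t * (\<xi> * m))) * exp (t * laplace_exponent M Z \<xi>) = exp (t * (laplace_exponent M Z \<xi> - \<xi> * m))"
  unfolding exp_add[symmetric] by (simp add: algebra_simps)
 finally show ?thesis .
qed

text \<open>Jensen's inequality by hand: \<open>1 + y <= exp y\<close> is added for
  \<open>y = - b * X w\<close> and, with weight \<open>b\<close>, for \<open>y = X w\<close>, and
  the linear terms cancel. It supplies the submartingale premises of Doob's inequality.\<close>

lemma (in prob_space) one_le_exp_moment_neg:
 assumes [measurable]: "X \<in> Borel M" and b: "0 <= b" and X: "(\<integral>\<^sup>+w. ennreal (exp (X w)) \<partial>M) = 1"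
 shows "1 <= (\<integral>\<^sup>+w. ennreal (exp (- b * X w)) \<partial>M)"
proof -
 have "ennreal 1 + ennreal b = (\<integral>\<^sup>+w. ennreal (1 + b) \<partial>M)"
  using b by (simp add: emeasure_space_1)
 also have "... <= (\<integral>\<^sup>+w. ennreal (exp (- b * X w)) + ennreal b * ennreal (exp (X w)) \<partial>M)"
 proof (intro nn_integral_mono)
  fix w
  have "1 + - b * X w <= exp (- b * X w)" by (rule exp_ge_add_one_self)
  moreover have "b * (1 + X w) <= b * exp (X w)" using b by (intro mult_left_mono exp_ge_add_one_self)
  ultimately have "1 + b <= exp (- b * X w) + b * exp (X w)" by (simp add: algebra_simps)
  then have "ennreal (1 + b) <= ennreal (exp (- b * X w) + b * exp (X w))" by (rule ennreal_leI)
  then show "ennreal (1 + b) <= ennreal (exp (- b * X w)) + ennreal b * ennreal (exp (X w))"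
   using b by (simp add: ennreal_mult)
 qed
 also have "... = (\<integral>\<^sup>+w. ennreal (exp (- b * X w)) \<partial>M) + ennreal b"
  by (simp add: nn_integral_add nn_integral_cmult X)
 finally show ?thesis by (simp add: add.commute[of _ "ennreal b"] ennreal_add_left_cancel_le)
qed

lemma running_inf_exp:
 assumes f: "cadlag f" and t: "0 <= t" and k: "0 < k"
 shows "(INF s\<in>{0..t}. exp (k * f s)) = exp (k * running_inf f t)"
  and "(SUP s\<in>{0..t}. exp (- k * f s)) = exp (- k * running_inf f t)"
proof -
 have ne: "f ` {0..t} \<noteq> {}" using t by simp
 have bd: "bdd_below (f ` {0..t})" by (rule bdd_image_cadlag(1)[OF f order_refl])
 have "exp (k * Inf (f ` {0..t})) = (INF x\<in>f ` {0..t}. exp (k * x))"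
  using k by (intro continuous_at_Inf_mono[OF _ _ ne bd] monoI continuous_intros) auto
 then show "(INF s\<in>{0..t}. exp (k * f s)) = exp (k * running_inf f t)"
  by (simp add: running_inf_def image_image)
 have "exp (- k * Inf (f ` {0..t})) = (SUP x\<in>f ` {0..t}. exp (- k * x))"
  using k by (intro continuous_at_Inf_antimono[OF _ _ ne bd] antimonoI continuous_intros) auto
 then show "(SUP s\<in>{0..t}. exp (- k * f s)) = exp (- k * running_inf f t)"
  by (simp add: running_inf_def image_image)
qed

text \<open>The theorem writes the expenditure with Bochner integrals. The integrands are
  nonnegative and the inner integrals finite almost surely, so they agree with the extended ones
  used for costs.\<close>

lemma (in public_good_economy) unit_cost_eq:
 assumes g: "agree M \<gamma>' \<gamma>" and th: "agree M \<theta>' \<theta>"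
 shows "(LINT w|M. (LINT t:{0..}|lborel. \<psi>x t w * \<gamma>' t w) + 1 / real n * (LINT t:{0..}|stieltjes \<theta>' w. \<psi>c t w)) = unit_cost"
proof -
 let ?I = "\<lambda>w. \<integral>\<^sup>+t\<in>{0..}. ennreal (\<psi>x t w * \<gamma> t w) \<partial>lborel"
 let ?K = "\<lambda>w. \<integral>\<^sup>+t\<in>{0..}. ennreal (\<psi>c t w) \<partial>stieltjes \<theta> w"
 have \<theta>1: "contribution M F X C (\<alpha> / (1 - \<alpha>)) r \<theta>" using contribution_\<theta>[of 1] by (simp add: eta_contract_eq)
 have K_M [measurable]: "?K \<in> Borel M" by (rule cost_measurable[OF \<theta>1])
 have g_M: "(\<lambda>p. ennreal (\<psi>x (snd p) (fst p) * \<gamma> (snd p) (fst p))) \<in> Borel X.time_space"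
  unfolding \<gamma>_def by measurable
 have I_M [measurable]: "?I \<in> Borel M"
  by (rule X.time_space_section_measurable[where f = "\<lambda>w t. ennreal (\<psi>x t w * \<gamma> t w)", OF g_M])
 have nK_M: "(\<lambda>w. ennreal (1 / real n) * ?K w) \<in> Borel M"
  by (rule measurable_compose[OF K_M, of "\<lambda>x. ennreal (1 / real n) * x" borel]) measurable
 have I: "(\<integral>\<^sup>+w. ?I w \<partial>M) = ennreal (\<alpha> / (\<beta> * A\<^sub>0) * J)"
  using X.nn_integral_time_space[where f = "\<lambda>w t. ennreal (\<psi>x t w * \<gamma> t w)", OF g_M] consumption_cost_\<gamma>[of 1]
  by (simp only: mult_1 zero_less_one)
 have K: "(\<integral>\<^sup>+w. ?K w \<partial>M) = ennreal (J / A\<^sub>0)"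
  using cost_\<theta>[of 1] by (simp only: mult_1 zero_less_one cost_def)
 have fin: "AE w in M. ?I w \<noteq> \<infinity>" "AE w in M. ?K w \<noteq> \<infinity>"
  by (rule nn_integral_PInf_AE[OF I_M], simp only: I, simp) (rule nn_integral_PInf_AE[OF K_M], simp only: K, simp)
 have LI: "(LINT t:{0..}|lborel. \<psi>x t w * \<gamma>' t w) = enn2real (?I w)" if w: "w \<in> space M" for w
 proof -
  have "(LINT t:{0..}|lborel. \<psi>x t w * \<gamma>' t w) = (LINT t|lborel. indicator {0..} t * (exp (- r * t + X (max 0 t) w) *
    (((\<alpha> + \<beta>) / \<alpha>) powr (- (1 / (1 - \<alpha>))) / A * exp (- (1 / (1 - \<alpha>)) * (X (max 0 t) w + \<beta> * k * R (max 0 t) w)))))"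
   unfolding set_lebesgue_integral_def
   by (intro Bochner_Integration.integral_cong) (auto simp: indicator_def max_absorb2 agreeD[OF g w] \<gamma>_def)
  also have "... = enn2real (\<integral>\<^sup>+t. ennreal (indicator {0..} t * (exp (- r * t + X (max 0 t) w) *
    (((\<alpha> + \<beta>) / \<alpha>) powr (- (1 / (1 - \<alpha>))) / A * exp (- (1 / (1 - \<alpha>)) * (X (max 0 t) w + \<beta> * k * R (max 0 t) w))))) \<partial>lborel)"
   using w A_pos by (intro integral_eq_nn_integral) auto
  also have "... = enn2real (?I w)"
   by (intro arg_cong[of _ _ enn2real] nn_integral_cong) (auto simp: indicator_def max_absorb2 \<gamma>_def)
  finally show ?thesis .
 qed
 have LK: "(LINT t:{0..}|stieltjes \<theta>' w. \<psi>c t w) = enn2real (?K w)" if w: "w \<in> space M" for w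
 proof -
  have m: "(\<lambda>t. indicator {0..} t * exp (- r * t + C (max 0 t) w)) \<in> Borel (stieltjes \<theta> w)"
   using w unfolding stieltjes_def measurable_cong_sets[OF sets_interval_measure refl] by measurable
  have "(LINT t:{0..}|stieltjes \<theta>' w. \<psi>c t w) = (LINT t|stieltjes \<theta> w. indicator {0..} t * exp (- r * t + C (max 0 t) w))"
   unfolding set_lebesgue_integral_def stieltjes_cong[OF th w]
   by (intro Bochner_Integration.integral_cong) (auto simp: indicator_def max_absorb2)
  also have "... = enn2real (\<integral>\<^sup>+t. ennreal (indicator {0..} t * exp (- r * t + C (max 0 t) w)) \<partial>stieltjes \<theta> w)"
   by (rule integral_eq_nn_integral[OF m]) simp
  also have "... = enn2real (?K w)"
   by (intro arg_cong[of _ _ enn2real] nn_integral_cong) (auto simp: indicator_def max_absorb2)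
  finally show ?thesis .
 qed
 have "(LINT w|M. (LINT t:{0..}|lborel. \<psi>x t w * \<gamma>' t w) + 1 / real n * (LINT t:{0..}|stieltjes \<theta>' w. \<psi>c t w))
  = (LINT w|M. enn2real (?I w) + 1 / real n * enn2real (?K w))"
  by (intro Bochner_Integration.integral_cong refl) (simp only: LI LK)
 also have "... = enn2real (\<integral>\<^sup>+w. ennreal (enn2real (?I w) + 1 / real n * enn2real (?K w)) \<partial>M)"
 proof (rule integral_eq_nn_integral)
  show "(\<lambda>w. enn2real (?I w) + 1 / real n * enn2real (?K w)) \<in> Borel M"
   by (intro borel_measurable_add borel_measurable_times borel_measurable_const borel_measurable_enn2real I_M K_M)
 qed simp
 also have "(\<integral>\<^sup>+w. ennreal (enn2real (?I w) + 1 / real n * enn2real (?K w)) \<partial>M) = (\<integral>\<^sup>+w. ?I w + ennreal (1 / real n) * ?K w \<partial>M)"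
 proof (rule nn_integral_cong_AE)
  show "AE w in M. ennreal (enn2real (?I w) + 1 / real n * enn2real (?K w)) = ?I w + ennreal (1 / real n) * ?K w"
   using fin
  proof eventually_elim
   case (elim w)
   have "ennreal (enn2real (?I w) + 1 / real n * enn2real (?K w)) = ennreal (enn2real (?I w)) + ennreal (1 / real n) * ennreal (enn2real (?K w))"
    by (subst ennreal_plus) (auto simp: ennreal_mult'[symmetric])
   then show ?case using elim by (simp only: ennreal_enn2real infinity_ennreal_def less_top[symmetric] not_False_eq_True)
  qed
 qed
 also have "... = ennreal (\<alpha> / (\<beta> * A\<^sub>0) * J) + ennreal (1 / real n) * ennreal (J / A\<^sub>0)"
  using I K by (simp only: nn_integral_add[OF I_M nK_M] nn_integral_cmult[OF K_M])
 also have "... = ennreal unit_cost"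
  using \<alpha> \<beta> A0_pos J(2) unfolding unit_cost_def by (subst ennreal_plus) (auto simp: ennreal_mult'[symmetric])
 finally show ?thesis using unit_cost_pos by simp
qed

theorem proposition5p4:
  fixes M :: "'a measure" and F :: "ennreal \<Rightarrow> 'a measure"
    and Zx Zc :: "real \<Rightarrow> 'a \<Rightarrow> real"
    and n :: nat and r w \<alpha> \<beta> :: real
    and \<pi>x \<pi>c :: "real \<Rightarrow> real" and \<pi>hat2 \<pi>tilde1 :: real
    and Ex Ec \<psi>x \<psi>c \<gamma> \<theta> :: "real \<Rightarrow> 'a \<Rightarrow> real" and \<delta> A \<kappa> lmult :: real
    and u :: "real \<Rightarrow> real \<Rightarrow> real"
    and xhat Chat :: "nat \<Rightarrow> real \<Rightarrow> 'a \<Rightarrow> real"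
  assumes "prob_space M" and "usual_conditions M F"
    and "n > 1" and "w > 0"
    and "0 < \<alpha>" "\<alpha> < 1" "0 < \<beta>" "\<beta> < 1" "\<alpha> + \<beta> < 1"
    and "levy_process M F Zx" and "levy_process M F Zc"
    and "independent_processes M Zx Zc"
    and "\<And>\<xi>. integrable M (\<lambda>\<omega>. exp (\<xi> * Zx 1 \<omega>))"
    and "\<And>\<xi>. integrable M (\<lambda>\<omega>. exp (\<xi> * Zc 1 \<omega>))"
    and "\<pi>x = laplace_exponent M Zx"
    and "\<pi>c = laplace_exponent M Zc"
    and "Ex = exp_martingale M Zx"
    and "Ec = exp_martingale M Zc"
    and "\<psi>x = (\<lambda>t \<omega>. exp (- r * t) * Ex t \<omega>)"
    and "\<psi>c = (\<lambda>t \<omega>. exp (- r * t) * Ec t \<omega>)"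
    and "u = cobb_douglas \<alpha> \<beta>"
    and "\<pi>hat2 = 2 / (1 - \<alpha> - \<beta>) * (\<beta> * \<pi>c 1 + \<alpha> * \<beta> / (1 - \<alpha>) * \<pi>x 1)
                 + \<pi>c (- (2 * \<beta> / (1 - \<alpha> - \<beta>)))
                 + \<pi>x (- (2 * \<alpha> * \<beta> / ((1 - \<alpha>) * (1 - \<alpha> - \<beta>))))"
    and "\<pi>tilde1 = 1 / (1 - \<alpha> - \<beta>) * (\<beta> * \<pi>c 1 + \<alpha> * \<pi>x 1)
                 + \<pi>c (- (\<beta> / (1 - \<alpha> - \<beta>))) + \<pi>x (- (\<alpha> / (1 - \<alpha> - \<beta>)))"
    and "\<delta> = \<beta> / \<alpha> * ((\<alpha> + \<beta>) / \<alpha>) powr (1 / (\<alpha> - 1))"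
    and "A = (LINT \<omega>|M. (LINT v:{0..}|lborel.
                \<delta> * exp (- r * v) *
                (INF s\<in>{0..v}. Ec s \<omega> * Ex (v - s) \<omega> powr (- (\<alpha> / (1 - \<alpha>))))))"
    and "\<gamma> = (\<lambda>t \<omega>. 1 / A *
                ((\<alpha> + \<beta>) / \<alpha> * Ex t \<omega> *
                 (INF s\<in>{0..t}. Ec s \<omega> powr (\<beta> * (1 - \<alpha>) / (1 - \<alpha> - \<beta>)) *
                                Ex s \<omega> powr (\<alpha> * \<beta> / (1 - \<alpha> - \<beta>)))) powr (- (1 / (1 - \<alpha>))))"
    and "\<theta> = (\<lambda>t \<omega>. SUP s\<in>{0..t}. Ec s \<omega> powr (- ((1 - \<alpha>) / (1 - \<alpha> - \<beta>))) *
                                     Ex s \<omega> powr (- (\<alpha> / (1 - \<alpha> - \<beta>))))"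
    and "\<kappa> = w / (LINT \<omega>|M. (LINT t:{0..}|lborel. \<psi>x t \<omega> * \<gamma> t \<omega>)
                            + 1 / real n * (LINT t:{0..}|stieltjes \<theta> \<omega>. \<psi>c t \<omega>))"
    and "xhat = (\<lambda>i t \<omega>. \<kappa> * \<gamma> t \<omega>)"
    and "Chat = (\<lambda>i t \<omega>. \<kappa> / real n * \<theta> t \<omega>)"
    and "lmult = A powr (1 - \<alpha>) * \<kappa> powr (\<alpha> + \<beta> - 1)"
    and "r > Max {0, \<alpha> / (1 - \<alpha>) * \<pi>x 1,
                  \<alpha> / (1 - \<alpha>) * \<pi>x 1 + \<pi>x (- (2 * \<alpha> / (1 - \<alpha>))),
                  \<pi>hat2 + \<alpha> / (1 - \<alpha>) * \<pi>x 1,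
                  \<pi>tilde1}"
  shows "nash_equilibrium M F \<psi>x \<psi>c r u w n xhat Chat \<and>
         symmetric_profile M n xhat Chat \<and>
         (\<forall>xs Cs. nash_equilibrium M F \<psi>x \<psi>c r u w n xs Cs \<and> symmetric_profile M n xs Cs \<longrightarrow>
            (\<forall>i\<in>{1..n}.
               (AE (\<omega>, t) in M \<Otimes>\<^sub>M lborel. 0 \<le> t \<longrightarrow> xs i t \<omega> = xhat i t \<omega>) \<and>
               (AE \<omega> in M. \<forall>t\<ge>0. Cs i t \<omega> = Chat i t \<omega>))) \<and>
         (\<forall>i\<in>{1..n}. \<forall>l. lagrange_multiplier M F \<psi>x \<psi>c r u w (xhat i) (Chat i)
                            (\<lambda>t \<omega>. \<Sum>j\<in>{1..n}. Chat j t \<omega>) l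
                          \<longleftrightarrow> l = lmult)"
proof -
 define a where "a = \<alpha> / (1 - \<alpha>)"
 \<comment> \<open>This is \<open>k - 1\<close>, the exponent of the running minimum in the value
   density.\<close>
 define b where "b = \<beta> / (1 - \<alpha> - \<beta>)"
 \<comment> \<open>With this drift \<open>Ex\<close> and \<open>Ec\<close> become the exponentials
   of \<open>X\<close> and \<open>C\<close>, with mean 1 at every time.\<close>
 define X where "X t \<omega> = Zx t \<omega> - \<pi>x 1 * t" for t \<omega>
 define C where "C t \<omega> = Zc t \<omega> - \<pi>c 1 * t" for t \<omega>
 note intX = assms(13) and intC = assms(14) and \<pi>x = assms(15) and \<pi>c = assms(16)
 have rate: "0 < r" "a * \<pi>x 1 + \<pi>x (- (2 * a)) < r" "\<pi>hat2 + a * \<pi>x 1 < r"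
  using assms(32) by (simp_all add: a_def)
 have a0: "0 < a" and b0: "0 < b" using assms(5-9) by (auto simp: a_def b_def)
 interpret filtered_prob_space M F
  using assms(1,2) by (intro filtered_prob_space.intro filtered_prob_space_axioms.intro) (auto simp: usual_conditions_def)
 interpret Zx: levy M F Zx by unfold_locales (fact assms(10))
 interpret Zc: levy M F Zc by unfold_locales (fact assms(11))
 interpret X: levy M F X
  by unfold_locales (simp only: X_def[abs_def] Zx.levy_process_drift)
 interpret C: levy M F C
  by unfold_locales (simp only: C_def[abs_def] Zc.levy_process_drift)
 interpret levy_pair M F X C
  by unfold_locales (simp only: X_def[abs_def] C_def[abs_def] independent_processes_drift[OF assms(12)])
 have mX: "(\<integral>\<^sup>+\<omega>. ennreal (exp (\<xi> * X t \<omega>)) \<partial>M) = ennreal (exp (t * (\<pi>x \<xi> - \<xi> * \<pi>x 1)))" if "0 <= t" for \<xi> t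
  unfolding X_def using Zx.exp_moment_drift[OF intX that, where m = "\<pi>x 1"] by (simp only: \<pi>x)
 have mC: "(\<integral>\<^sup>+\<omega>. ennreal (exp (\<xi> * C t \<omega>)) \<partial>M) = ennreal (exp (t * (\<pi>c \<xi> - \<xi> * \<pi>c 1)))" if "0 <= t" for \<xi> t
  unfolding C_def using Zc.exp_moment_drift[OF intC that, where m = "\<pi>c 1"] by (simp only: \<pi>c)
 have eX: "(\<integral>\<^sup>+\<omega>. ennreal (exp (X t \<omega>)) \<partial>M) = 1" and eC: "(\<integral>\<^sup>+\<omega>. ennreal (exp (C t \<omega>)) \<partial>M) = 1" if "0 <= t" for t
  using mX[OF that, of 1] mC[OF that, of 1] by simp_all
 interpret D: discounted_levy_pair M F X C a r
  by unfold_locales (use a0 rate(1) eC mC[of _ 2] in auto)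
 have finite_value: "(\<integral>\<^sup>+\<omega>. (\<integral>\<^sup>+t\<in>{0..}. ennreal (exp (- r * t - a * X (max 0 t) \<omega> - b * D.R (max 0 t) \<omega>)) \<partial>lborel) \<partial>M) < \<top>"
 \<comment> \<open>The two arguments are the growth rates of the second moments of
   \<open>exp (- a * X)\<close> and \<open>exp (- b * G)\<close>. Half their sum is the mean of two
   of the lower bounds for \<open>r\<close>, so it lies below \<open>r\<close>.\<close>
 proof (rule D.value_finite[OF b0, of "\<pi>x (- (2 * a)) + 2 * a * \<pi>x 1" \<pi>hat2])
  fix t :: real assume t: "0 <= t"
  have [measurable]: "X t \<in> borel_measurable M" "C t \<in> borel_measurable M" using t by auto
  show "(\<integral>\<^sup>+\<omega>. ennreal (exp (- 2 * a * X t \<omega>)) \<partial>M) = ennreal (exp (t * (\<pi>x (- (2 * a)) + 2 * a * \<pi>x 1)))"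
   using mX[OF t, of "- (2 * a)"] by simp
  show "1 <= (\<integral>\<^sup>+\<omega>. ennreal (exp (- b * a * X t \<omega>)) \<partial>M)"
   using one_le_exp_moment_neg[of "X t" "b * a", OF _ _ eX[OF t]] a0 b0 by simp
  show "1 <= (\<integral>\<^sup>+\<omega>. ennreal (exp (- b * C t \<omega>)) \<partial>M)"
   using one_le_exp_moment_neg[of "C t" b, OF _ _ eC[OF t]] b0 by simp
  \<comment> \<open>A joint increment from time 0, with a trivial past, splits the moment of
    \<open>G\<close> into moments of \<open>X\<close> and \<open>C\<close>.\<close>
  have "(\<integral>\<^sup>+\<omega>. ennreal (exp (- 2 * b * D.G t \<omega>)) \<partial>M)
   = (\<integral>\<^sup>+\<omega>. (\<lambda>(_, x, c). ennreal (exp (- (2 * b * a) * x)) * ennreal (exp (- (2 * b) * c))) ((), X (0 + t) \<omega> - X 0 \<omega>, C (0 + t) \<omega> - C 0 \<omega>) \<partial>M)"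
   by (intro nn_integral_cong)
     (simp add: D.G_def X.Z_0 C.Z_0 ennreal_mult[symmetric] exp_add[symmetric] algebra_simps)
  also have "... = (\<integral>\<^sup>+_. \<integral>\<^sup>+\<omega>1. \<integral>\<^sup>+\<omega>2. ennreal (exp (- (2 * b * a) * X t \<omega>1)) * ennreal (exp (- (2 * b) * C t \<omega>2)) \<partial>M \<partial>M \<partial>M)"
   using joint_nn_integral[OF order_refl t, of "\<lambda>_. ()" "count_space UNIV" "\<lambda>(_, x, c). ennreal (exp (- (2 * b * a) * x)) * ennreal (exp (- (2 * b) * c))"]
   by (simp add: split_beta')
  also have "... = ennreal (exp (t * (\<pi>x (- (2 * b * a)) + 2 * b * a * \<pi>x 1))) * ennreal (exp (t * (\<pi>c (- (2 * b)) + 2 * b * \<pi>c 1)))"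
   using mX[OF t, of "- (2 * b * a)"] mC[OF t, of "- (2 * b)"]
   by (simp add: nn_integral_cmult nn_integral_multc emeasure_space_1)
  also have "... = ennreal (exp (t * ((\<pi>x (- (2 * b * a)) + 2 * b * a * \<pi>x 1) + (\<pi>c (- (2 * b)) + 2 * b * \<pi>c 1))))"
   by (simp add: ennreal_mult[symmetric] exp_add[symmetric] distrib_left)
  also have "(\<pi>x (- (2 * b * a)) + 2 * b * a * \<pi>x 1) + (\<pi>c (- (2 * b)) + 2 * b * \<pi>c 1) = \<pi>hat2"
  proof -
   have e: "2 * b * a = 2 * \<alpha> * \<beta> / ((1 - \<alpha>) * (1 - \<alpha> - \<beta>))" "2 * b = 2 * \<beta> / (1 - \<alpha> - \<beta>)"
    by (simp_all add: a_def b_def mult_ac)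
   have eq: "2 / (1 - \<alpha> - \<beta>) * (\<beta> * \<pi>c 1 + \<alpha> * \<beta> / (1 - \<alpha>) * \<pi>x 1) = 2 * b * \<pi>c 1 + 2 * b * a * \<pi>x 1"
    by (simp add: a_def b_def distrib_left mult_ac)
   have p: "\<pi>x (- (2 * b * a)) = \<pi>x (- (2 * \<alpha> * \<beta> / ((1 - \<alpha>) * (1 - \<alpha> - \<beta>))))"
    "\<pi>c (- (2 * b)) = \<pi>c (- (2 * \<beta> / (1 - \<alpha> - \<beta>)))" by (simp only: e(1), simp only: e(2))
   show ?thesis unfolding assms(22) eq p by linarith
  qed
  finally show "(\<integral>\<^sup>+\<omega>. ennreal (exp (- 2 * b * D.G t \<omega>)) \<partial>M) = ennreal (exp (t * \<pi>hat2))" .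
 next
  show "(\<pi>x (- (2 * a)) + 2 * a * \<pi>x 1 + \<pi>hat2) / 2 < r" using rate(2,3) by simp
 qed
 interpret E: public_good_economy M F X C \<alpha> r \<beta> w n
  using D.discounted_levy_pair_axioms finite_value assms(3-9)
  by (intro public_good_economy.intro public_good_economy_axioms.intro) (simp_all add: a_def b_def)
 have exponent: "1 / (\<alpha> - 1) = - (1 / (1 - \<alpha>))"
  using assms(6) by (simp add: divide_simps)
 have Ex: "Ex = (\<lambda>t \<omega>. exp (X t \<omega>))" and Ec: "Ec = (\<lambda>t \<omega>. exp (C t \<omega>))"
  unfolding assms(17,18) X_def C_def exp_martingale_def[abs_def] \<pi>x \<pi>c by (rule refl)+
 have \<psi>x: "\<psi>x = E.\<psi>x" and \<psi>c: "\<psi>c = E.\<psi>c"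
  unfolding assms(19,20) Ex Ec exp_add by (rule refl)+
 have A: "A = E.A"
 proof -
  have "0 <= \<delta>" using assms(5,7) unfolding assms(24) by simp
  have e: "exp (C s \<omega>) * exp (X (v - s) \<omega>) powr (- (\<alpha> / (1 - \<alpha>))) = exp (C s \<omega> - a * X (v - s) \<omega>)" for s v \<omega>
   by (simp add: powr_def a_def exp_diff exp_minus divide_inverse)
  have "A = \<delta> * D.A\<^sub>0"
   unfolding assms(25) Ex Ec e by (rule D.A0_reversed[OF \<open>0 <= \<delta>\<close>])
  then show ?thesis unfolding E.A_def assms(24) exponent a_def .
 qed
 have G: "E.G t \<omega> = C t \<omega> + a * X t \<omega>" for t \<omega> by (simp add: E.G_def a_def)
 have \<gamma>: "agree M \<gamma> E.\<gamma>"
  unfolding agree_def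
 proof (intro ballI allI impI)
  fix \<omega> t assume \<omega>: "\<omega> \<in> space M" and t: "(0::real) <= t"
  have k: "0 < \<beta> * E.k" using E.k_pos assms(7) by simp
  have "\<beta> * (1 - \<alpha>) / (1 - \<alpha> - \<beta>) = \<beta> * E.k" "\<alpha> * \<beta> / (1 - \<alpha> - \<beta>) = \<beta> * E.k * a"
   using assms(6) by (simp_all add: E.k_def a_def)
  then have "exp (C s \<omega>) powr (\<beta> * (1 - \<alpha>) / (1 - \<alpha> - \<beta>)) * exp (X s \<omega>) powr (\<alpha> * \<beta> / (1 - \<alpha> - \<beta>)) = exp (\<beta> * E.k * E.G s \<omega>)" for s
   unfolding G by (simp add: powr_def exp_add[symmetric] distrib_left mult.assoc)
  then have inf: "(INF s\<in>{0..t}. exp (C s \<omega>) powr (\<beta> * (1 - \<alpha>) / (1 - \<alpha> - \<beta>)) * exp (X s \<omega>) powr (\<alpha> * \<beta> / (1 - \<alpha> - \<beta>))) = exp (\<beta> * E.k * E.R t \<omega>)"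
   using running_inf_exp(1)[OF E.cadlag_G[OF \<omega>] t k] by (simp add: E.R_def)
  have "((\<alpha> + \<beta>) / \<alpha> * exp (X t \<omega>) * exp (\<beta> * E.k * E.R t \<omega>)) powr (- (1 / (1 - \<alpha>)))
   = ((\<alpha> + \<beta>) / \<alpha>) powr (- (1 / (1 - \<alpha>))) * exp (- (1 / (1 - \<alpha>)) * (X t \<omega> + \<beta> * E.k * E.R t \<omega>))"
   using assms(5,7) by (simp only: mult.assoc exp_add[symmetric] powr_mult exp_ge_zero) (simp add: powr_def)
  then show "\<gamma> t \<omega> = E.\<gamma> t \<omega>"
   unfolding assms(26) Ex Ec inf E.\<gamma>_def A by simp
 qed
 have \<theta>: "agree M \<theta> E.\<theta>"
  unfolding agree_def
 proof (intro ballI allI impI)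
  fix \<omega> t assume \<omega>: "\<omega> \<in> space M" and t: "(0::real) <= t"
  have "(1 - \<alpha>) / (1 - \<alpha> - \<beta>) = E.k" "\<alpha> / (1 - \<alpha> - \<beta>) = E.k * a"
   using assms(6) by (simp_all add: E.k_def a_def)
  then have e: "exp (C s \<omega>) powr (- ((1 - \<alpha>) / (1 - \<alpha> - \<beta>))) * exp (X s \<omega>) powr (- (\<alpha> / (1 - \<alpha> - \<beta>))) = exp (- E.k * E.G s \<omega>)" for s
   unfolding G by (simp add: powr_def exp_add[symmetric] distrib_left mult.assoc)
  show "\<theta> t \<omega> = E.\<theta> t \<omega>"
   unfolding assms(27) Ex Ec e E.\<theta>_def E.R_def by (rule running_inf_exp(2)[OF E.cadlag_G[OF \<omega>] t E.k_pos])
 qed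
 have \<kappa>: "\<kappa> = E.\<kappa>"
  unfolding assms(28) E.\<kappa>_def \<psi>x \<psi>c E.unit_cost_eq[OF \<gamma> \<theta>] ..
 have xhat: "agree M (xhat i) (\<lambda>t \<omega>. E.\<kappa> * E.\<gamma> t \<omega>)" and Chat: "agree M (Chat i) (\<lambda>t \<omega>. E.\<kappa> / real n * E.\<theta> t \<omega>)" for i
  using \<gamma> \<theta> unfolding assms(29,30) \<kappa> by (simp_all add: agree_def)
 have sum: "agree M (\<lambda>t \<omega>. \<Sum>j\<in>{1..n}. Chat j t \<omega>) (\<lambda>t \<omega>. E.\<kappa> * E.\<theta> t \<omega>)"
  using \<theta> assms(3) unfolding assms(30) \<kappa> by (simp add: agree_def)
 have lmult: "lmult = E.multiplier" unfolding assms(31) A \<kappa> E.multiplier_def ..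
 have sym: "symmetric_profile M n xhat Chat" unfolding assms(29,30) symmetric_profile_def by simp
 have nash: "nash_equilibrium M F \<psi>x \<psi>c r u w n xhat Chat"
  unfolding \<psi>x \<psi>c assms(21) nash_equilibrium_cong[OF xhat Chat] by (rule E.nash_candidate)
 have unique: "(AE (\<omega>, t) in M \<Otimes>\<^sub>M lborel. 0 <= t \<longrightarrow> xs i t \<omega> = xhat i t \<omega>) \<and> (AE \<omega> in M. \<forall>t\<ge>0. Cs i t \<omega> = Chat i t \<omega>)"
  if nash: "nash_equilibrium M F \<psi>x \<psi>c r u w n xs Cs" and sym: "symmetric_profile M n xs Cs" and i: "i \<in> {1..n}" for xs Cs i
 proof
  note U = E.unique_candidate[OF nash[unfolded \<psi>x \<psi>c assms(21)] sym i]
  show "AE (\<omega>, t) in M \<Otimes>\<^sub>M lborel. 0 <= t \<longrightarrow> xs i t \<omega> = xhat i t \<omega>"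
   using U(1) by (rule AE_mp) (auto intro!: AE_I2 simp: space_pair_measure agreeD[OF xhat])
  show "AE \<omega> in M. \<forall>t\<ge>0. Cs i t \<omega> = Chat i t \<omega>"
   using U(2) by (rule AE_mp) (auto intro!: AE_I2 simp: agreeD[OF Chat])
 qed
 have lagrange: "lagrange_multiplier M F \<psi>x \<psi>c r u w (xhat i) (Chat i) (\<lambda>t \<omega>. \<Sum>j\<in>{1..n}. Chat j t \<omega>) l \<longleftrightarrow> l = lmult" for i l
  unfolding \<psi>x \<psi>c assms(21) lmult lagrange_multiplier_cong[OF xhat Chat sum] by (rule E.lagrange)
 from nash sym unique lagrange show ?thesis by blast
qed

end
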